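(* Let $M$ be one of $\mathrm{A}_n$ $(n\ge1)$, $\mathrm{D}_n$ $(n\ge4)$, $\mathrm{E}_n$ $(n=6,7,8)$, and let $A$ be the Artin group of type $M$. Then, for each $i\in\{1,\dots,n\}$ and each $\beta\in\Phi^+$, there are elements $T_{i,\beta}\in Z_0^{(1)}$, with $T_{i,\alpha_i}=1$, such that the following map on the generators of $A$ determines a representation of $A$ on $V^{(0)}$: $$s_i\mapsto \sigma_i=\tau_i+l^{-1}T_i,$$ where $\tau_i$ is the $Z_0^{(0)}$-linear map on $V^{(0)}$ determined by $$\tau_i(x_\beta)=\begin{cases}0&\text{if }(\alpha_i,\beta)=2,\\ x_{\beta-\alpha_i}&\text{if }(\alpha_i,\beta)=1,\\ x_\beta h_{\beta,i}&\text{if }(\alpha_i,\beta)=0,\\ x_{\beta+\alpha_i}-m\,x_\beta&\text{if }(\alpha_i,\beta)=-1,\end{cases}$$ and $T_i$ is the $Z_0^{(0)}$-linear map on $V^{(0)}$ determined by $T_ix_\beta=x_{\alpha_i}T_{i,\beta}$ for $\beta\in\Phi^+$. When tensored with $\mathbb{Q}(l,x)$, the representation of $A$ on $V^{(0)}$ becomes a representation on the vector space $V=V^{(0)}\otimes_{\mathbb{Q}[l^{\pm1},m]}\mathbb{Q}(l,x)$ which factors (via $s_i\mapsto g_i$) through the quotient $B/I_2$ of the BMW algebra $B$ of type $M$ over $\mathbb{Q}(l,x)$.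
   Context: Write $i\sim j$ for adjacent nodes of $M$, $i\not\sim j$ otherwise. Let $l,x$ be indeterminates, $m=(l-l^{-1})/(1-x)$. The BMW algebra $B=B(M)$ is the unital associative $\mathbb{Q}(l,x)$-algebra with generators $g_i,e_i$ ($i=1,\dots,n$) and relations: (B1) $g_ig_j=g_jg_i$ if $i\not\sim j$; (B2) $g_ig_jg_i=g_jg_ig_j$ if $i\sim j$; (D1) $me_i=l(g_i^2+mg_i-1)$; (R1) $g_ie_i=l^{-1}e_i$; (R2) $e_ig_je_i=le_i$ if $i\sim j$. $I_2$ is the two-sided ideal generated by all $e_ie_j$ with $i,j$ distinct and non-adjacent. The elements $g_i$ are invertible in $B$, so there is a homomorphism $A\to B^\times$, $s_i\mapsto g_i$. $A$ is the Artin group with generators $s_1,\dots,s_n$ and the braid relations of $M$; $W$ is the Coxeter group of type $M$ with fundamental reflections $r_1,\dots,r_n$; $\psi:W\to A$ sends $w$ to $s_{i_1}\cdots s_{i_t}$ for any reduced expression $w=r_{i_1}\cdots r_{i_t}$. $\Phi^+$ is the set of positive roots of the root system of type $M$ with simple roots $\alpha_1,\dots,\alpha_n$ (all roots normalized to $(\beta,\beta)=2$), $\alpha_0$ is the highest root, and $C$ is the set of nodes $j$ with $(\alpha_j,\alpha_0)=0$. For $\beta\in\Phi^+$, $w_{\alpha_0,\beta}$ is the unique shortest element of $W$ mapping $\beta$ to $\alpha_0$, and $d_\beta=\psi(w_{\alpha_0,\beta}^{-1})\in A$. $Z_0^{(0)}$ (resp. $Z_0^{(1)}$) is the Hecke algebra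 over $\mathbb{Q}[l^{\pm1},m]\subset\mathbb{Q}(l,x)$ (resp. over $\mathbb{Q}[m]$) of type $M|_C$ (the induced subdiagram on $C$): generators $z_j$ ($j\in C$), the braid relations of $M|_C$, and $z_j^2+mz_j-1=0$; so $Z_0^{(1)}\subset Z_0^{(0)}$ and $z_j^{-1}=z_j+m$. For $\beta\in\Phi^+$ and a node $i$ with $(\alpha_i,\beta)=0$, the element $d_\beta^{-1}s_id_\beta$ of $A$ equals $s_j$ for some $j\in C$; $h_{\beta,i}\in Z_0^{(1)}$ denotes the corresponding generator $z_j$. $V^{(0)}$ is the free right $Z_0^{(0)}$-module with basis $x_\beta$, $\beta\in\Phi^+$. *)

theory Defs
  imports
    "HOL-Library.Function_Algebras"
    "HOL-Computational_Algebra.Polynomial"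
    "HOL-Computational_Algebra.Fraction_Field"
    "HOL-Algebra.QuotRing"
    "HOL-Algebra.Module"
    "HOL-Algebra.Generated_Rings"
    "HOL-Algebra.Free_Abelian_Groups"
begin

text \<open>The field of rational functions over the rationals in two indeterminates, as the fraction
  field of polynomials in \<open>x\<close> whose coefficients are polynomials in \<open>l\<close>.\<close>

type_synonym ratfun = "rat poly poly fract"

definition l_ind :: ratfun where "l_ind = Fract [:[:0, 1:]:] 1"

definition x_ind :: ratfun where "x_ind = Fract [:0, 1:] 1"

definition m_par :: ratfun where "m_par = (l_ind - inverse l_ind) / (1 - x_ind)"

definition K_ring :: "ratfun ring" where
  "K_ring = \<lparr>carrier = UNIV, monoid.mult = (*), monoid.one = 1, ring.zero = 0, ring.add = (+)\<rparr>"

definition Q_consts :: "ratfun set" where "Q_consts = range (\<lambda>q. Fract [:[:q:]:] 1)"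

definition Q_m :: "ratfun set" where
  "Q_m = generate_ring K_ring (insert m_par Q_consts)"

definition Q_l_m :: "ratfun set" where
  "Q_l_m = generate_ring K_ring ({l_ind, inverse l_ind, m_par} \<union> Q_consts)"

text \<open>A letter \<open>(g, True)\<close> stands for the generator \<open>g\<close>, a letter \<open>(g, False)\<close> for its inverse.\<close>

type_synonym 'g sword = "('g \<times> bool) list"

inductive pres_eq :: "'g set \<Rightarrow> ('g sword \<times> 'g sword) set \<Rightarrow> 'g sword \<Rightarrow> 'g sword \<Rightarrow> bool"
  for S :: "'g set" and R :: "('g sword \<times> 'g sword) set"
where
  refl: "u \<in> lists (S \<times> UNIV) \<Longrightarrow> pres_eq S R u u"
| sym: "pres_eq S R u v \<Longrightarrow> pres_eq S R v u"
| trans: "pres_eq S R u v \<Longrightarrow> pres_eq S R v w \<Longrightarrow> pres_eq S R u w"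
| cancel: "u \<in> lists (S \<times> UNIV) \<Longrightarrow> v \<in> lists (S \<times> UNIV) \<Longrightarrow> g \<in> S \<Longrightarrow>
    pres_eq S R (u @ [(g, b), (g, \<not> b)] @ v) (u @ v)"
| rel: "u \<in> lists (S \<times> UNIV) \<Longrightarrow> v \<in> lists (S \<times> UNIV) \<Longrightarrow> (p, q) \<in> R \<Longrightarrow>
    pres_eq S R (u @ p @ v) (u @ q @ v)"

definition pres_class :: "'g set \<Rightarrow> ('g sword \<times> 'g sword) set \<Rightarrow> 'g sword \<Rightarrow> 'g sword set" where
  "pres_class S R u = {v. pres_eq S R u v}"

text \<open>The relators in \<open>R\<close> are expected to be words over \<open>S\<close>.\<close>

definition presented_group :: "'g set \<Rightarrow> ('g sword \<times> 'g sword) set \<Rightarrow> 'g sword set monoid" where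
  "presented_group S R =
    \<lparr>carrier = pres_class S R ` lists (S \<times> UNIV),
     monoid.mult = (\<lambda>X Y. \<Union>u\<in>X. \<Union>v\<in>Y. pres_class S R (u @ v)),
     monoid.one = pres_class S R []\<rparr>"

definition pos_word :: "'g list \<Rightarrow> 'g sword" where
  "pos_word = map (\<lambda>g. (g, True))"

text \<open>The type \<open>word\<close> is the free monoid, written additively so that the convolution product of
  \<open>'g word \<Rightarrow>\<^sub>0 'k\<close> is the product of noncommutative polynomials.\<close>

datatype 'g word = Word "'g list"

instantiation word :: (type) monoid_add
begin

definition zero_word :: "'a word" where "0 = Word []"

fun plus_word :: "'a word \<Rightarrow> 'a word \<Rightarrow> 'a word" where
  "Word u + Word v = Word (u @ v)"

instance
proof
  fix a b c :: "'a word"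
  show "a + b + c = a + (b + c)" by (cases a; cases b; cases c) simp
  show "0 + a = a" by (cases a) (simp add: zero_word_def)
  show "a + 0 = a" by (cases a) (simp add: zero_word_def)
qed

end

type_synonym 'g fpoly = "'g word \<Rightarrow>\<^sub>0 ratfun"

definition gen :: "'g \<Rightarrow> 'g fpoly" where "gen g = Poly_Mapping.single (Word [g]) 1"

definition const :: "ratfun \<Rightarrow> 'g fpoly" where "const c = Poly_Mapping.single 0 c"

text \<open>The free associative \<open>R\<close>-algebra on \<open>S\<close>, for a subring \<open>R\<close> of the field of rational
  functions.\<close>

definition free_algebra :: "ratfun set \<Rightarrow> 'g set \<Rightarrow> (ratfun, 'g fpoly) module" where
  "free_algebra R S =
    \<lparr>carrier = {p. Poly_Mapping.keys p \<subseteq> Word ` lists S \<and> (\<forall>w. Poly_Mapping.lookup p w \<in> R)},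
     monoid.mult = (*), monoid.one = 1, ring.zero = 0, ring.add = (+), smult = (\<lambda>c p. const c * p)\<rparr>"

definition quot_algebra :: "('k, 'a) module \<Rightarrow> 'a set \<Rightarrow> ('k, 'a set) module" where
  "quot_algebra A I =
    \<lparr>carrier = carrier (A Quot I),
     monoid.mult = monoid.mult (A Quot I), monoid.one = \<one>\<^bsub>A Quot I\<^esub>,
     ring.zero = \<zero>\<^bsub>A Quot I\<^esub>, ring.add = ring.add (A Quot I),
     smult = (\<lambda>c X. \<Union>a\<in>X. I +>\<^bsub>A\<^esub> (c \<odot>\<^bsub>A\<^esub> a))\<rparr>"

definition alg_hom :: "('k, 'c) ring_scheme \<Rightarrow> ('k, 'a) module \<Rightarrow> ('k, 'b) module \<Rightarrow> ('a \<Rightarrow> 'b) set" where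
  "alg_hom R A B = {f \<in> ring_hom A B.
     \<forall>c\<in>carrier R. \<forall>a\<in>carrier A. f (c \<odot>\<^bsub>A\<^esub> a) = c \<odot>\<^bsub>B\<^esub> f a}"

text \<open>A right module over a (possibly noncommutative) ring is kept in a \<open>module\<close> record:
  \<open>z \<odot> v\<close> then denotes the vector \<open>v\<close> multiplied by \<open>z\<close> from the right.
  The record fields \<open>mult\<close> and \<open>one\<close> carry no information.\<close>

definition free_right_module :: "('z, 'c) ring_scheme \<Rightarrow> 'b set \<Rightarrow> ('z, 'b \<Rightarrow> 'z) module" where
  "free_right_module Z X =
    \<lparr>carrier = {v \<in> X \<rightarrow>\<^sub>E carrier Z. finite {b \<in> X. v b \<noteq> \<zero>\<^bsub>Z\<^esub>}},
     monoid.mult = undefined, monoid.one = undefined,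
     ring.zero = (\<lambda>b\<in>X. \<zero>\<^bsub>Z\<^esub>), ring.add = (\<lambda>v w. \<lambda>b\<in>X. v b \<oplus>\<^bsub>Z\<^esub> w b),
     smult = (\<lambda>z v. \<lambda>b\<in>X. v b \<otimes>\<^bsub>Z\<^esub> z)\<rparr>"

definition basis_vec :: "('z, 'c) ring_scheme \<Rightarrow> 'b set \<Rightarrow> 'b \<Rightarrow> 'b \<Rightarrow> 'z" where
  "basis_vec Z X b = (\<lambda>c\<in>X. if c = b then \<one>\<^bsub>Z\<^esub> else \<zero>\<^bsub>Z\<^esub>)"

text \<open>For finite \<open>X\<close>: the linear endomorphism of \<^term>\<open>free_right_module Z X\<close> sending the basis
  vector of each \<open>b\<close> to \<open>u b\<close>.\<close>

definition linear_map_of ::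
    "('z, 'c) ring_scheme \<Rightarrow> 'b set \<Rightarrow> ('b \<Rightarrow> 'b \<Rightarrow> 'z) \<Rightarrow> ('b \<Rightarrow> 'z) \<Rightarrow> 'b \<Rightarrow> 'z" where
  "linear_map_of Z X u =
    (\<lambda>v\<in>carrier (free_right_module Z X).
       finsum (free_right_module Z X) (\<lambda>b. v b \<odot>\<^bsub>free_right_module Z X\<^esub> u b) X)"

text \<open>Linear endomorphisms under composition. The scalar multiplication in this record is meaningful
  only for commutative scalars.\<close>

definition linear_endos :: "('z, 'c) ring_scheme \<Rightarrow> ('z, 'v) module \<Rightarrow> ('z, 'v \<Rightarrow> 'v) module" where
  "linear_endos Z V =
    \<lparr>carrier = {f \<in> carrier V \<rightarrow>\<^sub>E carrier V.
        (\<forall>v\<in>carrier V. \<forall>w\<in>carrier V. f (v \<oplus>\<^bsub>V\<^esub> w) = f v \<oplus>\<^bsub>V\<^esub> f w) \<and>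
        (\<forall>z\<in>carrier Z. \<forall>v\<in>carrier V. f (z \<odot>\<^bsub>V\<^esub> v) = z \<odot>\<^bsub>V\<^esub> f v)},
     monoid.mult = (\<lambda>f g. compose (carrier V) f g), monoid.one = (\<lambda>v\<in>carrier V. v),
     ring.zero = (\<lambda>v\<in>carrier V. \<zero>\<^bsub>V\<^esub>), ring.add = (\<lambda>f g. \<lambda>v\<in>carrier V. f v \<oplus>\<^bsub>V\<^esub> g v),
     smult = (\<lambda>c f. \<lambda>v\<in>carrier V. c \<odot>\<^bsub>V\<^esub> f v)\<rparr>"

definition restrict_scalars :: "('k, 'z) module \<Rightarrow> ('z, 'v) module \<Rightarrow> ('k, 'v) module" where
  "restrict_scalars Z V =
    \<lparr>carrier = carrier V, monoid.mult = undefined, monoid.one = undefined,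
     ring.zero = \<zero>\<^bsub>V\<^esub>, ring.add = ring.add V,
     smult = (\<lambda>c v. (c \<odot>\<^bsub>Z\<^esub> \<one>\<^bsub>Z\<^esub>) \<odot>\<^bsub>V\<^esub> v)\<rparr>"

text \<open>The tensor product over \<open>R\<close> of an \<open>R\<close>-module \<open>V\<close> with the field of rational functions:
  the free abelian group on the pairs \<open>(v, c)\<close> modulo the usual bilinearity relations. It is a
  vector space via multiplication in the second factor.\<close>

definition tensor_free :: "(ratfun, 'v) module \<Rightarrow> ('v \<times> ratfun \<Rightarrow>\<^sub>0 int) monoid" where
  "tensor_free V = free_Abelian_group (carrier V \<times> UNIV)"

definition tensor_rels :: "ratfun set \<Rightarrow> (ratfun, 'v) module \<Rightarrow> ('v \<times> ratfun \<Rightarrow>\<^sub>0 int) set" where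
  "tensor_rels R V =
    {frag_of (v \<oplus>\<^bsub>V\<^esub> w, c) - frag_of (v, c) - frag_of (w, c) | v w c.
        v \<in> carrier V \<and> w \<in> carrier V} \<union>
    {frag_of (v, c + d) - frag_of (v, c) - frag_of (v, d) | v c d. v \<in> carrier V} \<union>
    {frag_of (r \<odot>\<^bsub>V\<^esub> v, c) - frag_of (v, r * c) | v r c. v \<in> carrier V \<and> r \<in> R}"

definition tensor_ker :: "ratfun set \<Rightarrow> (ratfun, 'v) module \<Rightarrow> ('v \<times> ratfun \<Rightarrow>\<^sub>0 int) set" where
  "tensor_ker R V = generate (tensor_free V) (tensor_rels R V)"

definition tensor_lift ::
    "ratfun set \<Rightarrow> (ratfun, 'v) module \<Rightarrow> ('v \<times> ratfun \<Rightarrow> 'v \<times> ratfun) \<Rightarrow>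
     ('v \<times> ratfun \<Rightarrow>\<^sub>0 int) set \<Rightarrow> ('v \<times> ratfun \<Rightarrow>\<^sub>0 int) set" where
  "tensor_lift R V \<phi> X =
    (\<Union>t\<in>X. tensor_ker R V #>\<^bsub>tensor_free V\<^esub> frag_extend (\<lambda>p. frag_of (\<phi> p)) t)"

definition tensor_K ::
    "ratfun set \<Rightarrow> (ratfun, 'v) module \<Rightarrow> (ratfun, ('v \<times> ratfun \<Rightarrow>\<^sub>0 int) set) module" where
  "tensor_K R V =
    \<lparr>carrier = carrier (tensor_free V Mod tensor_ker R V),
     monoid.mult = undefined, monoid.one = undefined,
     ring.zero = \<one>\<^bsub>tensor_free V Mod tensor_ker R V\<^esub>,
     ring.add = monoid.mult (tensor_free V Mod tensor_ker R V),
     smult = (\<lambda>k. tensor_lift R V (\<lambda>(v, c). (v, k * c)))\<rparr>"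

text \<open>The endomorphism \<open>f \<otimes> id\<close> of the tensor product.\<close>

definition tensor_map ::
    "ratfun set \<Rightarrow> (ratfun, 'v) module \<Rightarrow> ('v \<Rightarrow> 'v) \<Rightarrow>
     ('v \<times> ratfun \<Rightarrow>\<^sub>0 int) set \<Rightarrow> ('v \<times> ratfun \<Rightarrow>\<^sub>0 int) set" where
  "tensor_map R V f =
    (\<lambda>X\<in>carrier (tensor_K R V). tensor_lift R V (\<lambda>(v, c). (f v, c)) X)"

datatype diagram = TypeA nat | TypeD nat | TypeE nat

fun simply_laced_finite :: "diagram \<Rightarrow> bool" where
  "simply_laced_finite (TypeA n) \<longleftrightarrow> n \<ge> 1"
| "simply_laced_finite (TypeD n) \<longleftrightarrow> n \<ge> 4"
| "simply_laced_finite (TypeE n) \<longleftrightarrow> n \<in> {6, 7, 8}"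

fun nodes :: "diagram \<Rightarrow> nat set" where
  "nodes (TypeA n) = {1..n}"
| "nodes (TypeD n) = {1..n}"
| "nodes (TypeE n) = {1..n}"

text \<open>Nodes are labelled as in Bourbaki.\<close>

fun edges :: "diagram \<Rightarrow> nat set set" where
  "edges (TypeA n) = {{i, i + 1} | i. 1 \<le> i \<and> i < n}"
| "edges (TypeD n) = insert {n - 2, n} {{i, i + 1} | i. 1 \<le> i \<and> i < n - 1}"
| "edges (TypeE n) = {{1, 3}, {2, 4}} \<union> {{i, i + 1} | i. 3 \<le> i \<and> i < n}"

definition adj :: "diagram \<Rightarrow> nat \<Rightarrow> nat \<Rightarrow> bool" where
  "adj M i j \<longleftrightarrow> {i, j} \<in> edges M"

definition braid_rels :: "diagram \<Rightarrow> (nat sword \<times> nat sword) set" where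
  "braid_rels M =
    {(pos_word [i, j], pos_word [j, i]) | i j.
        i \<in> nodes M \<and> j \<in> nodes M \<and> i \<noteq> j \<and> \<not> adj M i j} \<union>
    {(pos_word [i, j, i], pos_word [j, i, j]) | i j.
        i \<in> nodes M \<and> j \<in> nodes M \<and> adj M i j}"

definition artin :: "diagram \<Rightarrow> nat sword set monoid" where
  "artin M = presented_group (nodes M) (braid_rels M)"

definition artin_word :: "diagram \<Rightarrow> nat list \<Rightarrow> nat sword set" where
  "artin_word M is = pres_class (nodes M) (braid_rels M) (pos_word is)"

abbreviation artin_gen :: "diagram \<Rightarrow> nat \<Rightarrow> nat sword set" where
  "artin_gen M i \<equiv> artin_word M [i]"

definition coxeter_rels :: "diagram \<Rightarrow> (nat sword \<times> nat sword) set" where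
  "coxeter_rels M = braid_rels M \<union> {(pos_word [i, i], []) | i. i \<in> nodes M}"

definition coxeter :: "diagram \<Rightarrow> nat sword set monoid" where
  "coxeter M = presented_group (nodes M) (coxeter_rels M)"

definition coxeter_word :: "diagram \<Rightarrow> nat list \<Rightarrow> nat sword set" where
  "coxeter_word M is = pres_class (nodes M) (coxeter_rels M) (pos_word is)"

definition expresses :: "diagram \<Rightarrow> nat list \<Rightarrow> nat sword set \<Rightarrow> bool" where
  "expresses M is w \<longleftrightarrow> is \<in> lists (nodes M) \<and> coxeter_word M is = w"

definition cox_length :: "diagram \<Rightarrow> nat sword set \<Rightarrow> nat" where
  "cox_length M w = (LEAST k. \<exists>is. expresses M is w \<and> length is = k)"

definition reduced_expr :: "diagram \<Rightarrow> nat list \<Rightarrow> nat sword set \<Rightarrow> bool" where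
  "reduced_expr M is w \<longleftrightarrow> expresses M is w \<and> length is = cox_length M w"

text \<open>By Matsumoto's theorem the value does not depend on the reduced expression.\<close>

definition psi :: "diagram \<Rightarrow> nat sword set \<Rightarrow> nat sword set" where
  "psi M w = artin_word M (SOME is. reduced_expr M is w)"

text \<open>Elements of the root lattice are given by their coordinates with respect to the simple
  roots. The bilinear form is the one in which all roots have square length 2.\<close>

type_synonym root = "nat \<Rightarrow> int"

definition simple_root :: "nat \<Rightarrow> root" where
  "simple_root i = (\<lambda>j. if j = i then 1 else 0)"

definition cartan :: "diagram \<Rightarrow> nat \<Rightarrow> nat \<Rightarrow> int" where
  "cartan M i j = (if i = j then 2 else if adj M i j then - 1 else 0)"

definition inner_form :: "diagram \<Rightarrow> root \<Rightarrow> root \<Rightarrow> int" where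
  "inner_form M u v = (\<Sum>i\<in>nodes M. \<Sum>j\<in>nodes M. cartan M i j * u i * v j)"

definition reflect :: "diagram \<Rightarrow> nat \<Rightarrow> root \<Rightarrow> root" where
  "reflect M i v = (\<lambda>j. v j - inner_form M (simple_root i) v * simple_root i j)"

definition cox_act :: "diagram \<Rightarrow> nat sword set \<Rightarrow> root \<Rightarrow> root" where
  "cox_act M w v = foldr (reflect M) (SOME is. expresses M is w) v"

definition roots :: "diagram \<Rightarrow> root set" where
  "roots M = {cox_act M w (simple_root i) | w i. w \<in> carrier (coxeter M) \<and> i \<in> nodes M}"

definition pos_roots :: "diagram \<Rightarrow> root set" where
  "pos_roots M = {\<beta> \<in> roots M. \<forall>j. \<beta> j \<ge> 0}"

definition highest_root :: "diagram \<Rightarrow> root" where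
  "highest_root M = (THE \<gamma>. \<gamma> \<in> pos_roots M \<and> (\<forall>\<beta>\<in>pos_roots M. \<forall>j. \<beta> j \<le> \<gamma> j))"

definition C_nodes :: "diagram \<Rightarrow> nat set" where
  "C_nodes M = {j \<in> nodes M. inner_form M (simple_root j) (highest_root M) = 0}"

definition w_to_highest :: "diagram \<Rightarrow> root \<Rightarrow> nat sword set" where
  "w_to_highest M \<beta> = (THE w. w \<in> carrier (coxeter M) \<and> cox_act M w \<beta> = highest_root M \<and>
     (\<forall>u\<in>carrier (coxeter M). cox_act M u \<beta> = highest_root M \<longrightarrow> cox_length M w \<le> cox_length M u))"

definition d_elt :: "diagram \<Rightarrow> root \<Rightarrow> nat sword set" where
  "d_elt M \<beta> = psi M (inv\<^bsub>coxeter M\<^esub> (w_to_highest M \<beta>))"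

definition hecke_rels :: "diagram \<Rightarrow> nat set \<Rightarrow> nat fpoly set" where
  "hecke_rels M J =
    {gen i * gen j - gen j * gen i | i j. i \<in> J \<and> j \<in> J \<and> \<not> adj M i j} \<union>
    {gen i * gen j * gen i - gen j * gen i * gen j | i j. i \<in> J \<and> j \<in> J \<and> adj M i j} \<union>
    {gen j ^ 2 + const m_par * gen j - 1 | j. j \<in> J}"

definition hecke_ideal :: "ratfun set \<Rightarrow> diagram \<Rightarrow> nat set \<Rightarrow> nat fpoly set" where
  "hecke_ideal R M J = Idl\<^bsub>free_algebra R J\<^esub> (hecke_rels M J)"

definition hecke :: "ratfun set \<Rightarrow> diagram \<Rightarrow> nat set \<Rightarrow> (ratfun, nat fpoly set) module" where
  "hecke R M J = quot_algebra (free_algebra R J) (hecke_ideal R M J)"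

definition hecke_gen :: "ratfun set \<Rightarrow> diagram \<Rightarrow> nat set \<Rightarrow> nat \<Rightarrow> nat fpoly set" where
  "hecke_gen R M J j = hecke_ideal R M J +>\<^bsub>free_algebra R J\<^esub> gen j"

abbreviation Z0 :: "diagram \<Rightarrow> (ratfun, nat fpoly set) module" where
  "Z0 M \<equiv> hecke Q_l_m M (C_nodes M)"

abbreviation Z1 :: "diagram \<Rightarrow> (ratfun, nat fpoly set) module" where
  "Z1 M \<equiv> hecke Q_m M (C_nodes M)"

text \<open>The inclusion of \<^term>\<open>Z1 M\<close> in \<^term>\<open>Z0 M\<close> on classes of polynomials.\<close>

definition Z1_incl :: "diagram \<Rightarrow> nat fpoly set \<Rightarrow> nat fpoly set" where
  "Z1_incl M X =
    (\<Union>p\<in>X. hecke_ideal Q_l_m M (C_nodes M) +>\<^bsub>free_algebra Q_l_m (C_nodes M)\<^esub> p)"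

definition h_elt :: "diagram \<Rightarrow> root \<Rightarrow> nat \<Rightarrow> nat fpoly set" where
  "h_elt M \<beta> i = hecke_gen Q_m M (C_nodes M)
     (THE j. j \<in> C_nodes M \<and>
        inv\<^bsub>artin M\<^esub> (d_elt M \<beta>) \<otimes>\<^bsub>artin M\<^esub> artin_gen M i \<otimes>\<^bsub>artin M\<^esub> d_elt M \<beta> = artin_gen M j)"

datatype bmw_gen = G nat | E nat

definition bmw_free :: "diagram \<Rightarrow> (ratfun, bmw_gen fpoly) module" where
  "bmw_free M = free_algebra UNIV (G ` nodes M \<union> E ` nodes M)"

definition bmw_rels :: "diagram \<Rightarrow> bmw_gen fpoly set" where
  "bmw_rels M =
    {gen (G i) * gen (G j) - gen (G j) * gen (G i) | i j.
        i \<in> nodes M \<and> j \<in> nodes M \<and> \<not> adj M i j} \<union>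
    {gen (G i) * gen (G j) * gen (G i) - gen (G j) * gen (G i) * gen (G j) | i j.
        i \<in> nodes M \<and> j \<in> nodes M \<and> adj M i j} \<union>
    {const m_par * gen (E i) - const l_ind * (gen (G i) ^ 2 + const m_par * gen (G i) - 1) | i.
        i \<in> nodes M} \<union>
    {gen (G i) * gen (E i) - const (inverse l_ind) * gen (E i) | i. i \<in> nodes M} \<union>
    {gen (E i) * gen (G j) * gen (E i) - const l_ind * gen (E i) | i j.
        i \<in> nodes M \<and> j \<in> nodes M \<and> adj M i j}"

definition bmw_ideal :: "diagram \<Rightarrow> bmw_gen fpoly set" where
  "bmw_ideal M = Idl\<^bsub>bmw_free M\<^esub> (bmw_rels M)"

definition bmw :: "diagram \<Rightarrow> (ratfun, bmw_gen fpoly set) module" where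
  "bmw M = quot_algebra (bmw_free M) (bmw_ideal M)"

definition bmw_elt :: "diagram \<Rightarrow> bmw_gen \<Rightarrow> bmw_gen fpoly set" where
  "bmw_elt M a = bmw_ideal M +>\<^bsub>bmw_free M\<^esub> gen a"

definition I2 :: "diagram \<Rightarrow> bmw_gen fpoly set set" where
  "I2 M = Idl\<^bsub>bmw M\<^esub>
    {bmw_elt M (E i) \<otimes>\<^bsub>bmw M\<^esub> bmw_elt M (E j) | i j.
        i \<in> nodes M \<and> j \<in> nodes M \<and> i \<noteq> j \<and> \<not> adj M i j}"

definition bmw_mod_I2 :: "diagram \<Rightarrow> (ratfun, bmw_gen fpoly set set) module" where
  "bmw_mod_I2 M = quot_algebra (bmw M) (I2 M)"

abbreviation V0 :: "diagram \<Rightarrow> (nat fpoly set, root \<Rightarrow> nat fpoly set) module" where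
  "V0 M \<equiv> free_right_module (Z0 M) (pos_roots M)"

abbreviation V0_scalars :: "diagram \<Rightarrow> (ratfun, root \<Rightarrow> nat fpoly set) module" where
  "V0_scalars M \<equiv> restrict_scalars (Z0 M) (V0 M)"

abbreviation x_vec :: "diagram \<Rightarrow> root \<Rightarrow> root \<Rightarrow> nat fpoly set" where
  "x_vec M \<equiv> basis_vec (Z0 M) (pos_roots M)"

text \<open>For a positive root \<open>\<beta>\<close> the inner product with a simple root is one of \<open>2, 1, 0, -1\<close>.\<close>

definition tau :: "diagram \<Rightarrow> nat \<Rightarrow> (root \<Rightarrow> nat fpoly set) \<Rightarrow> root \<Rightarrow> nat fpoly set" where
  "tau M i = linear_map_of (Z0 M) (pos_roots M) (\<lambda>\<beta>.
     if inner_form M (simple_root i) \<beta> = 2 then \<zero>\<^bsub>V0 M\<^esub>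
     else if inner_form M (simple_root i) \<beta> = 1 then x_vec M (\<beta> - simple_root i)
     else if inner_form M (simple_root i) \<beta> = 0 then Z1_incl M (h_elt M \<beta> i) \<odot>\<^bsub>V0 M\<^esub> x_vec M \<beta>
     else x_vec M (\<beta> + simple_root i) \<ominus>\<^bsub>V0 M\<^esub> (m_par \<odot>\<^bsub>V0_scalars M\<^esub> x_vec M \<beta>))"

definition T_map :: "diagram \<Rightarrow> (nat \<Rightarrow> root \<Rightarrow> nat fpoly set) \<Rightarrow> nat \<Rightarrow>
    (root \<Rightarrow> nat fpoly set) \<Rightarrow> root \<Rightarrow> nat fpoly set" where
  "T_map M T i = linear_map_of (Z0 M) (pos_roots M)
     (\<lambda>\<beta>. Z1_incl M (T i \<beta>) \<odot>\<^bsub>V0 M\<^esub> x_vec M (simple_root i))"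

definition sigma :: "diagram \<Rightarrow> (nat \<Rightarrow> root \<Rightarrow> nat fpoly set) \<Rightarrow> nat \<Rightarrow>
    (root \<Rightarrow> nat fpoly set) \<Rightarrow> root \<Rightarrow> nat fpoly set" where
  "sigma M T i = (\<lambda>v\<in>carrier (V0 M).
     tau M i v \<oplus>\<^bsub>V0 M\<^esub> (inverse l_ind \<odot>\<^bsub>V0_scalars M\<^esub> T_map M T i v))"

abbreviation VK :: "diagram \<Rightarrow> (ratfun, ((root \<Rightarrow> nat fpoly set) \<times> ratfun \<Rightarrow>\<^sub>0 int) set) module" where
  "VK M \<equiv> tensor_K Q_l_m (V0_scalars M)"

end

theory Submission
  imports Defs
begin

text \<open>Let \<open>U\<close> be the module of functions from the set \<open>\<Phi>\<close> of all roots to the coefficient ring. The maps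
  \<open>\<tau>\<^sub>i\<close> are truncations to \<open>\<Phi>\<^sup>+\<close> of operators \<open>S\<^sub>i\<close> on \<open>U\<close> that satisfy the braid relations and
  \<open>S\<^sub>i\<^sup>2 + m S\<^sub>i - 1 = 0\<close>, that is, of a Hecke algebra module induced from the stabilizer of \<open>\<alpha>\<^sub>0\<close>. Applying the
  \<open>S\<^sub>i\<^sup>-\<^sup>1\<close> along the words that raise a root \<open>\<gamma>\<close> to \<open>\<alpha>\<^sub>0\<close> turns the delta function of \<open>\<alpha>\<^sub>0\<close> into a vector \<open>X\<^sub>\<gamma>\<close>,
  which does not depend on the word, and one puts \<open>T\<^sub>i\<^sub>,\<^sub>\<beta> = X\<^sub>-\<^sub>\<beta>(-\<alpha>\<^sub>i)\<close>. Evaluating \<open>S\<^sub>j X\<^sub>-\<^sub>\<beta>\<close> at \<open>-\<alpha>\<^sub>i\<close> in two ways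
  shows that the functionals \<open>t\<^sub>i : x\<^sub>\<beta> \<mapsto> T\<^sub>i\<^sub>,\<^sub>\<beta>\<close> satisfy \<open>t\<^sub>i \<tau>\<^sub>j = t\<^sub>j \<tau>\<^sub>i\<close> for adjacent and
  \<open>t\<^sub>i \<tau>\<^sub>j = h t\<^sub>i\<close>, with \<open>h\<close> belonging to \<open>\<alpha>\<^sub>i\<close> and \<open>j\<close>, for distinct non-adjacent nodes, and \<open>t\<^sub>i x\<^sub>\<beta>\<close> is \<open>1\<close> or \<open>0\<close> when \<open>\<beta>\<close>
  is \<open>\<alpha>\<^sub>i\<close> or another simple root.

  These identities yield the braid relations for \<open>\<sigma>\<^sub>i = \<tau>\<^sub>i + l\<^sup>-\<^sup>1 x\<^sub>\<alpha>\<^sub>i t\<^sub>i\<close>. They also show that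
  \<open>q\<^sub>i = \<sigma>\<^sub>i\<^sup>2 + m \<sigma>\<^sub>i - 1\<close> has its image in the span of \<open>x\<^sub>\<alpha>\<^sub>i\<close> and satisfies \<open>\<sigma>\<^sub>i q\<^sub>i = l\<^sup>-\<^sup>1 q\<^sub>i\<close>,
  \<open>q\<^sub>i \<sigma>\<^sub>j q\<^sub>i = m q\<^sub>i\<close> for adjacent and \<open>q\<^sub>i q\<^sub>j = 0\<close> for distinct non-adjacent nodes, so that \<open>g\<^sub>i \<mapsto> \<sigma>\<^sub>i\<close> and
  \<open>e\<^sub>i \<mapsto> (l / m) q\<^sub>i\<close> respect the BMW relations and kill \<open>I\<^sub>2\<close>.\<close>

text \<open>A recursion for the coefficients over the positive roots alone would need a consistency
  check at every branching. On all roots the same formula is an action of the Hecke algebra on a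
  module whose standard basis is indexed by the cosets of the stabilizer of \<open>alpha0\<close>,
  that is, by the roots, and one confluence argument makes the vectors \<open>X\<close> well
  defined; their entries are relatives of R-polynomials. As \<open>S\<close> involves only
  \<open>m\<close> and Hecke generators, no \<open>l\<close> can enter. The sign in
  \<open>X (- \<beta>)\<close> reverses all inner products with simple roots and so turns the rule
  for \<open>S j (X v)\<close> into the rule for \<open>tau\<close> on basis vectors, except at
  \<open>simple_root j\<close>, where \<open>S\<close> yields \<open>X (simple_root j)\<close> and
  \<open>tau\<close> yields zero. Coordinates at negative simple roots are blind to this difference:
  \<open>X\<close> is triangular for \<open>depth\<close>, and these roots are deeper than every
  positive root. Roots are treated as the vectors of norm 2 in the root lattice, a set visibly
  closed under negation and reflections; agreement with the orbit definition follows once words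
  raising a root are available.\<close>

declare in_listsD [rule del] in_listsI [rule del]

subsection \<open>The quadratic form\<close>

lemma simple_root_self [simp]: "simple_root i i = 1"
  and simple_root_other: "j \<noteq> i \<Longrightarrow> simple_root i j = 0"
  by (simp_all add: simple_root_def)

lemma finite_nodes [simp]: "finite (nodes M)"
  by (cases M) auto

lemma adj_sym: "adj M i j \<longleftrightarrow> adj M j i"
  by (simp add: adj_def insert_commute)

lemma cartan_sym: "cartan M i j = cartan M j i"
  by (simp add: cartan_def adj_sym)

lemma cartan_self [simp]: "cartan M i i = 2"
  by (simp add: cartan_def)

lemma inner_form_sym: "inner_form M u v = inner_form M v u"
  unfolding inner_form_def
  by (subst sum.swap) (simp add: cartan_sym mult_ac)

lemma inner_form_add_right: "inner_form M u (v + w) = inner_form M u v + inner_form M u w"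
  unfolding inner_form_def by (simp add: algebra_simps sum.distrib)

lemma inner_form_diff_right: "inner_form M u (v - w) = inner_form M u v - inner_form M u w"
  unfolding inner_form_def by (simp add: algebra_simps sum_subtractf)

lemma inner_form_minus_right: "inner_form M u (- v) = - inner_form M u v"
  unfolding inner_form_def by (simp add: sum_negf)

lemma inner_form_add_left: "inner_form M (v + w) u = inner_form M v u + inner_form M w u"
  by (metis inner_form_add_right inner_form_sym)

lemma inner_form_diff_left: "inner_form M (v - w) u = inner_form M v u - inner_form M w u"
  by (metis inner_form_diff_right inner_form_sym)

lemma inner_form_minus_left: "inner_form M (- v) u = - inner_form M v u"
  by (metis inner_form_minus_right inner_form_sym)

lemmas inner_form_linear =
  inner_form_add_right inner_form_diff_right inner_form_minus_right
  inner_form_add_left inner_form_diff_left inner_form_minus_left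

lemma inner_form_scale_right: "inner_form M u (\<lambda>j. c * v j) = c * inner_form M u v"
  unfolding inner_form_def by (simp add: sum_distrib_left mult_ac)

lemma inner_form_simple_left:
  assumes "i \<in> nodes M"
  shows "inner_form M (simple_root i) v = (\<Sum>j\<in>nodes M. cartan M i j * v j)"
proof -
  have "inner_form M (simple_root i) v =
      (\<Sum>k\<in>nodes M. if k = i then (\<Sum>j\<in>nodes M. cartan M i j * v j) else 0)"
    unfolding inner_form_def by (intro sum.cong) (auto simp: simple_root_def)
  then show ?thesis using assms by simp
qed

lemma inner_form_simple_simple:
  assumes "i \<in> nodes M" "j \<in> nodes M"
  shows "inner_form M (simple_root i) (simple_root j) = cartan M i j"
proof -
  have "(\<Sum>k\<in>nodes M. cartan M i k * simple_root j k) =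
      (\<Sum>k\<in>nodes M. if k = j then cartan M i j else 0)"
    by (intro sum.cong) (auto simp: simple_root_def)
  then show ?thesis using assms by (simp add: inner_form_simple_left)
qed

lemma inner_form_expand:
  "inner_form M u v = (\<Sum>i\<in>nodes M. u i * inner_form M (simple_root i) v)"
  by (simp add: inner_form_simple_left sum_distrib_left mult_ac)
     (simp add: inner_form_def mult_ac)

lemma reflect_apply: "reflect M i v j = v j - inner_form M (simple_root i) v * simple_root i j"
  by (simp add: reflect_def)

lemma inner_form_reflect_right:
  "inner_form M u (reflect M i v) =
     inner_form M u v - inner_form M (simple_root i) v * inner_form M u (simple_root i)"
proof -
  have "reflect M i v = v - (\<lambda>j. inner_form M (simple_root i) v * simple_root i j)"
    by (auto simp: reflect_def)
  then show ?thesis by (simp add: inner_form_diff_right inner_form_scale_right)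
qed

lemma inner_form_reflect:
  assumes "i \<in> nodes M"
  shows "inner_form M (reflect M i u) (reflect M i v) = inner_form M u v"
proof -
  have *: "inner_form M (reflect M i u) w =
      inner_form M u w - inner_form M (simple_root i) u * inner_form M (simple_root i) w" for w
    using inner_form_reflect_right[of M w i u] inner_form_sym[of M w] by simp
  show ?thesis using assms
    by (simp add: * inner_form_reflect_right inner_form_simple_simple inner_form_sym[of M u "simple_root i"])
qed

lemma inner_form_simple_reflect_self:
  "i \<in> nodes M \<Longrightarrow> inner_form M (simple_root i) (reflect M i v) = - inner_form M (simple_root i) v"
  by (simp add: inner_form_reflect_right inner_form_simple_simple)

lemma inner_form_simple_reflect:
  "i \<in> nodes M \<Longrightarrow> j \<in> nodes M \<Longrightarrow> inner_form M (simple_root j) (reflect M i v) =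
     inner_form M (simple_root j) v - inner_form M (simple_root i) v * cartan M j i"
  by (simp add: inner_form_reflect_right inner_form_simple_simple)

lemma reflect_reflect [simp]: "i \<in> nodes M \<Longrightarrow> reflect M i (reflect M i v) = v"
  by (rule ext) (simp add: reflect_apply inner_form_simple_reflect_self)

lemma reflect_minus: "reflect M i (- v) = - reflect M i v"
  by (rule ext) (simp add: reflect_apply inner_form_minus_right)

lemma reflect_commute:
  assumes "i \<in> nodes M" "j \<in> nodes M" "i \<noteq> j" "\<not> adj M i j"
  shows "reflect M i (reflect M j v) = reflect M j (reflect M i v)"
  using assms
  by (intro ext) (simp add: reflect_apply inner_form_simple_reflect cartan_def adj_sym)

lemma adj_irrefl: "i \<in> nodes M \<Longrightarrow> \<not> adj M i i"
  by (cases M) (auto simp: adj_def)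

lemma reflect_braid:
  assumes "i \<in> nodes M" "j \<in> nodes M" "adj M i j"
  shows "reflect M i (reflect M j (reflect M i v)) = reflect M j (reflect M i (reflect M j v))"
proof -
  have "adj M j i" "i \<noteq> j" using assms adj_sym adj_irrefl by auto
  then show ?thesis using assms
    by (intro ext) (simp add: reflect_apply inner_form_simple_reflect cartan_def algebra_simps)
qed

section \<open>Positive definiteness: completing squares along the arms of the diagram\<close>

definition arm_form :: "nat \<Rightarrow> (nat \<Rightarrow> real) \<Rightarrow> real" where
  "arm_form k u = (\<Sum>i=1..k. (real i + 1) / (2 * real i) * (u i - real i / (real i + 1) * u (i + 1)) ^ 2)"

text \<open>The quadratic form of an arm of length \<open>k\<close> attached to a node with coordinate \<open>u (k + 1)\<close>,
  by completing squares from the leaf inwards.\<close>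

lemma arm_sum_squares:
  fixes u :: "nat \<Rightarrow> real"
  shows "(\<Sum>i=1..k. u i ^ 2) - (\<Sum>i=1..k. u i * u (i + 1)) =
     arm_form k u - real k / (2 * (real k + 1)) * u (k + 1) ^ 2"
  unfolding arm_form_def
proof (induction k)
  case (Suc k)
  have sq: "(a + 1) / (2 * a) * (x - a / (a + 1) * y) ^ 2 =
      (a + 1) / (2 * a) * x ^ 2 - x * y + a / (2 * (a + 1)) * y ^ 2" if "a > 0" for a x y :: real
  proof -
    have "(a + 1) / (2 * a) * (x - a / (a + 1) * y) ^ 2 =
        (a + 1) / (2 * a) * x ^ 2 - ((a + 1) / (2 * a) * 2 * (a / (a + 1))) * (x * y) +
        ((a + 1) / (2 * a) * (a / (a + 1)) * (a / (a + 1))) * y ^ 2"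
      by (simp only: power2_diff power_mult_distrib) (simp only: power2_eq_square ring_distribs mult_ac)
    also have "(a + 1) / (2 * a) * 2 * (a / (a + 1)) = 1" using that by simp
    also have "(a + 1) / (2 * a) * (a / (a + 1)) * (a / (a + 1)) = a / (2 * (a + 1))"
      using that by simp
    finally show ?thesis by simp
  qed
  \<comment> \<open>The negative remainder of the shorter arm lowers the coefficient of the square
    of \<open>u (Suc k)\<close> from 1 to exactly the leading coefficient of the next completed
    square.\<close>
  have "(real (Suc k) + 1) / (2 * real (Suc k)) + real k / (2 * (real k + 1)) = 1"
    by (simp add: divide_simps) (simp add: algebra_simps)
  then have "(real (Suc k) + 1) / (2 * real (Suc k)) * u (Suc k) ^ 2 +
      real k / (2 * (real k + 1)) * u (Suc k) ^ 2 = u (Suc k) ^ 2"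
    by (metis distrib_right mult_1)
  moreover have "(\<Sum>i = 1..Suc k. (real i + 1) / (2 * real i) * (u i - real i / (real i + 1) * u (i + 1)) ^ 2)
      = (\<Sum>i = 1..k. (real i + 1) / (2 * real i) * (u i - real i / (real i + 1) * u (i + 1)) ^ 2)
        + ((real (Suc k) + 1) / (2 * real (Suc k)) * u (Suc k) ^ 2
        - u (Suc k) * u (Suc k + 1) + real (Suc k) / (2 * (real (Suc k) + 1)) * u (Suc k + 1) ^ 2)"
    using sq[of "real (Suc k)" "u (Suc k)" "u (Suc k + 1)"] by simp
  moreover have "(\<Sum>i=1..Suc k. u i ^ 2) - (\<Sum>i=1..Suc k. u i * u (i + 1)) =
      ((\<Sum>i=1..k. u i ^ 2) - (\<Sum>i=1..k. u i * u (i + 1))) + u (Suc k) ^ 2 - u (Suc k) * u (Suc k + 1)"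
    by simp
  ultimately show ?case unfolding Suc.IH by simp
qed simp

lemma arm_form_1: "arm_form 1 u = (u 1 - u 2 / 2) ^ 2"
  by (simp add: arm_form_def numeral_2_eq_2)

lemma arm_form_2: "arm_form 2 u = (u 1 - u 2 / 2) ^ 2 + 3 / 4 * (u 2 - 2 / 3 * u 3) ^ 2"
proof -
  have "{1..2::nat} = {1, 2}" by auto
  then show ?thesis by (simp add: arm_form_def flip: numeral_2_eq_2)
qed

lemma arm_form_nonneg: "arm_form k u \<ge> 0"
  unfolding arm_form_def by (intro sum_nonneg) auto

text \<open>Every square in \<open>arm_form\<close> has coefficient at least 1/2, so each of them is
  at most \<open>2 * B ^ 2\<close>; since the factor \<open>i / (i + 1)\<close> is below 1, the
  absolute value grows by at most \<open>2 * B\<close> per step away from the branching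
  node.\<close>

lemma arm_bound:
  assumes "arm_form k u \<le> B ^ 2" "B \<ge> 0" "i \<in> {1..k}"
  shows "\<bar>u i\<bar> \<le> \<bar>u (k + 1)\<bar> + 2 * real k * B"
  using assms(3)
proof -
  have step: "\<bar>u i\<bar> \<le> \<bar>u (i + 1)\<bar> + 2 * B" if "i \<in> {1..k}" for i
  proof -
    let ?d = "u i - real i / (real i + 1) * u (i + 1)"
    have "(1/2) * ?d ^ 2 \<le> (real i + 1) / (2 * real i) * ?d ^ 2"
      using that by (intro mult_right_mono) (auto simp: field_simps)
    also have "\<dots> \<le> arm_form k u"
      unfolding arm_form_def using that by (intro member_le_sum) auto
    finally have "?d ^ 2 \<le> 2 * B ^ 2" using assms(1) by linarith
    also have "\<dots> \<le> (2 * B) ^ 2" by (simp add: power2_eq_square)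
    finally have "\<bar>?d\<bar> \<le> 2 * B" using assms(2) abs_le_square_iff[of ?d "2 * B"] by simp
    moreover have "\<bar>real i / (real i + 1) * u (i + 1)\<bar> \<le> 1 * \<bar>u (i + 1)\<bar>"
      unfolding abs_mult by (intro mult_right_mono) auto
    ultimately show ?thesis
      using abs_triangle_ineq[of ?d "real i / (real i + 1) * u (i + 1)"] by simp
  qed
  have "\<bar>u (k + 1 - d)\<bar> \<le> \<bar>u (k + 1)\<bar> + 2 * real d * B" if "d \<le> k" for d
    using that
  proof (induction d)
    case (Suc d)
    have eq: "k + 1 - Suc d + 1 = k + 1 - d" using Suc.prems by simp
    have "k + 1 - Suc d \<in> {1..k}" using Suc.prems by auto
    from step[OF this] Suc show ?case unfolding eq by (simp add: algebra_simps)
  qed simp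
  from this[of "k + 1 - i"] have "\<bar>u i\<bar> \<le> \<bar>u (k + 1)\<bar> + 2 * real (k + 1 - i) * B"
    using \<open>i \<in> {1..k}\<close> by force
  also have "\<dots> \<le> \<bar>u (k + 1)\<bar> + 2 * real k * B"
    using assms(2,3) by (intro add_left_mono mult_right_mono) auto
  finally show ?thesis .
qed

text \<open>Every edge is listed once, as leading from a node \<open>i\<close> in \<open>D\<close>
  to \<open>p i\<close>, which turns a sum over two-element sets into a sum over \<open>D\<close>.
  The last hypothesis prevents an edge from being listed from both of its ends.\<close>

lemma inner_form_oriented:
  assumes D: "D \<subseteq> nodes M" "p ` D \<subseteq> nodes M"
    and adj: "\<And>i j. i \<in> nodes M \<Longrightarrow> j \<in> nodes M \<Longrightarrow>
      adj M i j \<longleftrightarrow> (i \<in> D \<and> j = p i) \<or> (j \<in> D \<and> i = p j)"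
    and ex: "\<And>i. i \<in> D \<Longrightarrow> p i \<in> D \<Longrightarrow> p (p i) \<noteq> i"
  shows "inner_form M v v = 2 * (\<Sum>i\<in>nodes M. v i ^ 2) - 2 * (\<Sum>i\<in>D. v i * v (p i))"
proof -
  have fin: "finite D" using D(1) by (rule finite_subset) simp
  have "inner_form M v v = (\<Sum>i\<in>nodes M. \<Sum>j\<in>nodes M.
      (if i = j then 2 * v i ^ 2 else 0)
      - (if i \<in> D \<and> j = p i then v i * v (p i) else 0)
      - (if j \<in> D \<and> i = p j then v j * v (p j) else 0))"
    unfolding inner_form_def
  proof (intro sum.cong refl)
    fix i j assume ij: "i \<in> nodes M" "j \<in> nodes M"
    have "\<not> (i \<in> D \<and> j = p i \<and> j \<in> D \<and> i = p j)" using ex by metis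
    then show "cartan M i j * v i * v j = (if i = j then 2 * v i ^ 2 else 0)
      - (if i \<in> D \<and> j = p i then v i * v (p i) else 0)
      - (if j \<in> D \<and> i = p j then v j * v (p j) else 0)"
      using adj[OF ij] adj_irrefl[OF ij(1)] by (auto simp: cartan_def power2_eq_square)
  qed auto
  also have "\<dots> = (\<Sum>i\<in>nodes M. 2 * v i ^ 2)
      - (\<Sum>i\<in>nodes M. if i \<in> D then v i * v (p i) else 0)
      - (\<Sum>j\<in>nodes M. if j \<in> D then v j * v (p j) else 0)"
  proof -
    have a: "(\<Sum>j\<in>nodes M. if i \<in> D \<and> j = p i then v i * v (p i) else 0) =
        (if i \<in> D then v i * v (p i) else 0)" for i
      using D(2) by (cases "i \<in> D") auto
    have b: "(\<Sum>i\<in>nodes M. if j \<in> D \<and> i = p j then v j * v (p j) else 0) =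
        (if j \<in> D then v j * v (p j) else 0)" for j
      using D(2) by (cases "j \<in> D") auto
    have c: "(\<Sum>i\<in>nodes M. \<Sum>j\<in>nodes M. if j \<in> D \<and> i = p j then v j * v (p j) else 0) =
        (\<Sum>j\<in>nodes M. if j \<in> D then v j * v (p j) else 0)"
      by (subst sum.swap) (simp add: b)
    show ?thesis by (simp only: sum_subtractf a c) simp
  qed
  also have "(\<Sum>i\<in>nodes M. if i \<in> D then v i * v (p i) else 0) = (\<Sum>i\<in>D. v i * v (p i))"
    using D(1) by (simp add: sum.inter_filter[symmetric] Int_absorb1 Collect_conj_eq[symmetric]
        cong: conj_cong) (rule sum.cong; auto)
  finally show ?thesis by (simp add: sum_distrib_left sum_negf)
qed

lemma inner_form_TypeA:
  "inner_form (TypeA n) v v = 2 * (\<Sum>i=1..n. v i ^ 2) - 2 * (\<Sum>i=1..<n. v i * v (i + 1))"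
proof -
  have "inner_form (TypeA n) v v =
      2 * (\<Sum>i\<in>nodes (TypeA n). v i ^ 2) - 2 * (\<Sum>i\<in>{1..<n}. v i * v (i + 1))"
    by (rule inner_form_oriented) (auto simp: adj_def doubleton_eq_iff)
  then show ?thesis by simp
qed

lemma inner_form_TypeD:
  assumes "n \<ge> 4"
  shows "inner_form (TypeD n) v v =
    2 * (\<Sum>i=1..n. v i ^ 2) - 2 * ((\<Sum>i=1..n-2. v i * v (i + 1)) + v n * v (n - 2))"
proof -
  have "inner_form (TypeD n) v v = 2 * (\<Sum>i\<in>nodes (TypeD n). v i ^ 2)
      - 2 * (\<Sum>i\<in>insert n {1..n-2}. v i * v (if i = n then n - 2 else i + 1))"
    using assms by (intro inner_form_oriented) (auto simp: adj_def doubleton_eq_iff)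
  also have "(\<Sum>i\<in>insert n {1..n-2}. v i * v (if i = n then n - 2 else i + 1)) =
      v n * v (n - 2) + (\<Sum>i\<in>{1..n-2}. v i * v (if i = n then n - 2 else i + 1))"
    using assms by (subst sum.insert) auto
  also have "(\<Sum>i\<in>{1..n-2}. v i * v (if i = n then n - 2 else i + 1)) = (\<Sum>i=1..n-2. v i * v (i + 1))"
    using assms by (intro sum.cong) auto
  finally show ?thesis by simp
qed

lemma inner_form_TypeE:
  assumes "n \<ge> 5"
  shows "inner_form (TypeE n) v v = 2 * (\<Sum>i=1..n. v i ^ 2)
     - 2 * (v 1 * v 3 + v 2 * v 4 + v 3 * v 4 + (\<Sum>i=5..n. v i * v (i - 1)))"
proof -
  \<comment> \<open>All edges are oriented towards the branching node 4.\<close>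
  let ?p = "\<lambda>i. if i = 1 then 3 else if i = 2 \<or> i = 3 then 4 else i - 1"
  have "inner_form (TypeE n) v v = 2 * (\<Sum>i\<in>nodes (TypeE n). v i ^ 2)
      - 2 * (\<Sum>i\<in>{1,2,3} \<union> {5..n}. v i * v (?p i))"
  proof (rule inner_form_oriented)
    fix i j assume ij: "i \<in> nodes (TypeE n)" "j \<in> nodes (TypeE n)"
    have p: "i \<in> {1,2,3} \<union> {5..n} \<and> j = ?p i \<longleftrightarrow>
        (i = 1 \<and> j = 3) \<or> (i = 2 \<and> j = 4) \<or> (i = 3 \<and> j = 4) \<or> (5 \<le> i \<and> i \<le> n \<and> j = i - 1)" for i j :: nat
      by (cases "i = 1"; cases "i = 2"; cases "i = 3") simp_all
    have q: "3 \<le> i \<and> i < n \<and> j = i + 1 \<longleftrightarrow> (i = 3 \<and> j = 4) \<or> (5 \<le> j \<and> j \<le> n \<and> i = j - 1)" for i j :: nat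
      using assms by auto
    have "adj (TypeE n) i j \<longleftrightarrow> (i = 1 \<and> j = 3) \<or> (i = 3 \<and> j = 1) \<or> (i = 2 \<and> j = 4) \<or> (i = 4 \<and> j = 2)
       \<or> (3 \<le> i \<and> i < n \<and> j = i + 1) \<or> (3 \<le> j \<and> j < n \<and> i = j + 1)"
      by (auto simp: adj_def doubleton_eq_iff)
    also have "\<dots> \<longleftrightarrow> (i \<in> {1,2,3} \<union> {5..n} \<and> j = ?p i) \<or> (j \<in> {1,2,3} \<union> {5..n} \<and> i = ?p j)"
      unfolding p q by (simp only: disj_ac conj_ac)
    finally show "adj (TypeE n) i j \<longleftrightarrow> (i \<in> {1,2,3} \<union> {5..n} \<and> j = ?p i) \<or> (j \<in> {1,2,3} \<union> {5..n} \<and> i = ?p j)" .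
  next
    show "{1,2,3} \<union> {5..n} \<subseteq> nodes (TypeE n)" using assms by auto
    show "?p ` ({1,2,3} \<union> {5..n}) \<subseteq> nodes (TypeE n)" using assms by auto
    fix i assume "i \<in> {1,2,3} \<union> {5..n}" and D: "?p i \<in> {1,2,3} \<union> {5..n}"
    then consider "i = 1" | "i = 2" | "i = 3" | "i \<ge> 5" by fastforce
    then show "?p (?p i) \<noteq> i" using D by cases auto
  qed
  also have "(\<Sum>i\<in>{1,2,3} \<union> {5..n}. v i * v (?p i)) =
     v 1 * v 3 + v 2 * v 4 + v 3 * v 4 + (\<Sum>i=5..n. v i * v (?p i))"
    by (subst sum.union_disjoint) auto
  also have "(\<Sum>i=5..n. v i * v (?p i)) = (\<Sum>i=5..n. v i * v (i - 1))"
    by (intro sum.cong) auto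
  finally show ?thesis by simp
qed

text \<open>An arm \<open>(k, e)\<close> consists of the nodes \<open>e 1, \<dots>, e k\<close>, counted from its leaf, and is attached to the
  branching node \<open>e (k + 1)\<close>. The remaining coefficient at the branching node is positive because
  the diagram is of finite type.\<close>

lemma arm_decomposition:
  assumes "simply_laced_finite M"
  obtains c \<delta> A where "\<delta> > 0"
    and "\<And>i. i \<in> nodes M \<Longrightarrow> i = c \<or> (\<exists>(k, e)\<in>set A. i \<in> e ` {1..k})"
    and "\<And>k e. (k, e) \<in> set A \<Longrightarrow> e (k + 1) = c"
    and "\<And>v. real_of_int (inner_form M v v) =
      2 * (\<Sum>(k, e)\<leftarrow>A. arm_form k (\<lambda>i. real_of_int (v (e i)))) + 2 * \<delta> * real_of_int (v c) ^ 2"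
proof (cases M)
  case (TypeA n)
  with assms have n: "n \<ge> 1" by simp
  show ?thesis
  \<comment> \<open>A path counts as a single arm attached to its end node \<open>n\<close>. In all
    three cases the constant is 1 minus the sum of \<open>k / (2 * (k + 1))\<close> over the lengths
    \<open>k\<close> of the arms.\<close>
  proof (rule that[of "(real n + 1) / (2 * real n)" n "[(n - 1, id)]"])
    fix v :: root
    let ?u = "\<lambda>i. real_of_int (v i)"
    have sums: "{1..n} = insert n {1..n - 1}" "{1..<n} = {1..n - 1}" using n by auto
    have "real_of_int (inner_form M v v) = 2 * (\<Sum>i=1..n. ?u i ^ 2) - 2 * (\<Sum>i=1..<n. ?u i * ?u (i + 1))"
      unfolding TypeA inner_form_TypeA by simp
    also have "\<dots> = 2 * ?u n ^ 2 + 2 * ((\<Sum>i=1..n - 1. ?u i ^ 2) - (\<Sum>i=1..n - 1. ?u i * ?u (i + 1)))"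
      unfolding sums using n by simp
    also have "\<dots> = 2 * arm_form (n - 1) ?u + 2 * (1 - real (n - 1) / (2 * (real (n - 1) + 1))) * ?u n ^ 2"
    proof -
      have "n - 1 + 1 = n" using n by simp
      moreover have "2 * x + 2 * (f - q * x) = 2 * f + 2 * (1 - q) * x" for x f q :: real
        by (simp add: algebra_simps)
      ultimately show ?thesis unfolding arm_sum_squares[of ?u "n - 1"] by (simp only:)
    qed
    also have "1 - real (n - 1) / (2 * (real (n - 1) + 1)) = (real n + 1) / (2 * real n)"
      using n by (simp add: field_simps of_nat_diff)
    finally show "real_of_int (inner_form M v v) =
      2 * (\<Sum>(k, e)\<leftarrow>[(n - 1, id)]. arm_form k (\<lambda>i. ?u (e i))) + 2 * ((real n + 1) / (2 * real n)) * ?u n ^ 2"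
      by simp
  qed (use n TypeA in auto)
next
  case (TypeD n)
  with assms have n: "n \<ge> 4" by simp
  let ?A = "[(n - 3, id), (1, \<lambda>i. if i = 1 then n - 1 else n - 2), (1, \<lambda>i. if i = 1 then n else n - 2)]"
  show ?thesis
  proof (rule that[of "1 / (2 * (real n - 2))" "n - 2" ?A])
    fix v :: root
    let ?u = "\<lambda>i. real_of_int (v i)"
    have sums: "{1..n} = insert n (insert (n - 1) (insert (n - 2) {1..n - 3}))" "{1..n - 2} = insert (n - 2) {1..n - 3}"
      using n by auto
    have "real_of_int (inner_form M v v) = 2 * (\<Sum>i=1..n. ?u i ^ 2)
        - 2 * ((\<Sum>i=1..n-2. ?u i * ?u (i + 1)) + ?u n * ?u (n - 2))"
      unfolding TypeD inner_form_TypeD[OF n] by simp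
    also have "\<dots> = 2 * (?u n ^ 2 + ?u (n - 1) ^ 2 + ?u (n - 2) ^ 2) - 2 * (?u n * ?u (n - 2) + ?u (n - 2) * ?u (n - 1))
       + 2 * ((\<Sum>i=1..n - 3. ?u i ^ 2) - (\<Sum>i=1..n - 3. ?u i * ?u (i + 1)))"
    proof -
      have "n \<notin> insert (n - 1) (insert (n - 2) {1..n - 3})" "n - 1 \<notin> insert (n - 2) {1..n - 3}"
        "n - 2 \<notin> {1..n - 3}" "n - 2 + 1 = n - 1" using n by auto
      then show ?thesis unfolding sums
        by (simp only: sum.insert finite_insert finite_atLeastAtMost simp_thms) simp
    qed
    also have "\<dots> = 2 * (?u n ^ 2 + ?u (n - 1) ^ 2 + ?u (n - 2) ^ 2) - 2 * (?u n * ?u (n - 2) + ?u (n - 2) * ?u (n - 1))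
       + 2 * arm_form (n - 3) ?u - 2 * (real (n - 3) / (2 * (real (n - 3) + 1))) * ?u (n - 2) ^ 2"
    proof -
      have "n - 3 + 1 = n - 2" using n by simp
      then show ?thesis unfolding arm_sum_squares[of ?u "n - 3"] by simp
    qed
    also have "\<dots> = 2 * arm_form (n - 3) ?u + 2 * (?u (n - 1) - ?u (n - 2) / 2) ^ 2 + 2 * (?u n - ?u (n - 2) / 2) ^ 2
       + 2 * (1 / 2 - real (n - 3) / (2 * (real (n - 3) + 1))) * ?u (n - 2) ^ 2"
      by (simp add: power2_eq_square algebra_simps)
    also have "1 / 2 - real (n - 3) / (2 * (real (n - 3) + 1)) = 1 / (2 * (real n - 2))"
      using n by (simp add: of_nat_diff divide_simps)
    finally show "real_of_int (inner_form M v v) =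
      2 * (\<Sum>(k, e)\<leftarrow>?A. arm_form k (\<lambda>i. ?u (e i))) + 2 * (1 / (2 * (real n - 2))) * ?u (n - 2) ^ 2"
      by (simp add: arm_form_def)
  next
    fix i assume "i \<in> nodes M"
    then show "i = n - 2 \<or> (\<exists>(k, e)\<in>set ?A. i \<in> e ` {1..k})"
      using n TypeD by auto
  qed (use n TypeD in auto)
next
  case (TypeE n)
  with assms have n: "n = 6 \<or> n = 7 \<or> n = 8" by auto
  \<comment> \<open>The arms are \<open>n, n - 1, \<dots>, 5\<close>, then \<open>1, 3\<close>, then
    \<open>2\<close>, each written from its leaf and continued to the node 4.\<close>
  let ?A = "[(n - 4, \<lambda>i. n + 1 - i), (2, \<lambda>i. if i = 1 then 1 else i + 1), (1, \<lambda>i. 2 * i)]"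
  show ?thesis
  \<comment> \<open>Here 5/12 is what the arms of lengths 2 and 1 leave. The difference is positive
    for \<open>n = 6, 7, 8\<close> and vanishes at \<open>n = 9\<close>, the affine diagram.\<close>
  proof (rule that[of "5 / 12 - (real n - 4) / (2 * (real n - 3))" 4 ?A])
    fix v :: root
    let ?u = "\<lambda>i. real_of_int (v i)"
    let ?w = "\<lambda>i. ?u (n + 1 - i)"
    have "real_of_int (inner_form M v v) = 2 * (\<Sum>i=1..n. ?u i ^ 2)
     - 2 * (?u 1 * ?u 3 + ?u 2 * ?u 4 + ?u 3 * ?u 4 + (\<Sum>i=5..n. ?u i * ?u (i - 1)))"
      unfolding TypeE using inner_form_TypeE[of n v] n by auto
    also have "(\<Sum>i=1..n. ?u i ^ 2) = ?u 1 ^ 2 + ?u 2 ^ 2 + ?u 3 ^ 2 + ?u 4 ^ 2 + (\<Sum>i=5..n. ?u i ^ 2)"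
    proof -
      have "{1..n} = {1,2,3,4} \<union> {5..n}" using n by auto
      then show ?thesis by (simp only:, subst sum.union_disjoint) auto
    qed
    also have "(\<Sum>i=5..n. ?u i ^ 2) = (\<Sum>i=1..n - 4. ?w i ^ 2)"
      by (rule sum.reindex_bij_witness[of _ "\<lambda>i. n + 1 - i" "\<lambda>i. n + 1 - i"]) auto
    also have "(\<Sum>i=5..n. ?u i * ?u (i - 1)) = (\<Sum>i=1..n - 4. ?w i * ?w (i + 1))"
      by (rule sum.reindex_bij_witness[of _ "\<lambda>i. n + 1 - i" "\<lambda>i. n + 1 - i"]) auto
    also have "2 * (?u 1 ^ 2 + ?u 2 ^ 2 + ?u 3 ^ 2 + ?u 4 ^ 2 + (\<Sum>i=1..n - 4. ?w i ^ 2))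
        - 2 * (?u 1 * ?u 3 + ?u 2 * ?u 4 + ?u 3 * ?u 4 + (\<Sum>i=1..n - 4. ?w i * ?w (i + 1))) =
       2 * ((\<Sum>i=1..n - 4. ?w i ^ 2) - (\<Sum>i=1..n - 4. ?w i * ?w (i + 1)))
       + 2 * (?u 1 ^ 2 + ?u 2 ^ 2 + ?u 3 ^ 2 + ?u 4 ^ 2 - (?u 1 * ?u 3 + ?u 2 * ?u 4 + ?u 3 * ?u 4))"
      by simp
    also have "(\<Sum>i=1..n - 4. ?w i ^ 2) - (\<Sum>i=1..n - 4. ?w i * ?w (i + 1)) =
       arm_form (n - 4) ?w - real (n - 4) / (2 * (real (n - 4) + 1)) * ?u 4 ^ 2"
      unfolding arm_sum_squares[of ?w "n - 4"] using n by auto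
    also have "real (n - 4) / (2 * (real (n - 4) + 1)) = (real n - 4) / (2 * (real n - 3))"
      using n by auto
    also have "2 * (arm_form (n - 4) ?w - (real n - 4) / (2 * (real n - 3)) * ?u 4 ^ 2)
       + 2 * (?u 1 ^ 2 + ?u 2 ^ 2 + ?u 3 ^ 2 + ?u 4 ^ 2 - (?u 1 * ?u 3 + ?u 2 * ?u 4 + ?u 3 * ?u 4)) =
      2 * (arm_form (n - 4) ?w + ((?u 1 - ?u 3 / 2) ^ 2 + 3 / 4 * (?u 3 - 2 / 3 * ?u 4) ^ 2) + (?u 2 - ?u 4 / 2) ^ 2)
       + 2 * (5 / 12 - (real n - 4) / (2 * (real n - 3))) * ?u 4 ^ 2"
      by (simp add: power2_eq_square algebra_simps)
    finally show "real_of_int (inner_form M v v) =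
      2 * (\<Sum>(k, e)\<leftarrow>?A. arm_form k (\<lambda>i. ?u (e i))) + 2 * (5 / 12 - (real n - 4) / (2 * (real n - 3))) * ?u 4 ^ 2"
      by (simp add: arm_form_1 arm_form_2 del: One_nat_def)
  next
    fix i assume "i \<in> nodes M"
    then have "i = 1 \<or> i = 2 \<or> i = 3 \<or> i = 4 \<or> (5 \<le> i \<and> i \<le> n)" using TypeE by auto
    moreover have "i \<in> (\<lambda>i. n + 1 - i) ` {1..n - 4}" if "5 \<le> i" "i \<le> n"
      by (rule image_eqI[of _ _ "n + 1 - i"]) (use that in auto)
    ultimately show "i = 4 \<or> (\<exists>(k, e)\<in>set ?A. i \<in> e ` {1..k})" by force
  qed (use n TypeE in auto)
qed

lemma sum_list_arm_forms_nonneg: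
  "(\<Sum>(k, e)\<leftarrow>A. arm_form k (\<lambda>i. real_of_int (v (e i)))) \<ge> 0"
  by (intro sum_list_nonneg) (auto simp: arm_form_nonneg)

text \<open>The bound is homogeneous in \<open>B\<close> so that it serves twice:
  \<open>B = 0\<close> gives definiteness and \<open>B = 1\<close> confines the vectors of norm 2 to
  a finite box. The square at the branching node bounds its coordinate, and \<open>arm_bound\<close>
  carries the bound along the arms.\<close>

lemma inner_form_bound:
  assumes "simply_laced_finite M"
  obtains D where "\<And>v i B. \<lbrakk>real_of_int (inner_form M v v) \<le> 2 * B ^ 2; B \<ge> 0; i \<in> nodes M\<rbrakk>
    \<Longrightarrow> \<bar>real_of_int (v i)\<bar> \<le> D * B" "D \<ge> 0"
proof -
  obtain \<delta> c A where \<delta>: "\<delta> > 0"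
    and nodes: "\<And>i. i \<in> nodes M \<Longrightarrow> i = c \<or> (\<exists>(k, e)\<in>set A. i \<in> e ` {1..k})"
    and e: "\<And>k e. (k, e) \<in> set A \<Longrightarrow> e (k + 1) = c"
    and form: "\<And>v. real_of_int (inner_form M v v) =
      2 * (\<Sum>(k, e)\<leftarrow>A. arm_form k (\<lambda>i. real_of_int (v (e i)))) + 2 * \<delta> * real_of_int (v c) ^ 2"
    by (rule arm_decomposition[OF assms]) (rule that; assumption)
  define N where "N = Max (insert 0 (fst ` set A))"
  have N: "k \<le> N" if "(k, e) \<in> set A" for k e
    unfolding N_def using that by (intro Max_ge) force+
  define D where "D = sqrt (1 / \<delta>) + 2 * real N"
  have "\<bar>real_of_int (v i)\<bar> \<le> D * B"
    if v: "real_of_int (inner_form M v v) \<le> 2 * B ^ 2" and B: "B \<ge> 0" and i: "i \<in> nodes M" for v i B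
  proof -
    have "\<delta> * real_of_int (v c) ^ 2 \<le> B ^ 2"
      using v form[of v] sum_list_arm_forms_nonneg[of v A] by simp
    then have "real_of_int (v c) ^ 2 \<le> 1 / \<delta> * B ^ 2" using \<delta> by (simp add: field_simps)
    then have "real_of_int (v c) ^ 2 \<le> (sqrt (1 / \<delta>) * B) ^ 2" using \<delta> by (simp add: power_mult_distrib)
    then have c: "\<bar>real_of_int (v c)\<bar> \<le> sqrt (1 / \<delta>) * B"
      using abs_le_square_iff[of "real_of_int (v c)" "sqrt (1 / \<delta>) * B"] B \<delta> by (simp add: abs_mult)
    show ?thesis
    proof (cases "i = c")
      case True
      have "0 \<le> 2 * real N * B" using B by simp
      with c show ?thesis unfolding D_def distrib_right True by linarith
    next
      case False
      then obtain k e m where ke: "(k, e) \<in> set A" "m \<in> {1..k}" "i = e m" using nodes[OF i] by auto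
      have "arm_form k (\<lambda>i. real_of_int (v (e i))) \<le>
          (\<Sum>(k, e)\<leftarrow>A. arm_form k (\<lambda>i. real_of_int (v (e i))))"
        by (intro member_le_sum_list) (use ke in \<open>force intro: arm_form_nonneg\<close>)+
      also have "\<dots> \<le> B ^ 2"
      proof -
        have "0 \<le> 2 * \<delta> * real_of_int (v c) ^ 2" using \<delta> by simp
        then show ?thesis using v form[of v] by linarith
      qed
      finally have "\<bar>real_of_int (v (e m))\<bar> \<le> \<bar>real_of_int (v (e (k + 1)))\<bar> + 2 * real k * B"
        using arm_bound[OF _ B ke(2)] by blast
      also have "2 * real k * B \<le> 2 * real N * B"
        using N[OF ke(1)] B by (intro mult_right_mono) auto
      finally show ?thesis using c e[OF ke(1)] ke(3) unfolding D_def by (simp add: distrib_right)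
    qed
  qed
  moreover have "D \<ge> 0" unfolding D_def using \<delta> by simp
  ultimately show ?thesis using that by blast
qed

definition root_lattice :: "diagram \<Rightarrow> root set" where
  "root_lattice M = {v. \<forall>j. j \<notin> nodes M \<longrightarrow> v j = 0}"

lemma inner_form_nonneg:
  assumes "simply_laced_finite M"
  shows "inner_form M v v \<ge> 0"
proof -
  obtain \<delta> c A where \<delta>: "\<delta> > 0"
    and nodes: "\<And>i. i \<in> nodes M \<Longrightarrow> i = c \<or> (\<exists>(k, e)\<in>set A. i \<in> e ` {1..k})"
    and e: "\<And>k e. (k, e) \<in> set A \<Longrightarrow> e (k + 1) = c"
    and form: "\<And>v. real_of_int (inner_form M v v) =
      2 * (\<Sum>(k, e)\<leftarrow>A. arm_form k (\<lambda>i. real_of_int (v (e i)))) + 2 * \<delta> * real_of_int (v c) ^ 2"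
    by (rule arm_decomposition[OF assms]) (rule that; assumption)
  have "real_of_int (inner_form M v v) \<ge> 0"
    unfolding form using \<delta> sum_list_arm_forms_nonneg[of v A] by simp
  then show ?thesis by simp
qed

lemma inner_form_eq_0:
  assumes "simply_laced_finite M" "v \<in> root_lattice M" "inner_form M v v = 0"
  shows "v = 0"
proof
  fix i
  obtain D where "\<And>v i B. \<lbrakk>real_of_int (inner_form M v v) \<le> 2 * B ^ 2; B \<ge> 0; i \<in> nodes M\<rbrakk>
    \<Longrightarrow> \<bar>real_of_int (v i)\<bar> \<le> D * B" "D \<ge> 0" by (rule inner_form_bound[OF assms(1)]) (rule that; assumption)
  from this(1)[of v 0 i] show "v i = 0 i" using assms(2,3) by (cases "i \<in> nodes M") (auto simp: root_lattice_def)
qed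

text \<open>Diagonal terms carry the factor 2 and off-diagonal terms occur in equal pairs. With
  definiteness this forces nonzero lattice vectors to have norm at least 2.\<close>

lemma inner_form_even: "even (inner_form M v v)"
proof -
  have "inner_form M v v = (\<Sum>i\<in>nodes M. \<Sum>j\<in>nodes M. (if i = j then 2 * v i * v i else 0)) +
      (\<Sum>i\<in>nodes M. \<Sum>j\<in>nodes M. (if i = j then 0 else cartan M i j * v i * v j))"
    unfolding inner_form_def sum.distrib[symmetric] by (intro sum.cong) auto
  moreover have "even (\<Sum>i\<in>nodes M. \<Sum>j\<in>nodes M. (if i = j then 2 * v i * v i else 0))"
    by (intro dvd_sum) auto
  moreover have "even (\<Sum>i\<in>S. \<Sum>j\<in>S. (if i = j then 0 else cartan M i j * v i * v j))" if "finite S" for S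
    using that
  proof (induction S)
    case (insert a S)
    let ?f = "\<lambda>i j. if i = j then 0 else cartan M i j * v i * v j"
    have "(\<Sum>i\<in>S. ?f i a) = (\<Sum>i\<in>S. ?f a i)"
      by (intro sum.cong) (auto simp: cartan_sym)
    then have "(\<Sum>i\<in>insert a S. \<Sum>j\<in>insert a S. ?f i j) = 2 * (\<Sum>i\<in>S. ?f a i) + (\<Sum>i\<in>S. \<Sum>j\<in>S. ?f i j)"
      using insert by (simp add: sum.distrib)
    then show ?case using insert.IH by simp
  qed simp
  ultimately show ?thesis by simp
qed

lemma inner_form_ge_2:
  assumes "simply_laced_finite M" "v \<in> root_lattice M" "v \<noteq> 0"
  shows "inner_form M v v \<ge> 2"
  using inner_form_nonneg[OF assms(1), of v] inner_form_eq_0[OF assms(1,2)] assms(3)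
    inner_form_even[of M v] by (elim evenE) force

text \<open>These turn out to be exactly the roots (\<open>roots_eq\<close>). In this form closure
  under negation and reflections and finiteness are available before any group theory.\<close>

definition norm2_vectors :: "diagram \<Rightarrow> root set" where
  "norm2_vectors M = {v \<in> root_lattice M. inner_form M v v = 2}"

lemma finite_norm2_vectors:
  assumes "simply_laced_finite M"
  shows "finite (norm2_vectors M)"
proof -
  obtain D where D: "\<And>v i B. \<lbrakk>real_of_int (inner_form M v v) \<le> 2 * B ^ 2; B \<ge> 0; i \<in> nodes M\<rbrakk>
    \<Longrightarrow> \<bar>real_of_int (v i)\<bar> \<le> D * B" "D \<ge> 0" by (rule inner_form_bound[OF assms(1)]) (rule that; assumption)
  have "norm2_vectors M \<subseteq> {v. \<forall>i. (i \<in> nodes M \<longrightarrow> v i \<in> {- \<lceil>D\<rceil>..\<lceil>D\<rceil>}) \<and> (i \<notin> nodes M \<longrightarrow> v i = 0)}"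
  proof clarsimp
    fix v i assume v: "v \<in> norm2_vectors M"
    show "(i \<in> nodes M \<longrightarrow> - \<lceil>D\<rceil> \<le> v i \<and> v i \<le> \<lceil>D\<rceil>) \<and> (i \<notin> nodes M \<longrightarrow> v i = 0)"
    proof (intro conjI impI)
      assume "i \<in> nodes M"
      with D(1)[of v 1 i] v have "\<bar>real_of_int (v i)\<bar> \<le> D" by (simp add: norm2_vectors_def)
      then show "- \<lceil>D\<rceil> \<le> v i" "v i \<le> \<lceil>D\<rceil>" by linarith+
    qed (use v in \<open>auto simp: norm2_vectors_def root_lattice_def\<close>)
  qed
  moreover have "finite {v. \<forall>i. (i \<in> nodes M \<longrightarrow> v i \<in> {- \<lceil>D\<rceil>..\<lceil>D\<rceil>}) \<and> (i \<notin> nodes M \<longrightarrow> v i = 0)}"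
    by (rule finite_set_of_finite_funs) auto
  ultimately show ?thesis by (rule finite_subset)
qed

subsection \<open>Presented groups\<close>

definition word_rels :: "'g set \<Rightarrow> ('g sword \<times> 'g sword) set \<Rightarrow> bool" where
  "word_rels S R \<longleftrightarrow> R \<subseteq> lists (S \<times> UNIV) \<times> lists (S \<times> UNIV)"

definition inv_word :: "'g sword \<Rightarrow> 'g sword" where
  "inv_word u = map (\<lambda>(g, b). (g, \<not> b)) (rev u)"

lemma inv_word_in_lists: "u \<in> lists (S \<times> UNIV) \<Longrightarrow> inv_word u \<in> lists (S \<times> UNIV)"
  by (auto simp: inv_word_def in_lists_conv_set)

lemma pres_eq_in_lists:
  assumes "word_rels S R" "pres_eq S R u v"
  shows "u \<in> lists (S \<times> UNIV)" "v \<in> lists (S \<times> UNIV)"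
  using assms(2,1) by (induction) (auto simp: word_rels_def)

lemma pres_eq_append_left:
  "pres_eq S R u v \<Longrightarrow> w \<in> lists (S \<times> UNIV) \<Longrightarrow> pres_eq S R (w @ u) (w @ v)"
proof (induction rule: pres_eq.induct)
  case (trans u v x) then show ?case by (blast intro: pres_eq.trans)
next
  case (cancel u v g b) then show ?case using pres_eq.cancel[of "w @ u" S v g R b] by simp
next
  case (rel u v p q) then show ?case using pres_eq.rel[of "w @ u" S v p q R] by simp
qed (auto intro: pres_eq.refl pres_eq.sym)

lemma pres_eq_append_right:
  "pres_eq S R u v \<Longrightarrow> w \<in> lists (S \<times> UNIV) \<Longrightarrow> pres_eq S R (u @ w) (v @ w)"
proof (induction rule: pres_eq.induct)
  case (trans u v x) then show ?case by (blast intro: pres_eq.trans)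
next
  case (cancel u v g b) then show ?case using pres_eq.cancel[of u S "v @ w" g R b] by simp
next
  case (rel u v p q) then show ?case using pres_eq.rel[of u S "v @ w" p q R] by simp
qed (auto intro: pres_eq.refl pres_eq.sym)

lemma pres_eq_append:
  assumes "word_rels S R" "pres_eq S R u u'" "pres_eq S R v v'"
  shows "pres_eq S R (u @ v) (u' @ v')"
  using pres_eq_append_right[OF assms(2), of v] pres_eq_append_left[OF assms(3), of u']
    pres_eq_in_lists[OF assms(1,2)] pres_eq_in_lists[OF assms(1,3)] by (blast intro: pres_eq.trans)

lemma pres_eq_mono: "pres_eq S R u v \<Longrightarrow> R \<subseteq> R' \<Longrightarrow> pres_eq S R' u v"
proof (induction rule: pres_eq.induct)
  case (cancel u v g b) then show ?case using pres_eq.cancel[of u S v g R' b] by simp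
qed (auto intro: pres_eq.intros)

text \<open>Reflexivity of \<open>pres_eq\<close> holds only for words over \<open>S\<close>; having
  it for \<open>v\<close> is enough, since it places \<open>v\<close> in its own class.\<close>

lemma pres_class_eq_iff:
  assumes "v \<in> lists (S \<times> UNIV)"
  shows "pres_class S R u = pres_class S R v \<longleftrightarrow> pres_eq S R u v"
  using pres_eq.refl[OF assms, of R] unfolding pres_class_def
  by (auto intro: pres_eq.trans pres_eq.sym)

lemma presented_group_mult:
  assumes "word_rels S R" "u \<in> lists (S \<times> UNIV)" "v \<in> lists (S \<times> UNIV)"
  shows "pres_class S R u \<otimes>\<^bsub>presented_group S R\<^esub> pres_class S R v = pres_class S R (u @ v)"
proof -
  have "pres_class S R (u' @ v') = pres_class S R (u @ v)"
    if "pres_eq S R u u'" "pres_eq S R v v'" for u' v'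
    using pres_eq_append[OF assms(1) that] assms(2,3)
    by (subst pres_class_eq_iff) (auto intro: pres_eq.sym)
  moreover have "pres_eq S R u u" "pres_eq S R v v" using assms by (auto intro: pres_eq.refl)
  ultimately have "(\<Union>u'\<in>{u'. pres_eq S R u u'}. \<Union>v'\<in>{v'. pres_eq S R v v'}. pres_class S R (u' @ v')) =
      pres_class S R (u @ v)"
    by (intro equalityI UN_least) blast+
  then show ?thesis by (simp add: presented_group_def pres_class_def)
qed

lemma presented_group_one: "\<one>\<^bsub>presented_group S R\<^esub> = pres_class S R []"
  by (simp add: presented_group_def)

lemma presented_group_carrier: "carrier (presented_group S R) = pres_class S R ` lists (S \<times> UNIV)"
  by (simp add: presented_group_def)

lemma pres_class_in_carrier:
  "u \<in> lists (S \<times> UNIV) \<Longrightarrow> pres_class S R u \<in> carrier (presented_group S R)"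
  by (simp add: presented_group_carrier)

lemma pres_eq_inv_word: "u \<in> lists (S \<times> UNIV) \<Longrightarrow> pres_eq S R (inv_word u @ u) []"
proof (induction u)
  case Nil then show ?case by (auto intro: pres_eq.refl simp: inv_word_def)
next
  case (Cons a u)
  obtain g b where a: "a = (g, b)" by (cases a)
  have "pres_eq S R (inv_word u @ [(g, \<not> b), (g, \<not> \<not> b)] @ u) (inv_word u @ u)"
    using Cons.prems by (intro pres_eq.cancel) (auto simp: a intro: inv_word_in_lists)
  with Cons show ?case by (auto simp: a inv_word_def intro: pres_eq.trans)
qed

lemma group_presented_group:
  assumes "word_rels S R"
  shows "group (presented_group S R)"
proof (rule groupI)
  fix x assume "x \<in> carrier (presented_group S R)"
  then obtain u where u: "u \<in> lists (S \<times> UNIV)" "x = pres_class S R u"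
    by (auto simp: presented_group_carrier)
  then show "\<exists>y\<in>carrier (presented_group S R). y \<otimes>\<^bsub>presented_group S R\<^esub> x = \<one>\<^bsub>presented_group S R\<^esub>"
    by (intro bexI[of _ "pres_class S R (inv_word u)"])
       (simp_all add: presented_group_mult[OF assms] inv_word_in_lists presented_group_one
         pres_class_eq_iff pres_eq_inv_word pres_class_in_carrier)
qed (auto simp: presented_group_carrier presented_group_mult[OF assms] presented_group_one)

lemma presented_group_inv:
  assumes "word_rels S R" "u \<in> lists (S \<times> UNIV)"
  shows "inv\<^bsub>presented_group S R\<^esub> pres_class S R u = pres_class S R (inv_word u)"
proof -
  interpret group "presented_group S R" by (rule group_presented_group[OF assms(1)])
  show ?thesis
    by (rule inv_equality)
       (simp_all add: presented_group_mult[OF assms(1)] inv_word_in_lists presented_group_one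
         pres_class_eq_iff pres_eq_inv_word pres_class_in_carrier assms)
qed

section \<open>The universal property of a presented group\<close>

definition eval_letter :: "('a, 'b) monoid_scheme \<Rightarrow> ('g \<Rightarrow> 'a) \<Rightarrow> 'g \<times> bool \<Rightarrow> 'a" where
  "eval_letter H f = (\<lambda>(g, b). if b then f g else inv\<^bsub>H\<^esub> f g)"

definition eval_word :: "('a, 'b) monoid_scheme \<Rightarrow> ('g \<Rightarrow> 'a) \<Rightarrow> 'g sword \<Rightarrow> 'a" where
  "eval_word H f u = foldr (\<lambda>a x. eval_letter H f a \<otimes>\<^bsub>H\<^esub> x) u \<one>\<^bsub>H\<^esub>"

lemma eval_word_Nil [simp]: "eval_word H f [] = \<one>\<^bsub>H\<^esub>"
  and eval_word_Cons [simp]: "eval_word H f (a # u) = eval_letter H f a \<otimes>\<^bsub>H\<^esub> eval_word H f u"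
  by (simp_all add: eval_word_def)

context
  fixes H :: "('a, 'b) monoid_scheme" and S :: "'g set" and f :: "'g \<Rightarrow> 'a"
  assumes H: "group H" and f: "\<And>g. g \<in> S \<Longrightarrow> f g \<in> carrier H"
begin

interpretation group H by (rule H)

lemma eval_letter_closed: "a \<in> S \<times> UNIV \<Longrightarrow> eval_letter H f a \<in> carrier H"
  using f by (auto simp: eval_letter_def)

lemma eval_word_closed: "u \<in> lists (S \<times> UNIV) \<Longrightarrow> eval_word H f u \<in> carrier H"
  by (induction u) (auto intro: eval_letter_closed)

lemma eval_word_append:
  "u \<in> lists (S \<times> UNIV) \<Longrightarrow> v \<in> lists (S \<times> UNIV) \<Longrightarrow>
    eval_word H f (u @ v) = eval_word H f u \<otimes>\<^bsub>H\<^esub> eval_word H f v"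
  by (induction u) (auto simp: eval_word_closed eval_letter_closed m_assoc)

lemma eval_word_pres_eq:
  assumes R: "word_rels S R" "\<And>p q. (p, q) \<in> R \<Longrightarrow> eval_word H f p = eval_word H f q"
  shows "pres_eq S R u v \<Longrightarrow> eval_word H f u = eval_word H f v"
proof (induction rule: pres_eq.induct)
  case (cancel u v g b)
  have "eval_word H f [(g, b), (g, \<not> b)] = \<one>\<^bsub>H\<^esub>"
    using f[OF cancel(3)] by (cases b) (auto simp: eval_letter_def)
  then show ?case using cancel f
    by (simp add: eval_word_append eval_word_closed del: append_Cons eval_word_Cons)
next
  case (rel u v p q)
  then have "p \<in> lists (S \<times> UNIV)" "q \<in> lists (S \<times> UNIV)" using R(1) by (auto simp: word_rels_def)
  then show ?case using rel R(2)[OF rel(3)] by (simp add: eval_word_append eval_word_closed)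
qed auto

lemma presented_group_hom:
  assumes R: "word_rels S R" "\<And>p q. (p, q) \<in> R \<Longrightarrow> eval_word H f p = eval_word H f q"
  obtains \<phi> where "\<phi> \<in> hom (presented_group S R) H"
    and "\<And>u. u \<in> lists (S \<times> UNIV) \<Longrightarrow> \<phi> (pres_class S R u) = eval_word H f u"
proof -
  define \<phi> where "\<phi> X = eval_word H f (SOME u. u \<in> lists (S \<times> UNIV) \<and> X = pres_class S R u)" for X
  have \<phi>: "\<phi> (pres_class S R u) = eval_word H f u" if "u \<in> lists (S \<times> UNIV)" for u
  proof -
    let ?v = "SOME v. v \<in> lists (S \<times> UNIV) \<and> pres_class S R u = pres_class S R v"
    have "?v \<in> lists (S \<times> UNIV) \<and> pres_class S R u = pres_class S R ?v"
      by (rule someI[of _ u]) (simp add: that)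
    then have "pres_eq S R u ?v" using pres_class_eq_iff by blast
    from eval_word_pres_eq[OF R this] show ?thesis unfolding \<phi>_def by simp
  qed
  moreover have "\<phi> \<in> hom (presented_group S R) H"
    by (rule homI)
       (auto simp: presented_group_carrier presented_group_mult[OF R(1)] \<phi> eval_word_closed eval_word_append)
  ultimately show ?thesis using that by blast
qed

end

lemma hom_presented_group_eqI:
  assumes "word_rels S R" "group H" "\<phi> \<in> hom (presented_group S R) H" "\<psi> \<in> hom (presented_group S R) H"
    and gen: "\<And>g. g \<in> S \<Longrightarrow> \<phi> (pres_class S R [(g, True)]) = \<psi> (pres_class S R [(g, True)])"
    and x: "x \<in> carrier (presented_group S R)"
  shows "\<phi> x = \<psi> x"
proof -
  interpret G: group "presented_group S R" by (rule group_presented_group[OF assms(1)])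
  interpret \<phi>: group_hom "presented_group S R" H \<phi>
    using assms(2,3) G.group_axioms by (simp add: group_hom_def group_hom_axioms_def)
  interpret \<psi>: group_hom "presented_group S R" H \<psi>
    using assms(2,4) G.group_axioms by (simp add: group_hom_def group_hom_axioms_def)
  have letter: "\<phi> (pres_class S R [(g, b)]) = \<psi> (pres_class S R [(g, b)])" if g: "g \<in> S" for g b
  proof (cases b)
    case False
    have eq: "pres_class S R [(g, False)] = inv\<^bsub>presented_group S R\<^esub> pres_class S R [(g, True)]"
      using g by (subst presented_group_inv[OF assms(1)]) (auto simp: inv_word_def)
    have "pres_class S R [(g, True)] \<in> carrier (presented_group S R)"
      using g by (intro pres_class_in_carrier) auto
    then show ?thesis using False gen[OF g] by (simp add: eq)
  qed (simp add: gen g)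
  have "\<phi> (pres_class S R u) = \<psi> (pres_class S R u)" if "u \<in> lists (S \<times> UNIV)" for u
    using that
  proof (induction u)
    case Nil then show ?case by (simp add: presented_group_one[symmetric])
  next
    case (Cons a u)
    then have a: "[a] \<in> lists (S \<times> UNIV)" and u: "u \<in> lists (S \<times> UNIV)" by auto
    have "pres_class S R (a # u) = pres_class S R [a] \<otimes>\<^bsub>presented_group S R\<^esub> pres_class S R u"
      using presented_group_mult[OF assms(1) a u] by simp
    then show ?case
      using Cons letter[of "fst a" "snd a"] pres_class_in_carrier[OF a, of R] pres_class_in_carrier[OF u, of R]
      by auto
  qed
  then show ?thesis using x by (auto simp: presented_group_carrier)
qed

section \<open>Connectedness of the diagrams\<close>

lemma path_connected:
  assumes "\<And>i. a \<le> i \<Longrightarrow> i < b \<Longrightarrow> P i \<longleftrightarrow> P (Suc i)" "a \<le> i" "i \<le> b" "a \<le> j" "j \<le> b"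
  shows "P i \<longleftrightarrow> P j"
proof -
  have *: "P k \<longleftrightarrow> P a" if "a \<le> k" "k \<le> b" for k
    using that by (induction k rule: dec_induct) (auto simp: assms(1))
  show ?thesis using *[of i] *[of j] assms(2-5) by simp
qed

text \<open>Connectedness is phrased as the absence of proper nonempty node sets closed under
  adjacency, the form in which it is applied to the support of a root.\<close>

lemma diagram_connected:
  assumes "simply_laced_finite M" "a \<in> S" "S \<subseteq> nodes M"
    and S: "\<And>i j. i \<in> S \<Longrightarrow> j \<in> nodes M \<Longrightarrow> adj M i j \<Longrightarrow> j \<in> S"
  shows "nodes M \<subseteq> S"
proof -
  have iff: "i \<in> S \<longleftrightarrow> j \<in> S" if "i \<in> nodes M" "j \<in> nodes M" "adj M i j" for i j
    using S[of i j] S[of j i] that adj_sym by blast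
  show ?thesis
  proof (cases M)
    case (TypeA n)
    have "i \<in> S \<longleftrightarrow> Suc i \<in> S" if "1 \<le> i" "i < n" for i
      using that TypeA by (intro iff) (auto simp: adj_def)
    moreover have "1 \<le> a" "a \<le> n" using assms(2,3) TypeA by auto
    ultimately have "i \<in> S" if "1 \<le> i" "i \<le> n" for i
      using path_connected[of 1 n "\<lambda>i. i \<in> S" i a] that assms(2) by simp
    then show ?thesis using TypeA by auto
  next
    case (TypeD n)
    have n: "n \<ge> 4" using TypeD assms by simp
    have step: "i \<in> S \<longleftrightarrow> Suc i \<in> S" if "1 \<le> i" "i < n - 1" for i
      using that TypeD by (intro iff) (auto simp: adj_def)
    have "n \<in> S \<longleftrightarrow> n - 2 \<in> S"
      using TypeD n by (intro iff) (auto simp: adj_def)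
    moreover have "i \<in> S \<longleftrightarrow> n - 2 \<in> S" if "1 \<le> i" "i \<le> n - 1" for i
      using path_connected[of 1 "n - 1" "\<lambda>i. i \<in> S" i "n - 2", OF step] that n by simp
    ultimately have *: "i \<in> S \<longleftrightarrow> n - 2 \<in> S" if "i \<in> nodes M" for i
      using that TypeD by (cases "i = n") auto
    show ?thesis using * assms(2,3) by blast
  next
    case (TypeE n)
    have n: "n \<ge> 6" using TypeE assms by auto
    have step: "i \<in> S \<longleftrightarrow> Suc i \<in> S" if "3 \<le> i" "i < n" for i
      using that TypeE by (intro iff) (auto simp: adj_def)
    have 1: "1 \<in> S \<longleftrightarrow> 3 \<in> S" by (rule iff) (use TypeE n in \<open>auto simp: adj_def\<close>)
    have 2: "2 \<in> S \<longleftrightarrow> 4 \<in> S" by (rule iff) (use TypeE n in \<open>auto simp: adj_def\<close>)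
    have e: "i \<in> S \<longleftrightarrow> 4 \<in> S" if "3 \<le> i" "i \<le> n" for i
      using path_connected[of 3 n "\<lambda>i. i \<in> S" i 4, OF step] that n by simp
    have *: "i \<in> S \<longleftrightarrow> 4 \<in> S" if "i \<in> nodes M" for i
    proof -
      have "i = 1 \<or> i = 2 \<or> 3 \<le> i" "i \<le> n" using that TypeE by auto
      then show ?thesis using 1 2 e[of i] e[of 3] n by auto
    qed
    show ?thesis using * assms(2,3) by blast
  qed
qed

subsection \<open>Roots\<close>

locale simply_laced =
  fixes M :: diagram
  assumes simply_laced: "simply_laced_finite M"
begin

abbreviation ip :: "nat \<Rightarrow> root \<Rightarrow> int" where
  "ip i \<equiv> inner_form M (simple_root i)"

abbreviation refl :: "nat \<Rightarrow> root \<Rightarrow> root" where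
  "refl \<equiv> reflect M"

abbreviation Phi :: "root set" where
  "Phi \<equiv> norm2_vectors M"

definition Phi_pos :: "root set" where
  "Phi_pos = {v \<in> Phi. \<forall>j. v j \<ge> 0}"

lemma simple_root_lattice: "i \<in> nodes M \<Longrightarrow> simple_root i \<in> root_lattice M"
  by (auto simp: root_lattice_def simple_root_def)

lemma lattice_add: "u \<in> root_lattice M \<Longrightarrow> v \<in> root_lattice M \<Longrightarrow> u + v \<in> root_lattice M"
  and lattice_diff: "u \<in> root_lattice M \<Longrightarrow> v \<in> root_lattice M \<Longrightarrow> u - v \<in> root_lattice M"
  and lattice_minus: "u \<in> root_lattice M \<Longrightarrow> - u \<in> root_lattice M"
  by (auto simp: root_lattice_def)

lemma Phi_lattice: "v \<in> Phi \<Longrightarrow> v \<in> root_lattice M"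
  and Phi_norm: "v \<in> Phi \<Longrightarrow> inner_form M v v = 2"
  by (auto simp: norm2_vectors_def)

lemma simple_root_Phi [simp]: "i \<in> nodes M \<Longrightarrow> simple_root i \<in> Phi"
  by (simp add: norm2_vectors_def simple_root_lattice inner_form_simple_simple)

lemma simple_root_Phi_pos [simp]: "i \<in> nodes M \<Longrightarrow> simple_root i \<in> Phi_pos"
  by (simp add: Phi_pos_def) (simp add: simple_root_def)

lemma minus_Phi [simp]: "- v \<in> Phi \<longleftrightarrow> v \<in> Phi"
proof -
  have "- v \<in> Phi" if "v \<in> Phi" for v
    using that by (simp add: norm2_vectors_def lattice_minus inner_form_linear)
  from this[of v] this[of "- v"] show ?thesis by auto
qed

lemma reflect_Phi [simp]: "i \<in> nodes M \<Longrightarrow> v \<in> Phi \<Longrightarrow> refl i v \<in> Phi"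
  by (auto simp: norm2_vectors_def inner_form_reflect root_lattice_def reflect_apply simple_root_def)

lemma finite_Phi [simp]: "finite Phi"
  by (rule finite_norm2_vectors[OF simply_laced])

lemma finite_Phi_pos [simp]: "finite Phi_pos"
  by (rule finite_subset[OF _ finite_Phi]) (auto simp: Phi_pos_def)

lemma Phi_pos_Phi: "v \<in> Phi_pos \<Longrightarrow> v \<in> Phi"
  by (simp add: Phi_pos_def)

lemma Phi_nonzero: "v \<in> Phi \<Longrightarrow> v \<noteq> 0"
proof
  assume "v \<in> Phi" "v = 0"
  moreover have "inner_form M 0 0 = 0" by (simp add: inner_form_def)
  ultimately show False using Phi_norm by force
qed

text \<open>Write \<open>v = p - n\<close> with nonnegative parts of disjoint support. Off-diagonal
  Cartan entries are at most 0, hence \<open>inner_form M p n \<le> 0\<close>; if both parts were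
  nonzero, each would have norm at least 2 and \<open>v\<close> would have norm at least 4.\<close>

lemma Phi_pos_or_neg:
  assumes "v \<in> Phi"
  shows "v \<in> Phi_pos \<or> - v \<in> Phi_pos"
proof -
  define p n where "p = (\<lambda>j. max (v j) 0)" and "n = (\<lambda>j. max (- v j) 0)"
  have v: "v = p - n" by (auto simp: p_def n_def)
  have lat: "p \<in> root_lattice M" "n \<in> root_lattice M"
    using Phi_lattice[OF assms] by (auto simp: root_lattice_def p_def n_def)
  have "inner_form M p n \<le> 0"
    unfolding inner_form_def
  proof (intro sum_nonpos)
    fix i j
    show "cartan M i j * p i * n j \<le> 0"
    proof (cases "i = j")
      case True then show ?thesis by (simp add: p_def n_def max_def)
    next
      case False
      then have "cartan M i j \<le> 0" by (simp add: cartan_def)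
      then show ?thesis by (intro mult_nonpos_nonneg) (auto simp: p_def n_def)
    qed
  qed
  moreover have "2 = inner_form M p p - 2 * inner_form M p n + inner_form M n n"
    using Phi_norm[OF assms] unfolding v by (simp add: inner_form_linear inner_form_sym[of M n p])
  ultimately have "p = 0 \<or> n = 0"
    using inner_form_ge_2[OF simply_laced lat(1)] inner_form_ge_2[OF simply_laced lat(2)] by force
  then show ?thesis
  proof
    assume "p = 0"
    then have "- v = n" by (simp add: v)
    then have "n \<in> Phi" using assms minus_Phi by metis
    then have "n \<in> Phi_pos" by (simp add: Phi_pos_def) (simp add: n_def)
    then show ?thesis using \<open>- v = n\<close> by simp
  next
    assume "n = 0"
    then have "v = p" by (simp add: v)
    then have "p \<in> Phi" using assms by simp
    then have "p \<in> Phi_pos" by (simp add: Phi_pos_def) (simp add: p_def)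
    then show ?thesis using \<open>v = p\<close> by simp
  qed
qed

lemma not_pos_and_neg: "v \<in> Phi_pos \<Longrightarrow> - v \<notin> Phi_pos"
proof
  assume v: "v \<in> Phi_pos" "- v \<in> Phi_pos"
  have "v = 0"
  proof
    fix j show "v j = 0 j" using v by (auto simp: Phi_pos_def intro: order.antisym)
  qed
  then show False using Phi_nonzero Phi_pos_Phi v by blast
qed

text \<open>The Cauchy-Schwarz inequality with its equality case, read off from the norm of
  \<open>u - v\<close>.\<close>

lemma inner_le_2:
  assumes "u \<in> Phi" "v \<in> Phi"
  shows "inner_form M u v \<le> 2" "inner_form M u v = 2 \<Longrightarrow> u = v"
proof -
  have *: "inner_form M (u - v) (u - v) = 4 - 2 * inner_form M u v"
    using assms by (simp add: inner_form_linear Phi_norm inner_form_sym[of M v u])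
  show "inner_form M u v \<le> 2" using inner_form_nonneg[OF simply_laced, of "u - v"] * by simp
  assume "inner_form M u v = 2"
  then have "u - v = 0" using * assms by (intro inner_form_eq_0[OF simply_laced]) (auto intro: lattice_diff Phi_lattice)
  then show "u = v" by simp
qed

lemma ip_le_2: "i \<in> nodes M \<Longrightarrow> v \<in> Phi \<Longrightarrow> ip i v \<le> 2"
  and ip_eq_2: "i \<in> nodes M \<Longrightarrow> v \<in> Phi \<Longrightarrow> ip i v = 2 \<longleftrightarrow> v = simple_root i"
  using inner_le_2[of "simple_root i" v] by (auto simp: inner_form_simple_simple)

lemma ip_ge_minus_2: "i \<in> nodes M \<Longrightarrow> v \<in> Phi \<Longrightarrow> ip i v \<ge> - 2"
  and ip_eq_minus_2: "i \<in> nodes M \<Longrightarrow> v \<in> Phi \<Longrightarrow> ip i v = - 2 \<longleftrightarrow> v = - simple_root i"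
  using ip_le_2[of i "- v"] ip_eq_2[of i "- v"] by (auto simp: inner_form_linear minus_equation_iff[of v])

lemma ip_values:
  assumes "i \<in> nodes M" "v \<in> Phi"
  shows "ip i v \<in> {-2, -1, 0, 1, 2}"
  using ip_le_2[OF assms] ip_ge_minus_2[OF assms] by auto

lemma simple_root_not_neg: "i \<in> nodes M \<Longrightarrow> - simple_root i \<notin> Phi_pos"
  using not_pos_and_neg by auto

lemma ip_pos_values:
  assumes "i \<in> nodes M" "v \<in> Phi_pos"
  shows "ip i v \<in> {-1, 0, 1, 2}"
  using ip_values[OF assms(1) Phi_pos_Phi[OF assms(2)]] ip_eq_minus_2[OF assms(1) Phi_pos_Phi[OF assms(2)]]
    simple_root_not_neg assms by auto

lemma reflect_eq_diff: "ip i v = 1 \<Longrightarrow> refl i v = v - simple_root i"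
  and reflect_eq_add: "ip i v = - 1 \<Longrightarrow> refl i v = v + simple_root i"
  and reflect_eq_self: "ip i v = 0 \<Longrightarrow> refl i v = v"
  by (auto simp: reflect_apply)

lemma reflect_simple: "i \<in> nodes M \<Longrightarrow> refl i (simple_root i) = - simple_root i"
  by (rule ext) (simp add: reflect_apply inner_form_simple_simple)

text \<open>A simple reflection permutes the positive roots other than its own simple root: outside
  coordinate \<open>i\<close> nothing changes, so the sign can only change for a multiple of the simple root.\<close>

lemma reflect_Phi_pos:
  assumes i: "i \<in> nodes M" and v: "v \<in> Phi_pos" "v \<noteq> simple_root i"
  shows "refl i v \<in> Phi_pos"
proof (rule ccontr)
  assume "refl i v \<notin> Phi_pos"
  then have neg: "- refl i v \<in> Phi_pos"
    using Phi_pos_or_neg reflect_Phi i Phi_pos_Phi[OF v(1)] by blast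
  have zero: "v j = 0" if "j \<noteq> i" for j
  proof -
    have "refl i v j = v j" using that by (simp add: reflect_apply simple_root_other)
    moreover have "- refl i v j \<ge> 0" using neg by (simp add: Phi_pos_def)
    moreover have "v j \<ge> 0" using v by (simp add: Phi_pos_def)
    ultimately show ?thesis by simp
  qed
  then have "v = (\<lambda>j. v i * simple_root i j)" by (auto simp: simple_root_def fun_eq_iff)
  then have vv: "inner_form M u v = v i * inner_form M u (simple_root i)" for u
    using inner_form_scale_right[of M u "v i" "simple_root i"] by simp
  have "2 = v i * (v i * 2)"
    using Phi_norm[OF Phi_pos_Phi[OF v(1)]] vv[of v] vv[of "simple_root i"] inner_form_sym[of M v "simple_root i"] i
    by (simp add: inner_form_simple_simple)
  then have "v i * v i = 1" by linarith
  moreover have "v i \<ge> 0" using v by (simp add: Phi_pos_def)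
  ultimately have "v i = 1" by (simp add: zmult_eq_1_iff)
  then have "v = simple_root i" using zero by (auto simp: simple_root_def fun_eq_iff)
  then show False using v by simp
qed

section \<open>Height, dominant roots and the highest root\<close>

definition height :: "root \<Rightarrow> int" where
  "height v = (\<Sum>j\<in>nodes M. v j)"

lemma height_reflect: "i \<in> nodes M \<Longrightarrow> height (refl i v) = height v - ip i v"
proof -
  assume "i \<in> nodes M"
  then have "(\<Sum>j\<in>nodes M. simple_root i j) = 1" by (simp add: simple_root_def)
  then show ?thesis by (simp add: height_def reflect_apply sum_subtractf flip: sum_distrib_left)
qed

lemma height_minus: "height (- v) = - height v"
  by (simp add: height_def sum_negf)

lemma height_pos: "v \<in> Phi_pos \<Longrightarrow> height v \<ge> 1"
proof -
  assume v: "v \<in> Phi_pos"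
  obtain j where j: "v j \<noteq> 0" using Phi_nonzero[OF Phi_pos_Phi[OF v]] by (auto simp: fun_eq_iff)
  then have "j \<in> nodes M" using Phi_lattice[OF Phi_pos_Phi[OF v]] by (auto simp: root_lattice_def)
  then have "v j \<le> height v" unfolding height_def using v by (intro member_le_sum) (auto simp: Phi_pos_def)
  moreover have "v j \<ge> 0" using v by (simp add: Phi_pos_def)
  ultimately show ?thesis using j by linarith
qed

lemma dominant_inner_nonneg:
  assumes "\<And>i. i \<in> nodes M \<Longrightarrow> ip i \<gamma> \<ge> 0" "v \<in> Phi_pos"
  shows "inner_form M v \<gamma> \<ge> 0"
  unfolding inner_form_expand[of M v] using assms by (intro sum_nonneg mult_nonneg_nonneg) (auto simp: Phi_pos_def)

text \<open>A node outside the support but adjacent to it would have a negative inner product with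
  \<gamma>, as all its contributions are nonpositive and one is negative. Connectedness then spreads
  the support over the whole diagram.\<close>

lemma dominant_full_support:
  assumes dom: "\<And>i. i \<in> nodes M \<Longrightarrow> ip i \<gamma> \<ge> 0" and \<gamma>: "\<gamma> \<in> Phi_pos" and "i \<in> nodes M"
  shows "\<gamma> i > 0"
proof -
  define S where "S = {i \<in> nodes M. \<gamma> i \<noteq> 0}"
  obtain a where a: "a \<in> S"
    using Phi_nonzero[OF Phi_pos_Phi[OF \<gamma>]] Phi_lattice[OF Phi_pos_Phi[OF \<gamma>]]
    by (auto simp: S_def root_lattice_def fun_eq_iff)
  have "nodes M \<subseteq> S"
  proof (rule diagram_connected[OF simply_laced a])
    fix i j assume ij: "i \<in> S" "j \<in> nodes M" "adj M i j"
    show "j \<in> S"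
    proof (rule ccontr)
      assume "j \<notin> S"
      then have gj: "\<gamma> j = 0" using ij by (simp add: S_def)
      have le: "cartan M j k * \<gamma> k \<le> 0" for k
        using gj \<gamma> by (cases "k = j") (auto simp: cartan_def Phi_pos_def)
      have "ip j \<gamma> = (\<Sum>k\<in>nodes M. cartan M j k * \<gamma> k)" using ij by (simp add: inner_form_simple_left)
      also have "\<dots> = cartan M j i * \<gamma> i + (\<Sum>k\<in>nodes M - {i}. cartan M j k * \<gamma> k)"
        using ij by (intro sum.remove) (auto simp: S_def)
      also have "\<dots> \<le> cartan M j i * \<gamma> i" using sum_nonpos[of "nodes M - {i}" "\<lambda>k. cartan M j k * \<gamma> k"] le by simp
      also have "\<dots> = - \<gamma> i" using ij adj_irrefl adj_sym by (auto simp: cartan_def)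
      also have "\<dots> < 0" using ij(1) \<gamma> by (auto simp: S_def Phi_pos_def order.order_iff_strict)
      finally show False using dom[OF ij(2)] by simp
    qed
  qed (auto simp: S_def)
  then have "\<gamma> i \<noteq> 0" using assms(3) by (auto simp: S_def)
  then show ?thesis using \<gamma> by (auto simp: Phi_pos_def order.order_iff_strict)
qed

text \<open>Full support makes the inner product of two dominant positive roots positive. If they
  differ it must be 1, so their difference is a root; pairing its positive version with the root
  that is subtracted in it gives \<open>1 - 2 < 0\<close>, against dominance.\<close>

lemma dominant_unique:
  assumes \<beta>: "\<And>i. i \<in> nodes M \<Longrightarrow> ip i \<beta> \<ge> 0" "\<beta> \<in> Phi_pos"
    and \<gamma>: "\<And>i. i \<in> nodes M \<Longrightarrow> ip i \<gamma> \<ge> 0" "\<gamma> \<in> Phi_pos"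
  shows "\<beta> = \<gamma>"
proof (rule ccontr)
  assume ne: "\<beta> \<noteq> \<gamma>"
  have "inner_form M \<beta> \<gamma> > 0"
  proof (rule ccontr)
    assume "\<not> ?thesis"
    moreover have "inner_form M \<beta> \<gamma> = (\<Sum>i\<in>nodes M. \<beta> i * ip i \<gamma>)" by (rule inner_form_expand)
    moreover have nn: "\<beta> i * ip i \<gamma> \<ge> 0" if "i \<in> nodes M" for i
      using that \<beta> \<gamma> by (auto simp: Phi_pos_def)
    moreover have "(\<Sum>i\<in>nodes M. \<beta> i * ip i \<gamma>) \<ge> 0" by (rule sum_nonneg) (rule nn)
    ultimately have "(\<Sum>i\<in>nodes M. \<beta> i * ip i \<gamma>) = 0" by linarith
    then have "\<forall>i\<in>nodes M. \<beta> i * ip i \<gamma> = 0" using nn by (subst (asm) sum_nonneg_eq_0_iff) auto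
    then have "ip i \<gamma> = 0" if "i \<in> nodes M" for i using dominant_full_support[OF \<beta>] that by fastforce
    then have "inner_form M \<gamma> \<gamma> = 0" by (subst inner_form_expand) simp
    then show False using Phi_norm[OF Phi_pos_Phi[OF \<gamma>(2)]] by simp
  qed
  moreover have "inner_form M \<beta> \<gamma> \<noteq> 2" "inner_form M \<beta> \<gamma> \<le> 2"
    using inner_le_2[OF Phi_pos_Phi[OF \<beta>(2)] Phi_pos_Phi[OF \<gamma>(2)]] ne by auto
  ultimately have one: "inner_form M \<beta> \<gamma> = 1" by linarith
  have "inner_form M (\<beta> - \<gamma>) (\<beta> - \<gamma>) = 2"
    using one \<beta>(2) \<gamma>(2) by (simp add: inner_form_linear Phi_norm Phi_pos_Phi inner_form_sym[of M \<gamma> \<beta>])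
  moreover have "\<beta> - \<gamma> \<in> root_lattice M"
    using Phi_lattice[OF Phi_pos_Phi[OF \<beta>(2)]] Phi_lattice[OF Phi_pos_Phi[OF \<gamma>(2)]] by (rule lattice_diff)
  ultimately have "\<beta> - \<gamma> \<in> Phi" by (simp add: norm2_vectors_def)
  then consider "\<beta> - \<gamma> \<in> Phi_pos" | "\<gamma> - \<beta> \<in> Phi_pos" using Phi_pos_or_neg[of "\<beta> - \<gamma>"] by auto
  then show False
  proof cases
    case 1
    from dominant_inner_nonneg[OF \<gamma>(1) this] show False
      using one \<gamma>(2) by (simp add: inner_form_linear Phi_norm Phi_pos_Phi)
  next
    case 2
    from dominant_inner_nonneg[OF \<beta>(1) this] show False
      using one \<beta>(2) by (simp add: inner_form_linear Phi_norm Phi_pos_Phi inner_form_sym[of M \<gamma> \<beta>])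
  qed
qed

text \<open>Chosen by maximal height, which always exists in a finite nonempty set; that it
  dominates every positive root coordinatewise, as \<open>highest_root\<close> demands, is shown in
  \<open>le_alpha0\<close>.\<close>

definition alpha0 :: root where
  "alpha0 = (SOME \<gamma>. \<gamma> \<in> Phi_pos \<and> (\<forall>v\<in>Phi_pos. height v \<le> height \<gamma>))"

lemma nodes_nonempty: "nodes M \<noteq> {}"
  using simply_laced by (cases M) auto

lemma alpha0: "alpha0 \<in> Phi_pos" "v \<in> Phi_pos \<Longrightarrow> height v \<le> height alpha0"
proof -
  have "Phi_pos \<noteq> {}" using nodes_nonempty simple_root_Phi_pos by blast
  then have "\<exists>\<gamma>. \<gamma> \<in> Phi_pos \<and> (\<forall>v\<in>Phi_pos. height v \<le> height \<gamma>)"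
    using arg_min_if_finite[of Phi_pos "\<lambda>v. - height v"] by (metis finite_Phi_pos linorder_not_le neg_less_iff_less)
  from someI_ex[OF this] show "alpha0 \<in> Phi_pos" "v \<in> Phi_pos \<Longrightarrow> height v \<le> height alpha0"
    unfolding alpha0_def by auto
qed

lemma alpha0_dominant: "i \<in> nodes M \<Longrightarrow> ip i alpha0 \<ge> 0"
proof (rule ccontr)
  assume i: "i \<in> nodes M" and neg: "\<not> ip i alpha0 \<ge> 0"
  then have "alpha0 \<noteq> simple_root i" by (auto simp: inner_form_simple_simple)
  then have "refl i alpha0 \<in> Phi_pos" using i alpha0 by (intro reflect_Phi_pos)
  then show False using alpha0(2) height_reflect[OF i, of alpha0] neg by force
qed

text \<open>For positive \<open>v\<close> this is the uniqueness of the dominant root. A negative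
  root cannot be dominant, since it has inner product -2 with the positive root
  \<open>- v\<close>.\<close>

lemma ascent_exists:
  assumes "v \<in> Phi" "v \<noteq> alpha0"
  obtains i where "i \<in> nodes M" "ip i v < 0"
proof (cases "v \<in> Phi_pos")
  case True
  then show ?thesis using that dominant_unique[of v alpha0] alpha0 alpha0_dominant assms(2) by (meson linorder_not_le)
next
  case False
  then have neg: "- v \<in> Phi_pos" using Phi_pos_or_neg assms by blast
  show ?thesis
  proof (rule ccontr)
    assume "\<not> thesis"
    then have "ip i v \<ge> 0" if "i \<in> nodes M" for i using that \<open>\<And>i. _ \<Longrightarrow> _ \<Longrightarrow> thesis\<close> by force
    from dominant_inner_nonneg[OF this neg] show False using Phi_norm[OF assms(1)] by (simp add: inner_form_linear)
  qed
qed

text \<open>The length of a shortest element of the Weyl group mapping \<open>v\<close> to the highest root. The shift for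
  negative roots accounts for the jump of the height from \<open>-1\<close> to \<open>1\<close>.\<close>

definition depth :: "root \<Rightarrow> nat" where
  "depth v = nat (height alpha0 - height v - (if v \<in> Phi_pos then 0 else 1))"

lemma depth_reflect:
  assumes i: "i \<in> nodes M" and v: "v \<in> Phi" and "ip i v > 0"
  shows "depth (refl i v) = Suc (depth v)"
proof (cases "v = simple_root i")
  case True
  then show ?thesis
    using i alpha0(2)[of "simple_root i"] height_reflect[OF i, of v] height_pos[of "simple_root i"] simple_root_not_neg[OF i]
    by (simp add: depth_def reflect_simple height_minus inner_form_simple_simple)
next
  case False
  then have one: "ip i v = 1" using ip_values[OF i v] ip_eq_2[OF i v] assms(3) by auto
  have "refl i v \<in> Phi_pos \<longleftrightarrow> v \<in> Phi_pos"
  proof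
    assume "refl i v \<in> Phi_pos"
    moreover have "refl i v \<noteq> simple_root i" using one inner_form_simple_reflect_self[OF i, of v] i
      by (auto simp: inner_form_simple_simple)
    ultimately show "v \<in> Phi_pos" using reflect_Phi_pos[OF i, of "refl i v"] i by simp
  qed (use reflect_Phi_pos[OF i _ False] in auto)
  \<comment> \<open>This keeps the argument of \<open>nat\<close> in \<open>depth\<close>
    nonnegative, so that truncation cannot swallow the increment.\<close>
  moreover have "height v + (if v \<in> Phi_pos then 0 else 1) \<le> height alpha0"
    using alpha0(2)[of v] height_pos[of "- v"] height_pos[OF alpha0(1)] Phi_pos_or_neg[OF v] by (auto simp: height_minus)
  moreover have "height (refl i v) = height v - 1" using one height_reflect[OF i, of v] by simp
  ultimately show ?thesis unfolding depth_def by auto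
qed

lemma depth_reflect_neg:
  assumes i: "i \<in> nodes M" and v: "v \<in> Phi" and "ip i v < 0"
  shows "depth v = Suc (depth (refl i v))"
  using depth_reflect[OF i, of "refl i v"] assms by (simp add: inner_form_simple_reflect_self)

lemma depth_alpha0: "depth alpha0 = 0"
  by (simp add: depth_def alpha0)

lemma depth_eq_0: "v \<in> Phi \<Longrightarrow> depth v = 0 \<longleftrightarrow> v = alpha0"
  by (metis Zero_neq_Suc ascent_exists depth_alpha0 depth_reflect_neg)

end

subsection \<open>Words raising a root to the highest root\<close>

lemma pos_word_simps [simp]:
  "pos_word [] = []" "pos_word (i # p) = (i, True) # pos_word p" "pos_word (p @ q) = pos_word p @ pos_word q"
  by (simp_all add: pos_word_def)

lemma pos_word_in_lists [simp]: "pos_word p \<in> lists (S \<times> UNIV) \<longleftrightarrow> p \<in> lists S"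
  by (induction p) auto

lemma word_rels_braid: "word_rels (nodes M) (braid_rels M)"
  by (auto simp: word_rels_def braid_rels_def)

lemma word_rels_coxeter: "word_rels (nodes M) (coxeter_rels M)"
  using word_rels_braid by (auto simp: word_rels_def coxeter_rels_def)

lemma group_artin: "group (artin M)"
  unfolding artin_def by (rule group_presented_group[OF word_rels_braid])

lemma artin_word_eq_iff:
  "p \<in> lists (nodes M) \<Longrightarrow> q \<in> lists (nodes M) \<Longrightarrow>
    artin_word M p = artin_word M q \<longleftrightarrow> pres_eq (nodes M) (braid_rels M) (pos_word p) (pos_word q)"
  unfolding artin_word_def by (rule pres_class_eq_iff) simp

lemma coxeter_word_eq_iff:
  "p \<in> lists (nodes M) \<Longrightarrow> q \<in> lists (nodes M) \<Longrightarrow>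
    coxeter_word M p = coxeter_word M q \<longleftrightarrow> pres_eq (nodes M) (coxeter_rels M) (pos_word p) (pos_word q)"
  unfolding coxeter_word_def by (rule pres_class_eq_iff) simp

lemma artin_word_mult:
  "p \<in> lists (nodes M) \<Longrightarrow> q \<in> lists (nodes M) \<Longrightarrow>
    artin_word M p \<otimes>\<^bsub>artin M\<^esub> artin_word M q = artin_word M (p @ q)"
  unfolding artin_def artin_word_def by (simp add: presented_group_mult[OF word_rels_braid])

lemma artin_word_in_carrier [simp]: "p \<in> lists (nodes M) \<Longrightarrow> artin_word M p \<in> carrier (artin M)"
  unfolding artin_def artin_word_def by (rule pres_class_in_carrier) simp

lemma artin_word_cong:
  assumes "p \<in> lists (nodes M)" "p' \<in> lists (nodes M)" "q \<in> lists (nodes M)" "q' \<in> lists (nodes M)"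
    and "artin_word M p = artin_word M p'" "artin_word M q = artin_word M q'"
  shows "artin_word M (p @ q) = artin_word M (p' @ q')"
  using assms by (simp flip: artin_word_mult)

lemma artin_word_commute:
  assumes "i \<in> nodes M" "j \<in> nodes M" "i \<noteq> j" "\<not> adj M i j" "q \<in> lists (nodes M)"
  shows "artin_word M (i # j # q) = artin_word M (j # i # q)"
proof -
  have "pres_eq (nodes M) (braid_rels M) ([] @ pos_word [i, j] @ pos_word q) ([] @ pos_word [j, i] @ pos_word q)"
    using assms by (intro pres_eq.rel) (auto simp: braid_rels_def)
  then show ?thesis using assms by (simp add: artin_word_eq_iff)
qed

lemma artin_word_braid:
  assumes "i \<in> nodes M" "j \<in> nodes M" "adj M i j" "q \<in> lists (nodes M)"
  shows "artin_word M (i # j # i # q) = artin_word M (j # i # j # q)"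
proof -
  have "pres_eq (nodes M) (braid_rels M) ([] @ pos_word [i, j, i] @ pos_word q) ([] @ pos_word [j, i, j] @ pos_word q)"
  proof (rule pres_eq.rel)
    show "(pos_word [i, j, i], pos_word [j, i, j]) \<in> braid_rels M"
      unfolding braid_rels_def using assms by blast
  qed (use assms in auto)
  then show ?thesis using assms by (simp add: artin_word_eq_iff)
qed

lemma coxeter_positive_word:
  "u \<in> lists (nodes M \<times> UNIV) \<Longrightarrow> pres_eq (nodes M) (coxeter_rels M) u (pos_word (map fst u))"
proof (induction u)
  case Nil then show ?case by (auto intro: pres_eq.refl)
next
  case (Cons a u)
  obtain g b where a: "a = (g, b)" by (cases a)
  have g: "g \<in> nodes M" and u: "u \<in> lists (nodes M \<times> UNIV)" using Cons.prems a by auto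
  have "pres_eq (nodes M) (coxeter_rels M) (a # u) ((g, True) # u)"
  proof (cases b)
    case True then show ?thesis using a g u by (auto intro: pres_eq.refl)
  next
    case False
    have "pres_eq (nodes M) (coxeter_rels M) ([(g, False)] @ pos_word [g, g] @ u) ([(g, False)] @ [] @ u)"
      using g u by (intro pres_eq.rel) (auto simp: coxeter_rels_def)
    moreover have "pres_eq (nodes M) (coxeter_rels M) ([] @ [(g, False), (g, \<not> False)] @ ((g, True) # u)) ([] @ (g, True) # u)"
      using g u by (intro pres_eq.cancel) auto
    ultimately show ?thesis using a False by (auto intro: pres_eq.sym pres_eq.trans)
  qed
  moreover have "pres_eq (nodes M) (coxeter_rels M) ([(g, True)] @ u) ([(g, True)] @ pos_word (map fst u))"
    using Cons.IH[OF u] g by (intro pres_eq_append_left) auto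
  ultimately show ?case using a by (auto intro: pres_eq.trans)
qed

lemma expresses_exists:
  assumes "w \<in> carrier (coxeter M)"
  obtains p where "expresses M p w"
proof -
  obtain u where u: "u \<in> lists (nodes M \<times> UNIV)" "w = pres_class (nodes M) (coxeter_rels M) u"
    using assms by (auto simp: coxeter_def presented_group_carrier)
  have p: "map fst u \<in> lists (nodes M)" using u by (auto simp: in_lists_conv_set)
  have "w = coxeter_word M (map fst u)"
    using coxeter_positive_word[OF u(1)] p by (simp add: u(2) coxeter_word_def pres_class_eq_iff)
  then show ?thesis using that p by (simp add: expresses_def)
qed

lemma coxeter_word_in_carrier [simp]: "p \<in> lists (nodes M) \<Longrightarrow> coxeter_word M p \<in> carrier (coxeter M)"
  unfolding coxeter_def coxeter_word_def by (rule pres_class_in_carrier) simp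

lemma coxeter_word_inv:
  assumes "p \<in> lists (nodes M)"
  shows "inv\<^bsub>coxeter M\<^esub> coxeter_word M p = coxeter_word M (rev p)"
proof -
  have iw: "inv_word (pos_word p) \<in> lists (nodes M \<times> UNIV)" using assms by (intro inv_word_in_lists) simp
  have "inv\<^bsub>coxeter M\<^esub> coxeter_word M p = pres_class (nodes M) (coxeter_rels M) (inv_word (pos_word p))"
    unfolding coxeter_def coxeter_word_def using assms by (intro presented_group_inv[OF word_rels_coxeter]) simp
  also have "\<dots> = pres_class (nodes M) (coxeter_rels M) (pos_word (map fst (inv_word (pos_word p))))"
    using coxeter_positive_word[OF iw] pres_eq_in_lists[OF word_rels_coxeter coxeter_positive_word[OF iw]]
    by (subst pres_class_eq_iff) auto
  also have "map fst (inv_word (pos_word p)) = rev p"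
    by (simp add: inv_word_def pos_word_def rev_map comp_def)
  finally show ?thesis by (simp add: coxeter_word_def)
qed

text \<open>Signs of letters are ignored by the action, consistently because reflections are
  involutions. Hence the expression picked by \<open>SOME\<close> in \<open>cox_act\<close> does not
  affect the result.\<close>

lemma pres_eq_coxeter_act:
  "pres_eq (nodes M) (coxeter_rels M) u v \<Longrightarrow>
    foldr (\<lambda>(g, _). reflect M g) u = foldr (\<lambda>(g, _). reflect M g) v"
proof (induction rule: pres_eq.induct)
  case (cancel u v g b)
  then show ?case by (simp add: fun_eq_iff)
next
  case (rel u v p q)
  have *: "foldr (\<lambda>(g, _). reflect M g) p x = foldr (\<lambda>(g, _). reflect M g) q x" for x
    using rel(3) by (auto simp: coxeter_rels_def braid_rels_def intro: reflect_commute reflect_braid)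
  show ?case
  proof (rule ext)
    fix x show "foldr (\<lambda>(g, _). reflect M g) (u @ p @ v) x = foldr (\<lambda>(g, _). reflect M g) (u @ q @ v) x"
      using * by simp
  qed
qed simp_all

lemma foldr_pos_word: "foldr (\<lambda>(g, _). reflect M g) (pos_word p) = foldr (reflect M) p"
  by (induction p) auto

lemma coxeter_word_act:
  assumes "p \<in> lists (nodes M)" "q \<in> lists (nodes M)" "coxeter_word M p = coxeter_word M q"
  shows "foldr (reflect M) p = foldr (reflect M) q"
  using assms pres_eq_coxeter_act[of M "pos_word p" "pos_word q"]
  by (simp add: coxeter_word_eq_iff foldr_pos_word)

lemma artin_word_eq_imp_coxeter:
  assumes "p \<in> lists (nodes M)" "q \<in> lists (nodes M)" "artin_word M p = artin_word M q"
  shows "coxeter_word M p = coxeter_word M q"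
proof -
  have "pres_eq (nodes M) (braid_rels M) (pos_word p) (pos_word q)"
    using artin_word_eq_iff[OF assms(1,2)] assms(3) by simp
  then have "pres_eq (nodes M) (coxeter_rels M) (pos_word p) (pos_word q)"
    by (rule pres_eq_mono) (simp add: coxeter_rels_def)
  then show ?thesis using coxeter_word_eq_iff[OF assms(1,2)] by simp
qed

lemma artin_word_act:
  assumes "p \<in> lists (nodes M)" "q \<in> lists (nodes M)" "artin_word M p = artin_word M q"
  shows "foldr (reflect M) p = foldr (reflect M) q"
  using coxeter_word_act[OF assms(1,2) artin_word_eq_imp_coxeter[OF assms]] .

lemma cox_act_eq:
  assumes "expresses M p w"
  shows "cox_act M w v = foldr (reflect M) p v"
proof -
  have "expresses M (SOME p. expresses M p w) w" using assms by (rule someI)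
  then show ?thesis
    unfolding cox_act_def using assms coxeter_word_act[of "SOME p. expresses M p w" M p] by (simp add: expresses_def)
qed

lemma cox_length_attained:
  assumes "w \<in> carrier (coxeter M)"
  obtains p where "reduced_expr M p w"
proof -
  obtain p where "expresses M p w" using expresses_exists[OF assms] .
  then have "\<exists>k. \<exists>p. expresses M p w \<and> length p = k" by blast
  from LeastI_ex[OF this] show ?thesis using that unfolding cox_length_def reduced_expr_def by blast
qed

lemma cox_length_le: "expresses M p w \<Longrightarrow> cox_length M w \<le> length p"
  unfolding cox_length_def by (rule Least_le) blast

context simply_laced
begin

text \<open>The words \<open>p\<close> with \<open>desc p v\<close> are the reduced words of \<open>w\<^sup>-\<^sup>1\<close> for the shortest \<open>w\<close> that maps \<open>v\<close> to the
  highest root, so \<open>d\<^sub>v\<close> is the Artin group element of any of them. Here \<open>v\<close> may be negative.\<close>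

primrec desc :: "nat list \<Rightarrow> root \<Rightarrow> bool" where
  "desc [] v \<longleftrightarrow> v = alpha0"
| "desc (i # p) v \<longleftrightarrow> i \<in> nodes M \<and> ip i v < 0 \<and> desc p (refl i v)"

lemma alpha0_Phi [simp]: "alpha0 \<in> Phi"
  using alpha0 Phi_pos_Phi by blast

lemma desc_Phi: "desc p v \<Longrightarrow> v \<in> Phi"
proof (induction p arbitrary: v)
  case (Cons i p)
  then have "i \<in> nodes M" "refl i v \<in> Phi" by auto
  then show ?case using reflect_Phi[of i "refl i v"] by simp
qed simp

lemma desc_lists: "desc p v \<Longrightarrow> p \<in> lists (nodes M)"
  by (induction p arbitrary: v) auto

lemma desc_length: "desc p v \<Longrightarrow> length p = depth v"
proof (induction p arbitrary: v)
  case (Cons i p)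
  then show ?case using depth_reflect_neg[of i v] desc_Phi[OF Cons.prems] by simp
qed (simp add: depth_alpha0)

lemma desc_act: "desc p v \<Longrightarrow> foldr refl p alpha0 = v"
proof (induction p arbitrary: v)
  case (Cons i p) then show ?case by force
qed simp

lemma foldr_refl_rev: "p \<in> lists (nodes M) \<Longrightarrow> foldr refl (rev p) (foldr refl p v) = v"
  by (induction p) auto

lemma foldr_refl_Phi: "p \<in> lists (nodes M) \<Longrightarrow> v \<in> Phi \<Longrightarrow> foldr refl p v \<in> Phi"
  by (induction p) auto

lemma foldr_refl_inner: "p \<in> lists (nodes M) \<Longrightarrow> inner_form M (foldr refl p u) (foldr refl p v) = inner_form M u v"
  by (induction p) (auto simp: inner_form_reflect)

lemma foldr_refl_minus: "foldr refl p (- v) = - foldr refl p v"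
  by (induction p) (simp_all only: foldr.simps comp_apply id_apply reflect_minus)

lemma desc_exists:
  assumes "v \<in> Phi"
  obtains p where "desc p v"
  using assms
proof (induction "depth v" arbitrary: v thesis)
  case 0
  then show ?case using depth_eq_0[of v] desc.simps(1) by metis
next
  case (Suc n)
  then have "v \<noteq> alpha0" using depth_alpha0 by auto
  then obtain i where i: "i \<in> nodes M" "ip i v < 0" using ascent_exists Suc.prems by blast
  then have "depth (refl i v) = n" using depth_reflect_neg[OF i(1), of v] Suc by simp
  then obtain p where "desc p (refl i v)" using Suc.hyps(1)[of "refl i v"] i Suc.prems(2) by auto
  then show ?case using Suc.prems(1)[of "i # p"] i by simp
qed

text \<open>Confluence: two descending words for the same root can be joined below any pair of ascents, using
  one commutation or one braid relation.\<close>

lemma desc_unique: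
  assumes cong: "\<And>i p q. \<lbrakk>i \<in> nodes M; p \<in> lists (nodes M); q \<in> lists (nodes M); F p = F q\<rbrakk> \<Longrightarrow> F (i # p) = F (i # q)"
    and commute: "\<And>i j p. \<lbrakk>i \<in> nodes M; j \<in> nodes M; i \<noteq> j; \<not> adj M i j; p \<in> lists (nodes M)\<rbrakk> \<Longrightarrow>
      F (i # j # p) = F (j # i # p)"
    and braid: "\<And>i j p. \<lbrakk>i \<in> nodes M; j \<in> nodes M; adj M i j; p \<in> lists (nodes M)\<rbrakk> \<Longrightarrow>
      F (i # j # i # p) = F (j # i # j # p)"
  shows "desc p v \<Longrightarrow> desc q v \<Longrightarrow> F p = F q"
proof (induction "depth v" arbitrary: v p q rule: less_induct)
  case less
  \<comment> \<open>Nothing about \<open>F\<close> enters except compatibility with prefixing a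
    letter and the two relations, so the argument serves both Artin group elements and vectors of
    the Hecke module.\<close>
  show ?case
  proof (cases p)
    case Nil
    then have "depth v = 0" using less.prems by (simp add: depth_alpha0)
    then show ?thesis using Nil desc_length[OF less.prems(2)] by simp
  next
    case p: (Cons i p')
    have "q \<noteq> []" using desc_length[OF less.prems(1)] desc_length[OF less.prems(2)] p by auto
    then obtain j q' where q: "q = j # q'" by (cases q) auto
    have i: "i \<in> nodes M" "ip i v < 0" "desc p' (refl i v)" using less.prems p by auto
    have j: "j \<in> nodes M" "ip j v < 0" "desc q' (refl j v)" using less.prems q by auto
    have v: "v \<in> Phi" using less.prems desc_Phi by blast
    have d: "depth (refl i v) < depth v" "depth (refl j v) < depth v"
      using depth_reflect_neg[OF i(1) v i(2)] depth_reflect_neg[OF j(1) v j(2)] by simp_all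
    note IHi = less.hyps[OF d(1) i(3)] and IHj = less.hyps[OF d(2) j(3)]
    note lists = desc_lists[OF i(3)] desc_lists[OF j(3)]
    consider "i = j" | "i \<noteq> j" "\<not> adj M i j" | "adj M i j" by blast
    then show ?thesis
    proof cases
      case 1
      then have "F p' = F q'" using IHi j(3) by simp
      then show ?thesis unfolding p q using cong[OF i(1) lists] 1 by simp
    next
      case 2
      have ji: "ip j (refl i v) < 0" "ip i (refl j v) < 0"
        using 2 i j by (simp_all add: inner_form_simple_reflect cartan_def adj_sym)
      have "refl j (refl i v) \<in> Phi" using v i j by simp
      then obtain s where s: "desc s (refl j (refl i v))" by (rule desc_exists)
      then have "desc (j # s) (refl i v)" "desc (i # s) (refl j v)"
        using i j ji reflect_commute[OF i(1) j(1) 2] by simp_all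
      then have "F p' = F (j # s)" "F q' = F (i # s)" using IHi IHj by auto
      then have "F p = F (i # j # s)" "F q = F (j # i # s)"
        unfolding p q using i j desc_lists[OF s] lists by (auto intro!: cong)
      then show ?thesis using commute[OF i(1) j(1) 2 desc_lists[OF s]] by simp
    next
      case 3
      then have ne: "i \<noteq> j" "adj M j i" using adj_irrefl i adj_sym by auto
      \<comment> \<open>Both inner products of \<open>v\<close> are negative, so every step of
        either side of the braid relation is an ascent, and the two paths meet again after three
        steps.\<close>
      have ij: "ip j (refl i v) < 0" "ip i (refl j (refl i v)) < 0" "ip i (refl j v) < 0" "ip j (refl i (refl j v)) < 0"
        using 3 ne i j by (simp_all add: inner_form_simple_reflect cartan_def)
      have "refl i (refl j (refl i v)) \<in> Phi" using v i j by simp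
      then obtain s where s: "desc s (refl i (refl j (refl i v)))" by (rule desc_exists)
      then have "desc (j # i # s) (refl i v)" "desc (i # j # s) (refl j v)"
        using i j ij reflect_braid[OF i(1) j(1) 3] by simp_all
      then have "F p' = F (j # i # s)" "F q' = F (i # j # s)" using IHi IHj by auto
      then have "F p = F (i # j # i # s)" "F q = F (j # i # j # s)"
        unfolding p q using i j desc_lists[OF s] lists by (auto intro!: cong)
      then show ?thesis using braid[OF i(1) j(1) 3 desc_lists[OF s]] by simp
    qed
  qed
qed

lemma desc_artin_word: "desc p v \<Longrightarrow> desc q v \<Longrightarrow> artin_word M p = artin_word M q"
proof (rule desc_unique[of "artin_word M"])
  fix i p q assume "i \<in> nodes M" "p \<in> lists (nodes M)" "q \<in> lists (nodes M)" "artin_word M p = artin_word M q"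
  then show "artin_word M (i # p) = artin_word M (i # q)" using artin_word_cong[of "[i]" M "[i]" p q] by simp
next
  fix i j p assume "i \<in> nodes M" "j \<in> nodes M" "i \<noteq> j" "\<not> adj M i j" "p \<in> lists (nodes M)"
  then show "artin_word M (i # j # p) = artin_word M (j # i # p)" by (rule artin_word_commute)
next
  fix i j p assume "i \<in> nodes M" "j \<in> nodes M" "adj M i j" "p \<in> lists (nodes M)"
  then show "artin_word M (i # j # i # p) = artin_word M (j # i # j # p)" by (rule artin_word_braid)
qed

lemma desc_coxeter_word:
  assumes "desc p v" "desc q v"
  shows "coxeter_word M (rev p) = coxeter_word M (rev q)"
proof -
  note pq = desc_lists[OF assms(1)] desc_lists[OF assms(2)]
  have "coxeter_word M p = coxeter_word M q"
    using artin_word_eq_imp_coxeter[OF pq desc_artin_word[OF assms]] .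
  then show ?thesis using coxeter_word_inv[OF pq(1)] coxeter_word_inv[OF pq(2)] by simp
qed

text \<open>A reflection changes \<open>depth\<close> by at most one. A word of length
  \<open>depth v\<close> that reaches \<open>alpha0\<close> must therefore lower the depth at every
  letter; the reversal appears because the last letter acts first.\<close>

lemma shortest_word:
  assumes "p \<in> lists (nodes M)" "v \<in> Phi" "foldr refl p v = alpha0"
  shows "depth v \<le> length p \<and> (length p = depth v \<longrightarrow> desc (rev p) v)"
  using assms
proof (induction p arbitrary: v rule: rev_induct)
  case Nil then show ?case by (simp add: depth_alpha0)
next
  case (snoc k p)
  have k: "k \<in> nodes M" and p: "p \<in> lists (nodes M)" using snoc.prems by auto
  have IH: "depth (refl k v) \<le> length p \<and> (length p = depth (refl k v) \<longrightarrow> desc (rev p) (refl k v))"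
    using snoc k p by simp
  consider "ip k v > 0" | "ip k v = 0" | "ip k v < 0" by linarith
  then show ?case
  proof cases
    case 1 then show ?thesis using IH depth_reflect[OF k snoc.prems(2)] by simp
  next
    case 2 then show ?thesis using IH by (simp add: reflect_eq_self)
  next
    case 3 then show ?thesis using IH depth_reflect_neg[OF k snoc.prems(2)] k by simp
  qed
qed

section \<open>Agreement with the orbit definitions of roots, highest root and
  \<open>d_elt\<close>\<close>

lemma roots_eq: "roots M = Phi"
proof
  show "roots M \<subseteq> Phi"
  proof
    fix v assume "v \<in> roots M"
    then obtain w i where wi: "v = cox_act M w (simple_root i)" "w \<in> carrier (coxeter M)" "i \<in> nodes M"
      by (auto simp: roots_def)
    obtain p where p: "expresses M p w" using expresses_exists[OF wi(2)] .
    then show "v \<in> Phi" using wi by (simp add: cox_act_eq foldr_refl_Phi expresses_def)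
  qed
  show "Phi \<subseteq> roots M"
  proof
    fix v assume v: "v \<in> Phi"
    obtain i where i: "i \<in> nodes M" using nodes_nonempty by blast
    obtain p where p: "desc p v" using desc_exists[OF v] .
    obtain q where q: "desc q (simple_root i)" using desc_exists[of "simple_root i"] i by auto
    have pq: "p @ rev q \<in> lists (nodes M)" using desc_lists[OF p] desc_lists[OF q] by (auto simp: in_lists_conv_set)
    have "foldr refl (rev q) (simple_root i) = alpha0"
      using foldr_refl_rev[OF desc_lists[OF q], of alpha0] desc_act[OF q] by simp
    then have "cox_act M (coxeter_word M (p @ rev q)) (simple_root i) = v"
      using cox_act_eq[of M "p @ rev q"] pq desc_act[OF p] by (simp add: expresses_def)
    then show "v \<in> roots M" unfolding roots_def using pq i by (auto intro!: exI)
  qed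
qed

lemma pos_roots_eq: "pos_roots M = Phi_pos"
  by (simp add: pos_roots_def Phi_pos_def roots_eq)

text \<open>Each ascent on the way to \<open>alpha0\<close> raises one coordinate and leaves the
  others unchanged.\<close>

lemma le_alpha0:
  assumes "v \<in> Phi_pos"
  shows "v j \<le> alpha0 j"
  using assms
proof (induction "depth v" arbitrary: v)
  case 0
  then show ?case using depth_eq_0 Phi_pos_Phi by fastforce
next
  case (Suc n)
  have v: "v \<in> Phi" using Suc Phi_pos_Phi by blast
  have "v \<noteq> alpha0" using Suc depth_alpha0 by auto
  then obtain i where i: "i \<in> nodes M" "ip i v < 0" using ascent_exists v by blast
  then have "v \<noteq> simple_root i" by (auto simp: inner_form_simple_simple)
  then have "refl i v \<in> Phi_pos" using reflect_Phi_pos i Suc.prems by blast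
  then have "refl i v j \<le> alpha0 j" using Suc.hyps depth_reflect_neg[OF i(1) v i(2)] by simp
  moreover have "v j \<le> refl i v j" using i by (simp add: reflect_apply simple_root_def)
  ultimately show ?case by simp
qed

lemma highest_root_eq: "highest_root M = alpha0"
  unfolding highest_root_def pos_roots_eq
proof (rule the_equality)
  fix \<gamma> assume \<gamma>: "\<gamma> \<in> Phi_pos \<and> (\<forall>\<beta>\<in>Phi_pos. \<forall>j. \<beta> j \<le> \<gamma> j)"
  show "\<gamma> = alpha0"
  proof
    fix j show "\<gamma> j = alpha0 j" using \<gamma> le_alpha0[of \<gamma> j] alpha0(1) by (simp add: order.antisym)
  qed
qed (use alpha0(1) le_alpha0 in auto)

lemma C_nodes_eq: "C_nodes M = {j \<in> nodes M. ip j alpha0 = 0}"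
  by (simp add: C_nodes_def highest_root_eq)

text \<open>By \<open>shortest_word\<close> no element sending \<open>v\<close> to
  \<open>alpha0\<close> is shorter than \<open>depth v\<close>, and a reduced expression of one
  attaining this length is, read backwards, a descending word; confluence makes the element
  unique.\<close>

lemma w_to_highest_eq:
  assumes p: "desc p v"
  shows "w_to_highest M v = coxeter_word M (rev p)"
  unfolding w_to_highest_def highest_root_eq
proof (rule the_equality)
  have v: "v \<in> Phi" using desc_Phi[OF p] .
  have rp: "rev p \<in> lists (nodes M)" using desc_lists[OF p] by (simp add: in_lists_conv_set)
  let ?w = "coxeter_word M (rev p)"
  have ex: "expresses M (rev p) ?w" using rp by (simp add: expresses_def)
  have act: "cox_act M ?w v = alpha0"
    using cox_act_eq[OF ex] foldr_refl_rev[OF desc_lists[OF p], of alpha0] desc_act[OF p] by simp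
  have len: "cox_length M ?w \<le> depth v" using cox_length_le[OF ex] desc_length[OF p] by simp
  have ge: "\<exists>q. reduced_expr M q u \<and> depth v \<le> length q \<and> (length q = depth v \<longrightarrow> desc (rev q) v)"
    if u: "u \<in> carrier (coxeter M)" "cox_act M u v = alpha0" for u
  proof -
    obtain q where q: "reduced_expr M q u" using cox_length_attained[OF u(1)] .
    then have "expresses M q u" by (simp add: reduced_expr_def)
    then have "q \<in> lists (nodes M)" "foldr refl q v = alpha0" using cox_act_eq[of M q u v] u by (simp_all add: expresses_def)
    then show ?thesis using shortest_word[of q v] v q by blast
  qed
  show "?w \<in> carrier (coxeter M) \<and> cox_act M ?w v = alpha0 \<and>
      (\<forall>u\<in>carrier (coxeter M). cox_act M u v = alpha0 \<longrightarrow> cox_length M ?w \<le> cox_length M u)"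
  proof (intro conjI ballI impI)
    fix u assume "u \<in> carrier (coxeter M)" "cox_act M u v = alpha0"
    from ge[OF this] show "cox_length M ?w \<le> cox_length M u" using len by (auto simp: reduced_expr_def)
  qed (use rp act in auto)
  fix w assume w: "w \<in> carrier (coxeter M) \<and> cox_act M w v = alpha0 \<and>
      (\<forall>u\<in>carrier (coxeter M). cox_act M u v = alpha0 \<longrightarrow> cox_length M w \<le> cox_length M u)"
  then obtain q where q: "reduced_expr M q w" "depth v \<le> length q" "length q = depth v \<longrightarrow> desc (rev q) v"
    using ge by blast
  have "cox_length M w \<le> cox_length M ?w" using w act rp by simp
  then have "desc (rev q) v" using q len by (auto simp: reduced_expr_def)
  from desc_coxeter_word[OF this p] show "w = ?w" using q(1) by (simp add: reduced_expr_def expresses_def)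
qed

text \<open>Matsumoto's theorem is bypassed: whichever reduced expression \<open>psi\<close>
  selects, its length and its action force it to satisfy \<open>desc\<close> for \<open>v\<close>,
  and such words agree in the Artin group by confluence.\<close>

lemma d_elt_eq:
  assumes p: "desc p v"
  shows "d_elt M v = artin_word M p"
proof -
  have v: "v \<in> Phi" using desc_Phi[OF p] .
  note pl = desc_lists[OF p]
  have rp: "rev p \<in> lists (nodes M)" using pl by (simp add: in_lists_conv_set)
  have inv: "inv\<^bsub>coxeter M\<^esub> (w_to_highest M v) = coxeter_word M p"
    using w_to_highest_eq[OF p] coxeter_word_inv[OF rp] by simp
  define q where "q = (SOME q. reduced_expr M q (coxeter_word M p))"
  have "\<exists>q. reduced_expr M q (coxeter_word M p)" using cox_length_attained[of "coxeter_word M p" M] pl by auto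
  then have q: "reduced_expr M q (coxeter_word M p)" unfolding q_def by (rule someI_ex)
  have ql: "q \<in> lists (nodes M)" and qp: "coxeter_word M q = coxeter_word M p" using q by (auto simp: reduced_expr_def expresses_def)
  have "length q \<le> length p"
    using q cox_length_le[of M p "coxeter_word M p"] pl by (simp add: reduced_expr_def expresses_def)
  moreover have "foldr refl (rev q) v = alpha0"
    using coxeter_word_act[OF ql pl qp] desc_act[OF p] foldr_refl_rev[OF ql, of alpha0] by simp
  moreover have "rev q \<in> lists (nodes M)" using ql by (simp add: in_lists_conv_set)
  ultimately have "desc q v" using shortest_word[of "rev q" v] v desc_length[OF p] by simp
  then show ?thesis unfolding d_elt_def inv psi_def q_def[symmetric] by (rule desc_artin_word[OF _ p])
qed

text \<open>\<open>s\<^sub>i d\<^sub>v = d\<^sub>v s\<^sub>j\<close> in the Artin group.\<close>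

definition conj_rel :: "root \<Rightarrow> nat \<Rightarrow> nat \<Rightarrow> bool" where
  "conj_rel v i j \<longleftrightarrow> j \<in> C_nodes M \<and> (\<exists>p. desc p v \<and> artin_word M (i # p) = artin_word M (p @ [j]))"

lemma C_nodes_nodes: "j \<in> C_nodes M \<Longrightarrow> j \<in> nodes M"
  by (simp add: C_nodes_eq)

lemma conj_relD:
  assumes "conj_rel v i j" "desc p v" "i \<in> nodes M"
  shows "artin_word M (i # p) = artin_word M (p @ [j])"
proof -
  obtain q where q: "j \<in> C_nodes M" "desc q v" "artin_word M (i # q) = artin_word M (q @ [j])"
    using assms(1) by (auto simp: conj_rel_def)
  note j = C_nodes_nodes[OF q(1)]
  have pq: "artin_word M p = artin_word M q" using desc_artin_word assms q by blast
  have "artin_word M ([i] @ p) = artin_word M ([i] @ q)"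
    by (rule artin_word_cong) (use pq assms q desc_lists in auto)
  also have "\<dots> = artin_word M (q @ [j])" using q by simp
  also have "\<dots> = artin_word M (p @ [j])"
    by (rule artin_word_cong) (use pq assms q j desc_lists in auto)
  finally show ?thesis by simp
qed

lemma conj_rel_step_commute:
  assumes "conj_rel (refl k v) i j" "i \<in> nodes M" "k \<in> nodes M" "i \<noteq> k" "\<not> adj M i k" "ip k v < 0"
  shows "conj_rel v i j"
proof -
  obtain q where q: "j \<in> C_nodes M" "desc q (refl k v)" "artin_word M (i # q) = artin_word M (q @ [j])"
    using assms(1) by (auto simp: conj_rel_def)
  note j = C_nodes_nodes[OF q(1)] and ql = desc_lists[OF q(2)]
  have "artin_word M (i # k # q) = artin_word M (k # i # q)"
    using assms ql by (intro artin_word_commute)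
  also have "\<dots> = artin_word M ([k] @ (i # q))" by simp
  also have "\<dots> = artin_word M ([k] @ (q @ [j]))"
    by (rule artin_word_cong) (use assms q j ql in auto)
  finally show ?thesis unfolding conj_rel_def using q assms by (intro conjI exI[of _ "k # q"]) auto
qed

text \<open>With \<open>w = refl i (refl k v)\<close> one has
  \<open>d\<^sub>v = s\<^sub>k s\<^sub>i d\<^sub>w\<close>, and \<open>s\<^sub>i s\<^sub>k s\<^sub>i
  d\<^sub>w = s\<^sub>k s\<^sub>i s\<^sub>k d\<^sub>w = s\<^sub>k s\<^sub>i d\<^sub>w
  s\<^sub>j\<close>. The node changes from \<open>i\<close> to \<open>k\<close> on the way
  up.\<close>

lemma conj_rel_step_braid:
  assumes "conj_rel (refl i (refl k v)) k j" "i \<in> nodes M" "k \<in> nodes M" "adj M i k" "ip i v = 0" "ip k v < 0"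
  shows "conj_rel v i j"
proof -
  obtain q where q: "j \<in> C_nodes M" "desc q (refl i (refl k v))" "artin_word M (k # q) = artin_word M (q @ [j])"
    using assms(1) by (auto simp: conj_rel_def)
  note j = C_nodes_nodes[OF q(1)] and ql = desc_lists[OF q(2)]
  have "i \<noteq> k" "adj M k i" using assms adj_irrefl adj_sym by auto
  then have d: "desc (k # i # q) v" using q assms by (simp add: inner_form_simple_reflect cartan_def)
  have "artin_word M (i # k # i # q) = artin_word M (k # i # k # q)"
    using assms ql by (intro artin_word_braid)
  also have "\<dots> = artin_word M ([k, i] @ (k # q))" by simp
  also have "\<dots> = artin_word M ([k, i] @ (q @ [j]))"
    by (rule artin_word_cong) (use assms q j ql in auto)
  finally show ?thesis unfolding conj_rel_def using q d by (intro conjI exI[of _ "k # i # q"]) auto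
qed

text \<open>At \<open>alpha0\<close> the node lies in \<open>C_nodes M\<close> and conjugation is
  trivial. Elsewhere take an ascent \<open>k\<close>: one step suffices if it commutes with
  \<open>i\<close>, whereas for adjacent nodes two ascents have to be taken before the induction
  hypothesis applies, to the node \<open>k\<close>.\<close>

lemma conj_rel_exists:
  assumes "v \<in> Phi" "i \<in> nodes M" "ip i v = 0"
  shows "\<exists>j. conj_rel v i j"
  using assms
proof (induction "depth v" arbitrary: v i rule: less_induct)
  case less
  show ?case
  proof (cases "v = alpha0")
    case True
    then have "conj_rel v i i" using less.prems by (auto simp: conj_rel_def C_nodes_eq intro!: exI[of _ "[]"])
    then show ?thesis ..
  next
    case False
    then obtain k where k: "k \<in> nodes M" "ip k v < 0" using ascent_exists less.prems by blast
    then have ne: "i \<noteq> k" using less.prems by auto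
    have d: "depth (refl k v) < depth v" using depth_reflect_neg[OF k(1) less.prems(1) k(2)] by simp
    show ?thesis
    proof (cases "adj M i k")
      case False
      then have "ip i (refl k v) = 0" using ne k less.prems by (simp add: inner_form_simple_reflect cartan_def)
      then obtain j where "conj_rel (refl k v) i j" using less.hyps[OF d] k less.prems by auto
      then show ?thesis using conj_rel_step_commute less.prems k ne False by blast
    next
      case True
      then have a: "adj M k i" by (simp add: adj_sym)
      have u: "ip i (refl k v) < 0" "ip k (refl i (refl k v)) = 0"
        using ne k less.prems True a by (simp_all add: inner_form_simple_reflect cartan_def)
      have uP: "refl k v \<in> Phi" using k less.prems by simp
      have "depth (refl i (refl k v)) < depth v"
        using depth_reflect_neg[OF less.prems(2) uP u(1)] d by simp
      from less.hyps[OF this _ k(1) u(2)] obtain j where "conj_rel (refl i (refl k v)) k j"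
        using uP less.prems by auto
      then show ?thesis using conj_rel_step_braid less.prems k True by blast
    qed
  qed
qed

lemma reflect_inj:
  assumes "refl j = refl j'" "j \<in> nodes M" "j' \<in> nodes M"
  shows "j = j'"
proof (rule ccontr)
  assume "j \<noteq> j'"
  have "refl j (simple_root j) j = refl j' (simple_root j) j" using assms by simp
  then show False using \<open>j \<noteq> j'\<close> assms(2,3) by (simp add: reflect_apply inner_form_simple_simple simple_root_other)
qed

lemma conj_rel_act:
  assumes "conj_rel v i j" "desc p v" "i \<in> nodes M"
  shows "refl i (foldr refl p x) = foldr refl p (refl j x)"
proof -
  have "j \<in> nodes M" using assms by (simp add: conj_rel_def C_nodes_eq)
  then have "foldr refl (i # p) = foldr refl (p @ [j])"
    using assms desc_lists[OF assms(2)] by (intro artin_word_act conj_relD) auto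
  then show ?thesis by (metis comp_apply foldr.simps(1,2) foldr_append id_apply)
qed

text \<open>Uniqueness is seen in the reflection representation: the word of a descending path acts
  invertibly, so \<open>j\<close> and \<open>j'\<close> give the same reflection, and distinct nodes
  have distinct reflections.\<close>

lemma conj_rel_unique:
  assumes "conj_rel v i j" "conj_rel v i j'" "i \<in> nodes M"
  shows "j = j'"
proof -
  obtain p where p: "desc p v" using assms by (auto simp: conj_rel_def)
  have "refl j = refl j'"
  proof
    fix x
    have "foldr refl p (refl j x) = foldr refl p (refl j' x)"
      using conj_rel_act[OF assms(1) p assms(3)] conj_rel_act[OF assms(2) p assms(3)] by metis
    then show "refl j x = refl j' x" using foldr_refl_rev[OF desc_lists[OF p]] by metis
  qed
  then show ?thesis using assms by (intro reflect_inj) (auto simp: conj_rel_def C_nodes_eq)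
qed

text \<open>The index of the generator \<open>h\<close> attached to \<open>v\<close> and
  \<open>i\<close>, taken for negative roots as well.\<close>

definition hidx :: "root \<Rightarrow> nat \<Rightarrow> nat" where
  "hidx v i = (THE j. conj_rel v i j)"

lemma hidx_eqI: "conj_rel v i j \<Longrightarrow> i \<in> nodes M \<Longrightarrow> hidx v i = j"
  unfolding hidx_def by (rule the_equality) (auto intro: conj_rel_unique)

lemma hidx:
  assumes "v \<in> Phi" "i \<in> nodes M" "ip i v = 0"
  shows "conj_rel v i (hidx v i)"
  using conj_rel_exists[OF assms] hidx_eqI assms(2) by blast

lemma hidx_C: "v \<in> Phi \<Longrightarrow> i \<in> nodes M \<Longrightarrow> ip i v = 0 \<Longrightarrow> hidx v i \<in> C_nodes M"
  using hidx by (auto simp: conj_rel_def)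

lemma hidx_reflect_commute:
  assumes "v \<in> Phi" "i \<in> nodes M" "ip i v = 0" "k \<in> nodes M" "i \<noteq> k" "\<not> adj M i k"
  shows "hidx (refl k v) i = hidx v i"
proof -
  have z: "ip i (refl k v) = 0" using assms by (simp add: inner_form_simple_reflect cartan_def)
  consider "ip k v < 0" | "ip k v = 0" | "ip k v > 0" by linarith
  then show ?thesis
  proof cases
    case 1
    have "conj_rel (refl k v) i (hidx (refl k v) i)" using assms z by (intro hidx) auto
    from conj_rel_step_commute[OF this assms(2,4,5,6) 1] show ?thesis using hidx_eqI assms by metis
  next
    case 2 then show ?thesis by (simp add: reflect_eq_self)
  next
    case 3
    then have neg: "ip k (refl k v) < 0" using assms by (simp add: inner_form_simple_reflect_self)
    have "conj_rel (refl k (refl k v)) i (hidx v i)" using hidx[OF assms(1-3)] assms by simp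
    from conj_rel_step_commute[OF this assms(2,4,5,6) neg] show ?thesis using hidx_eqI assms by metis
  qed
qed

text \<open>Whichever of the two roots is deeper, \<open>conj_rel_step_braid\<close> applies to it,
  with \<open>i\<close> and \<open>k\<close> exchanged in the second case. Together with
  \<open>hidx_reflect_commute\<close> this is the invariance that the braid relations of
  \<open>S\<close> rest on.\<close>

lemma hidx_reflect_adj:
  assumes "v \<in> Phi" "i \<in> nodes M" "ip i v = 0" "k \<in> nodes M" "adj M i k" "ip k v \<noteq> 0"
  shows "hidx (refl i (refl k v)) k = hidx v i"
proof -
  have ne: "i \<noteq> k" "adj M k i" using assms adj_irrefl adj_sym by auto
  have z: "ip k (refl i (refl k v)) = 0"
    using assms ne by (simp add: inner_form_simple_reflect cartan_def)
  consider "ip k v < 0" | "ip k v = 0" | "ip k v > 0" by linarith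
  then show ?thesis
  proof cases
    case 1
    have "conj_rel (refl i (refl k v)) k (hidx (refl i (refl k v)) k)" using assms z by (intro hidx) auto
    from conj_rel_step_braid[OF this assms(2,4,5,3) 1] show ?thesis using hidx_eqI assms by metis
  next
    case 2 then show ?thesis using assms by simp
  next
    case 3
    let ?w = "refl i (refl k v)"
    have neg: "ip i ?w < 0" using assms ne 3 by (simp add: inner_form_simple_reflect cartan_def)
    have "conj_rel (refl k (refl i ?w)) i (hidx v i)" using hidx[OF assms(1-3)] assms by simp
    from conj_rel_step_braid[OF this assms(4,2) ne(2) z neg] show ?thesis using hidx_eqI assms by metis
  qed
qed

text \<open>Conjugation turns the reflection in the simple root of \<open>hidx v i\<close> into the
  reflection in that of \<open>i\<close>. So the image \<open>?u\<close> is negated by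
  \<open>refl i\<close>, hence proportional to the simple root, and both have norm 2; the sign is
  left open.\<close>

lemma hidx_act:
  assumes "v \<in> Phi" "i \<in> nodes M" "ip i v = 0" "desc p v"
  shows "foldr refl p (simple_root (hidx v i)) \<in> {simple_root i, - simple_root i}"
proof -
  note c = hidx[OF assms(1-3)]
  have j: "hidx v i \<in> nodes M" using hidx_C[OF assms(1-3)] by (rule C_nodes_nodes)
  let ?u = "foldr refl p (simple_root (hidx v i))"
  have u: "?u \<in> Phi" using j desc_lists[OF assms(4)] by (intro foldr_refl_Phi) auto
  have neg: "refl i ?u = - ?u"
    using conj_rel_act[OF c assms(4,2), of "simple_root (hidx v i)"] j
    by (simp add: reflect_simple foldr_refl_minus)
  \<comment> \<open>The equation \<open>refl i ?u = - ?u\<close> read coordinatewise: twice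
    \<open>?u\<close> is \<open>ip i ?u\<close> times the simple root.\<close>
  have eq: "ip i ?u * simple_root i m = 2 * ?u m" for m
    using fun_cong[OF neg, of m] by (simp add: reflect_apply)
  have "2 * inner_form M ?u ?u = ip i ?u * ip i ?u"
  proof -
    have "2 * inner_form M ?u ?u = inner_form M ?u (\<lambda>m. 2 * ?u m)" by (rule inner_form_scale_right[symmetric])
    also have "\<dots> = inner_form M ?u (\<lambda>m. ip i ?u * simple_root i m)" by (simp only: eq)
    also have "\<dots> = ip i ?u * inner_form M ?u (simple_root i)" by (rule inner_form_scale_right)
    also have "inner_form M ?u (simple_root i) = ip i ?u" by (rule inner_form_sym)
    finally show ?thesis .
  qed
  then have "ip i ?u * ip i ?u = 4" using Phi_norm[OF u] by simp
  then have "ip i ?u = 2 \<or> ip i ?u = - 2" using ip_values[OF assms(2) u] by auto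
  then show ?thesis using ip_eq_2[OF assms(2) u] ip_eq_minus_2[OF assms(2) u] by auto
qed

lemma hidx_cartan:
  assumes "v \<in> Phi" "i \<in> nodes M" "ip i v = 0" "k \<in> nodes M" "ip k v = 0"
  shows "cartan M (hidx v i) (hidx v k) \<in> {cartan M i k, - cartan M i k}"
proof -
  obtain p where p: "desc p v" using desc_exists[OF assms(1)] .
  have j: "hidx v i \<in> nodes M" "hidx v k \<in> nodes M" using hidx_C assms C_nodes_nodes by auto
  have "cartan M (hidx v i) (hidx v k) =
      inner_form M (foldr refl p (simple_root (hidx v i))) (foldr refl p (simple_root (hidx v k)))"
    using j desc_lists[OF p] by (simp add: foldr_refl_inner inner_form_simple_simple)
  also have "\<dots> \<in> {cartan M i k, - cartan M i k}"
    using hidx_act[OF assms(1-3) p] hidx_act[OF assms(1,4,5) p] assms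
    by (auto simp: inner_form_linear inner_form_simple_simple)
  finally show ?thesis .
qed

text \<open>The sign ambiguity in \<open>hidx_cartan\<close> is harmless: for distinct
  \<open>i\<close> and \<open>k\<close> the entry is 0 or -1, and 1 is not a Cartan entry.\<close>

lemma hidx_adj:
  assumes "v \<in> Phi" "i \<in> nodes M" "ip i v = 0" "k \<in> nodes M" "ip k v = 0" "i \<noteq> k"
  shows "adj M (hidx v i) (hidx v k) \<longleftrightarrow> adj M i k"
  using hidx_cartan[OF assms(1-5)] assms(6) by (auto simp: cartan_def split: if_splits)

lemma descent_exists:
  assumes "v \<in> Phi_pos" "\<And>k. k \<in> nodes M \<Longrightarrow> v \<noteq> simple_root k"
  obtains k where "k \<in> nodes M" "ip k v = 1"
proof -
  have "inner_form M v v = (\<Sum>i\<in>nodes M. v i * ip i v)" by (rule inner_form_expand)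
  then have "(\<Sum>i\<in>nodes M. v i * ip i v) > 0" using Phi_norm[OF Phi_pos_Phi[OF assms(1)]] by linarith
  then have "\<not> (\<forall>k\<in>nodes M. v k * ip k v \<le> 0)" by (meson linorder_not_le sum_nonpos)
  then obtain k where k: "k \<in> nodes M" "v k * ip k v > 0" by (auto simp: not_le)
  moreover have "v k \<ge> 0" using assms by (simp add: Phi_pos_def)
  ultimately have "ip k v > 0" by (simp add: zero_less_mult_iff)
  moreover have "ip k v \<noteq> 2" using ip_eq_2[OF k(1) Phi_pos_Phi[OF assms(1)]] assms(2)[OF k(1)] by blast
  ultimately have "ip k v = 1" using ip_values[OF k(1) Phi_pos_Phi[OF assms(1)]] by auto
  then show ?thesis using that k by blast
qed

text \<open>Reflections commute with negation, so the two invariance lemmas move \<open>v\<close>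
  and \<open>- v\<close> in parallel down to a simple root, whose negative is its own reflection.
  The result reconciles \<open>h\<close> at \<open>- \<beta>\<close>, which arises from
  \<open>X (- \<beta>)\<close>, with \<open>h\<close> at \<beta>, which occurs in
  \<open>tau\<close>.\<close>

lemma hidx_minus_pos:
  assumes "v \<in> Phi_pos" "i \<in> nodes M" "ip i v = 0"
  shows "hidx (- v) i = hidx v i"
  using assms
proof (induction "nat (height v)" arbitrary: v i rule: less_induct)
  case less
  have v: "v \<in> Phi" using less.prems Phi_pos_Phi by blast
  have mv: "- v \<in> Phi" "ip i (- v) = 0" using v less.prems by (auto simp: inner_form_linear)
  show ?case
  proof (cases "\<exists>k\<in>nodes M. v = simple_root k")
    case True
    then obtain k where k: "k \<in> nodes M" "v = simple_root k" by blast
    then have "i \<noteq> k" "\<not> adj M i k" using less.prems by (auto simp: inner_form_simple_simple cartan_def split: if_splits)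
    then show ?thesis using hidx_reflect_commute[OF v less.prems(2,3) k(1)] k by (simp add: reflect_simple)
  next
    case False
    then obtain k where k: "k \<in> nodes M" "ip k v = 1" using descent_exists[OF less.prems(1)] by blast
    have ne: "i \<noteq> k" using k less.prems by auto
    have pos: "refl k v \<in> Phi_pos" using reflect_Phi_pos[OF k(1) less.prems(1)] False k by blast
    have lt: "nat (height (refl k v)) < nat (height v)"
      using height_reflect[OF k(1), of v] k height_pos[OF less.prems(1)] by simp
    show ?thesis
    proof (cases "adj M i k")
      case False
      have z: "ip i (refl k v) = 0" using False ne k less.prems by (simp add: inner_form_simple_reflect cartan_def)
      have "hidx (- v) i = hidx (- refl k v) i"
        using hidx_reflect_commute[OF mv(1) less.prems(2) mv(2) k(1) ne False] by (simp add: reflect_minus)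
      also have "\<dots> = hidx (refl k v) i" by (rule less.hyps[OF lt pos less.prems(2) z])
      also have "\<dots> = hidx v i" by (rule hidx_reflect_commute[OF v less.prems(2,3) k(1) ne False])
      finally show ?thesis .
    next
      case True
      have a: "adj M k i" using True by (simp add: adj_sym)
      have one: "ip i (refl k v) = 1" using True ne k less.prems by (simp add: inner_form_simple_reflect cartan_def)
      have "refl k v \<noteq> simple_root i" using one less.prems by (auto simp: inner_form_simple_simple)
      then have pos2: "refl i (refl k v) \<in> Phi_pos" using reflect_Phi_pos[OF less.prems(2) pos] by blast
      have lt2: "nat (height (refl i (refl k v))) < nat (height v)"
        using height_reflect[OF less.prems(2), of "refl k v"] one lt height_pos[OF pos2] by simp
      have z: "ip k (refl i (refl k v)) = 0"
        using True a ne k less.prems by (simp add: inner_form_simple_reflect cartan_def)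
      have "hidx (- v) i = hidx (refl i (refl k (- v))) k"
        using k by (intro hidx_reflect_adj[symmetric] mv less.prems True) (auto simp: inner_form_linear)
      also have "\<dots> = hidx (- refl i (refl k v)) k" by (simp only: reflect_minus)
      also have "\<dots> = hidx (refl i (refl k v)) k" by (rule less.hyps[OF lt2 pos2 k(1) z])
      also have "\<dots> = hidx v i" using k by (intro hidx_reflect_adj v less.prems True) auto
      finally show ?thesis .
    qed
  qed
qed

lemma hidx_minus:
  assumes "v \<in> Phi" "i \<in> nodes M" "ip i v = 0"
  shows "hidx (- v) i = hidx v i"
  using Phi_pos_or_neg[OF assms(1)] hidx_minus_pos[of v i] hidx_minus_pos[of "- v" i] assms
  by (auto simp: inner_form_linear)

lemma h_elt_eq:
  assumes "v \<in> Phi" "i \<in> nodes M" "ip i v = 0"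
  shows "h_elt M v i = hecke_gen Q_m M (C_nodes M) (hidx v i)"
proof -
  interpret A: group "artin M" by (rule group_artin)
  obtain p where p: "desc p v" using desc_exists[OF assms(1)] .
  note pl = desc_lists[OF p] and d = d_elt_eq[OF p]
  have iff: "inv\<^bsub>artin M\<^esub> (d_elt M v) \<otimes>\<^bsub>artin M\<^esub> artin_gen M i \<otimes>\<^bsub>artin M\<^esub> d_elt M v = artin_gen M j
      \<longleftrightarrow> artin_word M (i # p) = artin_word M (p @ [j])" if j: "j \<in> nodes M" for j
  proof -
    have c: "artin_word M p \<in> carrier (artin M)" "artin_gen M i \<in> carrier (artin M)" "artin_gen M j \<in> carrier (artin M)"
      using pl assms j by auto
    have "inv\<^bsub>artin M\<^esub> (d_elt M v) \<otimes>\<^bsub>artin M\<^esub> artin_gen M i \<otimes>\<^bsub>artin M\<^esub> d_elt M v =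
        inv\<^bsub>artin M\<^esub> (artin_word M p) \<otimes>\<^bsub>artin M\<^esub> (artin_gen M i \<otimes>\<^bsub>artin M\<^esub> artin_word M p)"
      using c by (simp add: d A.m_assoc)
    also have "\<dots> = artin_gen M j \<longleftrightarrow> artin_gen M i \<otimes>\<^bsub>artin M\<^esub> artin_word M p = artin_word M p \<otimes>\<^bsub>artin M\<^esub> artin_gen M j"
      using c A.inv_solve_left' by (metis A.inv_closed A.inv_solve_left A.m_closed)
    also have "\<dots> \<longleftrightarrow> artin_word M (i # p) = artin_word M (p @ [j])"
      using artin_word_mult[of "[i]" M p] artin_word_mult[of p M "[j]"] pl assms j by simp
    finally show ?thesis .
  qed
  have "(THE j. j \<in> C_nodes M \<and>
      inv\<^bsub>artin M\<^esub> (d_elt M v) \<otimes>\<^bsub>artin M\<^esub> artin_gen M i \<otimes>\<^bsub>artin M\<^esub> d_elt M v = artin_gen M j) = hidx v i"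
  proof (rule the_equality)
    show "hidx v i \<in> C_nodes M \<and>
      inv\<^bsub>artin M\<^esub> (d_elt M v) \<otimes>\<^bsub>artin M\<^esub> artin_gen M i \<otimes>\<^bsub>artin M\<^esub> d_elt M v = artin_gen M (hidx v i)"
      using hidx_C[OF assms] iff[of "hidx v i"] C_nodes_nodes conj_relD[OF hidx[OF assms] p assms(2)] by blast
    fix j assume j: "j \<in> C_nodes M \<and>
      inv\<^bsub>artin M\<^esub> (d_elt M v) \<otimes>\<^bsub>artin M\<^esub> artin_gen M i \<otimes>\<^bsub>artin M\<^esub> d_elt M v = artin_gen M j"
    then have "conj_rel v i j" unfolding conj_rel_def using iff[of j] C_nodes_nodes p by blast
    then show "j = hidx v i" using hidx_eqI assms by simp
  qed
  then show ?thesis by (simp add: h_elt_def)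
qed

end

subsection \<open>The Hecke module on all roots\<close>

text \<open>The coefficients \<open>T\<^sub>i\<^sub>,\<^sub>\<beta>\<close> must lie in \<open>Z\<^sub>0\<^sup>(\<^sup>1\<^sup>)\<close> whereas the representation lives over \<open>Z\<^sub>0\<^sup>(\<^sup>0\<^sup>)\<close>, so the
  locale is interpreted for both rings.\<close>

locale hecke_coeffs = simply_laced M + ring Z for M :: diagram and Z :: "('z, 'c) ring_scheme" (structure) +
  fixes m :: 'z and z :: "nat \<Rightarrow> 'z"
  assumes m_closed' [simp]: "m \<in> carrier Z"
    and m_central: "\<And>x. x \<in> carrier Z \<Longrightarrow> x \<otimes> m = m \<otimes> x"
    and z_closed [simp]: "\<And>j. j \<in> C_nodes M \<Longrightarrow> z j \<in> carrier Z"
    and z_commute: "\<And>i j. \<lbrakk>i \<in> C_nodes M; j \<in> C_nodes M; \<not> adj M i j\<rbrakk> \<Longrightarrow> z i \<otimes> z j = z j \<otimes> z i"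
    and z_braid: "\<And>i j. \<lbrakk>i \<in> C_nodes M; j \<in> C_nodes M; adj M i j\<rbrakk> \<Longrightarrow>
      z i \<otimes> z j \<otimes> z i = z j \<otimes> z i \<otimes> z j"
    and z_quadratic: "\<And>j. j \<in> C_nodes M \<Longrightarrow> z j \<otimes> z j = \<one> \<ominus> m \<otimes> z j"
begin

definition h :: "root \<Rightarrow> nat \<Rightarrow> 'z" where
  "h v i = z (hidx v i)"

text \<open>The formula for \<open>\<tau>\<^sub>i\<close> read as an action on coefficient functions, on all roots.\<close>

definition S :: "nat \<Rightarrow> (root \<Rightarrow> 'z) \<Rightarrow> root \<Rightarrow> 'z" where
  "S i v = (\<lambda>\<gamma>\<in>Phi.
     if ip i \<gamma> = 0 then h \<gamma> i \<otimes> v \<gamma>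
     else if ip i \<gamma> > 0 then v (refl i \<gamma>)
     else v (refl i \<gamma>) \<ominus> m \<otimes> v \<gamma>)"

abbreviation U :: "(root \<Rightarrow> 'z) set" where
  "U \<equiv> Phi \<rightarrow>\<^sub>E carrier Z"

lemma h_closed [simp]: "v \<in> Phi \<Longrightarrow> i \<in> nodes M \<Longrightarrow> ip i v = 0 \<Longrightarrow> h v i \<in> carrier Z"
  by (simp add: h_def hidx_C)

lemma U_closed [simp]: "v \<in> U \<Longrightarrow> \<gamma> \<in> Phi \<Longrightarrow> v \<gamma> \<in> carrier Z"
  by (auto dest: PiE_mem)

lemma S_closed [simp]: "i \<in> nodes M \<Longrightarrow> v \<in> U \<Longrightarrow> S i v \<in> U"
  by (auto simp: S_def)

lemma S_zero: "\<gamma> \<in> Phi \<Longrightarrow> ip i \<gamma> = 0 \<Longrightarrow> S i v \<gamma> = h \<gamma> i \<otimes> v \<gamma>"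
  and S_pos: "\<gamma> \<in> Phi \<Longrightarrow> ip i \<gamma> > 0 \<Longrightarrow> S i v \<gamma> = v (refl i \<gamma>)"
  and S_neg: "\<gamma> \<in> Phi \<Longrightarrow> ip i \<gamma> < 0 \<Longrightarrow> S i v \<gamma> = v (refl i \<gamma>) \<ominus> m \<otimes> v \<gamma>"
  by (simp_all add: S_def)

lemma U_eqI: "v \<in> U \<Longrightarrow> w \<in> U \<Longrightarrow> (\<And>\<gamma>. \<gamma> \<in> Phi \<Longrightarrow> v \<gamma> = w \<gamma>) \<Longrightarrow> v = w"
  by (rule PiE_ext)

lemma h_quadratic:
  assumes "v \<in> Phi" "i \<in> nodes M" "ip i v = 0" "x \<in> carrier Z"
  shows "h v i \<otimes> (h v i \<otimes> x) = x \<ominus> m \<otimes> (h v i \<otimes> x)"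
proof -
  have "h v i \<otimes> (h v i \<otimes> x) = (\<one> \<ominus> m \<otimes> h v i) \<otimes> x"
    using assms z_quadratic[OF hidx_C[OF assms(1-3)]] by (simp add: m_assoc[symmetric]) (simp add: h_def)
  also have "\<dots> = x \<ominus> m \<otimes> (h v i \<otimes> x)"
    using assms by (simp add: minus_eq l_distr l_minus m_assoc)
  finally show ?thesis .
qed

lemma m_left_commute: "x \<in> carrier Z \<Longrightarrow> y \<in> carrier Z \<Longrightarrow> x \<otimes> (m \<otimes> y) = m \<otimes> (x \<otimes> y)"
  by (simp add: m_assoc[symmetric] m_central)

lemma h_m: "v \<in> Phi \<Longrightarrow> i \<in> nodes M \<Longrightarrow> ip i v = 0 \<Longrightarrow> y \<in> carrier Z \<Longrightarrow> h v i \<otimes> (m \<otimes> y) = m \<otimes> (h v i \<otimes> y)"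
  by (rule m_left_commute) auto

lemma S_quadratic:
  assumes i: "i \<in> nodes M" and v: "v \<in> U" and \<gamma>: "\<gamma> \<in> Phi"
  shows "S i (S i v) \<gamma> = v \<gamma> \<ominus> m \<otimes> S i v \<gamma>"
proof -
  consider "ip i \<gamma> = 0" | "ip i \<gamma> > 0" | "ip i \<gamma> < 0" by linarith
  then show ?thesis
  proof cases
    case 1
    then show ?thesis using assms h_quadratic[OF \<gamma> i 1, of "v \<gamma>"] by (simp add: S_zero)
  next
    case 2
    then show ?thesis using assms by (simp add: S_pos S_neg inner_form_simple_reflect_self)
  next
    case 3
    then show ?thesis using assms by (simp add: S_pos S_neg inner_form_simple_reflect_self)
  qed
qed

lemma S_commute:
  assumes ij: "i \<in> nodes M" "j \<in> nodes M" "i \<noteq> j" "\<not> adj M i j" and v: "v \<in> U"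
  shows "S i (S j v) = S j (S i v)"
proof (rule U_eqI)
  fix \<gamma> assume \<gamma>: "\<gamma> \<in> Phi"
  have a: "\<not> adj M j i" using ij by (simp add: adj_sym)
  have ipij: "ip i (refl j \<gamma>) = ip i \<gamma>" "ip j (refl i \<gamma>) = ip j \<gamma>"
    using ij a by (simp_all add: inner_form_simple_reflect cartan_def)
  have hi: "h (refl j \<gamma>) i = h \<gamma> i" if "ip i \<gamma> = 0"
    using hidx_reflect_commute[OF \<gamma> ij(1) that ij(2,3,4)] by (simp add: h_def)
  have hj: "h (refl i \<gamma>) j = h \<gamma> j" if "ip j \<gamma> = 0"
    using hidx_reflect_commute[OF \<gamma> ij(2) that ij(1) ij(3)[symmetric] a] by (simp add: h_def)
  have rc: "refl i (refl j \<gamma>) = refl j (refl i \<gamma>)" using ij by (rule reflect_commute)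
  consider "ip i \<gamma> = 0" "ip j \<gamma> = 0" | "ip i \<gamma> = 0" "ip j \<gamma> > 0" | "ip i \<gamma> = 0" "ip j \<gamma> < 0"
    | "ip i \<gamma> > 0" "ip j \<gamma> = 0" | "ip i \<gamma> > 0" "ip j \<gamma> > 0" | "ip i \<gamma> > 0" "ip j \<gamma> < 0"
    | "ip i \<gamma> < 0" "ip j \<gamma> = 0" | "ip i \<gamma> < 0" "ip j \<gamma> > 0" | "ip i \<gamma> < 0" "ip j \<gamma> < 0"
    by (cases "ip i \<gamma>" "0 :: int" rule: linorder_cases; cases "ip j \<gamma>" "0 :: int" rule: linorder_cases;
        (rule that; assumption))
  then show "S i (S j v) \<gamma> = S j (S i v) \<gamma>"
  proof cases
    case 1
    have "\<not> adj M (hidx \<gamma> i) (hidx \<gamma> j)" using hidx_adj[OF \<gamma> ij(1) 1(1) ij(2) 1(2) ij(3)] ij by simp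
    then have "h \<gamma> i \<otimes> h \<gamma> j = h \<gamma> j \<otimes> h \<gamma> i"
      unfolding h_def using 1 ij \<gamma> by (intro z_commute hidx_C) auto
    then show ?thesis using 1 ij v \<gamma> by (simp add: S_zero m_assoc[symmetric])
  next
    case 2 then show ?thesis using ij v \<gamma> by (simp add: S_zero S_pos ipij hi)
  next
    case 3 then show ?thesis using ij v \<gamma> by (simp add: S_zero S_neg ipij hi minus_eq r_distr r_minus h_m)
  next
    case 4 then show ?thesis using ij v \<gamma> by (simp add: S_zero S_pos ipij hj)
  next
    case 5 then show ?thesis using ij v \<gamma> by (simp add: S_pos ipij rc)
  next
    case 6 then show ?thesis using ij v \<gamma> by (simp add: S_pos S_neg ipij rc)
  next
    case 7 then show ?thesis using ij v \<gamma> by (simp add: S_zero S_neg ipij hj minus_eq r_distr r_minus h_m)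
  next
    case 8 then show ?thesis using ij v \<gamma> by (simp add: S_pos S_neg ipij rc)
  next
    case 9 then show ?thesis using ij v \<gamma>
      by (simp add: S_neg ipij rc) (simp add: minus_eq r_distr r_minus minus_add a_ac)
  qed
qed (use ij v in auto)

text \<open>The branches taken depend only on the signs of \<open>?a\<close>, \<open>?b\<close> and
  \<open>?a + ?b\<close>, the inner products with the three positive roots of the rank two
  subsystem. If both \<open>?a\<close> and \<open>?b\<close> vanish, \<gamma> is fixed and the braid
  relation of the coefficient ring is used; if exactly one of the three vanishes,
  \<open>hidx_reflect_adj\<close> identifies the factors \<open>h\<close>; otherwise only
  reflections and \<open>m\<close> occur.\<close>

lemma S_braid:
  assumes ij: "i \<in> nodes M" "j \<in> nodes M" "adj M i j" and v: "v \<in> U"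
  shows "S i (S j (S i v)) = S j (S i (S j v))"
proof (rule U_eqI)
  fix \<gamma> assume \<gamma>: "\<gamma> \<in> Phi"
  have a: "adj M j i" "i \<noteq> j" using ij adj_irrefl by (auto simp: adj_sym)
  have ipr: "ip i (refl j \<delta>) = ip i \<delta> + ip j \<delta>" "ip j (refl i \<delta>) = ip j \<delta> + ip i \<delta>"
     "ip i (refl i \<delta>) = - ip i \<delta>" "ip j (refl j \<delta>) = - ip j \<delta>" for \<delta>
    using ij a by (simp_all add: inner_form_simple_reflect inner_form_simple_reflect_self cartan_def)
  have hi: "h (refl i (refl j \<delta>)) j = h \<delta> i" if "\<delta> \<in> Phi" "ip i \<delta> = 0" "ip j \<delta> \<noteq> 0" for \<delta>
    using hidx_reflect_adj[OF that(1) ij(1) that(2) ij(2,3) that(3)] by (simp add: h_def)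
  have hj: "h (refl j (refl i \<delta>)) i = h \<delta> j" if "\<delta> \<in> Phi" "ip j \<delta> = 0" "ip i \<delta> \<noteq> 0" for \<delta>
    using hidx_reflect_adj[OF that(1) ij(2) that(2) ij(1) a(1) that(3)] by (simp add: h_def)
  have rc: "refl i (refl j (refl i \<delta>)) = refl j (refl i (refl j \<delta>))" for \<delta> using ij by (rule reflect_braid)
  note simps = S_zero S_pos S_neg minus_eq r_distr r_minus h_m minus_add a_ac ipr rc
  let ?a = "ip i \<gamma>" and ?b = "ip j \<gamma>"
  consider "?a = 0" "?b = 0" | "?a = 0" "?b > 0" | "?a = 0" "?b < 0"
    | "?a > 0" "?b = 0" | "?a < 0" "?b = 0" | "?a > 0" "?b > 0" | "?a < 0" "?b < 0"
    | "?a > 0" "?b < 0" "?a + ?b > 0" | "?a > 0" "?b < 0" "?a + ?b = 0" | "?a > 0" "?b < 0" "?a + ?b < 0"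
    | "?a < 0" "?b > 0" "?a + ?b > 0" | "?a < 0" "?b > 0" "?a + ?b = 0" | "?a < 0" "?b > 0" "?a + ?b < 0"
    by (cases ?a "0 :: int" rule: linorder_cases; cases ?b "0 :: int" rule: linorder_cases;
        cases "?a + ?b" "0 :: int" rule: linorder_cases; (rule that; assumption))
  then show "S i (S j (S i v)) \<gamma> = S j (S i (S j v)) \<gamma>"
  proof cases
    case 1
    have "adj M (hidx \<gamma> i) (hidx \<gamma> j)" using hidx_adj[OF \<gamma> ij(1) 1(1) ij(2) 1(2) a(2)] ij by simp
    then have "h \<gamma> i \<otimes> h \<gamma> j \<otimes> h \<gamma> i = h \<gamma> j \<otimes> h \<gamma> i \<otimes> h \<gamma> j"
      unfolding h_def using 1 ij \<gamma> by (intro z_braid hidx_C) auto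
    then show ?thesis using 1 ij v \<gamma> by (simp add: S_zero m_assoc[symmetric])
  next
    case 2 then show ?thesis using ij v \<gamma> hi[OF \<gamma>] by (simp add: simps)
  next
    case 3 then show ?thesis using ij v \<gamma> hi[OF \<gamma>] h_quadratic[OF \<gamma> ij(1) 3(1), of "v \<gamma>"] by (simp add: simps)
  next
    case 4 then show ?thesis using ij v \<gamma> hj[OF \<gamma>] by (simp add: simps)
  next
    case 5 then show ?thesis using ij v \<gamma> hj[OF \<gamma>] h_quadratic[OF \<gamma> ij(2) 5(2), of "v \<gamma>"] by (simp add: simps)
  next
    case 9
    have "ip j (refl i \<gamma>) = 0" using 9 by (simp add: ipr)
    then have "h (refl j \<gamma>) i = h (refl i \<gamma>) j" using hj[of "refl i \<gamma>"] 9 ij \<gamma> by (simp add: ipr)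
    then show ?thesis using 9 ij v \<gamma> by (simp add: simps)
  next
    case 12
    have "ip i (refl j \<gamma>) = 0" using 12 by (simp add: ipr)
    then have "h (refl i \<gamma>) j = h (refl j \<gamma>) i" using hi[of "refl j \<gamma>"] 12 ij \<gamma> by (simp add: ipr)
    then show ?thesis using 12 ij v \<gamma> by (simp add: simps)
  qed (use ij v \<gamma> in \<open>simp_all add: simps\<close>)
qed (use ij v in auto)

text \<open>The quadratic relation makes the inverse of \<open>S i\<close> equal to
  \<open>S i\<close> plus \<open>m\<close>.\<close>

definition Sinv :: "nat \<Rightarrow> (root \<Rightarrow> 'z) \<Rightarrow> root \<Rightarrow> 'z" where
  "Sinv i v = (\<lambda>\<gamma>\<in>Phi. S i v \<gamma> \<oplus> m \<otimes> v \<gamma>)"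

definition rmul :: "(root \<Rightarrow> 'z) \<Rightarrow> 'z \<Rightarrow> root \<Rightarrow> 'z" where
  "rmul v a = (\<lambda>\<gamma>\<in>Phi. v \<gamma> \<otimes> a)"

lemma Sinv_closed [simp]: "i \<in> nodes M \<Longrightarrow> v \<in> U \<Longrightarrow> Sinv i v \<in> U"
  by (auto simp: Sinv_def intro!: a_closed m_closed U_closed)

lemma rmul_closed [simp]: "v \<in> U \<Longrightarrow> a \<in> carrier Z \<Longrightarrow> rmul v a \<in> U"
  by (auto simp: rmul_def)

lemma Sinv_zero: "\<gamma> \<in> Phi \<Longrightarrow> ip i \<gamma> = 0 \<Longrightarrow> Sinv i v \<gamma> = h \<gamma> i \<otimes> v \<gamma> \<oplus> m \<otimes> v \<gamma>"
  and Sinv_pos: "\<gamma> \<in> Phi \<Longrightarrow> ip i \<gamma> > 0 \<Longrightarrow> Sinv i v \<gamma> = v (refl i \<gamma>) \<oplus> m \<otimes> v \<gamma>"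
  by (simp_all add: Sinv_def S_zero S_pos)

lemma Sinv_neg: "i \<in> nodes M \<Longrightarrow> v \<in> U \<Longrightarrow> \<gamma> \<in> Phi \<Longrightarrow> ip i \<gamma> < 0 \<Longrightarrow> Sinv i v \<gamma> = v (refl i \<gamma>)"
  by (simp add: Sinv_def S_neg minus_eq a_assoc l_neg)

lemma S_Sinv:
  assumes i: "i \<in> nodes M" and v: "v \<in> U"
  shows "S i (Sinv i v) = v"
proof (rule U_eqI)
  fix \<gamma> assume \<gamma>: "\<gamma> \<in> Phi"
  consider "ip i \<gamma> = 0" | "ip i \<gamma> > 0" | "ip i \<gamma> < 0" by linarith
  then show "S i (Sinv i v) \<gamma> = v \<gamma>"
  proof cases
    case 1
    then show ?thesis using assms \<gamma>
      by (simp add: S_zero Sinv_zero r_distr h_m h_quadratic minus_eq a_assoc l_neg)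
  next
    case 2
    then show ?thesis using assms \<gamma> by (simp add: S_pos Sinv_neg inner_form_simple_reflect_self)
  next
    case 3
    then show ?thesis using assms \<gamma>
      by (simp add: S_neg Sinv_pos Sinv_neg inner_form_simple_reflect_self minus_eq a_assoc r_neg)
  qed
qed (use assms in auto)

lemma Sinv_S:
  assumes i: "i \<in> nodes M" and v: "v \<in> U"
  shows "Sinv i (S i v) = v"
proof (rule U_eqI)
  fix \<gamma> assume \<gamma>: "\<gamma> \<in> Phi"
  show "Sinv i (S i v) \<gamma> = v \<gamma>"
    using assms \<gamma> by (simp add: Sinv_def S_quadratic minus_eq a_assoc l_neg)
qed (use assms in auto)

lemma Sinv_commute:
  assumes "i \<in> nodes M" "j \<in> nodes M" "i \<noteq> j" "\<not> adj M i j" "v \<in> U"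
  shows "Sinv i (Sinv j v) = Sinv j (Sinv i v)"
proof -
  have "Sinv i (Sinv j v) = Sinv i (Sinv j (S i (S j (Sinv j (Sinv i v)))))"
    using assms by (simp add: S_Sinv S_commute[of i j])
  also have "\<dots> = Sinv j (Sinv i v)"
    using assms by (simp add: S_commute[of i j] Sinv_S)
  finally show ?thesis .
qed

lemma S_Sinv_commute:
  assumes "i \<in> nodes M" "j \<in> nodes M" "i \<noteq> j" "\<not> adj M i j" "v \<in> U"
  shows "S i (Sinv j v) = Sinv j (S i v)"
proof -
  have "S j (S i (Sinv j v)) = S i v" using assms by (simp add: S_commute[of i j, symmetric] S_Sinv)
  then show ?thesis using assms Sinv_S[of j "S i (Sinv j v)"] by simp
qed

text \<open>The braid relation solved for a mixed product, in the shape that pulls \<open>S\<close>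
  through the last two letters of a descending word.\<close>

lemma S_Sinv_braid:
  assumes "i \<in> nodes M" "j \<in> nodes M" "adj M i j" "v \<in> U"
  shows "S i (Sinv j (Sinv i v)) = Sinv j (Sinv i (S j v))"
proof -
  have "S i (S j (S i (Sinv j (Sinv i v)))) = S j v"
    using assms by (simp add: S_braid[of i j] S_Sinv)
  then have "S i (Sinv j (Sinv i v)) = Sinv j (Sinv i (S j v))"
    using assms Sinv_S[of i "S j (S i (Sinv j (Sinv i v)))"] Sinv_S[of j "S i (Sinv j (Sinv i v))"] by simp
  then show ?thesis .
qed

lemma Sinv_braid:
  assumes "i \<in> nodes M" "j \<in> nodes M" "adj M i j" "v \<in> U"
  shows "Sinv i (Sinv j (Sinv i v)) = Sinv j (Sinv i (Sinv j v))"
proof -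
  have "S i (Sinv j (Sinv i (Sinv j v))) = Sinv j (Sinv i v)"
    using assms S_Sinv_braid[of i j "Sinv j v"] by (simp add: S_Sinv)
  then show ?thesis using assms Sinv_S[of i "Sinv j (Sinv i (Sinv j v))"] by simp
qed

lemma S_rmul: "i \<in> nodes M \<Longrightarrow> v \<in> U \<Longrightarrow> a \<in> carrier Z \<Longrightarrow> S i (rmul v a) = rmul (S i v) a"
proof (rule U_eqI)
  fix \<gamma> assume *: "i \<in> nodes M" "v \<in> U" "a \<in> carrier Z" "\<gamma> \<in> Phi"
  consider "ip i \<gamma> = 0" | "ip i \<gamma> > 0" | "ip i \<gamma> < 0" by linarith
  then show "S i (rmul v a) \<gamma> = rmul (S i v) a \<gamma>"
    by cases (use * in \<open>simp_all add: S_zero S_pos S_neg rmul_def m_assoc minus_eq l_distr l_minus\<close>)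
qed auto

lemma Sinv_rmul: "i \<in> nodes M \<Longrightarrow> v \<in> U \<Longrightarrow> a \<in> carrier Z \<Longrightarrow> Sinv i (rmul v a) = rmul (Sinv i v) a"
proof (rule U_eqI)
  fix \<gamma> assume *: "i \<in> nodes M" "v \<in> U" "a \<in> carrier Z" "\<gamma> \<in> Phi"
  then have "Sinv i (rmul v a) \<gamma> = rmul (S i v) a \<gamma> \<oplus> m \<otimes> rmul v a \<gamma>" by (simp add: Sinv_def S_rmul)
  also have "\<dots> = rmul (Sinv i v) a \<gamma>" using * by (simp add: Sinv_def rmul_def m_assoc l_distr)
  finally show "Sinv i (rmul v a) \<gamma> = rmul (Sinv i v) a \<gamma>" .
qed auto

definition delta0 :: "root \<Rightarrow> 'z" where
  "delta0 = (\<lambda>\<gamma>\<in>Phi. if \<gamma> = alpha0 then \<one> else \<zero>)"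

lemma delta0_closed [simp]: "delta0 \<in> U"
  by (auto simp: delta0_def)

definition Xw :: "nat list \<Rightarrow> root \<Rightarrow> 'z" where
  "Xw p = foldr Sinv p delta0"

lemma Xw_closed: "p \<in> lists (nodes M) \<Longrightarrow> Xw p \<in> U"
  by (induction p) (auto simp: Xw_def)

lemma Xw_unique: "desc p v \<Longrightarrow> desc q v \<Longrightarrow> Xw p = Xw q"
proof (rule desc_unique[of Xw])
  fix i p q assume "Xw p = Xw q" then show "Xw (i # p) = Xw (i # q)" by (simp add: Xw_def)
next
  fix i j p assume "i \<in> nodes M" "j \<in> nodes M" "i \<noteq> j" "\<not> adj M i j" "p \<in> lists (nodes M)"
  then show "Xw (i # j # p) = Xw (j # i # p)"
    using Xw_closed[of p] Sinv_commute[of i j "Xw p"] by (simp add: Xw_def)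
next
  fix i j p assume "i \<in> nodes M" "j \<in> nodes M" "adj M i j" "p \<in> lists (nodes M)"
  then show "Xw (i # j # i # p) = Xw (j # i # j # p)"
    using Xw_closed[of p] Sinv_braid[of i j "Xw p"] by (simp add: Xw_def)
qed

text \<open>In the Hecke algebra of \<open>W\<close>, viewed as a bimodule, \<open>X v\<close> is the image of the standard basis element of \<open>v\<close>
  under the bar involution.\<close>

definition X :: "root \<Rightarrow> root \<Rightarrow> 'z" where
  "X v = Xw (SOME p. desc p v)"

lemma X_eq: "desc p v \<Longrightarrow> X v = Xw p"
  unfolding X_def by (rule Xw_unique) (rule someI)

lemma X_closed [simp]: "v \<in> Phi \<Longrightarrow> X v \<in> U"
  by (metis X_eq Xw_closed desc_exists desc_lists)

lemma X_alpha0: "X alpha0 = delta0"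
  using X_eq[of "[]" alpha0] by (simp add: Xw_def)

lemma X_step:
  assumes "v \<in> Phi" "j \<in> nodes M" "ip j v < 0"
  shows "X v = Sinv j (X (refl j v))"
proof -
  have "refl j v \<in> Phi" using assms by simp
  then obtain p where p: "desc p (refl j v)" by (rule desc_exists)
  then have "desc (j # p) v" using assms by simp
  then show ?thesis using X_eq[OF p] X_eq[of "j # p" v] by (simp add: Xw_def)
qed

lemma S_X_neg: "v \<in> Phi \<Longrightarrow> j \<in> nodes M \<Longrightarrow> ip j v < 0 \<Longrightarrow> S j (X v) = X (refl j v)"
  using X_step[of v j] S_Sinv[of j "X (refl j v)"] by simp

lemma S_X_pos:
  assumes "v \<in> Phi" "j \<in> nodes M" "ip j v > 0" "\<gamma> \<in> Phi"
  shows "S j (X v) \<gamma> = X (refl j v) \<gamma> \<ominus> m \<otimes> X v \<gamma>"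
proof -
  have "X v = S j (X (refl j v))" using S_X_neg[of "refl j v" j] assms by (simp add: inner_form_simple_reflect_self)
  then show ?thesis using S_quadratic[of j "X (refl j v)" \<gamma>] assms by simp
qed

text \<open>The recursion of \<open>conj_rel_exists\<close> repeated on vectors: \<open>S j\<close>
  is carried through the inverse operators, changing its node at braid steps, until it meets
  \<open>delta0\<close> and becomes a right factor.\<close>

lemma S_X_zero:
  assumes "v \<in> Phi" "j \<in> nodes M" "ip j v = 0"
  shows "S j (X v) = rmul (X v) (h v j)"
  using assms
proof (induction "depth v" arbitrary: v j rule: less_induct)
  case less
  show ?case
  proof (cases "v = alpha0")
    case True
    \<comment> \<open>The only nonzero entry of \<open>delta0\<close> is 1, so here the left
      multiplication performed by \<open>S\<close> and the right multiplication agree.\<close>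
    have "S j delta0 = rmul delta0 (h alpha0 j)"
    proof (rule U_eqI)
      fix \<gamma> assume \<gamma>: "\<gamma> \<in> Phi"
      have j0: "refl j alpha0 = alpha0" "ip j alpha0 = 0" using less.prems True by (auto simp: reflect_eq_self)
      have "refl j \<gamma> = alpha0 \<longleftrightarrow> \<gamma> = alpha0" using j0 less.prems(2) by (metis reflect_reflect)
      then show "S j delta0 \<gamma> = rmul delta0 (h alpha0 j) \<gamma>"
        using \<gamma> j0 less.prems by (auto simp: S_def rmul_def delta0_def minus_eq)
    qed (use less.prems True in auto)
    then show ?thesis using True by (simp add: X_alpha0)
  next
    case False
    then obtain k where k: "k \<in> nodes M" "ip k v < 0" using ascent_exists less.prems by blast
    then have ne: "j \<noteq> k" using less.prems by auto
    have d: "depth (refl k v) < depth v" using depth_reflect_neg[OF k(1) less.prems(1) k(2)] by simp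
    have uP: "refl k v \<in> Phi" using k less.prems by simp
    show ?thesis
    proof (cases "adj M j k")
      case False
      then have z: "ip j (refl k v) = 0" using ne k less.prems by (simp add: inner_form_simple_reflect cartan_def)
      have "S j (X v) = Sinv k (S j (X (refl k v)))"
        using X_step[OF less.prems(1) k] S_Sinv_commute[of j k] less.prems k ne False uP by simp
      also have "\<dots> = rmul (Sinv k (X (refl k v))) (h (refl k v) j)"
        using less.hyps[OF d uP less.prems(2) z] Sinv_rmul[of k] k uP less.prems z by simp
      also have "h (refl k v) j = h v j"
        using hidx_reflect_commute[OF less.prems k(1) ne False] by (simp add: h_def)
      finally show ?thesis using X_step[OF less.prems(1) k] by simp
    next
      case True
      then have a: "adj M k j" by (simp add: adj_sym)
      have u: "ip j (refl k v) < 0" "ip k (refl j (refl k v)) = 0"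
        using ne k less.prems True a by (simp_all add: inner_form_simple_reflect cartan_def)
      let ?w = "refl j (refl k v)"
      have wP: "?w \<in> Phi" using uP less.prems by simp
      have dw: "depth ?w < depth v" using depth_reflect_neg[OF less.prems(2) uP u(1)] d by simp
      have Xv: "X v = Sinv k (Sinv j (X ?w))"
        using X_step[OF less.prems(1) k] X_step[OF uP less.prems(2) u(1)] by simp
      have "S j (X v) = Sinv k (Sinv j (S k (X ?w)))"
        unfolding Xv using S_Sinv_braid[OF less.prems(2) k(1) True] wP by simp
      also have "\<dots> = rmul (Sinv k (Sinv j (X ?w))) (h ?w k)"
        using less.hyps[OF dw wP k(1) u(2)] Sinv_rmul k wP less.prems u by simp
      also have "h ?w k = h v j"
        using hidx_reflect_adj[OF less.prems k(1) True] k by (simp add: h_def)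
      finally show ?thesis using Xv by simp
    qed
  qed
qed

text \<open>Induction along an ascent \<open>k\<close> of \<open>v\<close>: \<open>Sinv k\<close>
  evaluated at \<gamma> looks only at \<gamma> and \<open>refl k \<gamma>\<close>, whose depths are
  at least \<open>depth v - 1\<close>, and the leading entry 1 is carried from
  \<open>refl k v\<close> to \<open>v\<close>.\<close>

lemma X_triangular:
  assumes "v \<in> Phi" "\<gamma> \<in> Phi" "depth v \<le> depth \<gamma>"
  shows "X v \<gamma> = (if \<gamma> = v then \<one> else \<zero>)"
  using assms
proof (induction "depth v" arbitrary: v \<gamma>)
  case 0
  then show ?case using depth_eq_0[of v] by (simp add: X_alpha0 delta0_def)
next
  case (Suc n)
  then have "v \<noteq> alpha0" using depth_alpha0 by auto
  then obtain k where k: "k \<in> nodes M" "ip k v < 0" using ascent_exists Suc.prems by blast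
  have d: "depth v = Suc (depth (refl k v))" using depth_reflect_neg[OF k(1) Suc.prems(1) k(2)] .
  have uP: "refl k v \<in> Phi" using k Suc.prems by simp
  have IH: "X (refl k v) \<delta> = (if \<delta> = refl k v then \<one> else \<zero>)" if "\<delta> \<in> Phi" "depth (refl k v) \<le> depth \<delta>" for \<delta>
    using Suc.hyps(1)[of "refl k v" \<delta>] that d Suc.hyps(2) uP by simp
  have ne: "\<gamma> \<noteq> refl k v" using d Suc.prems by auto
  consider "ip k \<gamma> = 0" | "ip k \<gamma> > 0" | "ip k \<gamma> < 0" by linarith
  then show ?case
  proof cases
    case 1
    then have "\<gamma> \<noteq> v" using k by auto
    then show ?thesis unfolding X_step[OF Suc.prems(1) k]
      using Suc.prems k d 1 ne uP IH[of \<gamma>] by (simp add: Sinv_zero)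
  next
    case 2
    then have "\<gamma> \<noteq> v" "refl k \<gamma> \<noteq> refl k v" using k by (auto, metis reflect_reflect less_asym)
    then show ?thesis unfolding X_step[OF Suc.prems(1) k]
      using Suc.prems k d 2 ne uP IH[of \<gamma>] IH[of "refl k \<gamma>"] depth_reflect[OF k(1) Suc.prems(2) 2] by (simp add: Sinv_pos)
  next
    case 3
    have "refl k \<gamma> = refl k v \<longleftrightarrow> \<gamma> = v" using k by (metis reflect_reflect)
    then show ?thesis unfolding X_step[OF Suc.prems(1) k]
      using Suc.prems k d 3 uP IH[of "refl k \<gamma>"] depth_reflect_neg[OF k(1) Suc.prems(2) 3] by (simp add: Sinv_neg)
  qed
qed

definition T_coeff :: "nat \<Rightarrow> root \<Rightarrow> 'z" where
  "T_coeff i \<beta> = X (- \<beta>) (- simple_root i)"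

lemma T_coeff_closed: "i \<in> nodes M \<Longrightarrow> \<beta> \<in> Phi \<Longrightarrow> T_coeff i \<beta> \<in> carrier Z"
  by (simp add: T_coeff_def)

lemma depth_minus_simple: "i \<in> nodes M \<Longrightarrow> depth (- simple_root i) = nat (height alpha0)"
proof -
  assume i: "i \<in> nodes M"
  have "height (simple_root i) = 1" using i by (simp add: height_def simple_root_def)
  then show ?thesis using simple_root_not_neg[OF i] by (simp add: depth_def height_minus)
qed

text \<open>All negative simple roots have the same depth, so \<open>X_triangular\<close> determines
  both the diagonal and the off-diagonal values.\<close>

lemma T_coeff_simple:
  assumes "i \<in> nodes M" "k \<in> nodes M"
  shows "T_coeff i (simple_root k) = (if k = i then \<one> else \<zero>)"
proof -
  have "- simple_root i = - simple_root k \<longleftrightarrow> k = i"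
    by (metis neg_equal_iff_equal simple_root_other simple_root_self zero_neq_one)
  then show ?thesis
    using assms X_triangular[of "- simple_root k" "- simple_root i"] by (simp add: T_coeff_def depth_minus_simple)
qed

text \<open>For the functional \<open>t\<^sub>i\<close> given by \<open>x\<^sub>\<beta> \<mapsto> T_coeff i \<beta>\<close> this is \<open>t\<^sub>i (\<tau>\<^sub>j x\<^sub>\<beta>)\<close>.\<close>

definition T_tau :: "(nat \<Rightarrow> root \<Rightarrow> 'z) \<Rightarrow> nat \<Rightarrow> nat \<Rightarrow> root \<Rightarrow> 'z" where
  "T_tau T i j \<beta> = (if ip j \<beta> = 2 then \<zero>
     else if ip j \<beta> = 1 then T i (refl j \<beta>)
     else if ip j \<beta> = 0 then T i \<beta> \<otimes> h \<beta> j
     else T i (refl j \<beta>) \<ominus> m \<otimes> T i \<beta>)"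

text \<open>Each branch of \<open>T_tau\<close> is one of the three rules for
  \<open>S j (X v)\<close> at \<open>v = - \<beta>\<close>, the inner product having changed its
  sign.\<close>

lemma T_tau_eq_S:
  assumes i: "i \<in> nodes M" and j: "j \<in> nodes M" and \<beta>: "\<beta> \<in> Phi_pos"
  shows "T_tau T_coeff i j \<beta> = S j (X (- \<beta>)) (- simple_root i)"
proof -
  have bP: "\<beta> \<in> Phi" using \<beta> Phi_pos_Phi by blast
  have m\<beta>: "ip j (- \<beta>) = - ip j \<beta>" by (simp add: inner_form_linear)
  have si: "- simple_root i \<in> Phi" using i by simp
  consider "ip j \<beta> = 2" | "ip j \<beta> = 1" | "ip j \<beta> = 0" | "ip j \<beta> = - 1"
    using ip_pos_values[OF j \<beta>] by auto
  then show ?thesis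
  proof cases
    case 1
    then have b: "\<beta> = simple_root j" using ip_eq_2[OF j bP] by simp
    \<comment> \<open>The exceptional root: \<open>tau\<close> gives zero here, and \<open>S\<close>
      gives a vector whose coordinate at a negative simple root vanishes by triangularity, as
      \<beta> is positive.\<close>
    have "S j (X (- \<beta>)) = X \<beta>" using S_X_neg[of "- \<beta>" j] bP j 1 m\<beta> b by (simp add: reflect_minus reflect_simple)
    moreover have "depth \<beta> \<le> depth (- simple_root i)"
      unfolding depth_minus_simple[OF i] b using j height_pos[of "simple_root j"] by (simp add: depth_def)
    moreover have "\<beta> \<noteq> - simple_root i" using \<beta> simple_root_not_neg[OF i] by auto
    ultimately have "S j (X (- \<beta>)) (- simple_root i) = \<zero>" using X_triangular[OF bP si] by auto
    then show ?thesis using 1 by (simp add: T_tau_def)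
  next
    case 2
    then show ?thesis using S_X_neg[of "- \<beta>" j] bP j m\<beta> by (simp add: T_tau_def T_coeff_def reflect_minus)
  next
    case 3
    have "h (- \<beta>) j = h \<beta> j" using hidx_minus[OF bP j 3] by (simp add: h_def)
    then show ?thesis using S_X_zero[of "- \<beta>" j] bP j m\<beta> 3 si by (simp add: T_tau_def T_coeff_def rmul_def)
  next
    case 4
    then show ?thesis using S_X_pos[of "- \<beta>" j "- simple_root i"] bP j m\<beta> si
      by (simp add: T_tau_def T_coeff_def reflect_minus)
  qed
qed

text \<open>\<open>S j\<close> at the negative simple root of \<open>i\<close> and
  \<open>S i\<close> at that of \<open>j\<close> both read the same coordinate, at the negative of
  the sum of the two simple roots.\<close>

lemma T_tau_adj:
  assumes ij: "i \<in> nodes M" "j \<in> nodes M" "adj M i j" and \<beta>: "\<beta> \<in> Phi_pos"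
  shows "T_tau T_coeff i j \<beta> = T_tau T_coeff j i \<beta>"
proof -
  have a: "adj M j i" "i \<noteq> j" using ij adj_irrefl by (auto simp: adj_sym)
  have "ip j (- simple_root i) = 1" "ip i (- simple_root j) = 1"
    using ij a by (simp_all add: inner_form_linear inner_form_simple_simple cartan_def)
  moreover from this have "refl j (- simple_root i) = refl i (- simple_root j)"
    by (simp add: reflect_eq_diff)
  ultimately show ?thesis using ij \<beta> by (simp add: T_tau_eq_S S_pos)
qed

text \<open>The reflection \<open>refl j\<close> fixes the negative simple root of \<open>i\<close>,
  so \<open>S j\<close> multiplies this coordinate by \<open>h\<close> from the left.\<close>

lemma T_tau_nonadj:
  assumes ij: "i \<in> nodes M" "j \<in> nodes M" "i \<noteq> j" "\<not> adj M i j" and \<beta>: "\<beta> \<in> Phi_pos"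
  shows "T_tau T_coeff i j \<beta> = h (simple_root i) j \<otimes> T_coeff i \<beta>"
proof -
  have z: "ip j (- simple_root i) = 0" "ip j (simple_root i) = 0"
    using ij adj_sym by (simp_all add: inner_form_linear inner_form_simple_simple cartan_def)
  have "h (- simple_root i) j = h (simple_root i) j" using hidx_minus[of "simple_root i" j] z ij by (simp add: h_def)
  then show ?thesis using ij \<beta> z by (simp add: T_tau_eq_S S_zero T_coeff_def)
qed

end

subsection \<open>The representation on the positive roots\<close>

lemma free_right_module_carrier:
  "finite X \<Longrightarrow> carrier (free_right_module Z X) = X \<rightarrow>\<^sub>E carrier Z"
  by (auto simp: free_right_module_def)

lemma free_right_module_add: "v \<oplus>\<^bsub>free_right_module Z X\<^esub> w = (\<lambda>b\<in>X. v b \<oplus>\<^bsub>Z\<^esub> w b)"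
  and free_right_module_zero: "\<zero>\<^bsub>free_right_module Z X\<^esub> = (\<lambda>b\<in>X. \<zero>\<^bsub>Z\<^esub>)"
  and free_right_module_smult: "a \<odot>\<^bsub>free_right_module Z X\<^esub> v = (\<lambda>b\<in>X. v b \<otimes>\<^bsub>Z\<^esub> a)"
  by (simp_all add: free_right_module_def)

lemma (in ring) abelian_group_free_right_module:
  assumes "finite X"
  shows "abelian_group (free_right_module R X)"
proof (rule abelian_groupI)
  fix v assume v: "v \<in> carrier (free_right_module R X)"
  then have "(\<lambda>b\<in>X. \<ominus> v b) \<in> carrier (free_right_module R X)"
    by (auto simp: free_right_module_carrier assms)
  moreover have "(\<lambda>b\<in>X. \<ominus> v b) \<oplus>\<^bsub>free_right_module R X\<^esub> v = \<zero>\<^bsub>free_right_module R X\<^esub>"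
    using v by (auto simp: free_right_module_carrier assms free_right_module_add free_right_module_zero l_neg fun_eq_iff PiE_iff)
  ultimately show "\<exists>w\<in>carrier (free_right_module R X). w \<oplus>\<^bsub>free_right_module R X\<^esub> v = \<zero>\<^bsub>free_right_module R X\<^esub>" by blast
qed (auto simp: free_right_module_carrier assms free_right_module_add free_right_module_zero a_ac PiE_iff
      fun_eq_iff extensional_def)

definition single :: "('z, 'c) ring_scheme \<Rightarrow> 'b set \<Rightarrow> 'b \<Rightarrow> 'z \<Rightarrow> 'b \<Rightarrow> 'z" where
  "single Z X b a = (\<lambda>c\<in>X. if c = b then a else \<zero>\<^bsub>Z\<^esub>)"

lemma (in ring) single_closed [simp]:
  "finite X \<Longrightarrow> a \<in> carrier R \<Longrightarrow> single R X b a \<in> carrier (free_right_module R X)"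
  by (auto simp: free_right_module_carrier single_def)

lemma (in ring) single_add:
  "a \<in> carrier R \<Longrightarrow> c \<in> carrier R \<Longrightarrow>
    single R X b a \<oplus>\<^bsub>free_right_module R X\<^esub> single R X b c = single R X b (a \<oplus> c)"
  by (auto simp: single_def free_right_module_add)

text \<open>The operation \<open>pl\<close> of the target is arbitrary, so the lemma covers
  functionals with values in the ring as well as endomorphisms.\<close>

lemma (in ring) additive_eqI:
  assumes X: "finite X" and v: "v \<in> carrier (free_right_module R X)"
    and f: "\<And>v w. v \<in> carrier (free_right_module R X) \<Longrightarrow> w \<in> carrier (free_right_module R X) \<Longrightarrow>
      f (v \<oplus>\<^bsub>free_right_module R X\<^esub> w) = pl (f v) (f w)"
    and g: "\<And>v w. v \<in> carrier (free_right_module R X) \<Longrightarrow> w \<in> carrier (free_right_module R X) \<Longrightarrow>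
      g (v \<oplus>\<^bsub>free_right_module R X\<^esub> w) = pl (g v) (g w)"
    and zero: "f \<zero>\<^bsub>free_right_module R X\<^esub> = g \<zero>\<^bsub>free_right_module R X\<^esub>"
    and single: "\<And>b a. b \<in> X \<Longrightarrow> a \<in> carrier R \<Longrightarrow> f (single R X b a) = g (single R X b a)"
  shows "f v = g v"
proof -
  have "f v = g v" if "finite Y" "Y \<subseteq> X" "v \<in> carrier (free_right_module R X)" "\<And>b. b \<in> X - Y \<Longrightarrow> v b = \<zero>" for Y v
    using that
  proof (induction Y arbitrary: v)
    case empty
    then have "v = \<zero>\<^bsub>free_right_module R X\<^esub>"
      by (auto simp: free_right_module_carrier X free_right_module_zero fun_eq_iff PiE_iff extensional_def)
    then show ?case using zero by simp
  next
    case (insert b Y)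
    let ?w = "\<lambda>c\<in>X. if c = b then \<zero> else v c"
    have b: "b \<in> X" using insert.prems by auto
    have vb: "v b \<in> carrier R" using insert.prems b by (auto simp: free_right_module_carrier X)
    have w: "?w \<in> carrier (free_right_module R X)" using insert.prems by (auto simp: free_right_module_carrier X)
    have v: "v = ?w \<oplus>\<^bsub>free_right_module R X\<^esub> single R X b (v b)"
      using insert.prems(2) b vb
      by (auto simp: free_right_module_add single_def free_right_module_carrier X fun_eq_iff PiE_iff extensional_def)
    have "f ?w = g ?w" by (rule insert.IH[OF _ w]) (use insert.prems in auto)
    then have "f (?w \<oplus>\<^bsub>free_right_module R X\<^esub> single R X b (v b)) = g (?w \<oplus>\<^bsub>free_right_module R X\<^esub> single R X b (v b))"
      using f[OF w, of "single R X b (v b)"] g[OF w, of "single R X b (v b)"] single[OF b vb] vb X by simp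
    then show ?case using v by simp
  qed
  from this[of X v] X v show ?thesis by auto
qed

text \<open>\<open>L\<close> stands for the inverse of \<open>l\<close>. The coefficients enter only
  through their values at simple roots and the two identities, so they can be computed over the
  smaller Hecke algebra and transported.\<close>

locale hecke_rep = hecke_coeffs +
  fixes L :: 'a and T :: "nat \<Rightarrow> root \<Rightarrow> 'a"
  assumes L_closed [simp]: "L \<in> carrier Z"
    and L_central: "\<And>x. x \<in> carrier Z \<Longrightarrow> x \<otimes> L = L \<otimes> x"
    and T_closed [simp]: "\<And>i \<beta>. i \<in> nodes M \<Longrightarrow> \<beta> \<in> Phi_pos \<Longrightarrow> T i \<beta> \<in> carrier Z"
    and T_simple: "\<And>i k. i \<in> nodes M \<Longrightarrow> k \<in> nodes M \<Longrightarrow> T i (simple_root k) = (if k = i then \<one> else \<zero>)"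
    and T_adj: "\<And>i j \<beta>. \<lbrakk>i \<in> nodes M; j \<in> nodes M; adj M i j; \<beta> \<in> Phi_pos\<rbrakk> \<Longrightarrow> T_tau T i j \<beta> = T_tau T j i \<beta>"
    and T_nonadj: "\<And>i j \<beta>. \<lbrakk>i \<in> nodes M; j \<in> nodes M; i \<noteq> j; \<not> adj M i j; \<beta> \<in> Phi_pos\<rbrakk> \<Longrightarrow>
      T_tau T i j \<beta> = h (simple_root i) j \<otimes> T i \<beta>"
begin

abbreviation V :: "('a, root \<Rightarrow> 'a) module" where
  "V \<equiv> free_right_module Z Phi_pos"

sublocale V: abelian_group V
  by (rule abelian_group_free_right_module) simp

abbreviation e :: "root \<Rightarrow> 'a \<Rightarrow> root \<Rightarrow> 'a" where
  "e \<equiv> single Z Phi_pos"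

definition ext :: "(root \<Rightarrow> 'a) \<Rightarrow> root \<Rightarrow> 'a" where
  "ext v = (\<lambda>\<gamma>\<in>Phi. if \<gamma> \<in> Phi_pos then v \<gamma> else \<zero>)"

definition tau' :: "nat \<Rightarrow> (root \<Rightarrow> 'a) \<Rightarrow> root \<Rightarrow> 'a" where
  "tau' i v = (\<lambda>\<gamma>\<in>Phi_pos. S i (ext v) \<gamma>)"

definition t :: "nat \<Rightarrow> (root \<Rightarrow> 'a) \<Rightarrow> 'a" where
  "t i v = (\<Oplus>\<beta>\<in>Phi_pos. T i \<beta> \<otimes> v \<beta>)"

definition sig :: "nat \<Rightarrow> (root \<Rightarrow> 'a) \<Rightarrow> root \<Rightarrow> 'a" where
  "sig i v = tau' i v \<oplus>\<^bsub>V\<^esub> e (simple_root i) (L \<otimes> t i v)"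

lemma V_carrier: "carrier V = Phi_pos \<rightarrow>\<^sub>E carrier Z"
  by (rule free_right_module_carrier) simp

lemma V_closed [simp]: "v \<in> carrier V \<Longrightarrow> \<gamma> \<in> Phi_pos \<Longrightarrow> v \<gamma> \<in> carrier Z"
  by (auto simp: V_carrier)

lemma V_eqI: "v \<in> carrier V \<Longrightarrow> w \<in> carrier V \<Longrightarrow> (\<And>\<gamma>. \<gamma> \<in> Phi_pos \<Longrightarrow> v \<gamma> = w \<gamma>) \<Longrightarrow> v = w"
  unfolding V_carrier by (rule PiE_ext)

lemma V_add_apply [simp]: "\<gamma> \<in> Phi_pos \<Longrightarrow> (v \<oplus>\<^bsub>V\<^esub> w) \<gamma> = v \<gamma> \<oplus> w \<gamma>"
  by (simp add: free_right_module_add)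

lemma V_smult_closed: "a \<in> carrier Z \<Longrightarrow> v \<in> carrier V \<Longrightarrow> a \<odot>\<^bsub>V\<^esub> v \<in> carrier V"
  unfolding V_carrier free_right_module_smult by auto

lemma e_closed [simp]: "a \<in> carrier Z \<Longrightarrow> e \<beta> a \<in> carrier V"
  by simp

lemma e_apply: "\<gamma> \<in> Phi_pos \<Longrightarrow> e \<beta> a \<gamma> = (if \<gamma> = \<beta> then a else \<zero>)"
  by (simp add: single_def)

lemma ext_closed [simp]: "v \<in> carrier V \<Longrightarrow> ext v \<in> U"
  by (auto simp: ext_def V_carrier)

lemma tau'_closed [simp]: "i \<in> nodes M \<Longrightarrow> v \<in> carrier V \<Longrightarrow> tau' i v \<in> carrier V"
  using S_closed[of i "ext v"] Phi_pos_Phi by (auto simp: tau'_def V_carrier intro!: U_closed)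

lemma t_closed [simp]: "i \<in> nodes M \<Longrightarrow> v \<in> carrier V \<Longrightarrow> t i v \<in> carrier Z"
  by (auto simp: t_def intro!: finsum_closed)

lemma sig_closed [simp]: "i \<in> nodes M \<Longrightarrow> v \<in> carrier V \<Longrightarrow> sig i v \<in> carrier V"
  by (simp add: sig_def)

lemma t_add: "i \<in> nodes M \<Longrightarrow> v \<in> carrier V \<Longrightarrow> w \<in> carrier V \<Longrightarrow> t i (v \<oplus>\<^bsub>V\<^esub> w) = t i v \<oplus> t i w"
proof -
  assume *: "i \<in> nodes M" "v \<in> carrier V" "w \<in> carrier V"
  then have "t i (v \<oplus>\<^bsub>V\<^esub> w) = (\<Oplus>\<beta>\<in>Phi_pos. T i \<beta> \<otimes> v \<beta> \<oplus> T i \<beta> \<otimes> w \<beta>)"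
    unfolding t_def by (intro finsum_cong') (auto simp: r_distr)
  also have "\<dots> = t i v \<oplus> t i w" unfolding t_def using * by (intro finsum_addf) auto
  finally show ?thesis .
qed

lemma t_rmul:
  assumes "i \<in> nodes M" "v \<in> carrier V" "a \<in> carrier Z"
  shows "t i (a \<odot>\<^bsub>V\<^esub> v) = t i v \<otimes> a"
proof -
  have "t i v \<otimes> a = (\<Oplus>\<beta>\<in>Phi_pos. T i \<beta> \<otimes> v \<beta> \<otimes> a)"
    unfolding t_def using assms by (intro finsum_ldistr) auto
  also have "\<dots> = t i (a \<odot>\<^bsub>V\<^esub> v)"
    unfolding t_def using assms by (intro finsum_cong') (auto simp: free_right_module_smult m_assoc)
  finally show ?thesis ..
qed

lemma t_e:
  assumes "i \<in> nodes M" "\<beta> \<in> Phi_pos" "a \<in> carrier Z"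
  shows "t i (e \<beta> a) = T i \<beta> \<otimes> a"
proof -
  have "t i (e \<beta> a) = (\<Oplus>\<gamma>\<in>Phi_pos. if \<beta> = \<gamma> then T i \<gamma> \<otimes> a else \<zero>)"
    unfolding t_def using assms by (intro finsum_cong') (auto simp: e_apply)
  also have "\<dots> = T i \<beta> \<otimes> a" using assms by (intro finsum_singleton) auto
  finally show ?thesis .
qed

lemma tau'_apply: "\<gamma> \<in> Phi_pos \<Longrightarrow> tau' i v \<gamma> = S i (ext v) \<gamma>"
  by (simp add: tau'_def)

lemma tau'_add:
  assumes "i \<in> nodes M" "v \<in> carrier V" "w \<in> carrier V"
  shows "tau' i (v \<oplus>\<^bsub>V\<^esub> w) = tau' i v \<oplus>\<^bsub>V\<^esub> tau' i w"
proof (rule V_eqI)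
  fix \<gamma> assume \<gamma>: "\<gamma> \<in> Phi_pos"
  then have gP: "\<gamma> \<in> Phi" by (rule Phi_pos_Phi)
  have ext: "ext (v \<oplus>\<^bsub>V\<^esub> w) \<delta> = ext v \<delta> \<oplus> ext w \<delta>" if "\<delta> \<in> Phi" for \<delta>
    using that by (simp add: ext_def)
  consider "ip i \<gamma> = 0" | "ip i \<gamma> > 0" | "ip i \<gamma> < 0" by linarith
  then show "tau' i (v \<oplus>\<^bsub>V\<^esub> w) \<gamma> = (tau' i v \<oplus>\<^bsub>V\<^esub> tau' i w) \<gamma>"
    by cases (use assms \<gamma> gP in \<open>simp_all add: tau'_def ext S_zero S_pos S_neg r_distr minus_eq minus_add a_ac\<close>)
qed (use assms in auto)

lemma tau'_rmul:
  assumes "i \<in> nodes M" "v \<in> carrier V" "a \<in> carrier Z"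
  shows "tau' i (a \<odot>\<^bsub>V\<^esub> v) = a \<odot>\<^bsub>V\<^esub> tau' i v"
proof -
  have "ext (a \<odot>\<^bsub>V\<^esub> v) = rmul (ext v) a"
    using assms by (intro ext) (auto simp: ext_def rmul_def free_right_module_smult)
  then show ?thesis using assms S_rmul[of i "ext v" a] Phi_pos_Phi
    by (intro ext) (auto simp: tau'_def free_right_module_smult rmul_def)
qed

text \<open>The coordinate formula of \<open>S\<close> turned into values on basis vectors, the form
  in which \<open>tau\<close> is defined. In the first case the image would sit at a negative simple
  root and is cut off.\<close>

lemma tau'_e:
  assumes i: "i \<in> nodes M" and \<beta>: "\<beta> \<in> Phi_pos" and a: "a \<in> carrier Z"
  shows "ip i \<beta> = 2 \<Longrightarrow> tau' i (e \<beta> a) = \<zero>\<^bsub>V\<^esub>"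
    and "ip i \<beta> = 1 \<Longrightarrow> tau' i (e \<beta> a) = e (refl i \<beta>) a"
    and "ip i \<beta> = 0 \<Longrightarrow> tau' i (e \<beta> a) = e \<beta> (h \<beta> i \<otimes> a)"
    and "ip i \<beta> = - 1 \<Longrightarrow> tau' i (e \<beta> a) = e (refl i \<beta>) a \<oplus>\<^bsub>V\<^esub> e \<beta> (\<ominus> (m \<otimes> a))"
proof -
  have bP: "\<beta> \<in> Phi" using \<beta> by (rule Phi_pos_Phi)
  have ext: "ext (e \<beta> a) \<delta> = (if \<delta> = \<beta> then a else \<zero>)" if "\<delta> \<in> Phi" for \<delta>
    using that \<beta> by (simp add: ext_def e_apply)
  have inj: "refl i \<gamma> = \<beta> \<longleftrightarrow> \<gamma> = refl i \<beta>" for \<gamma> using reflect_reflect[OF i] by metis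
  have val: "tau' i (e \<beta> a) \<gamma> = (if ip i \<gamma> = 0 then (if \<gamma> = \<beta> then h \<gamma> i \<otimes> a else \<zero>)
      else if ip i \<gamma> > 0 then (if \<gamma> = refl i \<beta> then a else \<zero>)
      else (if \<gamma> = refl i \<beta> then a else \<zero>) \<ominus> m \<otimes> (if \<gamma> = \<beta> then a else \<zero>))" if \<gamma>: "\<gamma> \<in> Phi_pos" for \<gamma>
    using \<gamma> Phi_pos_Phi[OF \<gamma>] i by (auto simp: tau'_def S_def ext inj)
  have ipr: "ip i (refl i \<beta>) = - ip i \<beta>" using i by (rule inner_form_simple_reflect_self)
  have cl: "tau' i (e \<beta> a) \<in> carrier V" using i a by simp
  show "tau' i (e \<beta> a) = \<zero>\<^bsub>V\<^esub>" if two: "ip i \<beta> = 2"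
  proof (rule V_eqI[OF cl])
    fix \<gamma> assume \<gamma>: "\<gamma> \<in> Phi_pos"
    have "refl i \<beta> \<notin> Phi_pos" using two ip_eq_2[OF i bP] simple_root_not_neg[OF i] by (simp add: reflect_simple i)
    then show "tau' i (e \<beta> a) \<gamma> = \<zero>\<^bsub>V\<^esub> \<gamma>" using \<gamma> two by (auto simp: val free_right_module_zero minus_eq)
  qed simp
  have rP: "refl i \<beta> \<in> Phi_pos" if "ip i \<beta> \<noteq> 2" using reflect_Phi_pos[OF i \<beta>] ip_eq_2[OF i bP] that by blast
  show "tau' i (e \<beta> a) = e (refl i \<beta>) a" if "ip i \<beta> = 1"
    by (rule V_eqI[OF cl]) (use a that ipr in \<open>auto simp: val e_apply minus_eq\<close>)
  show "tau' i (e \<beta> a) = e \<beta> (h \<beta> i \<otimes> a)" if "ip i \<beta> = 0"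
    by (rule V_eqI[OF cl]) (use a that i bP in \<open>auto simp: val e_apply minus_eq reflect_eq_self\<close>)
  show "tau' i (e \<beta> a) = e (refl i \<beta>) a \<oplus>\<^bsub>V\<^esub> e \<beta> (\<ominus> (m \<otimes> a))" if "ip i \<beta> = - 1"
  proof (rule V_eqI[OF cl])
    fix \<gamma> assume \<gamma>: "\<gamma> \<in> Phi_pos"
    have "refl i \<beta> \<noteq> \<beta>" using ipr that by auto
    then show "tau' i (e \<beta> a) \<gamma> = (e (refl i \<beta>) a \<oplus>\<^bsub>V\<^esub> e \<beta> (\<ominus> (m \<otimes> a))) \<gamma>"
      using a that ipr \<gamma> by (auto simp: val e_apply minus_eq)
  qed (use a in auto)
qed

text \<open>Truncating to the positive coordinates loses the braid relations only through coordinates at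
  negative simple roots, which do not interfere.\<close>

lemma S_ext_neg:
  assumes "i \<in> nodes M" "v \<in> carrier V" "\<gamma> \<in> Phi" "\<gamma> \<notin> Phi_pos" "\<gamma> \<noteq> - simple_root i"
  shows "S i (ext v) \<gamma> = \<zero>"
proof -
  have "refl i \<gamma> \<notin> Phi_pos"
  proof
    assume "refl i \<gamma> \<in> Phi_pos"
    moreover have "refl i \<gamma> \<noteq> simple_root i"
    proof
      assume "refl i \<gamma> = simple_root i"
      then have "refl i (refl i \<gamma>) = - simple_root i" using assms by (simp add: reflect_simple)
      then show False using assms by simp
    qed
    ultimately have "refl i (refl i \<gamma>) \<in> Phi_pos" by (rule reflect_Phi_pos[OF assms(1)])
    then show False using assms by simp
  qed
  then show ?thesis using assms by (auto simp: S_def ext_def minus_eq)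
qed

lemma S_pos_cong:
  assumes "i \<in> nodes M" "u \<in> U" "w \<in> U" "\<gamma> \<in> Phi_pos"
    and "\<And>\<delta>. \<delta> \<in> Phi_pos \<Longrightarrow> u \<delta> = w \<delta>" "u (- simple_root i) = w (- simple_root i)"
  shows "S i u \<gamma> = S i w \<gamma>"
proof -
  have "u (refl i \<gamma>) = w (refl i \<gamma>)"
  proof (cases "\<gamma> = simple_root i")
    case True then show ?thesis using assms by (simp add: reflect_simple)
  next
    case False then show ?thesis using reflect_Phi_pos[OF assms(1,4)] assms(5) by blast
  qed
  then show ?thesis using assms(4,5) Phi_pos_Phi[OF assms(4)] by (simp add: S_def)
qed

lemma ext_neg_simple: "i \<in> nodes M \<Longrightarrow> ext v (- simple_root i) = \<zero>"
  using simple_root_not_neg by (simp add: ext_def)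

lemma ext_pos: "\<gamma> \<in> Phi_pos \<Longrightarrow> ext v \<gamma> = v \<gamma>"
  using Phi_pos_Phi by (simp add: ext_def)

lemma minus_simple_root_eq_iff: "- simple_root i = - simple_root j \<longleftrightarrow> i = j"
  by (metis neg_equal_iff_equal simple_root_other simple_root_self zero_neq_one)

section \<open>Relations that survive truncation to the positive roots\<close>

lemma tau'_tau':
  assumes "i \<in> nodes M" "j \<in> nodes M" "i \<noteq> j" "v \<in> carrier V" "\<gamma> \<in> Phi_pos"
  shows "tau' i (tau' j v) \<gamma> = S i (S j (ext v)) \<gamma>"
proof -
  have "S j (ext v) (- simple_root i) = \<zero>"
    using assms simple_root_not_neg minus_simple_root_eq_iff by (intro S_ext_neg) auto
  then have "S i (ext (tau' j v)) \<gamma> = S i (S j (ext v)) \<gamma>"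
    using assms by (intro S_pos_cong) (auto simp: ext_pos ext_neg_simple tau'_apply)
  then show ?thesis using assms by (simp add: tau'_def)
qed

lemma tau'_commute:
  assumes "i \<in> nodes M" "j \<in> nodes M" "i \<noteq> j" "\<not> adj M i j" "v \<in> carrier V"
  shows "tau' i (tau' j v) = tau' j (tau' i v)"
  using assms S_commute[of i j "ext v"] by (intro V_eqI) (auto simp: tau'_tau')

text \<open>At positive roots \<open>S i\<close> reads only positive coordinates and the one at the
  negative simple root of \<open>i\<close>. There \<open>S j\<close> passes on the coordinate
  \<open>?w\<close> at the negative of the sum of two simple roots, where \<open>S_ext_neg\<close>
  gives zero.\<close>

lemma tau'_tau'_tau':
  assumes "i \<in> nodes M" "j \<in> nodes M" "adj M i j" "v \<in> carrier V" "\<gamma> \<in> Phi_pos"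
  shows "tau' i (tau' j (tau' i v)) \<gamma> = S i (S j (S i (ext v))) \<gamma>"
proof -
  have ne: "i \<noteq> j" "adj M j i" using assms adj_irrefl adj_sym by auto
  have one: "ip j (- simple_root i) = 1"
    using assms ne by (simp add: inner_form_linear inner_form_simple_simple cartan_def)
  let ?w = "refl j (- simple_root i)"
  have w: "?w \<notin> Phi_pos"
  proof
    assume "?w \<in> Phi_pos"
    moreover have "?w \<noteq> simple_root j" using one inner_form_simple_reflect_self[of j M "- simple_root i"] assms
      by (auto simp: inner_form_simple_simple)
    ultimately have "refl j ?w \<in> Phi_pos" by (rule reflect_Phi_pos[OF assms(2)])
    then show False using simple_root_not_neg assms by simp
  qed
  have "?w \<noteq> - simple_root i" using one inner_form_simple_reflect_self[of j M "- simple_root i"] assms by auto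
  then have "S i (ext v) ?w = \<zero>" using w assms by (intro S_ext_neg) auto
  then have z: "S j (S i (ext v)) (- simple_root i) = \<zero>" using assms one by (simp add: S_pos)
  have "S i (ext (tau' j (tau' i v))) \<gamma> = S i (S j (S i (ext v))) \<gamma>"
    using assms z ne by (intro S_pos_cong) (auto simp: ext_pos ext_neg_simple tau'_tau')
  then show ?thesis using assms by (simp add: tau'_def[of i "tau' j (tau' i v)"])
qed

lemma tau'_braid:
  assumes "i \<in> nodes M" "j \<in> nodes M" "adj M i j" "v \<in> carrier V"
  shows "tau' i (tau' j (tau' i v)) = tau' j (tau' i (tau' j v))"
proof -
  have "adj M j i" using assms by (simp add: adj_sym)
  then show ?thesis using assms S_braid[of i j "ext v"] by (intro V_eqI) (auto simp: tau'_tau'_tau')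
qed

lemma tau'_simple_apply: "i \<in> nodes M \<Longrightarrow> tau' i v (simple_root i) = \<zero>"
  by (simp add: tau'_def S_pos inner_form_simple_simple reflect_simple ext_neg_simple)

text \<open>Unlike in the mixed products, the coordinate cut off is not zero: \<open>S i\<close>
  moves \<open>v (simple_root i)\<close> to the negative simple root, from where the second
  \<open>S i\<close> would bring it back. The last summand is exactly this loss.\<close>

lemma tau'_quadratic:
  assumes "i \<in> nodes M" "v \<in> carrier V"
  shows "tau' i (tau' i v) = v \<oplus>\<^bsub>V\<^esub> (\<ominus> m) \<odot>\<^bsub>V\<^esub> tau' i v \<oplus>\<^bsub>V\<^esub> e (simple_root i) (\<ominus> v (simple_root i))"
proof (rule V_eqI)
  fix \<gamma> assume \<gamma>: "\<gamma> \<in> Phi_pos"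
  have vs: "v (simple_root i) \<in> carrier Z" using assms by simp
  show "tau' i (tau' i v) \<gamma> = (v \<oplus>\<^bsub>V\<^esub> (\<ominus> m) \<odot>\<^bsub>V\<^esub> tau' i v \<oplus>\<^bsub>V\<^esub> e (simple_root i) (\<ominus> v (simple_root i))) \<gamma>"
  proof (cases "\<gamma> = simple_root i")
    case True
    then show ?thesis using assms vs \<gamma>
      by (simp add: tau'_simple_apply e_apply free_right_module_smult r_neg)
  next
    case False
    \<comment> \<open>Clearing the coordinate at the negative simple root reproduces what truncation
      does as far as \<open>S i\<close> can see, and for roots other than
      \<open>simple_root i\<close> it is not read at all.\<close>
    let ?w = "\<lambda>\<delta>\<in>Phi. if \<delta> = - simple_root i then \<zero> else S i (ext v) \<delta>"
    have w: "?w \<in> U" using S_closed[OF assms(1) ext_closed[OF assms(2)]] by (auto simp: PiE_iff)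
    have "tau' i (tau' i v) \<gamma> = S i (ext (tau' i v)) \<gamma>" by (rule tau'_apply[OF \<gamma>])
    also have "\<dots> = S i ?w \<gamma>"
      using assms \<gamma> w simple_root_not_neg[OF assms(1)] Phi_pos_Phi
      by (intro S_pos_cong) (auto simp: ext_pos ext_neg_simple tau'_apply)
    also have "\<dots> = S i (S i (ext v)) \<gamma>"
    proof -
      have "refl i \<gamma> \<noteq> - simple_root i"
      proof
        assume "refl i \<gamma> = - simple_root i"
        then have "refl i (refl i \<gamma>) = simple_root i" using assms(1) by (simp add: reflect_minus reflect_simple)
        then show False using False assms(1) by simp
      qed
      moreover have "\<gamma> \<noteq> - simple_root i" using \<gamma> simple_root_not_neg[OF assms(1)] by auto
      ultimately show ?thesis using assms Phi_pos_Phi[OF \<gamma>] by (simp add: S_def)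
    qed
    also have "\<dots> = v \<gamma> \<ominus> m \<otimes> S i (ext v) \<gamma>"
      using S_quadratic[OF assms(1) ext_closed[OF assms(2)] Phi_pos_Phi[OF \<gamma>]] \<gamma> by (simp add: ext_pos)
    also have "\<dots> = v \<gamma> \<oplus> tau' i v \<gamma> \<otimes> (\<ominus> m)"
      using \<gamma> assms Phi_pos_Phi[OF \<gamma>] by (simp add: tau'_apply minus_eq r_minus m_central)
    finally show ?thesis using \<gamma> assms False by (simp add: e_apply free_right_module_smult)
  qed
next
  show "v \<oplus>\<^bsub>V\<^esub> (\<ominus> m) \<odot>\<^bsub>V\<^esub> tau' i v \<oplus>\<^bsub>V\<^esub> e (simple_root i) (\<ominus> v (simple_root i)) \<in> carrier V"
    using assms by (intro V.a_closed V_smult_closed e_closed tau'_closed) auto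
qed (use assms in auto)

lemma V_zero_apply: "\<gamma> \<in> Phi_pos \<Longrightarrow> \<zero>\<^bsub>V\<^esub> \<gamma> = \<zero>"
  by (simp add: free_right_module_zero)

lemma t_zero: "i \<in> nodes M \<Longrightarrow> t i \<zero>\<^bsub>V\<^esub> = \<zero>"
  using t_add[of i "\<zero>\<^bsub>V\<^esub>" "\<zero>\<^bsub>V\<^esub>"] by (metis V.l_zero V.zero_closed add.r_cancel_one' t_closed)

lemma tau'_zero: "i \<in> nodes M \<Longrightarrow> tau' i \<zero>\<^bsub>V\<^esub> = \<zero>\<^bsub>V\<^esub>"
  using tau'_add[of i "\<zero>\<^bsub>V\<^esub>" "\<zero>\<^bsub>V\<^esub>"] by (metis V.add.r_cancel_one' V.l_zero V.zero_closed tau'_closed)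

lemma t_tau'_e:
  assumes "i \<in> nodes M" "j \<in> nodes M" "\<beta> \<in> Phi_pos" "a \<in> carrier Z"
  shows "t i (tau' j (e \<beta> a)) = T_tau T i j \<beta> \<otimes> a"
proof -
  have bP: "\<beta> \<in> Phi" using assms Phi_pos_Phi by blast
  have rP: "refl j \<beta> \<in> Phi_pos" if "ip j \<beta> \<noteq> 2"
    using reflect_Phi_pos[OF assms(2,3)] ip_eq_2[OF assms(2) bP] that by blast
  consider "ip j \<beta> = 2" | "ip j \<beta> = 1" | "ip j \<beta> = 0" | "ip j \<beta> = - 1"
    using ip_pos_values[OF assms(2,3)] by auto
  then show ?thesis
  proof cases
    case 1 then show ?thesis using assms by (simp add: tau'_e T_tau_def t_zero)
  next
    case 2 then show ?thesis using assms rP by (simp add: tau'_e T_tau_def t_e)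
  next
    case 3 then show ?thesis using assms bP by (simp add: tau'_e T_tau_def t_e m_assoc)
  next
    case 4
    then have "t i (tau' j (e \<beta> a)) = T i (refl j \<beta>) \<otimes> a \<oplus> T i \<beta> \<otimes> (\<ominus> (m \<otimes> a))"
      using assms rP by (simp add: tau'_e t_add t_e)
    also have "\<dots> = (T i (refl j \<beta>) \<ominus> m \<otimes> T i \<beta>) \<otimes> a"
      using assms rP 4 by (simp add: minus_eq l_distr l_minus r_minus m_left_commute m_assoc)
    finally show ?thesis using 4 by (simp add: T_tau_def)
  qed
qed

lemma t_tau'_adj:
  assumes "i \<in> nodes M" "j \<in> nodes M" "adj M i j" "v \<in> carrier V"
  shows "t i (tau' j v) = t j (tau' i v)"
  by (rule additive_eqI[where X = Phi_pos and pl = "(\<oplus>)" and f = "\<lambda>v. t i (tau' j v)" and g = "\<lambda>v. t j (tau' i v)"])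
     (use assms T_adj[OF assms(1-3)] in \<open>auto simp: tau'_add t_add tau'_zero t_zero t_tau'_e\<close>)

lemma t_tau'_nonadj:
  assumes "i \<in> nodes M" "j \<in> nodes M" "i \<noteq> j" "\<not> adj M i j" "v \<in> carrier V"
  shows "t i (tau' j v) = h (simple_root i) j \<otimes> t i v"
proof -
  have "ip j (simple_root i) = 0" using assms by (simp add: inner_form_simple_simple cartan_def adj_sym)
  then have hc: "h (simple_root i) j \<in> carrier Z" using assms by simp
  show ?thesis
    by (rule additive_eqI[where X = Phi_pos and pl = "(\<oplus>)" and f = "\<lambda>v. t i (tau' j v)"
          and g = "\<lambda>v. h (simple_root i) j \<otimes> t i v", rotated])
       (use hc assms(1-3,5) T_nonadj[OF assms(1-4)] in \<open>simp_all add: tau'_add t_add tau'_zero t_zero t_tau'_e t_e r_distr m_assoc\<close>)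
qed

end

subsection \<open>Endomorphism rings\<close>

lemma linear_endos_carrierD:
  assumes "f \<in> carrier (linear_endos Z V)"
  shows "f \<in> extensional (carrier V)" "\<And>v. v \<in> carrier V \<Longrightarrow> f v \<in> carrier V"
    "\<And>v w. v \<in> carrier V \<Longrightarrow> w \<in> carrier V \<Longrightarrow> f (v \<oplus>\<^bsub>V\<^esub> w) = f v \<oplus>\<^bsub>V\<^esub> f w"
    "\<And>z v. z \<in> carrier Z \<Longrightarrow> v \<in> carrier V \<Longrightarrow> f (z \<odot>\<^bsub>V\<^esub> v) = z \<odot>\<^bsub>V\<^esub> f v"
  using assms by (auto simp: linear_endos_def PiE_iff)

lemma linear_endosI:
  assumes "\<And>v. v \<in> carrier V \<Longrightarrow> f v \<in> carrier V"
    "\<And>v w. v \<in> carrier V \<Longrightarrow> w \<in> carrier V \<Longrightarrow> f (v \<oplus>\<^bsub>V\<^esub> w) = f v \<oplus>\<^bsub>V\<^esub> f w"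
    "\<And>z v. z \<in> carrier Z \<Longrightarrow> v \<in> carrier V \<Longrightarrow> f (z \<odot>\<^bsub>V\<^esub> v) = z \<odot>\<^bsub>V\<^esub> f v"
    "\<And>v w. v \<in> carrier V \<Longrightarrow> w \<in> carrier V \<Longrightarrow> v \<oplus>\<^bsub>V\<^esub> w \<in> carrier V"
    "\<And>z v. z \<in> carrier Z \<Longrightarrow> v \<in> carrier V \<Longrightarrow> z \<odot>\<^bsub>V\<^esub> v \<in> carrier V"
  shows "(\<lambda>v\<in>carrier V. f v) \<in> carrier (linear_endos Z V)"
  using assms by (auto simp: linear_endos_def)

lemma linear_endos_mult: "f \<otimes>\<^bsub>linear_endos Z V\<^esub> g = (\<lambda>v\<in>carrier V. f (g v))"
  and linear_endos_one: "\<one>\<^bsub>linear_endos Z V\<^esub> = (\<lambda>v\<in>carrier V. v)"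
  and linear_endos_add: "f \<oplus>\<^bsub>linear_endos Z V\<^esub> g = (\<lambda>v\<in>carrier V. f v \<oplus>\<^bsub>V\<^esub> g v)"
  and linear_endos_zero: "\<zero>\<^bsub>linear_endos Z V\<^esub> = (\<lambda>v\<in>carrier V. \<zero>\<^bsub>V\<^esub>)"
  and linear_endos_smult: "c \<odot>\<^bsub>linear_endos Z V\<^esub> f = (\<lambda>v\<in>carrier V. c \<odot>\<^bsub>V\<^esub> f v)"
  by (simp_all add: linear_endos_def compose_def)

lemma linear_endos_eqI:
  assumes "f \<in> carrier (linear_endos Z V)" "g \<in> carrier (linear_endos Z V)"
    "\<And>v. v \<in> carrier V \<Longrightarrow> f v = g v"
  shows "f = g"
  using assms by (intro extensionalityI[of f "carrier V"]) (auto dest: linear_endos_carrierD(1))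

text \<open>Only additivity of scalars is required for the ring of endomorphisms, so the same locale
  covers right modules over a noncommutative ring and the tensor product over the field.\<close>

locale scalar_action =
  fixes Z :: "('z, 'c) ring_scheme" and V :: "('z, 'v) module"
  assumes V_abelian_group: "abelian_group V"
    and smult_closed: "\<And>z v. z \<in> carrier Z \<Longrightarrow> v \<in> carrier V \<Longrightarrow> z \<odot>\<^bsub>V\<^esub> v \<in> carrier V"
    and smult_add: "\<And>z v w. z \<in> carrier Z \<Longrightarrow> v \<in> carrier V \<Longrightarrow> w \<in> carrier V \<Longrightarrow>
      z \<odot>\<^bsub>V\<^esub> (v \<oplus>\<^bsub>V\<^esub> w) = z \<odot>\<^bsub>V\<^esub> v \<oplus>\<^bsub>V\<^esub> z \<odot>\<^bsub>V\<^esub> w"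
begin

interpretation V: abelian_group V by (rule V_abelian_group)

abbreviation E where "E \<equiv> linear_endos Z V"

lemma smult_zero: "z \<in> carrier Z \<Longrightarrow> z \<odot>\<^bsub>V\<^esub> \<zero>\<^bsub>V\<^esub> = \<zero>\<^bsub>V\<^esub>"
  using smult_add[of z "\<zero>\<^bsub>V\<^esub>" "\<zero>\<^bsub>V\<^esub>"] smult_closed[of z "\<zero>\<^bsub>V\<^esub>"]
  by (metis V.add.r_cancel_one' V.l_zero V.zero_closed)

lemma smult_minus: "z \<in> carrier Z \<Longrightarrow> v \<in> carrier V \<Longrightarrow> z \<odot>\<^bsub>V\<^esub> (\<ominus>\<^bsub>V\<^esub> v) = \<ominus>\<^bsub>V\<^esub> (z \<odot>\<^bsub>V\<^esub> v)"
  using smult_add[of z "\<ominus>\<^bsub>V\<^esub> v" v] smult_closed smult_zero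
  by (simp add: V.l_neg V.minus_equality)

lemma linear_endos_closed:
  "f \<in> carrier E \<Longrightarrow> g \<in> carrier E \<Longrightarrow> (\<lambda>v\<in>carrier V. f v \<oplus>\<^bsub>V\<^esub> g v) \<in> carrier E"
  "f \<in> carrier E \<Longrightarrow> g \<in> carrier E \<Longrightarrow> (\<lambda>v\<in>carrier V. f (g v)) \<in> carrier E"
  "f \<in> carrier E \<Longrightarrow> (\<lambda>v\<in>carrier V. \<ominus>\<^bsub>V\<^esub> f v) \<in> carrier E"
  "(\<lambda>v\<in>carrier V. v) \<in> carrier E" "(\<lambda>v\<in>carrier V. \<zero>\<^bsub>V\<^esub>) \<in> carrier E"
  by (intro linear_endosI; simp add: linear_endos_carrierD smult_closed smult_add smult_zero smult_minus V.a_ac V.minus_add)+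

lemma linear_endos_ring: "ring E"
proof (rule ringI)
  show "abelian_group E"
  proof (rule abelian_groupI)
    fix f assume f: "f \<in> carrier E"
    show "\<exists>g\<in>carrier E. g \<oplus>\<^bsub>E\<^esub> f = \<zero>\<^bsub>E\<^esub>"
      by (rule bexI[OF _ linear_endos_closed(3)[OF f]])
         (auto simp: linear_endos_add linear_endos_zero linear_endos_carrierD[OF f] V.l_neg fun_eq_iff)
  qed (auto simp: linear_endos_add linear_endos_zero linear_endos_closed linear_endos_carrierD V.a_ac fun_eq_iff
      intro!: ext dest: linear_endos_carrierD(1) simp: extensional_def)
  show "monoid E"
    by (rule monoidI)
       (auto simp: linear_endos_mult linear_endos_one linear_endos_closed linear_endos_carrierD fun_eq_iff
         dest: linear_endos_carrierD(1) simp: extensional_def)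
qed (auto simp: linear_endos_add linear_endos_mult linear_endos_carrierD fun_eq_iff)

lemma linear_endos_minus:
  assumes f: "f \<in> carrier E"
  shows "\<ominus>\<^bsub>E\<^esub> f = (\<lambda>v\<in>carrier V. \<ominus>\<^bsub>V\<^esub> f v)"
proof -
  interpret E: ring E by (rule linear_endos_ring)
  show ?thesis
    by (rule E.minus_equality)
       (auto simp: f linear_endos_closed linear_endos_add linear_endos_zero linear_endos_carrierD[OF f] V.l_neg fun_eq_iff)
qed

end

text \<open>If \<open>x (x\<^sup>2 + \<mu> x - 1) = \<lambda> (x\<^sup>2 + \<mu> x - 1)\<close> then \<open>\<lambda> = x (1 + \<lambda> x + \<lambda> \<mu> - x\<^sup>2 - \<mu> x)\<close>.\<close>

lemma (in ring) cubic_unit: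
  assumes x: "x \<in> carrier R" and \<mu>: "\<mu> \<in> carrier R" "x \<otimes> \<mu> = \<mu> \<otimes> x"
    and l: "l \<in> Units R" "x \<otimes> l = l \<otimes> x" "\<mu> \<otimes> l = l \<otimes> \<mu>"
    and eq: "x \<otimes> (x \<otimes> x \<oplus> \<mu> \<otimes> x \<ominus> \<one>) = l \<otimes> (x \<otimes> x \<oplus> \<mu> \<otimes> x \<ominus> \<one>)"
  shows "x \<in> Units R"
proof -
  have lc: "l \<in> carrier R" using l(1) by (rule Units_closed)
  define y where "y = \<one> \<oplus> l \<otimes> (x \<oplus> \<mu>) \<ominus> (x \<otimes> x \<oplus> \<mu> \<otimes> x)"
  have y: "y \<in> carrier R" using x \<mu> lc by (simp add: y_def)
  define p where "p = x \<otimes> x \<oplus> \<mu> \<otimes> x"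
  have pc: "p \<in> carrier R" using x \<mu> by (simp add: p_def)
  have xp: "x \<otimes> p = p \<otimes> x" using x \<mu> by (simp add: p_def r_distr l_distr m_assoc[symmetric])
  have lp: "x \<otimes> (l \<otimes> (x \<oplus> \<mu>)) = l \<otimes> p" "l \<otimes> (x \<oplus> \<mu>) \<otimes> x = l \<otimes> p"
    using x \<mu> lc l(2) by (simp_all add: p_def r_distr l_distr m_assoc[symmetric]) (simp add: m_assoc \<mu>(2))
  have e: "x \<otimes> p \<ominus> x = l \<otimes> p \<ominus> l"
    using eq x lc pc by (simp add: p_def[symmetric] minus_eq r_distr r_minus)
  have "x \<otimes> y = x \<oplus> l \<otimes> p \<ominus> x \<otimes> p"
    using x \<mu> lc pc lp by (simp add: y_def p_def[symmetric] minus_eq r_distr r_minus)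
  also have "\<dots> = l \<otimes> p \<ominus> (x \<otimes> p \<ominus> x)"
    using x lc pc by (simp add: minus_eq minus_add a_ac)
  also have "\<dots> = l" unfolding e using x lc pc by (simp add: minus_eq minus_add r_neg2)
  finally have xy: "x \<otimes> y = l" .
  have "y \<otimes> x = x \<oplus> l \<otimes> p \<ominus> x \<otimes> p"
    using x \<mu> lc pc lp xp by (simp add: y_def p_def[symmetric] minus_eq l_distr l_minus)
  also have "\<dots> = x \<otimes> y"
    using x \<mu> lc pc lp by (simp add: y_def p_def[symmetric] minus_eq r_distr r_minus)
  finally have yx: "y \<otimes> x = l" using xy by simp
  have "x \<otimes> (y \<otimes> inv l) = \<one>" using xy x y l by (simp add: m_assoc[symmetric])
  moreover have "(inv l \<otimes> y) \<otimes> x = \<one>" using yx x y l by (simp add: m_assoc)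
  moreover have "inv l \<otimes> y = y \<otimes> inv l"
  proof -
    have "(inv l \<otimes> y) \<otimes> (x \<otimes> (y \<otimes> inv l)) = (inv l \<otimes> y) \<otimes> x \<otimes> (y \<otimes> inv l)"
      using x y l by (simp add: m_assoc)
    then show ?thesis using calculation x y l by simp
  qed
  moreover have "y \<otimes> inv l \<in> carrier R" using y l(1) by simp
  ultimately show ?thesis using x unfolding Units_def by auto
qed

section \<open>Braid and BMW relations for the operators \<open>sig\<close>\<close>

context hecke_rep
begin

lemma scalar_action_V: "scalar_action Z V"
proof
  fix z v w assume "z \<in> carrier Z" "v \<in> carrier V" "w \<in> carrier V"
  then show "z \<odot>\<^bsub>V\<^esub> v \<in> carrier V" by (intro V_smult_closed)
  show "z \<odot>\<^bsub>V\<^esub> (v \<oplus>\<^bsub>V\<^esub> w) = z \<odot>\<^bsub>V\<^esub> v \<oplus>\<^bsub>V\<^esub> z \<odot>\<^bsub>V\<^esub> w"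
    using \<open>z \<in> carrier Z\<close> \<open>v \<in> carrier V\<close> \<open>w \<in> carrier V\<close>
    by (auto simp: free_right_module_smult free_right_module_add l_distr fun_eq_iff)
qed

lemma sig_add:
  assumes "i \<in> nodes M" "v \<in> carrier V" "w \<in> carrier V"
  shows "sig i (v \<oplus>\<^bsub>V\<^esub> w) = sig i v \<oplus>\<^bsub>V\<^esub> sig i w"
proof -
  have "e (simple_root i) (L \<otimes> t i (v \<oplus>\<^bsub>V\<^esub> w)) = e (simple_root i) (L \<otimes> t i v) \<oplus>\<^bsub>V\<^esub> e (simple_root i) (L \<otimes> t i w)"
    using assms by (simp add: t_add r_distr single_add)
  then show ?thesis using assms by (simp add: sig_def tau'_add V.a_ac)
qed

lemma smult_e: "a \<in> carrier Z \<Longrightarrow> b \<in> carrier Z \<Longrightarrow> a \<odot>\<^bsub>V\<^esub> e \<beta> b = e \<beta> (b \<otimes> a)"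
  by (auto simp: free_right_module_smult single_def)

lemma sig_rmul:
  assumes "i \<in> nodes M" "v \<in> carrier V" "a \<in> carrier Z"
  shows "sig i (a \<odot>\<^bsub>V\<^esub> v) = a \<odot>\<^bsub>V\<^esub> sig i v"
  using assms scalar_action.smult_add[OF scalar_action_V, of a "tau' i v"]
  by (simp add: sig_def tau'_rmul t_rmul smult_e m_assoc)

lemma ip_simple_adj: "i \<in> nodes M \<Longrightarrow> j \<in> nodes M \<Longrightarrow> adj M i j \<Longrightarrow> ip i (simple_root j) = - 1"
  using adj_irrefl by (auto simp: inner_form_simple_simple cartan_def)

lemma ip_simple_nonadj: "i \<in> nodes M \<Longrightarrow> j \<in> nodes M \<Longrightarrow> i \<noteq> j \<Longrightarrow> \<not> adj M i j \<Longrightarrow> ip i (simple_root j) = 0"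
  by (auto simp: inner_form_simple_simple cartan_def)

lemma sum_root:
  assumes "i \<in> nodes M" "j \<in> nodes M" "adj M i j"
  shows "refl i (simple_root j) \<in> Phi_pos" "refl j (simple_root i) = refl i (simple_root j)"
    "ip i (refl i (simple_root j)) = 1" "refl i (refl i (simple_root j)) = simple_root j"
    "refl i (simple_root j) \<noteq> simple_root i"
proof -
  have a: "adj M j i" using assms by (simp add: adj_sym)
  show "ip i (refl i (simple_root j)) = 1"
    using ip_simple_adj[OF assms] assms by (simp add: inner_form_simple_reflect_self)
  then show "refl i (simple_root j) \<noteq> simple_root i" using assms by (auto simp: inner_form_simple_simple)
  show "refl j (simple_root i) = refl i (simple_root j)"
    using ip_simple_adj[OF assms] ip_simple_adj[OF assms(2,1) a] by (simp add: reflect_eq_add add.commute)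
  have "simple_root j \<noteq> simple_root i" using adj_irrefl assms minus_simple_root_eq_iff by metis
  then show "refl i (simple_root j) \<in> Phi_pos" using assms by (intro reflect_Phi_pos) auto
qed (use assms in simp)

text \<open>The adjacency identity evaluated at \<open>simple_root i\<close>: on one side
  \<open>tau' i\<close> kills the basis vector, on the other \<open>tau' j\<close> yields the sum
  root minus \<open>m\<close> times the simple root.\<close>

lemma T_sum_root:
  assumes "i \<in> nodes M" "j \<in> nodes M" "adj M i j"
  shows "T i (refl i (simple_root j)) = m"
proof -
  have a: "adj M j i" using assms by (simp add: adj_sym)
  have "T_tau T i j (simple_root i) = T_tau T j i (simple_root i)" using assms by (intro T_adj) auto
  moreover have "ip i (simple_root i) = 2" using assms by (simp add: inner_form_simple_simple)
  ultimately have "T i (refl j (simple_root i)) \<ominus> m = \<zero>"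
    using assms ip_simple_adj[OF assms(2,1) a] by (simp add: T_tau_def T_simple)
  then show ?thesis using assms sum_root[OF assms] by (metis T_closed m_closed' r_right_minus_eq)
qed

lemma sig_e_self:
  assumes "i \<in> nodes M" "a \<in> carrier Z"
  shows "sig i (e (simple_root i) a) = e (simple_root i) (L \<otimes> a)"
  using assms by (simp add: sig_def tau'_e inner_form_simple_simple t_e T_simple)

lemma sig_e_adj:
  assumes "i \<in> nodes M" "j \<in> nodes M" "adj M i j" "a \<in> carrier Z"
  shows "sig i (e (simple_root j) a) = e (refl i (simple_root j)) a \<oplus>\<^bsub>V\<^esub> e (simple_root j) (\<ominus> (m \<otimes> a))"
proof -
  have "i \<noteq> j" using assms adj_irrefl by auto
  moreover have "e (simple_root i) \<zero> = \<zero>\<^bsub>V\<^esub>" by (auto simp: single_def free_right_module_zero)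
  ultimately show ?thesis using assms by (simp add: sig_def tau'_e ip_simple_adj t_e T_simple)
qed

lemma sig_e_nonadj:
  assumes "i \<in> nodes M" "j \<in> nodes M" "i \<noteq> j" "\<not> adj M i j" "a \<in> carrier Z"
  shows "sig i (e (simple_root j) a) = e (simple_root j) (h (simple_root j) i \<otimes> a)"
proof -
  have "e (simple_root i) \<zero> = \<zero>\<^bsub>V\<^esub>" by (auto simp: single_def free_right_module_zero)
  then show ?thesis using assms by (simp add: sig_def tau'_e ip_simple_nonadj t_e T_simple)
qed

lemma sig_e_sum:
  assumes "i \<in> nodes M" "j \<in> nodes M" "adj M i j" "a \<in> carrier Z"
  shows "sig i (e (refl i (simple_root j)) a) = e (simple_root j) a \<oplus>\<^bsub>V\<^esub> e (simple_root i) (L \<otimes> (m \<otimes> a))"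
  using assms sum_root[OF assms(1-3)] by (simp add: sig_def tau'_e t_e T_sum_root)

lemma L_left_commute: "x \<in> carrier Z \<Longrightarrow> y \<in> carrier Z \<Longrightarrow> x \<otimes> (L \<otimes> y) = L \<otimes> (x \<otimes> y)"
  by (simp add: m_assoc[symmetric] L_central)

text \<open>The correction terms on the right are symmetric in \<open>i\<close> and
  \<open>j\<close>, which reduces commutation of \<open>sig\<close> to that of
  \<open>tau'\<close>.\<close>

lemma sig_sig_nonadj:
  assumes "i \<in> nodes M" "j \<in> nodes M" "i \<noteq> j" "\<not> adj M i j" "v \<in> carrier V"
  shows "sig i (sig j v) = tau' i (tau' j v) \<oplus>\<^bsub>V\<^esub> (e (simple_root i) (L \<otimes> (h (simple_root i) j \<otimes> t i v))
    \<oplus>\<^bsub>V\<^esub> e (simple_root j) (L \<otimes> (h (simple_root j) i \<otimes> t j v)))"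
proof -
  have a: "\<not> adj M j i" using assms by (simp add: adj_sym)
  have h: "h (simple_root i) j \<in> carrier Z" "h (simple_root j) i \<in> carrier Z"
    using assms a by (simp_all add: ip_simple_nonadj)
  have "sig i (sig j v) = sig i (tau' j v) \<oplus>\<^bsub>V\<^esub> sig i (e (simple_root j) (L \<otimes> t j v))"
    using assms by (simp add: sig_def[of j] sig_add)
  also have "sig i (tau' j v) = tau' i (tau' j v) \<oplus>\<^bsub>V\<^esub> e (simple_root i) (L \<otimes> (h (simple_root i) j \<otimes> t i v))"
    using assms by (simp add: sig_def t_tau'_nonadj)
  also have "sig i (e (simple_root j) (L \<otimes> t j v)) = e (simple_root j) (L \<otimes> (h (simple_root j) i \<otimes> t j v))"
    using assms h by (simp add: sig_e_nonadj L_left_commute)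
  finally show ?thesis using assms h by (simp add: V.a_assoc)
qed

lemma sig_commute:
  assumes "i \<in> nodes M" "j \<in> nodes M" "i \<noteq> j" "\<not> adj M i j" "v \<in> carrier V"
  shows "sig i (sig j v) = sig j (sig i v)"
proof -
  have a: "\<not> adj M j i" using assms by (simp add: adj_sym)
  have h: "h (simple_root i) j \<in> carrier Z" "h (simple_root j) i \<in> carrier Z"
    using assms a by (simp_all add: ip_simple_nonadj)
  show ?thesis
    using assms a h sig_sig_nonadj[OF assms] sig_sig_nonadj[OF assms(2,1) assms(3)[symmetric] a assms(5)]
      tau'_commute[OF assms] by (simp add: V.a_comm)
qed

text \<open>Expanded until symmetry is visible: interchanging \<open>i\<close> and \<open>j\<close>
  exchanges \<open>a\<close> with \<open>b\<close>, while \<open>c\<close> and the sum root are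
  unchanged by \<open>t_tau'_adj\<close> and \<open>sum_root\<close>. What remains is the braid
  relation of \<open>tau'\<close>.\<close>

lemma sig_sig_sig:
  assumes ij: "i \<in> nodes M" "j \<in> nodes M" "adj M i j" and v: "v \<in> carrier V"
  defines "a \<equiv> L \<otimes> t i v" and "b \<equiv> L \<otimes> t j v" and "c \<equiv> L \<otimes> t j (tau' i v)"
  shows "sig i (sig j (sig i v)) = tau' i (tau' j (tau' i v)) \<oplus>\<^bsub>V\<^esub> (e (refl i (simple_root j)) c \<oplus>\<^bsub>V\<^esub>
    ((e (simple_root j) a \<oplus>\<^bsub>V\<^esub> e (simple_root i) b) \<oplus>\<^bsub>V\<^esub>
     (e (simple_root j) (\<ominus> (m \<otimes> c)) \<oplus>\<^bsub>V\<^esub> e (simple_root i) (\<ominus> (m \<otimes> c)))))"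
proof -
  have ji: "adj M j i" using ij by (simp add: adj_sym)
  have ac: "a \<in> carrier Z" "b \<in> carrier Z" "c \<in> carrier Z" using ij v by (simp_all add: a_def b_def c_def)
  let ?s = "refl i (simple_root j)"
  have 1: "sig j (sig i v) = tau' j (tau' i v) \<oplus>\<^bsub>V\<^esub> e (simple_root j) c \<oplus>\<^bsub>V\<^esub>
      (e ?s a \<oplus>\<^bsub>V\<^esub> e (simple_root i) (\<ominus> (m \<otimes> a)))"
  proof -
    have "sig j (sig i v) = sig j (tau' i v) \<oplus>\<^bsub>V\<^esub> sig j (e (simple_root i) a)"
      using ij v ac by (simp add: sig_def[of i] sig_add a_def)
    then show ?thesis using ij ji ac v sum_root[OF ij] by (simp add: sig_e_adj sig_def[of j "tau' i v"] c_def)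
  qed
  \<comment> \<open>The adjacency identity moves the outer node to \<open>i\<close>, which makes
    \<open>tau'_quadratic\<close> applicable; its defect at \<open>simple_root i\<close> is
    invisible to \<open>t j\<close>.\<close>
  have tt: "t i (tau' j (tau' i v)) = t j v \<ominus> m \<otimes> t j (tau' i v)"
  proof -
    have "t i (tau' j (tau' i v)) = t j (tau' i (tau' i v))" using ij v by (intro t_tau'_adj) auto
    also have "\<dots> = t j v \<oplus> t j (tau' i v) \<otimes> (\<ominus> m)"
    proof -
      have "i \<noteq> j" using ij adj_irrefl by auto
      then show ?thesis unfolding tau'_quadratic[OF ij(1) v]
        using ij v by (simp add: t_add t_rmul t_e T_simple V_smult_closed)
    qed
    finally show ?thesis using ij v by (simp add: minus_eq r_minus m_central)
  qed
  have Ltt: "L \<otimes> t i (tau' j (tau' i v)) = b \<oplus> \<ominus> (m \<otimes> c)"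
    unfolding tt using ij v by (simp add: b_def c_def minus_eq r_distr r_minus m_left_commute)
  have cancel: "e (simple_root i) (L \<otimes> (m \<otimes> a)) \<oplus>\<^bsub>V\<^esub> e (simple_root i) (L \<otimes> (\<ominus> (m \<otimes> a))) = \<zero>\<^bsub>V\<^esub>"
    using ac by (simp add: single_add r_minus r_neg) (auto simp: single_def free_right_module_zero)
  have "sig i (sig j (sig i v)) = (sig i (tau' j (tau' i v)) \<oplus>\<^bsub>V\<^esub> sig i (e (simple_root j) c)) \<oplus>\<^bsub>V\<^esub>
      (sig i (e ?s a) \<oplus>\<^bsub>V\<^esub> sig i (e (simple_root i) (\<ominus> (m \<otimes> a))))"
    unfolding 1 using ij v ac by (simp add: sig_add)
  also have "sig i (tau' j (tau' i v)) = tau' i (tau' j (tau' i v)) \<oplus>\<^bsub>V\<^esub>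
      (e (simple_root i) b \<oplus>\<^bsub>V\<^esub> e (simple_root i) (\<ominus> (m \<otimes> c)))"
    using ij v ac by (simp add: sig_def[of i "tau' j (tau' i v)"] Ltt single_add)
  also have "sig i (e (simple_root j) c) = e ?s c \<oplus>\<^bsub>V\<^esub> e (simple_root j) (\<ominus> (m \<otimes> c))"
    using ij ac by (simp add: sig_e_adj)
  also have "sig i (e ?s a) \<oplus>\<^bsub>V\<^esub> sig i (e (simple_root i) (\<ominus> (m \<otimes> a))) = e (simple_root j) a"
    using ij ac cancel by (simp add: sig_e_sum sig_e_self V.a_assoc)
  finally show ?thesis using ij v ac by (simp add: V.a_ac)
qed

lemma sig_braid:
  assumes "i \<in> nodes M" "j \<in> nodes M" "adj M i j" "v \<in> carrier V"
  shows "sig i (sig j (sig i v)) = sig j (sig i (sig j v))"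
proof -
  have ji: "adj M j i" using assms by (simp add: adj_sym)
  show ?thesis
    unfolding sig_sig_sig[OF assms] sig_sig_sig[OF assms(2,1) ji assms(4)]
    using assms tau'_braid[OF assms] t_tau'_adj[OF assms] sum_root[OF assms(1-3)] by (simp add: V.a_ac)
qed

text \<open>The functional through which \<open>quad i\<close> factors. The first summand is the
  defect of \<open>tau'_quadratic\<close>, the others come from the rank one part of
  \<open>sig\<close>; outside \<open>simple_root i\<close> everything cancels
  (\<open>quad_eq\<close>).\<close>

definition phi :: "nat \<Rightarrow> (root \<Rightarrow> 'a) \<Rightarrow> 'a" where
  "phi i v = \<ominus> v (simple_root i) \<oplus> L \<otimes> t i (tau' i v) \<oplus> L \<otimes> (L \<otimes> t i v) \<oplus> m \<otimes> (L \<otimes> t i v)"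

lemma phi_closed [simp]: "i \<in> nodes M \<Longrightarrow> v \<in> carrier V \<Longrightarrow> phi i v \<in> carrier Z"
  by (simp add: phi_def)

definition quad :: "nat \<Rightarrow> (root \<Rightarrow> 'a) \<Rightarrow> root \<Rightarrow> 'a" where
  "quad i v = sig i (sig i v) \<oplus>\<^bsub>V\<^esub> m \<odot>\<^bsub>V\<^esub> sig i v \<ominus>\<^bsub>V\<^esub> v"

lemma V_minus_apply: "v \<in> carrier V \<Longrightarrow> \<gamma> \<in> Phi_pos \<Longrightarrow> (\<ominus>\<^bsub>V\<^esub> v) \<gamma> = \<ominus> v \<gamma>"
  by (metis V.a_inv_closed V.l_neg V_add_apply V_closed V_zero_apply minus_equality)

lemma V_smult_apply: "\<gamma> \<in> Phi_pos \<Longrightarrow> (a \<odot>\<^bsub>V\<^esub> v) \<gamma> = v \<gamma> \<otimes> a"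
  by (simp add: free_right_module_smult)

lemma quad_eq:
  assumes i: "i \<in> nodes M" and v: "v \<in> carrier V"
  shows "quad i v = e (simple_root i) (phi i v)"
proof (rule V_eqI)
  fix \<gamma> assume \<gamma>: "\<gamma> \<in> Phi_pos"
  let ?a = "L \<otimes> t i v" and ?b = "L \<otimes> t i (tau' i v)" and ?\<alpha> = "simple_root i"
  have sum: "sig i (sig i v) = tau' i (tau' i v) \<oplus>\<^bsub>V\<^esub> e ?\<alpha> ?b \<oplus>\<^bsub>V\<^esub> e ?\<alpha> (L \<otimes> ?a)"
  proof -
    have "sig i (sig i v) = sig i (tau' i v) \<oplus>\<^bsub>V\<^esub> sig i (e ?\<alpha> ?a)"
      using i v by (simp add: sig_def[of i v] sig_add)
    then show ?thesis using i v by (simp add: sig_e_self sig_def[of i "tau' i v"])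
  qed
  have c: "v \<gamma> \<in> carrier Z" "tau' i v \<gamma> \<in> carrier Z" "?a \<in> carrier Z" "?b \<in> carrier Z" using i v \<gamma> by auto
  have val: "quad i v \<gamma> = (v \<gamma> \<oplus> tau' i v \<gamma> \<otimes> (\<ominus> m) \<oplus> e ?\<alpha> (\<ominus> v ?\<alpha>) \<gamma>) \<oplus> e ?\<alpha> ?b \<gamma> \<oplus> e ?\<alpha> (L \<otimes> ?a) \<gamma>
      \<oplus> (tau' i v \<gamma> \<oplus> e ?\<alpha> ?a \<gamma>) \<otimes> m \<oplus> \<ominus> v \<gamma>"
    using i v \<gamma> unfolding quad_def sum tau'_quadratic[OF i v] a_minus_def
    by (simp add: V_minus_apply V_smult_apply sig_def)
  show "quad i v \<gamma> = e ?\<alpha> (phi i v) \<gamma>"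
  proof (cases "\<gamma> = ?\<alpha>")
    case True
    then show ?thesis unfolding val using i v \<gamma> c
      by (simp add: e_apply phi_def tau'_simple_apply l_distr m_central[of ?a])
         (simp add: a_ac r_neg r_neg1 r_neg2)
  next
    case False
    then show ?thesis unfolding val using i v \<gamma> c
      by (simp add: e_apply r_minus) (simp add: a_ac r_neg r_neg1 r_neg2)
  qed
qed (use assms in \<open>auto simp: quad_def V_smult_closed\<close>)

lemma sig_quad: "i \<in> nodes M \<Longrightarrow> v \<in> carrier V \<Longrightarrow> sig i (quad i v) = L \<odot>\<^bsub>V\<^esub> quad i v"
  by (simp add: quad_eq sig_e_self smult_e L_central)

lemma phi_e_nonadj:
  assumes "i \<in> nodes M" "j \<in> nodes M" "i \<noteq> j" "\<not> adj M i j" "a \<in> carrier Z"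
  shows "phi i (e (simple_root j) a) = \<zero>"
proof -
  have "simple_root i \<noteq> simple_root j" using assms minus_simple_root_eq_iff by metis
  then show ?thesis using assms
    by (simp add: phi_def e_apply tau'_e ip_simple_nonadj t_e T_simple)
qed

lemma quad_quad_nonadj:
  assumes "i \<in> nodes M" "j \<in> nodes M" "i \<noteq> j" "\<not> adj M i j" "v \<in> carrier V"
  shows "quad i (quad j v) = \<zero>\<^bsub>V\<^esub>"
  using assms by (simp add: quad_eq phi_e_nonadj) (auto simp: single_def free_right_module_zero)

text \<open>\<open>sig j\<close> sends the basis vector to the sum root minus \<open>m\<close> times
  the simple root. On this, \<open>t i\<close> gives \<open>m - m = 0\<close>, and
  \<open>tau' i\<close> leaves only the basis vector of \<open>simple_root j\<close>, again killed
  by \<open>t i\<close>; so only the negated coordinate at \<open>simple_root i\<close>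
  contributes.\<close>

lemma phi_sig_e_adj:
  assumes "i \<in> nodes M" "j \<in> nodes M" "adj M i j" "a \<in> carrier Z"
  shows "phi i (sig j (e (simple_root i) a)) = m \<otimes> a"
proof -
  have ji: "adj M j i" "i \<noteq> j" using assms adj_irrefl by (auto simp: adj_sym)
  note s = sum_root[OF assms(1-3)]
  let ?w = "e (refl i (simple_root j)) a \<oplus>\<^bsub>V\<^esub> e (simple_root i) (\<ominus> (m \<otimes> a))"
  have w: "sig j (e (simple_root i) a) = ?w" using assms ji s by (simp add: sig_e_adj)
  have t: "t i ?w = \<zero>" using assms s by (simp add: t_add t_e T_sum_root T_simple r_neg)
  have "tau' i ?w = e (simple_root j) a"
    using assms s by (simp add: tau'_add tau'_e inner_form_simple_simple)
  then have tt: "t i (tau' i ?w) = \<zero>" using assms ji by (simp add: t_e T_simple)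
  have "?w (simple_root i) = \<ominus> (m \<otimes> a)" using assms s by (simp add: e_apply)
  then show ?thesis unfolding w phi_def t tt using assms by simp
qed

lemma quad_sig_quad_adj:
  assumes "i \<in> nodes M" "j \<in> nodes M" "adj M i j" "v \<in> carrier V"
  shows "quad i (sig j (quad i v)) = m \<odot>\<^bsub>V\<^esub> quad i v"
proof -
  have "quad i (sig j (quad i v)) = e (simple_root i) (phi i (sig j (e (simple_root i) (phi i v))))"
    using assms quad_eq[of i "sig j (quad i v)"] by (simp add: quad_eq)
  then show ?thesis using assms by (simp add: phi_sig_e_adj quad_eq smult_e m_central)
qed

end

subsection \<open>Free algebras and their quotients\<close>

lemma K_ring_simps [simp]:
  "carrier K_ring = UNIV" "a \<otimes>\<^bsub>K_ring\<^esub> b = a * b" "\<one>\<^bsub>K_ring\<^esub> = 1" "\<zero>\<^bsub>K_ring\<^esub> = 0" "a \<oplus>\<^bsub>K_ring\<^esub> b = a + b"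
  by (simp_all add: K_ring_def)

lemma ring_K_ring: "ring K_ring"
proof (rule ringI)
  show "abelian_group K_ring"
    by (rule abelian_groupI) (auto simp: algebra_simps intro: exI[of _ "- x" for x])
  show "monoid K_ring" by (rule monoidI) (auto simp: algebra_simps)
qed (auto simp: algebra_simps)

definition coeff_ring :: "ratfun set \<Rightarrow> bool" where
  "coeff_ring R \<longleftrightarrow> 0 \<in> R \<and> 1 \<in> R \<and> (\<forall>a\<in>R. - a \<in> R) \<and> (\<forall>a\<in>R. \<forall>b\<in>R. a + b \<in> R \<and> a * b \<in> R)"

lemma coeff_ring_generate: "coeff_ring (generate_ring K_ring H)"
proof -
  interpret K: ring K_ring by (rule ring_K_ring)
  have minus: "\<ominus>\<^bsub>K_ring\<^esub> a = - a" for a by (rule K.minus_equality) auto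
  have "subring (generate_ring K_ring H) K_ring" by (rule K.generate_ring_is_subring) simp
  then show ?thesis
    using subringE[of "generate_ring K_ring H" K_ring] by (auto simp: coeff_ring_def minus)
qed

lemma coeff_ring_Q_m: "coeff_ring Q_m" and coeff_ring_Q_l_m: "coeff_ring Q_l_m" and coeff_ring_UNIV: "coeff_ring UNIV"
  by (auto simp: Q_m_def Q_l_m_def coeff_ring_generate) (simp add: coeff_ring_def)

lemma Q_generators: "m_par \<in> Q_m" "m_par \<in> Q_l_m" "l_ind \<in> Q_l_m" "inverse l_ind \<in> Q_l_m"
  unfolding Q_m_def Q_l_m_def by (auto intro: generate_ring.incl)

lemma Q_m_subset: "Q_m \<subseteq> Q_l_m"
proof -
  interpret K: ring K_ring by (rule ring_K_ring)
  show ?thesis unfolding Q_m_def Q_l_m_def by (rule K.mono_generate_ring) auto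
qed

lemma l_ind_nonzero: "l_ind \<noteq> 0"
  by (simp add: l_ind_def Zero_fract_def eq_fract)

lemma x_ind_not_1: "x_ind \<noteq> 1"
  by (simp add: x_ind_def One_fract_def eq_fract one_pCons)

text \<open>Permits the factor \<open>l_ind / m_par\<close> in the image of the generators
  \<open>E i\<close>.\<close>

lemma m_par_nonzero: "m_par \<noteq> 0"
proof -
  have "l_ind * l_ind \<noteq> 1"
    by (simp add: l_ind_def One_fract_def eq_fract one_pCons)
  then have "l_ind \<noteq> inverse l_ind" using l_ind_nonzero by (metis right_inverse)
  then show ?thesis using x_ind_not_1 by (simp add: m_par_def)
qed

lemma poly_mapping_sum_singles:
  "p = (\<Sum>w\<in>Poly_Mapping.keys p. Poly_Mapping.single w (Poly_Mapping.lookup p w))"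
proof (rule poly_mapping_eqI)
  fix k
  have "(\<Sum>w\<in>Poly_Mapping.keys p. Poly_Mapping.lookup (Poly_Mapping.single w (Poly_Mapping.lookup p w)) k) =
      (\<Sum>w\<in>Poly_Mapping.keys p. if w = k then Poly_Mapping.lookup p w else 0)"
    by (intro sum.cong) (auto simp: lookup_single when_def)
  also have "\<dots> = Poly_Mapping.lookup p k" by (simp add: in_keys_iff)
  finally show "Poly_Mapping.lookup p k =
      Poly_Mapping.lookup (\<Sum>w\<in>Poly_Mapping.keys p. Poly_Mapping.single w (Poly_Mapping.lookup p w)) k"
    by (simp add: lookup_sum)
qed

lemma const_central:
  fixes p :: "'g fpoly"
  shows "const c * p = p * const c"
proof -
  have "const c * Poly_Mapping.single w a = Poly_Mapping.single w a * const c" for w :: "'g word" and a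
    by (simp add: const_def mult_single mult.commute)
  then show ?thesis
    by (subst (1 2) poly_mapping_sum_singles[of p]) (simp add: sum_distrib_left sum_distrib_right)
qed

lemma const_mult: "const c * const d = const (c * d)"
  and const_add: "const c + const d = const (c + d)"
  and const_1: "const 1 = 1"
  and const_single: "const c * Poly_Mapping.single w a = Poly_Mapping.single w (c * a)"
  by (simp_all add: const_def mult_single Poly_Mapping.single_add)

lemma free_algebra_simps:
  "a \<otimes>\<^bsub>free_algebra R S\<^esub> b = a * b" "\<one>\<^bsub>free_algebra R S\<^esub> = 1" "\<zero>\<^bsub>free_algebra R S\<^esub> = 0"
  "a \<oplus>\<^bsub>free_algebra R S\<^esub> b = a + b" "c \<odot>\<^bsub>free_algebra R S\<^esub> a = const c * a"
  by (simp_all add: free_algebra_def)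

lemma free_algebra_carrier:
  "p \<in> carrier (free_algebra R S) \<longleftrightarrow>
    Poly_Mapping.keys p \<subseteq> Word ` lists S \<and> (\<forall>w. Poly_Mapping.lookup p w \<in> R)"
  by (simp add: free_algebra_def)

lemma free_algebra_mono:
  "R \<subseteq> R' \<Longrightarrow> carrier (free_algebra R S) \<subseteq> carrier (free_algebra R' S)"
  by (auto simp: free_algebra_carrier subset_iff)

context
  fixes R :: "ratfun set" and S :: "'g set"
  assumes R: "coeff_ring R"
begin

lemma free_algebra_single:
  "w \<in> lists S \<Longrightarrow> c \<in> R \<Longrightarrow> Poly_Mapping.single (Word w) c \<in> carrier (free_algebra R S)"
  using R by (auto simp: free_algebra_carrier lookup_single when_def coeff_ring_def)

lemma free_algebra_add:
  "p \<in> carrier (free_algebra R S) \<Longrightarrow> q \<in> carrier (free_algebra R S) \<Longrightarrow> p + q \<in> carrier (free_algebra R S)"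
  using R keys_add[of p q] by (auto simp: free_algebra_carrier lookup_add coeff_ring_def)

lemma free_algebra_0: "0 \<in> carrier (free_algebra R S)"
  using R by (auto simp: free_algebra_carrier coeff_ring_def)

lemma free_algebra_sum:
  "finite A \<Longrightarrow> (\<And>a. a \<in> A \<Longrightarrow> f a \<in> carrier (free_algebra R S)) \<Longrightarrow> sum f A \<in> carrier (free_algebra R S)"
  by (induction A rule: finite_induct) (auto simp: free_algebra_0 free_algebra_add)

lemma free_algebra_const: "c \<in> R \<Longrightarrow> const c \<in> carrier (free_algebra R S)"
  unfolding const_def zero_word_def by (rule free_algebra_single) auto

lemma free_algebra_gen: "g \<in> S \<Longrightarrow> gen g \<in> carrier (free_algebra R S)"
  using R unfolding gen_def by (intro free_algebra_single) (auto simp: coeff_ring_def)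

lemma free_algebra_minus: "p \<in> carrier (free_algebra R S) \<Longrightarrow> - p \<in> carrier (free_algebra R S)"
  using R by (auto simp: free_algebra_carrier coeff_ring_def)

lemma free_algebra_mult:
  assumes "p \<in> carrier (free_algebra R S)" "q \<in> carrier (free_algebra R S)"
  shows "p * q \<in> carrier (free_algebra R S)"
proof -
  have "p * q = (\<Sum>w\<in>Poly_Mapping.keys p. \<Sum>w'\<in>Poly_Mapping.keys q.
      Poly_Mapping.single (w + w') (Poly_Mapping.lookup p w * Poly_Mapping.lookup q w'))"
    by (subst poly_mapping_sum_singles[of p], subst poly_mapping_sum_singles[of q])
       (simp add: sum_distrib_left sum_distrib_right mult_single sum.swap[of _ "Poly_Mapping.keys q"])
  moreover have "Poly_Mapping.single (w + w') (Poly_Mapping.lookup p w * Poly_Mapping.lookup q w') \<in> carrier (free_algebra R S)"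
    if "w \<in> Poly_Mapping.keys p" "w' \<in> Poly_Mapping.keys q" for w w'
  proof -
    have "w \<in> Word ` lists S" "w' \<in> Word ` lists S"
      using that assms unfolding free_algebra_carrier by blast+
    then obtain u u' where u: "w = Word u" "u \<in> lists S" "w' = Word u'" "u' \<in> lists S" by blast
    have "Poly_Mapping.lookup p w * Poly_Mapping.lookup q w' \<in> R"
      using assms R by (simp add: free_algebra_carrier coeff_ring_def)
    then show ?thesis using u by (simp add: free_algebra_single)
  qed
  ultimately show ?thesis by (simp add: free_algebra_sum)
qed

lemma ring_free_algebra: "ring (free_algebra R S)"
proof (rule ringI)
  show "abelian_group (free_algebra R S)"
  proof (rule abelian_groupI)
    fix p assume "p \<in> carrier (free_algebra R S)"
    then show "\<exists>q\<in>carrier (free_algebra R S). q \<oplus>\<^bsub>free_algebra R S\<^esub> p = \<zero>\<^bsub>free_algebra R S\<^esub>"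
      by (intro bexI[of _ "- p"]) (auto simp: free_algebra_simps free_algebra_minus)
  qed (auto simp: free_algebra_simps free_algebra_add free_algebra_0)
  show "monoid (free_algebra R S)"
    using free_algebra_const[of 1] R
    by (intro monoidI) (auto simp: free_algebra_simps free_algebra_mult mult.assoc const_1 coeff_ring_def)
qed (auto simp: free_algebra_simps algebra_simps)

lemma free_algebra_uminus: "p \<in> carrier (free_algebra R S) \<Longrightarrow> \<ominus>\<^bsub>free_algebra R S\<^esub> p = - p"
  using abelian_group.minus_equality[OF ring.is_abelian_group[OF ring_free_algebra], of "- p" p]
  by (simp add: free_algebra_simps free_algebra_minus)

lemma free_algebra_diff:
  "p \<in> carrier (free_algebra R S) \<Longrightarrow> q \<in> carrier (free_algebra R S) \<Longrightarrow> p - q \<in> carrier (free_algebra R S)"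
  using free_algebra_add[of p "- q"] by (simp add: free_algebra_minus)

lemma free_algebra_1: "1 \<in> carrier (free_algebra R S)"
  using ring.ring_simprules(6)[OF ring_free_algebra] by (simp add: free_algebra_simps)

lemma free_algebra_power2: "p \<in> carrier (free_algebra R S) \<Longrightarrow> p ^ 2 \<in> carrier (free_algebra R S)"
  by (simp add: power2_eq_square free_algebra_mult)

end

lemma free_algebra_induct [consumes 2, case_names zero single add]:
  assumes R: "coeff_ring R" and "p \<in> carrier (free_algebra R S)"
    and "P 0" and single: "\<And>w c. w \<in> lists S \<Longrightarrow> c \<in> R \<Longrightarrow> P (Poly_Mapping.single (Word w) c)"
    and add: "\<And>p q. p \<in> carrier (free_algebra R S) \<Longrightarrow> q \<in> carrier (free_algebra R S) \<Longrightarrow> P p \<Longrightarrow> P q \<Longrightarrow> P (p + q)"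
  shows "P p"
proof -
  let ?f = "\<lambda>w. Poly_Mapping.single w (Poly_Mapping.lookup p w)"
  have f: "?f w \<in> carrier (free_algebra R S) \<and> P (?f w)" if w: "w \<in> Poly_Mapping.keys p" for w
  proof -
    have "w \<in> Word ` lists S" using assms(2) w unfolding free_algebra_carrier by blast
    then obtain u where u: "w = Word u" "u \<in> lists S" by blast
    have c: "Poly_Mapping.lookup p w \<in> R" using assms(2) by (simp add: free_algebra_carrier)
    show ?thesis using free_algebra_single[OF R u(2) c] single[OF u(2) c] u(1) by simp
  qed
  have "sum ?f A \<in> carrier (free_algebra R S) \<and> P (sum ?f A)" if "finite A" "A \<subseteq> Poly_Mapping.keys p" for A
    using that
  proof (induction A rule: finite_induct)
    case (insert w A)
    then show ?case using f[of w] by (auto intro: add free_algebra_add[OF R])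
  qed (simp add: assms(3) free_algebra_0[OF R])
  from this[of "Poly_Mapping.keys p"] show ?thesis using poly_mapping_sum_singles[of p] by simp
qed

text \<open>Scalars act through ring elements \<open>\<iota> c\<close>, so ideals are stable under
  scalars automatically and a quotient is again of this kind; this lets \<open>quot_algebra\<close>
  be applied twice.\<close>

locale scalar_algebra = ring A for A :: "('k, 'a) module" (structure) +
  fixes K :: "'k set" and \<iota> :: "'k \<Rightarrow> 'a"
  assumes scalar_closed [simp]: "c \<in> K \<Longrightarrow> \<iota> c \<in> carrier A"
    and smult_eq: "c \<in> K \<Longrightarrow> a \<in> carrier A \<Longrightarrow> c \<odot>\<^bsub>A\<^esub> a = \<iota> c \<otimes> a"

lemma scalar_algebra_free_algebra:
  assumes "coeff_ring R"
  shows "scalar_algebra (free_algebra R S) R const"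
  by (intro scalar_algebra.intro ring_free_algebra assms)
     (unfold_locales, auto simp: free_algebra_simps free_algebra_const[OF assms])

lemma quot_algebra_simps:
  "carrier (quot_algebra A I) = carrier (A Quot I)"
  "X \<otimes>\<^bsub>quot_algebra A I\<^esub> Y = X \<otimes>\<^bsub>A Quot I\<^esub> Y" "\<one>\<^bsub>quot_algebra A I\<^esub> = \<one>\<^bsub>A Quot I\<^esub>"
  "\<zero>\<^bsub>quot_algebra A I\<^esub> = \<zero>\<^bsub>A Quot I\<^esub>" "X \<oplus>\<^bsub>quot_algebra A I\<^esub> Y = X \<oplus>\<^bsub>A Quot I\<^esub> Y"
  "c \<odot>\<^bsub>quot_algebra A I\<^esub> X = (\<Union>a\<in>X. I +>\<^bsub>A\<^esub> (c \<odot>\<^bsub>A\<^esub> a))"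
  by (simp_all add: quot_algebra_def)

lemma ring_transfer:
  assumes "ring A" "carrier B = carrier A" "monoid.mult B = monoid.mult A" "monoid.one B = monoid.one A"
    "ring.zero B = ring.zero A" "ring.add B = ring.add A"
  shows "ring B"
proof -
  interpret ring A by (rule assms)
  show ?thesis
  proof (rule ringI)
    show "abelian_group B"
      by (rule abelian_groupI) (auto simp: assms(2-) a_ac intro!: bexI[of _ "\<ominus>\<^bsub>A\<^esub> x" for x] l_neg)
    show "monoid B" by (rule monoidI) (auto simp: assms(2-) m_assoc)
  qed (auto simp: assms(2-) l_distr r_distr)
qed

locale scalar_algebra_ideal = scalar_algebra + ideal I A for I
begin

abbreviation Q where "Q \<equiv> quot_algebra A I"

lemma ring_quot: "ring Q"
  by (rule ring_transfer[OF quotient_is_ring]) (auto simp: quot_algebra_def)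

lemma quot_carrier: "X \<in> carrier Q \<longleftrightarrow> (\<exists>a\<in>carrier A. X = I +> a)"
  by (auto simp: quot_algebra_simps FactRing_def A_RCOSETS_def' a_r_coset_def)

lemma coset_closed [simp]: "a \<in> carrier A \<Longrightarrow> I +> a \<in> carrier Q"
  using quot_carrier by blast

lemma coset_hom: "(\<lambda>a. I +> a) \<in> ring_hom A Q"
  using rcos_ring_hom by (auto simp: ring_hom_def quot_algebra_simps)

lemma coset_mult: "a \<in> carrier A \<Longrightarrow> b \<in> carrier A \<Longrightarrow> (I +> a) \<otimes>\<^bsub>Q\<^esub> (I +> b) = I +> (a \<otimes> b)"
  and coset_add: "a \<in> carrier A \<Longrightarrow> b \<in> carrier A \<Longrightarrow> (I +> a) \<oplus>\<^bsub>Q\<^esub> (I +> b) = I +> (a \<oplus> b)"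
  and coset_one: "\<one>\<^bsub>Q\<^esub> = I +> \<one>"
  using coset_hom by (auto simp: ring_hom_def)

lemma coset_eq_iff: "a \<in> carrier A \<Longrightarrow> b \<in> carrier A \<Longrightarrow> I +> a = I +> b \<longleftrightarrow> a \<ominus> b \<in> I"
  using quotient_eq_iff_same_a_r_cos[OF is_ideal] by metis

lemma smult_coset:
  assumes c: "c \<in> K" and a: "a \<in> carrier A"
  shows "c \<odot>\<^bsub>Q\<^esub> (I +> a) = I +> (\<iota> c \<otimes> a)"
proof -
  have "I +> (c \<odot>\<^bsub>A\<^esub> b) = I +> (\<iota> c \<otimes> a)" if b: "b \<in> I +> a" for b
  proof -
    obtain y where y: "y \<in> I" "b = y \<oplus> a" using b by (auto simp: a_r_coset_def')
    then have bc: "b \<in> carrier A" using a Icarr by simp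
    have "\<iota> c \<otimes> b \<ominus> \<iota> c \<otimes> a = \<iota> c \<otimes> y"
      using y a c Icarr[OF y(1)] by (simp add: r_distr minus_eq a_assoc r_neg)
    then have "\<iota> c \<otimes> b \<ominus> \<iota> c \<otimes> a \<in> I" using y c by (simp add: I_l_closed)
    then show ?thesis using c bc a by (simp add: smult_eq coset_eq_iff)
  qed
  moreover have "a \<in> I +> a" using a by (rule a_rcos_self)
  ultimately show ?thesis unfolding quot_algebra_simps by auto
qed

lemma scalar_algebra_quot: "scalar_algebra Q K (\<lambda>c. I +> \<iota> c)"
proof (intro scalar_algebra.intro ring_quot scalar_algebra_axioms.intro)
  fix c X assume c: "c \<in> K"
  show "I +> \<iota> c \<in> carrier Q" using c by simp
  assume "X \<in> carrier Q"
  then obtain a where "a \<in> carrier A" "X = I +> a" using quot_carrier by blast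
  then show "c \<odot>\<^bsub>Q\<^esub> X = (I +> \<iota> c) \<otimes>\<^bsub>Q\<^esub> X" using c by (simp add: smult_coset coset_mult)
qed

text \<open>Cosets determine representatives only up to the ideal, so the induced map picks one by
  \<open>SOME\<close> and the kernel hypothesis makes the choice irrelevant.\<close>

lemma quot_lift:
  assumes B: "ring B" and f: "f \<in> alg_hom R A B" and R: "carrier R \<subseteq> K"
    and ker: "\<And>a. a \<in> I \<Longrightarrow> f a = \<zero>\<^bsub>B\<^esub>"
  obtains g where "g \<in> alg_hom R Q B" "\<And>a. a \<in> carrier A \<Longrightarrow> g (I +> a) = f a"
proof -
  interpret B: ring B by (rule B)
  have fh: "f \<in> ring_hom A B" using f by (simp add: alg_hom_def)
  interpret f: ring_hom_ring A B f
    using fh by (intro ring_hom_ringI2 B ring_axioms)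
  define g where "g X = f (SOME a. a \<in> carrier A \<and> X = I +> a)" for X
  have g: "g (I +> a) = f a" if a: "a \<in> carrier A" for a
  proof -
    define b where "b = (SOME b. b \<in> carrier A \<and> I +> a = I +> b)"
    have b: "b \<in> carrier A \<and> I +> a = I +> b" unfolding b_def by (rule someI[of _ a]) (simp add: a)
    then have "a \<ominus> b \<in> I" using a coset_eq_iff[of a b] by blast
    then have z: "f (a \<ominus> b) = \<zero>\<^bsub>B\<^esub>" by (rule ker)
    have bc: "b \<in> carrier A" using b ..
    have "f (a \<ominus> b) = f a \<ominus>\<^bsub>B\<^esub> f b" using a bc by (simp add: a_minus_def)
    then have "f a \<ominus>\<^bsub>B\<^esub> f b = \<zero>\<^bsub>B\<^esub>" using z by simp
    then have "f a = f b" using B.r_right_minus_eq f.hom_closed a bc by blast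
    then show ?thesis by (simp only: g_def b_def[symmetric])
  qed
  have "g \<in> alg_hom R Q B"
    unfolding alg_hom_def
  proof (intro CollectI conjI ballI)
    show "g \<in> ring_hom Q B"
      by (rule ring_hom_memI) (auto simp: quot_carrier coset_mult coset_add coset_one g)
    fix c X assume c: "c \<in> carrier R" and "X \<in> carrier Q"
    then obtain a where a: "a \<in> carrier A" "X = I +> a" using quot_carrier by blast
    have cK: "c \<in> K" using c R by blast
    have "g (c \<odot>\<^bsub>Q\<^esub> X) = f (\<iota> c \<otimes> a)" using a cK by (simp add: smult_coset g)
    also have "\<dots> = f (c \<odot>\<^bsub>A\<^esub> a)" using a cK by (simp add: smult_eq)
    also have "\<dots> = c \<odot>\<^bsub>B\<^esub> g X" using f c a by (simp add: alg_hom_def g)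
    finally show "g (c \<odot>\<^bsub>Q\<^esub> X) = c \<odot>\<^bsub>B\<^esub> g X" .
  qed
  then show ?thesis using that g by blast
qed

end

lemma alg_hom_kills_ideal:
  assumes "ring A" "ring B" "f \<in> ring_hom A B" "X \<subseteq> carrier A" "\<And>x. x \<in> X \<Longrightarrow> f x = \<zero>\<^bsub>B\<^esub>" "a \<in> Idl\<^bsub>A\<^esub> X"
  shows "f a = \<zero>\<^bsub>B\<^esub>"
proof -
  interpret f: ring_hom_ring A B f by (intro ring_hom_ringI2 assms)
  have "Idl\<^bsub>A\<^esub> X \<subseteq> a_kernel A B f"
  proof (rule f.R.genideal_minimal[OF f.kernel_is_ideal])
    show "X \<subseteq> a_kernel A B f" unfolding a_kernel_def' using assms(4,5) by blast
  qed
  then show ?thesis using assms(6) unfolding a_kernel_def' by blast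
qed

section \<open>Evaluation of noncommutative polynomials in a unital algebra\<close>

locale unital_algebra = ring B for B :: "(ratfun, 'b) module" (structure) +
  assumes smult_closed: "b \<in> carrier B \<Longrightarrow> c \<odot>\<^bsub>B\<^esub> b \<in> carrier B"
    and smult_add_right: "b \<in> carrier B \<Longrightarrow> d \<in> carrier B \<Longrightarrow> c \<odot>\<^bsub>B\<^esub> (b \<oplus> d) = c \<odot>\<^bsub>B\<^esub> b \<oplus> c \<odot>\<^bsub>B\<^esub> d"
    and smult_add_left: "b \<in> carrier B \<Longrightarrow> (c + c') \<odot>\<^bsub>B\<^esub> b = c \<odot>\<^bsub>B\<^esub> b \<oplus> c' \<odot>\<^bsub>B\<^esub> b"
    and smult_assoc: "b \<in> carrier B \<Longrightarrow> (c * c') \<odot>\<^bsub>B\<^esub> b = c \<odot>\<^bsub>B\<^esub> (c' \<odot>\<^bsub>B\<^esub> b)"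
    and smult_one: "b \<in> carrier B \<Longrightarrow> 1 \<odot>\<^bsub>B\<^esub> b = b"
    and smult_mult_left: "b \<in> carrier B \<Longrightarrow> d \<in> carrier B \<Longrightarrow> (c \<odot>\<^bsub>B\<^esub> b) \<otimes> d = c \<odot>\<^bsub>B\<^esub> (b \<otimes> d)"
    and smult_mult_right: "b \<in> carrier B \<Longrightarrow> d \<in> carrier B \<Longrightarrow> b \<otimes> (c \<odot>\<^bsub>B\<^esub> d) = c \<odot>\<^bsub>B\<^esub> (b \<otimes> d)"
begin

primrec word_prod :: "('g \<Rightarrow> 'b) \<Rightarrow> 'g list \<Rightarrow> 'b" where
  "word_prod f [] = \<one>"
| "word_prod f (g # w) = f g \<otimes> word_prod f w"

definition fpoly_eval :: "('g \<Rightarrow> 'b) \<Rightarrow> 'g fpoly \<Rightarrow> 'b" where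
  "fpoly_eval f p = (\<Oplus>w\<in>Poly_Mapping.keys p. Poly_Mapping.lookup p w \<odot>\<^bsub>B\<^esub> (case w of Word u \<Rightarrow> word_prod f u))"

context
  fixes f :: "'g \<Rightarrow> 'b" and S :: "'g set"
  assumes f: "\<And>g. g \<in> S \<Longrightarrow> f g \<in> carrier B"
begin

lemma word_prod_closed: "w \<in> lists S \<Longrightarrow> word_prod f w \<in> carrier B"
  by (induction w rule: lists.induct) (auto simp: f)

lemma word_prod_append:
  "v \<in> lists S \<Longrightarrow> w \<in> lists S \<Longrightarrow> word_prod f (v @ w) = word_prod f v \<otimes> word_prod f w"
  by (induction v rule: lists.induct) (auto simp: f word_prod_closed m_assoc)

abbreviation F where "F \<equiv> free_algebra UNIV S"

lemma smult_zero_left: "b \<in> carrier B \<Longrightarrow> 0 \<odot>\<^bsub>B\<^esub> b = \<zero>"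
  using smult_add_left[of b 0 0] smult_closed[of b 0] by (metis add.r_cancel_one' add_0 zero_closed)

lemma fpoly_eval_superset:
  assumes "p \<in> carrier F" "finite A" "Poly_Mapping.keys p \<subseteq> A" "A \<subseteq> Word ` lists S"
  shows "fpoly_eval f p = (\<Oplus>w\<in>A. Poly_Mapping.lookup p w \<odot>\<^bsub>B\<^esub> (case w of Word u \<Rightarrow> word_prod f u))"
  unfolding fpoly_eval_def
proof (rule add.finprod_mono_neutral_cong_left)
  show "(\<lambda>w. Poly_Mapping.lookup p w \<odot>\<^bsub>B\<^esub> (case w of Word u \<Rightarrow> word_prod f u)) \<in> A \<rightarrow> carrier B"
    using assms(4) by (auto intro!: smult_closed word_prod_closed)
  fix w assume "w \<in> A - Poly_Mapping.keys p"
  then show "Poly_Mapping.lookup p w \<odot>\<^bsub>B\<^esub> (case w of Word u \<Rightarrow> word_prod f u) = \<zero>"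
  proof -
    have "w \<in> Word ` lists S" "Poly_Mapping.lookup p w = 0"
      using \<open>w \<in> A - Poly_Mapping.keys p\<close> assms(4) by (auto simp: in_keys_iff)
    then show ?thesis by (auto simp: smult_zero_left word_prod_closed)
  qed
qed (use assms in auto)

lemma fpoly_eval_closed:
  assumes "p \<in> carrier F" shows "fpoly_eval f p \<in> carrier B"
  unfolding fpoly_eval_def using assms
  by (intro finsum_closed) (auto simp: free_algebra_carrier intro!: smult_closed word_prod_closed)

lemma fpoly_eval_single:
  assumes "w \<in> lists S"
  shows "fpoly_eval f (Poly_Mapping.single (Word w) c) = c \<odot>\<^bsub>B\<^esub> word_prod f w"
proof -
  have "Poly_Mapping.single (Word w) c \<in> carrier F"
    using assms by (intro free_algebra_single coeff_ring_UNIV) auto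
  from fpoly_eval_superset[OF this, of "{Word w}"] assms show ?thesis
    by (simp add: smult_closed word_prod_closed)
qed

lemma fpoly_eval_add:
  assumes "p \<in> carrier F" "q \<in> carrier F"
  shows "fpoly_eval f (p + q) = fpoly_eval f p \<oplus> fpoly_eval f q"
proof -
  let ?A = "Poly_Mapping.keys p \<union> Poly_Mapping.keys q"
  let ?t = "\<lambda>p w. Poly_Mapping.lookup p w \<odot>\<^bsub>B\<^esub> (case w of Word u \<Rightarrow> word_prod f u)"
  have A: "?A \<subseteq> Word ` lists S" "finite ?A" using assms by (auto simp: free_algebra_carrier)
  have pq: "p + q \<in> carrier F" using assms by (intro free_algebra_add coeff_ring_UNIV)
  have cl: "?t r \<in> ?A \<rightarrow> carrier B" for r using A by (auto intro!: smult_closed word_prod_closed)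
  have "fpoly_eval f (p + q) = (\<Oplus>w\<in>?A. ?t (p + q) w)"
    using fpoly_eval_superset[OF pq A(2) keys_add A(1)] .
  also have "\<dots> = (\<Oplus>w\<in>?A. ?t p w \<oplus> ?t q w)"
  proof (intro finsum_cong' refl)
    fix w assume "w \<in> ?A"
    then obtain u where "w = Word u" "u \<in> lists S" using A(1) by blast
    then show "?t (p + q) w = ?t p w \<oplus> ?t q w" by (simp add: lookup_add smult_add_left word_prod_closed)
  qed (use cl in \<open>auto simp: Pi_iff\<close>)
  also have "\<dots> = (\<Oplus>w\<in>?A. ?t p w) \<oplus> (\<Oplus>w\<in>?A. ?t q w)" by (intro finsum_addf cl)
  also have "(\<Oplus>w\<in>?A. ?t p w) = fpoly_eval f p" using fpoly_eval_superset[OF assms(1) A(2) _ A(1)] by simp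
  also have "(\<Oplus>w\<in>?A. ?t q w) = fpoly_eval f q" using fpoly_eval_superset[OF assms(2) A(2) _ A(1)] by simp
  finally show ?thesis .
qed

lemma fpoly_eval_zero: "fpoly_eval f 0 = \<zero>"
  by (simp add: fpoly_eval_def)

lemma fpoly_eval_mult:
  assumes "p \<in> carrier F" "q \<in> carrier F"
  shows "fpoly_eval f (p * q) = fpoly_eval f p \<otimes> fpoly_eval f q"
  using coeff_ring_UNIV assms(1)
proof (induction p rule: free_algebra_induct)
  case (single w c)
  from coeff_ring_UNIV assms(2) show ?case
  proof (induction q rule: free_algebra_induct)
    case (single w' c')
    have "c \<odot>\<^bsub>B\<^esub> (c' \<odot>\<^bsub>B\<^esub> b) = c' \<odot>\<^bsub>B\<^esub> (c \<odot>\<^bsub>B\<^esub> b)" if "b \<in> carrier B" for b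
      using that by (simp add: smult_assoc[symmetric] mult.commute)
    then show ?case using \<open>w \<in> lists S\<close> \<open>w' \<in> lists S\<close>
      by (simp add: mult_single fpoly_eval_single word_prod_append smult_mult_left smult_mult_right
          smult_assoc smult_closed word_prod_closed)
  next
    case (add p q)
    have w: "Poly_Mapping.single (Word w) c \<in> carrier F"
      using \<open>w \<in> lists S\<close> by (intro free_algebra_single coeff_ring_UNIV) auto
    show ?case using add w
      by (simp add: distrib_left fpoly_eval_add free_algebra_mult[OF coeff_ring_UNIV] r_distr fpoly_eval_closed)
  qed (use \<open>w \<in> lists S\<close> in \<open>simp add: fpoly_eval_zero fpoly_eval_single smult_closed word_prod_closed\<close>)
next
  case (add p p')
  then show ?case using assms(2)
    by (simp add: distrib_right fpoly_eval_add free_algebra_mult[OF coeff_ring_UNIV] l_distr fpoly_eval_closed)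
qed (simp add: fpoly_eval_zero fpoly_eval_closed[OF assms(2)])

lemma fpoly_eval_const: "fpoly_eval f (const c) = c \<odot>\<^bsub>B\<^esub> \<one>"
  using fpoly_eval_single[of "[]" c] by (simp add: const_def zero_word_def)

lemma fpoly_eval_gen: "g \<in> S \<Longrightarrow> fpoly_eval f (gen g) = f g"
  using fpoly_eval_single[of "[g]" 1] f by (simp add: gen_def smult_one)

lemma fpoly_eval_alg_hom: "fpoly_eval f \<in> alg_hom K_ring F B"
  unfolding alg_hom_def
proof (intro CollectI conjI ballI)
  show "fpoly_eval f \<in> ring_hom F B"
    using fpoly_eval_const[of 1]
    by (intro ring_hom_memI) (auto simp: free_algebra_simps fpoly_eval_closed fpoly_eval_mult fpoly_eval_add const_1 smult_one)
  fix c p assume "p \<in> carrier F"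
  then show "fpoly_eval f (c \<odot>\<^bsub>F\<^esub> p) = c \<odot>\<^bsub>B\<^esub> fpoly_eval f p"
    using free_algebra_const[OF coeff_ring_UNIV, of c S]
    by (simp add: free_algebra_simps fpoly_eval_mult fpoly_eval_const smult_mult_left fpoly_eval_closed)
qed

end

end

subsection \<open>Extension of scalars\<close>

locale scalar_extension =
  fixes R :: "ratfun set" and W :: "(ratfun, 'v) module"
  assumes W_abelian: "abelian_group W"
    and W_smult_closed: "\<And>r v. r \<in> R \<Longrightarrow> v \<in> carrier W \<Longrightarrow> r \<odot>\<^bsub>W\<^esub> v \<in> carrier W"
    and W_smult_add: "\<And>r v w. r \<in> R \<Longrightarrow> v \<in> carrier W \<Longrightarrow> w \<in> carrier W \<Longrightarrow>
      r \<odot>\<^bsub>W\<^esub> (v \<oplus>\<^bsub>W\<^esub> w) = r \<odot>\<^bsub>W\<^esub> v \<oplus>\<^bsub>W\<^esub> r \<odot>\<^bsub>W\<^esub> w"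
begin

interpretation W: abelian_group W by (rule W_abelian)

abbreviation TK where "TK \<equiv> tensor_K R W"

abbreviation TF where "TF \<equiv> tensor_free W"

abbreviation N where "N \<equiv> tensor_ker R W"

definition frags :: "('v \<times> ratfun \<Rightarrow>\<^sub>0 int) set" where
  "frags = {x. Poly_Mapping.keys x \<subseteq> carrier W \<times> UNIV}"

definition co :: "('v \<times> ratfun \<Rightarrow>\<^sub>0 int) \<Rightarrow> ('v \<times> ratfun \<Rightarrow>\<^sub>0 int) set" where
  "co x = N #>\<^bsub>TF\<^esub> x"

definition pure :: "'v \<Rightarrow> ratfun \<Rightarrow> ('v \<times> ratfun \<Rightarrow>\<^sub>0 int) set" where
  "pure v c = co (frag_of (v, c))"

lemma tensor_free_simps:
  "carrier TF = frags" "x \<otimes>\<^bsub>TF\<^esub> y = x + y" "\<one>\<^bsub>TF\<^esub> = 0"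
  by (auto simp: tensor_free_def frags_def)

lemma frags_closed: "0 \<in> frags" "x \<in> frags \<Longrightarrow> y \<in> frags \<Longrightarrow> x + y \<in> frags" "x \<in> frags \<Longrightarrow> - x \<in> frags"
  "x \<in> frags \<Longrightarrow> y \<in> frags \<Longrightarrow> x - y \<in> frags" "v \<in> carrier W \<Longrightarrow> frag_of (v, c) \<in> frags"
  using keys_add[of x y] keys_diff[of x y] by (auto simp: frags_def)

lemma comm_group_TF: "comm_group TF"
  unfolding tensor_free_def by (rule abelian_free_Abelian_group)

lemma tensor_relsI:
  "v \<in> carrier W \<Longrightarrow> w \<in> carrier W \<Longrightarrow>
    frag_of (v \<oplus>\<^bsub>W\<^esub> w, c) - frag_of (v, c) - frag_of (w, c) \<in> tensor_rels R W"
  "v \<in> carrier W \<Longrightarrow> frag_of (v, c + d) - frag_of (v, c) - frag_of (v, d) \<in> tensor_rels R W"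
  "v \<in> carrier W \<Longrightarrow> r \<in> R \<Longrightarrow> frag_of (r \<odot>\<^bsub>W\<^esub> v, c) - frag_of (v, r * c) \<in> tensor_rels R W"
  unfolding tensor_rels_def by blast+

lemma tensor_relsE:
  assumes "x \<in> tensor_rels R W"
  obtains v w c where "v \<in> carrier W" "w \<in> carrier W" "x = frag_of (v \<oplus>\<^bsub>W\<^esub> w, c) - frag_of (v, c) - frag_of (w, c)"
  | v c d where "v \<in> carrier W" "x = frag_of (v, c + d) - frag_of (v, c) - frag_of (v, d)"
  | v r c where "v \<in> carrier W" "r \<in> R" "x = frag_of (r \<odot>\<^bsub>W\<^esub> v, c) - frag_of (v, r * c)"
  using assms unfolding tensor_rels_def by blast

lemma rels_subset: "tensor_rels R W \<subseteq> frags"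
  unfolding tensor_rels_def by (auto intro!: frags_closed W.a_closed W_smult_closed)

lemma N_subgroup: "subgroup N TF"
proof -
  interpret comm_group TF by (rule comm_group_TF)
  show ?thesis unfolding tensor_ker_def by (rule generate_is_subgroup) (simp add: tensor_free_simps rels_subset)
qed

lemma N_frags: "N \<subseteq> frags"
  using subgroup.subset[OF N_subgroup] by (simp add: tensor_free_simps)

lemma N_0: "0 \<in> N" and N_add: "x \<in> N \<Longrightarrow> y \<in> N \<Longrightarrow> x + y \<in> N" and N_minus: "x \<in> N \<Longrightarrow> - x \<in> N"
  and N_diff: "x \<in> N \<Longrightarrow> y \<in> N \<Longrightarrow> x - y \<in> N"
proof -
  show 0: "0 \<in> N" using subgroup.one_closed[OF N_subgroup] by (simp add: tensor_free_simps)
  show add: "x + y \<in> N" if "x \<in> N" "y \<in> N" for x y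
    using subgroup.m_closed[OF N_subgroup that] by (simp add: tensor_free_simps)
  show minus: "- x \<in> N" if "x \<in> N" for x
  proof -
    have "Poly_Mapping.keys x \<subseteq> carrier W \<times> UNIV" using N_frags that by (auto simp: frags_def)
    then show ?thesis
      using subgroup.m_inv_closed[OF N_subgroup that] by (simp add: tensor_free_def)
  qed
  show "x - y \<in> N" if "x \<in> N" "y \<in> N" using add[OF that(1) minus[OF that(2)]] by simp
qed

lemma N_rels: "x \<in> tensor_rels R W \<Longrightarrow> x \<in> N"
  unfolding tensor_ker_def by (rule generate.incl)

lemma co_set: "co x = (\<lambda>k. k + x) ` N"
  by (auto simp: co_def r_coset_def tensor_free_simps)

lemma co_eq_iff: "co x = co y \<longleftrightarrow> x - y \<in> N"
proof
  assume "co x = co y"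
  moreover have "x \<in> co x" using N_0 by (force simp: co_set)
  ultimately obtain k where "k \<in> N" "x = k + y" by (auto simp: co_set)
  then show "x - y \<in> N" by simp
next
  assume xy: "x - y \<in> N"
  have "co a \<subseteq> co b" if "a - b \<in> N" for a b
  proof
    fix z assume "z \<in> co a"
    then obtain k where k: "k \<in> N" "z = k + a" by (auto simp: co_set)
    then have "z = (k + (a - b)) + b" "k + (a - b) \<in> N" using N_add[OF k(1) that] by simp_all
    then show "z \<in> co b" unfolding co_set by blast
  qed
  from this[OF xy] this[of y x] show "co x = co y" using N_minus[OF xy] by auto
qed

lemma TK_carrier: "carrier TK = co ` frags"
  by (auto simp: tensor_K_def FactGroup_def RCOSETS_def co_def tensor_free_simps)

lemma co_closed [simp]: "x \<in> frags \<Longrightarrow> co x \<in> carrier TK"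
  by (simp add: TK_carrier)

lemma co_add: "co x \<oplus>\<^bsub>TK\<^esub> co y = co (x + y)"
proof -
  have "co x \<oplus>\<^bsub>TK\<^esub> co y = (\<Union>h\<in>co x. \<Union>k\<in>co y. {h + k})"
    by (simp add: tensor_K_def FactGroup_def set_mult_def tensor_free_simps)
  also have "\<dots> = co (x + y)"
  proof
    show "(\<Union>h\<in>co x. \<Union>k\<in>co y. {h + k}) \<subseteq> co (x + y)"
    proof clarify
      fix h k assume "h \<in> co x" "k \<in> co y"
      then obtain a b where ab: "a \<in> N" "h = a + x" "b \<in> N" "k = b + y" by (auto simp: co_set)
      then have "h + k = (a + b) + (x + y)" by simp
      then show "h + k \<in> co (x + y)" unfolding co_set using N_add[OF ab(1,3)] by blast
    qed
    show "co (x + y) \<subseteq> (\<Union>h\<in>co x. \<Union>k\<in>co y. {h + k})"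
    proof
      fix z assume "z \<in> co (x + y)"
      then obtain k where k: "k \<in> N" "z = (k + x) + (0 + y)" by (auto simp: co_set add.assoc)
      moreover have "k + x \<in> co x" "0 + y \<in> co y" unfolding co_set using k(1) N_0 by blast+
      ultimately show "z \<in> (\<Union>h\<in>co x. \<Union>k\<in>co y. {h + k})" by blast
    qed
  qed
  finally show ?thesis .
qed

lemma TK_zero: "\<zero>\<^bsub>TK\<^esub> = co 0"
  by (auto simp: tensor_K_def FactGroup_def co_set)

lemma abelian_group_TK: "abelian_group TK"
proof (rule abelian_groupI)
  fix X assume "X \<in> carrier TK"
  then obtain x where x: "x \<in> frags" "X = co x" by (auto simp: TK_carrier)
  then show "\<exists>Y\<in>carrier TK. Y \<oplus>\<^bsub>TK\<^esub> X = \<zero>\<^bsub>TK\<^esub>"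
    by (intro bexI[of _ "co (- x)"]) (auto simp: co_add TK_zero frags_closed)
qed (auto simp: TK_carrier co_add TK_zero frags_closed add_ac intro!: imageI)

interpretation TK: abelian_group TK by (rule abelian_group_TK)

lemma pure_closed [simp]: "v \<in> carrier W \<Longrightarrow> pure v c \<in> carrier TK"
  by (simp add: pure_def frags_closed)

lemma pure_add_left:
  assumes "v \<in> carrier W" "w \<in> carrier W"
  shows "pure (v \<oplus>\<^bsub>W\<^esub> w) c = pure v c \<oplus>\<^bsub>TK\<^esub> pure w c"
proof -
  have "frag_of (v \<oplus>\<^bsub>W\<^esub> w, c) - frag_of (v, c) - frag_of (w, c) \<in> N"
    using assms by (intro N_rels tensor_relsI)
  then show ?thesis unfolding pure_def co_add co_eq_iff by (simp add: diff_diff_eq)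
qed

lemma pure_add_right:
  assumes "v \<in> carrier W"
  shows "pure v (c + d) = pure v c \<oplus>\<^bsub>TK\<^esub> pure v d"
proof -
  have "frag_of (v, c + d) - frag_of (v, c) - frag_of (v, d) \<in> N"
    using assms by (intro N_rels tensor_relsI)
  then show ?thesis unfolding pure_def co_add co_eq_iff by (simp add: diff_diff_eq)
qed

lemma pure_smult:
  assumes "v \<in> carrier W" "r \<in> R"
  shows "pure (r \<odot>\<^bsub>W\<^esub> v) c = pure v (r * c)"
proof -
  have "frag_of (r \<odot>\<^bsub>W\<^esub> v, c) - frag_of (v, r * c) \<in> N"
    using assms by (intro N_rels tensor_relsI)
  then show ?thesis unfolding pure_def co_eq_iff .
qed

text \<open>Pure tensors generate the tensor product as an abelian group, so additivity suffices and
  linearity over the field need not be established beforehand; it is obtained for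
  \<open>tensor_map\<close> by this very lemma.\<close>

lemma TK_additive_eqI:
  assumes F: "\<And>X. X \<in> carrier TK \<Longrightarrow> F X \<in> carrier TK"
      "\<And>X Y. X \<in> carrier TK \<Longrightarrow> Y \<in> carrier TK \<Longrightarrow> F (X \<oplus>\<^bsub>TK\<^esub> Y) = F X \<oplus>\<^bsub>TK\<^esub> F Y"
    and H: "\<And>X. X \<in> carrier TK \<Longrightarrow> H X \<in> carrier TK"
      "\<And>X Y. X \<in> carrier TK \<Longrightarrow> Y \<in> carrier TK \<Longrightarrow> H (X \<oplus>\<^bsub>TK\<^esub> Y) = H X \<oplus>\<^bsub>TK\<^esub> H Y"
    and pure: "\<And>v c. v \<in> carrier W \<Longrightarrow> F (pure v c) = H (pure v c)"
    and X: "X \<in> carrier TK"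
  shows "F X = H X"
proof -
  have zero: "F (co 0) = H (co 0)"
    using F(1)[of "co 0"] F(2)[of "co 0" "co 0"] H(1)[of "co 0"] H(2)[of "co 0" "co 0"] frags_closed(1)
    by (metis TK.add.r_cancel_one' TK_zero TK.l_zero TK.zero_closed)
  obtain x where x: "x \<in> frags" "X = co x" using X by (auto simp: TK_carrier)
  have "Poly_Mapping.keys x \<subseteq> carrier W \<times> UNIV" using x by (simp add: frags_def)
  then have "F (co x) = H (co x)"
  proof (induction x rule: free_Abelian_group_induct[consumes 1, case_names 1 2 3])
    case 1 show ?case by (rule zero)
  next
    case (2 x y)
    have xf: "x \<in> frags" "y \<in> frags" using 2 by (auto simp: frags_def)
    \<comment> \<open>The induction on the free abelian group produces differences, whereas the maps
      are known to respect sums; cancellation bridges the two.\<close>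
    have xy: "co (x - y) \<oplus>\<^bsub>TK\<^esub> co y = co x" by (simp add: co_add)
    have c: "co (x - y) \<in> carrier TK" "co y \<in> carrier TK" using xf by (simp_all add: frags_closed)
    have "F (co (x - y)) \<oplus>\<^bsub>TK\<^esub> F (co y) = H (co (x - y)) \<oplus>\<^bsub>TK\<^esub> F (co y)"
      using F(2)[OF c] H(2)[OF c] 2 xy by simp
    then show ?case using F(1)[OF c(1)] F(1)[OF c(2)] H(1)[OF c(1)] by simp
  next
    case (3 a)
    then show ?case using pure[of "fst a" "snd a"] by (auto simp: pure_def)
  qed
  then show ?thesis using x by simp
qed

definition preserves_rels :: "('v \<times> ratfun \<Rightarrow> 'v \<times> ratfun) \<Rightarrow> bool" where
  "preserves_rels \<phi> \<longleftrightarrow> (\<forall>v\<in>carrier W. \<forall>c. \<phi> (v, c) \<in> carrier W \<times> UNIV) \<and>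
     (\<forall>x\<in>tensor_rels R W. frag_extend (\<lambda>p. frag_of (\<phi> p)) x \<in> N)"

context
  fixes \<phi> assumes \<phi>: "preserves_rels \<phi>"
begin

abbreviation ex where "ex \<equiv> frag_extend (\<lambda>p. frag_of (\<phi> p))"

lemma ex_frags:
  assumes "x \<in> frags"
  shows "ex x \<in> frags"
proof -
  have "Poly_Mapping.keys (ex x) \<subseteq> (\<Union>p\<in>Poly_Mapping.keys x. Poly_Mapping.keys (frag_of (\<phi> p)))"
    by (rule keys_frag_extend)
  also have "\<dots> \<subseteq> carrier W \<times> UNIV"
  proof (rule UN_least)
    fix p assume "p \<in> Poly_Mapping.keys x"
    then have "p \<in> carrier W \<times> UNIV" using assms unfolding frags_def by blast
    then have "\<phi> p \<in> carrier W \<times> UNIV" using \<phi> by (cases p) (auto simp: preserves_rels_def)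
    then show "Poly_Mapping.keys (frag_of (\<phi> p)) \<subseteq> carrier W \<times> UNIV" by simp
  qed
  finally show ?thesis by (simp add: frags_def)
qed

lemma ex_N: "x \<in> N \<Longrightarrow> ex x \<in> N"
proof -
  assume "x \<in> N"
  then have "x \<in> generate TF (tensor_rels R W)" by (simp add: tensor_ker_def)
  then show "ex x \<in> N"
  proof (induction rule: generate.induct)
    case one then show ?case by (simp add: tensor_free_simps N_0)
  next
    case (incl h) then show ?case using \<phi> by (simp add: preserves_rels_def)
  next
    case (inv h)
    then have "Poly_Mapping.keys h \<subseteq> carrier W \<times> UNIV" using rels_subset by (auto simp: frags_def)
    then have "inv\<^bsub>TF\<^esub> h = - h" by (simp add: tensor_free_def)
    then show ?case using inv \<phi> by (simp add: preserves_rels_def frag_extend_minus N_minus)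
  next
    case (eng h1 h2) then show ?case by (simp add: tensor_free_simps frag_extend_add N_add)
  qed
qed

text \<open>\<open>tensor_lift\<close> takes a union over all representatives of a coset. A map that
  preserves the relations sends them all into one coset, so the union is a single coset.\<close>

lemma tensor_lift_co: "tensor_lift R W \<phi> (co x) = co (ex x)"
proof -
  have "co (ex y) = co (ex x)" if y: "y \<in> co x" for y
  proof -
    obtain k where "k \<in> N" "y = k + x" using y by (auto simp: co_set)
    then show ?thesis by (simp add: co_eq_iff frag_extend_add ex_N)
  qed
  moreover have "x \<in> co x" using N_0 by (force simp: co_set)
  ultimately show ?thesis unfolding tensor_lift_def co_def[symmetric] by blast
qed

lemma tensor_lift_closed: "X \<in> carrier TK \<Longrightarrow> tensor_lift R W \<phi> X \<in> carrier TK"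
  by (auto simp: TK_carrier tensor_lift_co ex_frags)

lemma tensor_lift_add: "X \<in> carrier TK \<Longrightarrow> Y \<in> carrier TK \<Longrightarrow>
    tensor_lift R W \<phi> (X \<oplus>\<^bsub>TK\<^esub> Y) = tensor_lift R W \<phi> X \<oplus>\<^bsub>TK\<^esub> tensor_lift R W \<phi> Y"
  by (auto simp: TK_carrier tensor_lift_co co_add frag_extend_add)

lemma tensor_lift_pure: "tensor_lift R W \<phi> (pure v c) = pure (fst (\<phi> (v, c))) (snd (\<phi> (v, c)))"
  by (simp add: pure_def tensor_lift_co)

end

lemma preserves_scale: "preserves_rels (\<lambda>(v, c). (v, k * c))"
  unfolding preserves_rels_def
proof (intro conjI ballI allI)
  fix x assume "x \<in> tensor_rels R W"
  then have "frag_extend (\<lambda>p. frag_of (case p of (v, c) \<Rightarrow> (v, k * c))) x \<in> tensor_rels R W"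
  proof (cases rule: tensor_relsE)
    case (1 v w c) then show ?thesis by (simp add: frag_extend_diff tensor_relsI)
  next
    case (2 v c d) then show ?thesis by (simp add: frag_extend_diff distrib_left tensor_relsI)
  next
    case (3 v r c)
    then show ?thesis using tensor_relsI(3)[of v r "k * c"] by (simp add: frag_extend_diff mult.left_commute)
  qed
  then show "frag_extend (\<lambda>p. frag_of (case p of (v, c) \<Rightarrow> (v, k * c))) x \<in> N" by (rule N_rels)
qed auto

lemma TK_smult: "k \<odot>\<^bsub>TK\<^esub> X = tensor_lift R W (\<lambda>(v, c). (v, k * c)) X"
  by (simp add: tensor_K_def)

lemma TK_smult_closed: "X \<in> carrier TK \<Longrightarrow> k \<odot>\<^bsub>TK\<^esub> X \<in> carrier TK"
  and TK_smult_add: "X \<in> carrier TK \<Longrightarrow> Y \<in> carrier TK \<Longrightarrow> k \<odot>\<^bsub>TK\<^esub> (X \<oplus>\<^bsub>TK\<^esub> Y) = k \<odot>\<^bsub>TK\<^esub> X \<oplus>\<^bsub>TK\<^esub> k \<odot>\<^bsub>TK\<^esub> Y"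
  and TK_smult_pure: "k \<odot>\<^bsub>TK\<^esub> pure v c = pure v (k * c)"
  unfolding TK_smult
  by (simp_all add: tensor_lift_closed[OF preserves_scale] tensor_lift_add[OF preserves_scale] tensor_lift_pure[OF preserves_scale])

lemma TK_smult_assoc: "X \<in> carrier TK \<Longrightarrow> (k * k') \<odot>\<^bsub>TK\<^esub> X = k \<odot>\<^bsub>TK\<^esub> (k' \<odot>\<^bsub>TK\<^esub> X)"
  by (rule TK_additive_eqI[where F = "\<lambda>X. (k * k') \<odot>\<^bsub>TK\<^esub> X" and H = "\<lambda>X. k \<odot>\<^bsub>TK\<^esub> (k' \<odot>\<^bsub>TK\<^esub> X)"])
     (simp_all add: TK_smult_closed TK_smult_add TK_smult_pure mult.assoc)

lemma TK_smult_add_left: "X \<in> carrier TK \<Longrightarrow> (k + k') \<odot>\<^bsub>TK\<^esub> X = k \<odot>\<^bsub>TK\<^esub> X \<oplus>\<^bsub>TK\<^esub> k' \<odot>\<^bsub>TK\<^esub> X"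
  by (rule TK_additive_eqI[where F = "\<lambda>X. (k + k') \<odot>\<^bsub>TK\<^esub> X" and H = "\<lambda>X. k \<odot>\<^bsub>TK\<^esub> X \<oplus>\<^bsub>TK\<^esub> k' \<odot>\<^bsub>TK\<^esub> X"])
     (simp_all add: TK_smult_closed TK_smult_add TK_smult_pure distrib_right pure_add_right TK.a_ac)

lemma TK_smult_one: "X \<in> carrier TK \<Longrightarrow> 1 \<odot>\<^bsub>TK\<^esub> X = X"
  by (rule TK_additive_eqI[where F = "\<lambda>X. 1 \<odot>\<^bsub>TK\<^esub> X" and H = "\<lambda>X. X"])
     (simp_all add: TK_smult_closed TK_smult_add TK_smult_pure)

lemma scalar_action_TK: "scalar_action K_ring TK"
  by (rule scalar_action.intro) (simp_all add: abelian_group_TK TK_smult_closed TK_smult_add)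

abbreviation EK where "EK \<equiv> linear_endos K_ring TK"

lemma ring_EK: "ring EK"
  by (rule scalar_action.linear_endos_ring[OF scalar_action_TK])

lemma EK_smult_closed: "f \<in> carrier EK \<Longrightarrow> k \<odot>\<^bsub>EK\<^esub> f \<in> carrier EK"
  unfolding linear_endos_smult
  by (rule linear_endosI)
     (simp_all add: linear_endos_carrierD TK_smult_closed TK_smult_add TK_smult_assoc[symmetric] mult.commute)

lemmas linear_endos_simps = linear_endos_smult linear_endos_add linear_endos_mult

lemma unital_algebra_EK: "unital_algebra EK"
proof (intro unital_algebra.intro ring_EK unital_algebra_axioms.intro)
  fix f g k k' assume f: "f \<in> carrier EK"
  show "k \<odot>\<^bsub>EK\<^esub> f \<in> carrier EK" using f by (rule EK_smult_closed)
  show "(k + k') \<odot>\<^bsub>EK\<^esub> f = k \<odot>\<^bsub>EK\<^esub> f \<oplus>\<^bsub>EK\<^esub> k' \<odot>\<^bsub>EK\<^esub> f"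
    using f unfolding linear_endos_simps by (intro restrict_ext) (simp add: linear_endos_carrierD TK_smult_add_left TK_smult_assoc TK_smult_closed)
  show "(k * k') \<odot>\<^bsub>EK\<^esub> f = k \<odot>\<^bsub>EK\<^esub> (k' \<odot>\<^bsub>EK\<^esub> f)"
    using f unfolding linear_endos_simps by (intro restrict_ext) (simp add: linear_endos_carrierD TK_smult_add_left TK_smult_assoc TK_smult_closed)
  have one: "1 \<odot>\<^bsub>EK\<^esub> f \<in> carrier EK" using f by (rule EK_smult_closed)
  show "1 \<odot>\<^bsub>EK\<^esub> f = f"
    by (rule linear_endos_eqI[OF one f]) (use f in \<open>simp add: linear_endos_smult linear_endos_carrierD TK_smult_one\<close>)
  assume g: "g \<in> carrier EK"
  show "k \<odot>\<^bsub>EK\<^esub> (f \<oplus>\<^bsub>EK\<^esub> g) = k \<odot>\<^bsub>EK\<^esub> f \<oplus>\<^bsub>EK\<^esub> k \<odot>\<^bsub>EK\<^esub> g"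
    using f g unfolding linear_endos_simps by (intro restrict_ext; simp add: linear_endos_carrierD TK_smult_add TK_smult_closed)+
  show "(k \<odot>\<^bsub>EK\<^esub> f) \<otimes>\<^bsub>EK\<^esub> g = k \<odot>\<^bsub>EK\<^esub> (f \<otimes>\<^bsub>EK\<^esub> g)" "f \<otimes>\<^bsub>EK\<^esub> (k \<odot>\<^bsub>EK\<^esub> g) = k \<odot>\<^bsub>EK\<^esub> (f \<otimes>\<^bsub>EK\<^esub> g)"
    using f g unfolding linear_endos_simps by (intro restrict_ext; simp add: linear_endos_carrierD TK_smult_add TK_smult_closed)+
qed

definition W_linear :: "('v \<Rightarrow> 'v) \<Rightarrow> bool" where
  "W_linear f \<longleftrightarrow> (\<forall>v\<in>carrier W. f v \<in> carrier W) \<and>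
     (\<forall>v\<in>carrier W. \<forall>w\<in>carrier W. f (v \<oplus>\<^bsub>W\<^esub> w) = f v \<oplus>\<^bsub>W\<^esub> f w) \<and>
     (\<forall>r\<in>R. \<forall>v\<in>carrier W. f (r \<odot>\<^bsub>W\<^esub> v) = r \<odot>\<^bsub>W\<^esub> f v)"

lemma preserves_map:
  assumes "W_linear f"
  shows "preserves_rels (\<lambda>(v, c). (f v, c))"
  unfolding preserves_rels_def
proof (intro conjI ballI allI)
  fix x assume "x \<in> tensor_rels R W"
  then have "frag_extend (\<lambda>p. frag_of (case p of (v, c) \<Rightarrow> (f v, c))) x \<in> tensor_rels R W"
  proof (cases rule: tensor_relsE)
    case (1 v w c) then show ?thesis using assms by (simp add: W_linear_def frag_extend_diff tensor_relsI)
  next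
    case (2 v c d) then show ?thesis using assms by (simp add: W_linear_def frag_extend_diff tensor_relsI)
  next
    case (3 v r c) then show ?thesis using assms by (simp add: W_linear_def frag_extend_diff tensor_relsI)
  qed
  then show "frag_extend (\<lambda>p. frag_of (case p of (v, c) \<Rightarrow> (f v, c))) x \<in> N" by (rule N_rels)
qed (use assms in \<open>auto simp: W_linear_def\<close>)

lemma tensor_map_apply: "X \<in> carrier TK \<Longrightarrow> tensor_map R W f X = tensor_lift R W (\<lambda>(v, c). (f v, c)) X"
  by (simp add: tensor_map_def)

context
  fixes f assumes f: "W_linear f"
begin

lemma tensor_map_value_closed: "X \<in> carrier TK \<Longrightarrow> tensor_map R W f X \<in> carrier TK"
  and tensor_map_additive: "X \<in> carrier TK \<Longrightarrow> Y \<in> carrier TK \<Longrightarrow>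
    tensor_map R W f (X \<oplus>\<^bsub>TK\<^esub> Y) = tensor_map R W f X \<oplus>\<^bsub>TK\<^esub> tensor_map R W f Y"
  and tensor_map_pure: "v \<in> carrier W \<Longrightarrow> tensor_map R W f (pure v c) = pure (f v) c"
  by (simp_all add: tensor_map_apply tensor_lift_closed[OF preserves_map[OF f]] tensor_lift_add[OF preserves_map[OF f]]
      tensor_lift_pure[OF preserves_map[OF f]])

lemma tensor_map_smult:
  assumes "X \<in> carrier TK"
  shows "tensor_map R W f (k \<odot>\<^bsub>TK\<^esub> X) = k \<odot>\<^bsub>TK\<^esub> tensor_map R W f X"
  by (rule TK_additive_eqI[where F = "\<lambda>X. tensor_map R W f (k \<odot>\<^bsub>TK\<^esub> X)" and H = "\<lambda>X. k \<odot>\<^bsub>TK\<^esub> tensor_map R W f X"])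
     (use f assms in \<open>simp_all add: TK_smult_closed TK_smult_add TK_smult_pure tensor_map_value_closed
        tensor_map_additive tensor_map_pure W_linear_def\<close>)

lemma tensor_map_closed: "tensor_map R W f \<in> carrier EK"
proof -
  have "(\<lambda>X\<in>carrier TK. tensor_map R W f X) \<in> carrier EK"
    by (rule linear_endosI)
       (simp_all add: tensor_map_value_closed tensor_map_additive tensor_map_smult TK_smult_closed)
  then show ?thesis by (simp add: tensor_map_def cong: restrict_cong)
qed

end

lemma tensor_map_eqI:
  assumes "W_linear f" "g \<in> carrier EK" "\<And>v c. v \<in> carrier W \<Longrightarrow> pure (f v) c = g (pure v c)"
  shows "tensor_map R W f = g"
proof (rule linear_endos_eqI[OF tensor_map_closed[OF assms(1)] assms(2)])
  fix X assume X: "X \<in> carrier TK"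
  show "tensor_map R W f X = g X"
    by (rule TK_additive_eqI[where F = "tensor_map R W f" and H = g])
       (use assms X in \<open>simp_all add: tensor_map_value_closed tensor_map_additive tensor_map_pure linear_endos_carrierD\<close>)
qed

end

subsection \<open>The two Hecke algebras\<close>

lemma (in ring) quadratic_rewrite:
  assumes "x \<in> carrier R" "y \<in> carrier R" "x \<oplus> y \<ominus> \<one> = \<zero>"
  shows "x = \<one> \<ominus> y"
proof -
  have "x \<oplus> y = \<one>" using assms by simp
  then have "x \<oplus> y \<ominus> y = \<one> \<ominus> y" by simp
  then show ?thesis using assms by (simp add: minus_eq a_assoc r_neg)
qed

locale hecke_alg =
  fixes R :: "ratfun set" and M :: diagram and J :: "nat set"
  assumes R: "coeff_ring R" and m_R: "m_par \<in> R"
begin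

abbreviation A where "A \<equiv> free_algebra R J"

abbreviation I where "I \<equiv> hecke_ideal R M J"

lemma hecke_rels_subset: "hecke_rels M J \<subseteq> carrier A"
  unfolding hecke_rels_def
  by (auto intro!: free_algebra_diff[OF R] free_algebra_mult[OF R] free_algebra_add[OF R] free_algebra_gen[OF R]
      free_algebra_power2[OF R] free_algebra_const[OF R] free_algebra_1[OF R] m_R)

lemma ideal_I: "ideal I A"
  unfolding hecke_ideal_def by (rule ring.genideal_ideal[OF ring_free_algebra[OF R] hecke_rels_subset])

sublocale H: scalar_algebra_ideal A R const I
  by (intro scalar_algebra_ideal.intro scalar_algebra_free_algebra R ideal_I)

lemma hecke_eq: "hecke R M J = quot_algebra A I"
  by (simp add: hecke_def)

lemma hecke_rels_I: "x \<in> hecke_rels M J \<Longrightarrow> x \<in> I"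
  unfolding hecke_ideal_def using ring.genideal_self[OF ring_free_algebra[OF R] hecke_rels_subset] by blast

abbreviation cl :: "nat fpoly \<Rightarrow> nat fpoly set" where
  "cl p \<equiv> I +>\<^bsub>A\<^esub> p"

lemma A_minus: "p \<in> carrier A \<Longrightarrow> q \<in> carrier A \<Longrightarrow> p \<ominus>\<^bsub>A\<^esub> q = p - q"
  by (simp add: a_minus_def free_algebra_simps free_algebra_uminus[OF R])

lemma cl_eqI: "p \<in> carrier A \<Longrightarrow> q \<in> carrier A \<Longrightarrow> p - q \<in> I \<Longrightarrow> cl p = cl q"
  by (simp add: H.coset_eq_iff A_minus)

sublocale Q: ring "hecke R M J"
  unfolding hecke_eq by (rule H.ring_quot)

lemma cl_closed [simp]: "p \<in> carrier A \<Longrightarrow> cl p \<in> carrier (hecke R M J)"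
  and cl_mult: "p \<in> carrier A \<Longrightarrow> q \<in> carrier A \<Longrightarrow> cl p \<otimes>\<^bsub>hecke R M J\<^esub> cl q = cl (p * q)"
  and cl_add: "p \<in> carrier A \<Longrightarrow> q \<in> carrier A \<Longrightarrow> cl p \<oplus>\<^bsub>hecke R M J\<^esub> cl q = cl (p + q)"
  and cl_one: "\<one>\<^bsub>hecke R M J\<^esub> = cl 1"
  and cl_smult: "c \<in> R \<Longrightarrow> p \<in> carrier A \<Longrightarrow> c \<odot>\<^bsub>hecke R M J\<^esub> cl p = cl (const c * p)"
  unfolding hecke_eq
  by (simp_all add: H.coset_mult H.coset_add H.coset_one H.smult_coset free_algebra_simps)

lemma hecke_carrier: "X \<in> carrier (hecke R M J) \<longleftrightarrow> (\<exists>p\<in>carrier A. X = cl p)"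
  unfolding hecke_eq by (rule H.quot_carrier)

lemma cl_zero: "\<zero>\<^bsub>hecke R M J\<^esub> = cl 0"
proof -
  have "cl 0 \<oplus>\<^bsub>hecke R M J\<^esub> cl 0 = cl 0" using cl_add[OF free_algebra_0[OF R] free_algebra_0[OF R]] by (simp only: add_0)
  then show ?thesis using cl_closed[OF free_algebra_0[OF R]] by (metis Q.add.l_cancel_one)
qed

lemma cl_uminus: "p \<in> carrier A \<Longrightarrow> \<ominus>\<^bsub>hecke R M J\<^esub> cl p = cl (- p)"
  by (rule Q.minus_equality) (simp_all add: cl_add free_algebra_minus[OF R] cl_zero)

lemma gen_A: "j \<in> J \<Longrightarrow> gen j \<in> carrier A"
  by (rule free_algebra_gen[OF R])

lemma hecke_gen_cl: "hecke_gen R M J j = cl (gen j)"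
  by (simp add: hecke_gen_def)

lemma const_A: "c \<in> R \<Longrightarrow> const c \<in> carrier A"
  by (rule free_algebra_const[OF R])

lemma scalar_central:
  assumes "c \<in> R" "X \<in> carrier (hecke R M J)"
  shows "X \<otimes>\<^bsub>hecke R M J\<^esub> cl (const c) = cl (const c) \<otimes>\<^bsub>hecke R M J\<^esub> X"
proof -
  obtain p where "p \<in> carrier A" "X = cl p" using assms(2) by (auto simp: hecke_carrier)
  then show ?thesis using assms(1) by (simp add: cl_mult const_A const_central)
qed

lemma hecke_gen_closed: "j \<in> J \<Longrightarrow> hecke_gen R M J j \<in> carrier (hecke R M J)"
  by (simp add: hecke_gen_cl gen_A)

lemma hecke_gen_commute:
  assumes "i \<in> J" "j \<in> J" "\<not> adj M i j"
  shows "hecke_gen R M J i \<otimes>\<^bsub>hecke R M J\<^esub> hecke_gen R M J j = hecke_gen R M J j \<otimes>\<^bsub>hecke R M J\<^esub> hecke_gen R M J i"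
proof -
  have "gen i * gen j - gen j * gen i \<in> I" using assms by (intro hecke_rels_I) (auto simp: hecke_rels_def)
  then have "cl (gen i * gen j) = cl (gen j * gen i)"
    using assms by (intro cl_eqI free_algebra_mult[OF R] gen_A)
  then show ?thesis using assms by (simp add: hecke_gen_cl cl_mult gen_A)
qed

lemma hecke_gen_braid:
  assumes "i \<in> J" "j \<in> J" "adj M i j"
  shows "hecke_gen R M J i \<otimes>\<^bsub>hecke R M J\<^esub> hecke_gen R M J j \<otimes>\<^bsub>hecke R M J\<^esub> hecke_gen R M J i =
    hecke_gen R M J j \<otimes>\<^bsub>hecke R M J\<^esub> hecke_gen R M J i \<otimes>\<^bsub>hecke R M J\<^esub> hecke_gen R M J j"
proof -
  have "gen i * gen j * gen i - gen j * gen i * gen j \<in> I"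
    using assms by (intro hecke_rels_I) (auto simp: hecke_rels_def)
  then have "cl (gen i * gen j * gen i) = cl (gen j * gen i * gen j)"
    using assms by (intro cl_eqI free_algebra_mult[OF R] gen_A)
  then show ?thesis using assms by (simp add: hecke_gen_cl cl_mult gen_A free_algebra_mult[OF R])
qed

lemma hecke_gen_quadratic:
  assumes "j \<in> J"
  shows "hecke_gen R M J j \<otimes>\<^bsub>hecke R M J\<^esub> hecke_gen R M J j =
    \<one>\<^bsub>hecke R M J\<^esub> \<ominus>\<^bsub>hecke R M J\<^esub> cl (const m_par) \<otimes>\<^bsub>hecke R M J\<^esub> hecke_gen R M J j"
proof -
  have g: "gen j \<in> carrier A" "const m_par \<in> carrier A" using assms by (auto intro: gen_A const_A m_R)
  have "gen j ^ 2 + const m_par * gen j - 1 \<in> I" using assms by (intro hecke_rels_I) (auto simp: hecke_rels_def)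
  moreover have "gen j * gen j - (1 - const m_par * gen j) = gen j ^ 2 + const m_par * gen j - 1"
    by (simp add: power2_eq_square)
  ultimately have "gen j * gen j - (1 - const m_par * gen j) \<in> I" by (simp only:)
  then have "cl (gen j * gen j) = cl (1 - const m_par * gen j)"
    using g by (intro cl_eqI free_algebra_mult[OF R] free_algebra_diff[OF R] free_algebra_1[OF R])
  moreover have "cl (1 - const m_par * gen j) = cl 1 \<ominus>\<^bsub>hecke R M J\<^esub> cl (const m_par * gen j)"
    using g by (simp add: a_minus_def cl_uminus cl_add free_algebra_mult[OF R] free_algebra_minus[OF R] free_algebra_1[OF R])
  ultimately show ?thesis using g by (simp add: hecke_gen_cl cl_mult cl_one)
qed

end

text \<open>The criterion that identifies \<open>tau\<close> and \<open>T_map\<close>, defined by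
  finite sums over the basis, with operators given by closed formulas.\<close>

lemma (in ring) linear_map_of_endo:
  assumes X: "finite X" and f: "f \<in> carrier (linear_endos R (free_right_module R X))"
    and u: "\<And>b. b \<in> X \<Longrightarrow> u b = f (single R X b \<one>)" and v: "v \<in> carrier (free_right_module R X)"
  shows "linear_map_of R X u v = f v"
proof -
  let ?V = "free_right_module R X"
  interpret V: abelian_group ?V by (rule abelian_group_free_right_module[OF X])
  have u_closed: "u b \<in> carrier ?V" if "b \<in> X" for b
    using linear_endos_carrierD(2)[OF f] u[OF that] X by simp
  have sm: "a \<odot>\<^bsub>?V\<^esub> w \<in> carrier ?V" if "a \<in> carrier R" "w \<in> carrier ?V" for a w
    using that by (auto simp: free_right_module_carrier X free_right_module_smult)
  have vc: "v b \<in> carrier R" if "v \<in> carrier ?V" "b \<in> X" for v b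
    using that by (auto simp: free_right_module_carrier X)
  have sadd: "(a \<oplus> c) \<odot>\<^bsub>?V\<^esub> w = a \<odot>\<^bsub>?V\<^esub> w \<oplus>\<^bsub>?V\<^esub> c \<odot>\<^bsub>?V\<^esub> w"
    if "a \<in> carrier R" "c \<in> carrier R" "w \<in> carrier ?V" for a c w
    using that vc by (auto simp: free_right_module_smult free_right_module_add r_distr fun_eq_iff)
  define g where "g v = finsum ?V (\<lambda>b. v b \<odot>\<^bsub>?V\<^esub> u b) X" for v
  have g_closed: "g v \<in> carrier ?V" if "v \<in> carrier ?V" for v
    unfolding g_def using that u_closed sm vc by (intro V.finsum_closed) auto
  have g_add: "g (v \<oplus>\<^bsub>?V\<^esub> w) = g v \<oplus>\<^bsub>?V\<^esub> g w" if "v \<in> carrier ?V" "w \<in> carrier ?V" for v w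
  proof -
    have "g (v \<oplus>\<^bsub>?V\<^esub> w) = finsum ?V (\<lambda>b. v b \<odot>\<^bsub>?V\<^esub> u b \<oplus>\<^bsub>?V\<^esub> w b \<odot>\<^bsub>?V\<^esub> u b) X"
      unfolding g_def
    proof (intro V.finsum_cong' refl)
      fix b assume b: "b \<in> X"
      then show "(v \<oplus>\<^bsub>?V\<^esub> w) b \<odot>\<^bsub>?V\<^esub> u b = v b \<odot>\<^bsub>?V\<^esub> u b \<oplus>\<^bsub>?V\<^esub> w b \<odot>\<^bsub>?V\<^esub> u b"
        using sadd[OF vc[OF that(1) b] vc[OF that(2) b] u_closed[OF b]] by (simp add: free_right_module_add)
    qed (use that sm vc u_closed in auto)
    also have "\<dots> = g v \<oplus>\<^bsub>?V\<^esub> g w"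
      unfolding g_def using that sm vc u_closed by (intro V.finsum_addf) auto
    finally show ?thesis .
  qed
  have "f v = g v"
  proof (rule additive_eqI[OF X v, where pl = "(\<oplus>\<^bsub>?V\<^esub>)"])
    have fz: "f \<zero>\<^bsub>?V\<^esub> = \<zero>\<^bsub>?V\<^esub>"
      using linear_endos_carrierD(2,3)[OF f] by (metis V.add.r_cancel_one' V.l_zero V.zero_closed)
    have "g \<zero>\<^bsub>?V\<^esub> = \<zero>\<^bsub>?V\<^esub>"
      using g_add[of "\<zero>\<^bsub>?V\<^esub>" "\<zero>\<^bsub>?V\<^esub>"] g_closed by (metis V.add.r_cancel_one' V.l_zero V.zero_closed)
    then show "f \<zero>\<^bsub>?V\<^esub> = g \<zero>\<^bsub>?V\<^esub>" using fz by simp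
    fix b a assume b: "b \<in> X" and a: "a \<in> carrier R"
    have "single R X b a = a \<odot>\<^bsub>?V\<^esub> single R X b \<one>"
      using a by (auto simp: single_def free_right_module_smult)
    then have "f (single R X b a) = a \<odot>\<^bsub>?V\<^esub> u b"
      using linear_endos_carrierD(4)[OF f a, of "single R X b \<one>"] u[OF b] X by simp
    moreover have "g (single R X b a) = finsum ?V (\<lambda>c. if b = c then a \<odot>\<^bsub>?V\<^esub> u c else \<zero>\<^bsub>?V\<^esub>) X"
      unfolding g_def
    proof (intro V.finsum_cong' refl)
      fix c assume c: "c \<in> X"
      have "\<zero> \<odot>\<^bsub>?V\<^esub> u c = \<zero>\<^bsub>?V\<^esub>"
        using vc[OF u_closed[OF c]] by (auto simp: free_right_module_smult free_right_module_zero)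
      then show "single R X b a c \<odot>\<^bsub>?V\<^esub> u c = (if b = c then a \<odot>\<^bsub>?V\<^esub> u c else \<zero>\<^bsub>?V\<^esub>)"
        using c by (simp add: single_def)
    qed (use a sm u_closed in auto)
    moreover have "\<dots> = a \<odot>\<^bsub>?V\<^esub> u b"
      using b X a sm u_closed by (intro V.finsum_singleton) auto
    ultimately show "f (single R X b a) = g (single R X b a)" by simp
  qed (use linear_endos_carrierD[OF f] g_add in auto)
  then show ?thesis using v by (simp add: linear_map_of_def g_def)
qed

section \<open>Passage from the smaller Hecke algebra to the larger one\<close>

context simply_laced
begin

sublocale Z0: hecke_alg Q_l_m M "C_nodes M"
  by unfold_locales (simp_all add: coeff_ring_Q_l_m Q_generators)

sublocale Z1: hecke_alg Q_m M "C_nodes M"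
  by unfold_locales (simp_all add: coeff_ring_Q_m Q_generators)

text \<open>The larger ideal intersected with the smaller free algebra is an ideal containing the
  relations, hence contains the ideal that they generate there. This makes \<open>Z1_incl\<close>
  well defined.\<close>

lemma hecke_ideal_mono: "Z1.I \<subseteq> Z0.I"
proof -
  have sub: "carrier Z1.A \<subseteq> carrier Z0.A" by (rule free_algebra_mono[OF Q_m_subset])
  let ?K = "Z0.I \<inter> carrier Z1.A"
  have uminus: "\<ominus>\<^bsub>Z1.A\<^esub> p = \<ominus>\<^bsub>Z0.A\<^esub> p" if "p \<in> carrier Z1.A" for p
    using free_algebra_uminus[OF coeff_ring_Q_m that] free_algebra_uminus[OF coeff_ring_Q_l_m subsetD[OF sub that]] by simp
  have "ideal ?K Z1.A"
  proof (rule idealI[OF Z1.H.ring_axioms])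
    show "subgroup ?K (add_monoid Z1.A)"
    proof (rule Z1.H.add.subgroupI)
      show "?K \<noteq> {}"
        using Z0.H.zero_closed free_algebra_0[OF coeff_ring_Q_m, of "C_nodes M"] by (auto simp: free_algebra_simps)
    next
      fix p assume "p \<in> ?K"
      then show "\<ominus>\<^bsub>Z1.A\<^esub> p \<in> ?K" using Z0.H.a_inv_closed[of p] uminus[of p] free_algebra_minus[OF coeff_ring_Q_m, of p]
        free_algebra_uminus[OF coeff_ring_Q_m, of p] by auto
    next
      fix p q assume "p \<in> ?K" "q \<in> ?K"
      then show "p \<oplus>\<^bsub>Z1.A\<^esub> q \<in> ?K"
        using Z0.H.a_closed[of p q] free_algebra_add[OF coeff_ring_Q_m, of p _ q] by (auto simp: free_algebra_simps)
    qed auto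
  next
    fix p q assume "p \<in> ?K" "q \<in> carrier Z1.A"
    then show "q \<otimes>\<^bsub>Z1.A\<^esub> p \<in> ?K" "p \<otimes>\<^bsub>Z1.A\<^esub> q \<in> ?K"
      using Z0.H.I_l_closed[of p q] Z0.H.I_r_closed[of p q] Z1.H.m_closed[of p q] Z1.H.m_closed[of q p] sub
      by (auto simp: free_algebra_simps)
  qed
  moreover have "hecke_rels M (C_nodes M) \<subseteq> ?K" using Z0.hecke_rels_I Z1.hecke_rels_subset by blast
  ultimately have "Z1.I \<subseteq> ?K" unfolding hecke_ideal_def[of Q_m] by (rule Z1.H.genideal_minimal)
  then show ?thesis by blast
qed

lemma Z1_incl_cl:
  assumes p: "p \<in> carrier Z1.A"
  shows "Z1_incl M (Z1.cl p) = Z0.cl p"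
proof -
  have sub: "carrier Z1.A \<subseteq> carrier Z0.A" by (rule free_algebra_mono[OF Q_m_subset])
  have "Z0.cl q = Z0.cl p" if q: "q \<in> Z1.cl p" for q
  proof -
    obtain y where y: "y \<in> Z1.I" "q = y + p" using q by (auto simp: a_r_coset_def' free_algebra_simps)
    then have "q \<in> carrier Z1.A" using Z1.H.Icarr[of y] p free_algebra_add[OF coeff_ring_Q_m] by blast
    then show ?thesis using y p sub hecke_ideal_mono by (intro Z0.cl_eqI) auto
  qed
  moreover have "p \<in> Z1.cl p" using p by (rule Z1.H.a_rcos_self)
  ultimately show ?thesis unfolding Z1_incl_def by blast
qed

lemma Z1_incl_hom: "Z1_incl M \<in> ring_hom (Z1 M) (Z0 M)"
proof (rule ring_hom_memI)
  have sub: "p \<in> carrier Z1.A \<Longrightarrow> p \<in> carrier Z0.A" for p using free_algebra_mono[OF Q_m_subset] by blast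
  fix X assume "X \<in> carrier (Z1 M)"
  then obtain p where p: "p \<in> carrier Z1.A" "X = Z1.cl p" by (auto simp: Z1.hecke_carrier)
  then show "Z1_incl M X \<in> carrier (Z0 M)" by (simp add: Z1_incl_cl sub)
  fix Y assume "Y \<in> carrier (Z1 M)"
  then obtain q where q: "q \<in> carrier Z1.A" "Y = Z1.cl q" by (auto simp: Z1.hecke_carrier)
  show "Z1_incl M (X \<otimes>\<^bsub>Z1 M\<^esub> Y) = Z1_incl M X \<otimes>\<^bsub>Z0 M\<^esub> Z1_incl M Y"
    using p q by (simp add: Z1.cl_mult Z0.cl_mult Z1_incl_cl sub free_algebra_mult[OF coeff_ring_Q_m])
  show "Z1_incl M (X \<oplus>\<^bsub>Z1 M\<^esub> Y) = Z1_incl M X \<oplus>\<^bsub>Z0 M\<^esub> Z1_incl M Y"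
    using p q by (simp add: Z1.cl_add Z0.cl_add Z1_incl_cl sub free_algebra_add[OF coeff_ring_Q_m])
next
  show "Z1_incl M \<one>\<^bsub>Z1 M\<^esub> = \<one>\<^bsub>Z0 M\<^esub>"
    by (simp add: Z1.cl_one Z0.cl_one Z1_incl_cl free_algebra_1[OF coeff_ring_Q_m])
qed

abbreviation z1 :: "nat \<Rightarrow> nat fpoly set" where
  "z1 \<equiv> hecke_gen Q_m M (C_nodes M)"

abbreviation z0 :: "nat \<Rightarrow> nat fpoly set" where
  "z0 \<equiv> hecke_gen Q_l_m M (C_nodes M)"

sublocale C1: hecke_coeffs M "Z1 M" "Z1.cl (const m_par)" z1
proof unfold_locales
  fix i j assume "i \<in> C_nodes M" "j \<in> C_nodes M" "\<not> adj M i j"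
  then show "z1 i \<otimes>\<^bsub>Z1 M\<^esub> z1 j = z1 j \<otimes>\<^bsub>Z1 M\<^esub> z1 i" by (rule Z1.hecke_gen_commute)
next
  fix i j assume "i \<in> C_nodes M" "j \<in> C_nodes M" "adj M i j"
  then show "z1 i \<otimes>\<^bsub>Z1 M\<^esub> z1 j \<otimes>\<^bsub>Z1 M\<^esub> z1 i = z1 j \<otimes>\<^bsub>Z1 M\<^esub> z1 i \<otimes>\<^bsub>Z1 M\<^esub> z1 j"
    by (rule Z1.hecke_gen_braid)
qed (simp_all add: Z1.const_A Q_generators Z1.scalar_central Z1.hecke_gen_closed Z1.hecke_gen_quadratic)

sublocale C0: hecke_coeffs M "Z0 M" "Z0.cl (const m_par)" z0
proof unfold_locales
  fix i j assume "i \<in> C_nodes M" "j \<in> C_nodes M" "\<not> adj M i j"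
  then show "z0 i \<otimes>\<^bsub>Z0 M\<^esub> z0 j = z0 j \<otimes>\<^bsub>Z0 M\<^esub> z0 i" by (rule Z0.hecke_gen_commute)
next
  fix i j assume "i \<in> C_nodes M" "j \<in> C_nodes M" "adj M i j"
  then show "z0 i \<otimes>\<^bsub>Z0 M\<^esub> z0 j \<otimes>\<^bsub>Z0 M\<^esub> z0 i = z0 j \<otimes>\<^bsub>Z0 M\<^esub> z0 i \<otimes>\<^bsub>Z0 M\<^esub> z0 j"
    by (rule Z0.hecke_gen_braid)
qed (simp_all add: Z0.const_A Q_generators Z0.scalar_central Z0.hecke_gen_closed Z0.hecke_gen_quadratic)

lemma Z1_incl_gen: "j \<in> C_nodes M \<Longrightarrow> Z1_incl M (z1 j) = z0 j"
  by (simp add: Z1.hecke_gen_cl Z0.hecke_gen_cl Z1_incl_cl Z1.gen_A)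

lemma Z1_incl_m: "Z1_incl M (Z1.cl (const m_par)) = Z0.cl (const m_par)"
  by (simp add: Z1_incl_cl Z1.const_A Q_generators)

text \<open>The coefficients are constructed in the smaller algebra, as the theorem demands; the
  representation uses their images.\<close>

definition T0 :: "nat \<Rightarrow> root \<Rightarrow> nat fpoly set" where
  "T0 i \<beta> = Z1_incl M (C1.T_coeff i \<beta>)"

interpretation incl: ring_hom_ring "Z1 M" "Z0 M" "Z1_incl M"
  by (intro ring_hom_ringI2 Z1_incl_hom Z1.Q.ring_axioms Z0.Q.ring_axioms)

lemma T0_tau:
  assumes ij: "i \<in> nodes M" "j \<in> nodes M" and \<beta>: "\<beta> \<in> Phi_pos"
  shows "C0.T_tau T0 i j \<beta> = Z1_incl M (C1.T_tau C1.T_coeff i j \<beta>)"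
proof -
  have bP: "\<beta> \<in> Phi" using \<beta> Phi_pos_Phi by blast
  have c: "C1.T_coeff i \<gamma> \<in> carrier (Z1 M)" if "\<gamma> \<in> Phi" for \<gamma> using C1.T_coeff_closed ij that by blast
  have h: "Z1_incl M (C1.h \<beta> j) = C0.h \<beta> j" if "ip j \<beta> = 0"
    unfolding C1.h_def C0.h_def using hidx_C[OF bP ij(2) that] by (rule Z1_incl_gen)
  show ?thesis
    using c[OF bP] c[of "refl j \<beta>"] bP ij h
    by (simp add: C0.T_tau_def C1.T_tau_def T0_def a_minus_def Z1_incl_m Z1.const_A Q_generators)
qed

sublocale rep: hecke_rep M "Z0 M" "Z0.cl (const m_par)" z0 "Z0.cl (const (inverse l_ind))" T0
proof unfold_locales
  fix i k assume "i \<in> nodes M" "k \<in> nodes M"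
  then show "T0 i (simple_root k) = (if k = i then \<one>\<^bsub>Z0 M\<^esub> else \<zero>\<^bsub>Z0 M\<^esub>)"
    by (simp add: T0_def C1.T_coeff_simple)
next
  fix i j \<beta> assume ij: "i \<in> nodes M" "j \<in> nodes M" "adj M i j" and \<beta>: "\<beta> \<in> Phi_pos"
  then show "C0.T_tau T0 i j \<beta> = C0.T_tau T0 j i \<beta>"
    by (simp add: T0_tau C1.T_tau_adj[OF ij \<beta>])
next
  fix i j \<beta> assume ij: "i \<in> nodes M" "j \<in> nodes M" "i \<noteq> j" "\<not> adj M i j" and \<beta>: "\<beta> \<in> Phi_pos"
  have z: "ip j (simple_root i) = 0" using ij by (simp add: inner_form_simple_simple cartan_def adj_sym)
  have "Z1_incl M (C1.h (simple_root i) j) = C0.h (simple_root i) j"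
    unfolding C1.h_def C0.h_def using hidx_C[OF simple_root_Phi[OF ij(1)] ij(2) z] by (rule Z1_incl_gen)
  then show "C0.T_tau T0 i j \<beta> = C0.h (simple_root i) j \<otimes>\<^bsub>Z0 M\<^esub> T0 i \<beta>"
    using ij \<beta> z by (simp add: T0_tau C1.T_tau_nonadj T0_def C1.T_coeff_closed Phi_pos_Phi)
qed (auto simp: Z0.const_A Q_generators Z0.scalar_central T0_def C1.T_coeff_closed Phi_pos_Phi)

end

subsection \<open>The homomorphism from the Artin group\<close>

context simply_laced
begin

abbreviation E0 where "E0 \<equiv> linear_endos (Z0 M) rep.V"

abbreviation scal :: "ratfun \<Rightarrow> nat fpoly set" where
  "scal c \<equiv> Z0.cl (const c)"

lemma ring_E0: "ring E0"
  by (rule scalar_action.linear_endos_ring[OF rep.scalar_action_V])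

sublocale E0: ring E0
  by (rule ring_E0)

definition sigE :: "nat \<Rightarrow> (root \<Rightarrow> nat fpoly set) \<Rightarrow> root \<Rightarrow> nat fpoly set" where
  "sigE i = (\<lambda>v\<in>carrier rep.V. rep.sig i v)"

lemma V_smult_add: "z \<in> carrier (Z0 M) \<Longrightarrow> v \<in> carrier rep.V \<Longrightarrow> w \<in> carrier rep.V \<Longrightarrow>
    z \<odot>\<^bsub>rep.V\<^esub> (v \<oplus>\<^bsub>rep.V\<^esub> w) = z \<odot>\<^bsub>rep.V\<^esub> v \<oplus>\<^bsub>rep.V\<^esub> z \<odot>\<^bsub>rep.V\<^esub> w"
  by (rule scalar_action.smult_add[OF rep.scalar_action_V])

lemma sigE_closed [simp]: "i \<in> nodes M \<Longrightarrow> sigE i \<in> carrier E0"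
  unfolding sigE_def
  by (rule linear_endosI) (simp_all add: rep.sig_add rep.sig_rmul rep.V_smult_closed)

lemma sigE_apply: "v \<in> carrier rep.V \<Longrightarrow> sigE i v = rep.sig i v"
  by (simp add: sigE_def)

lemma restrict_scalars_simps:
  "carrier (restrict_scalars (Z0 M) rep.V) = carrier rep.V"
  "v \<oplus>\<^bsub>restrict_scalars (Z0 M) rep.V\<^esub> w = v \<oplus>\<^bsub>rep.V\<^esub> w"
  "\<zero>\<^bsub>restrict_scalars (Z0 M) rep.V\<^esub> = \<zero>\<^bsub>rep.V\<^esub>"
  by (simp_all add: restrict_scalars_def)

lemma restrict_scalars_smult:
  "c \<in> Q_l_m \<Longrightarrow> c \<odot>\<^bsub>restrict_scalars (Z0 M) rep.V\<^esub> v = scal c \<odot>\<^bsub>rep.V\<^esub> v"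
  by (simp add: restrict_scalars_def Z0.cl_one Z0.cl_smult free_algebra_1[OF coeff_ring_Q_l_m])

lemma basis_vec_eq: "basis_vec (Z0 M) Phi_pos \<beta> = rep.e \<beta> \<one>\<^bsub>Z0 M\<^esub>"
  by (simp add: basis_vec_def single_def)

text \<open>Both sides are linear, so basis vectors decide; there \<open>tau'_e\<close> supplies the
  values and \<open>h_elt_eq\<close> identifies the factor defined through conjugation in the Artin
  group.\<close>

lemma tau_eq:
  assumes i: "i \<in> nodes M" and v: "v \<in> carrier rep.V"
  shows "tau M i v = rep.tau' i v"
proof -
  let ?f = "\<lambda>v\<in>carrier rep.V. rep.tau' i v"
  have f: "?f \<in> carrier E0"
    using i by (intro linear_endosI) (simp_all add: rep.tau'_add rep.tau'_rmul rep.V_smult_closed)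
  have "tau M i v = ?f v"
    unfolding tau_def pos_roots_eq
  proof (rule Z0.Q.linear_map_of_endo[OF finite_Phi_pos f _ v])
    fix \<beta> assume \<beta>: "\<beta> \<in> Phi_pos"
    note bP = Phi_pos_Phi[OF \<beta>]
    let ?x = "rep.e \<beta> \<one>\<^bsub>Z0 M\<^esub>"
    have fx: "?f ?x = rep.tau' i ?x" by simp
    note te = rep.tau'_e[OF i \<beta> Z0.Q.one_closed]
    consider "ip i \<beta> = 2" | "ip i \<beta> = 1" | "ip i \<beta> = 0" | "ip i \<beta> = - 1"
      using ip_pos_values[OF i \<beta>] by auto
    then show "(if ip i \<beta> = 2 then \<zero>\<^bsub>rep.V\<^esub>
         else if ip i \<beta> = 1 then basis_vec (Z0 M) Phi_pos (\<beta> - simple_root i)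
         else if ip i \<beta> = 0 then Z1_incl M (h_elt M \<beta> i) \<odot>\<^bsub>rep.V\<^esub> basis_vec (Z0 M) Phi_pos \<beta>
         else basis_vec (Z0 M) Phi_pos (\<beta> + simple_root i) \<ominus>\<^bsub>rep.V\<^esub>
           (m_par \<odot>\<^bsub>restrict_scalars (Z0 M) rep.V\<^esub> basis_vec (Z0 M) Phi_pos \<beta>)) = ?f ?x"
    proof cases
      case 1 then show ?thesis unfolding fx te(1)[OF 1] by simp
    next
      case 2 then show ?thesis unfolding fx te(2)[OF 2] by (simp add: basis_vec_eq reflect_eq_diff)
    next
      case 3
      have "Z1_incl M (h_elt M \<beta> i) = C0.h \<beta> i"
        unfolding h_elt_eq[OF bP i 3] C0.h_def by (rule Z1_incl_gen[OF hidx_C[OF bP i 3]])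
      then show ?thesis unfolding fx te(3)[OF 3] using 3 bP i
        by (simp add: basis_vec_eq rep.smult_e)
    next
      case 4
      have "\<ominus>\<^bsub>rep.V\<^esub> rep.e \<beta> (scal m_par) = rep.e \<beta> (\<ominus>\<^bsub>Z0 M\<^esub> scal m_par)"
      proof (rule rep.V_eqI)
        fix \<gamma> assume "\<gamma> \<in> Phi_pos"
        then show "(\<ominus>\<^bsub>rep.V\<^esub> rep.e \<beta> (scal m_par)) \<gamma> = rep.e \<beta> (\<ominus>\<^bsub>Z0 M\<^esub> scal m_par) \<gamma>"
          by (simp add: rep.V_minus_apply rep.e_apply Q_generators)
      qed (simp_all add: Q_generators)
      then show ?thesis unfolding fx te(4)[OF 4] using 4
        by (simp add: basis_vec_eq reflect_eq_add restrict_scalars_smult Q_generators rep.smult_e a_minus_def)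
    qed
  qed
  then show ?thesis using v by simp
qed

lemma T_map_eq:
  assumes i: "i \<in> nodes M" and v: "v \<in> carrier rep.V"
  shows "T_map M C1.T_coeff i v = rep.e (simple_root i) (rep.t i v)"
proof -
  let ?f = "\<lambda>v\<in>carrier rep.V. rep.e (simple_root i) (rep.t i v)"
  have f: "?f \<in> carrier E0"
    using i by (intro linear_endosI)
      (simp_all add: rep.t_add rep.t_rmul rep.V_smult_closed Z0.Q.single_add rep.smult_e)
  have "T_map M C1.T_coeff i v = ?f v"
    unfolding T_map_def pos_roots_eq
  proof (rule Z0.Q.linear_map_of_endo[OF finite_Phi_pos f _ v])
    fix \<beta> assume \<beta>: "\<beta> \<in> Phi_pos"
    show "Z1_incl M (C1.T_coeff i \<beta>) \<odot>\<^bsub>rep.V\<^esub> basis_vec (Z0 M) Phi_pos (simple_root i) = ?f (rep.e \<beta> \<one>\<^bsub>Z0 M\<^esub>)"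
      using i \<beta> rep.T_closed[OF i \<beta>] by (simp add: basis_vec_eq rep.smult_e rep.t_e T0_def[symmetric])
  qed
  then show ?thesis using v by simp
qed

lemma sigma_eq: "i \<in> nodes M \<Longrightarrow> sigma M C1.T_coeff i = sigE i"
  unfolding sigma_def sigE_def pos_roots_eq
  by (rule restrict_ext)
     (simp add: tau_eq T_map_eq restrict_scalars_smult Q_generators rep.smult_e rep.sig_def Z0.scalar_central)

text \<open>Multiplication by a scalar as an endomorphism; it is linear over the noncommutative ring
  because the scalars are central. It replaces the scalar multiplication of
  \<open>linear_endos\<close>, which is meaningful only for commutative rings.\<close>

definition smul :: "ratfun \<Rightarrow> (root \<Rightarrow> nat fpoly set) \<Rightarrow> root \<Rightarrow> nat fpoly set" where
  "smul c = (\<lambda>v\<in>carrier rep.V. scal c \<odot>\<^bsub>rep.V\<^esub> v)"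

lemma V_smult_smult:
  "a \<in> carrier (Z0 M) \<Longrightarrow> b \<in> carrier (Z0 M) \<Longrightarrow> v \<in> carrier rep.V \<Longrightarrow>
    a \<odot>\<^bsub>rep.V\<^esub> (b \<odot>\<^bsub>rep.V\<^esub> v) = (b \<otimes>\<^bsub>Z0 M\<^esub> a) \<odot>\<^bsub>rep.V\<^esub> v"
  unfolding free_right_module_smult by (rule restrict_ext) (simp add: Z0.Q.m_assoc)

lemma V_smult_one: "v \<in> carrier rep.V \<Longrightarrow> \<one>\<^bsub>Z0 M\<^esub> \<odot>\<^bsub>rep.V\<^esub> v = v"
  by (rule rep.V_eqI) (simp_all add: rep.V_smult_closed rep.V_smult_apply)

lemma smul_closed [simp]: "c \<in> Q_l_m \<Longrightarrow> smul c \<in> carrier E0"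
  unfolding smul_def
  by (rule linear_endosI) (simp_all add: rep.V_smult_closed V_smult_add V_smult_smult Z0.scalar_central)

lemma smul_apply: "v \<in> carrier rep.V \<Longrightarrow> smul c v = scal c \<odot>\<^bsub>rep.V\<^esub> v"
  by (simp add: smul_def)

lemma smul_central: "c \<in> Q_l_m \<Longrightarrow> f \<in> carrier E0 \<Longrightarrow> f \<otimes>\<^bsub>E0\<^esub> smul c = smul c \<otimes>\<^bsub>E0\<^esub> f"
  unfolding linear_endos_mult
  by (rule restrict_ext) (simp add: smul_apply linear_endos_carrierD)

lemma smul_mult: "c \<in> Q_l_m \<Longrightarrow> d \<in> Q_l_m \<Longrightarrow> smul c \<otimes>\<^bsub>E0\<^esub> smul d = smul (c * d)"
  unfolding linear_endos_mult smul_def[of "c * d"]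
  by (rule restrict_ext)
     (simp add: smul_apply rep.V_smult_closed V_smult_smult Z0.cl_mult Z0.const_A const_mult mult.commute)

lemma smul_one: "smul 1 = \<one>\<^bsub>E0\<^esub>"
  unfolding linear_endos_one smul_def const_1 Z0.cl_one[symmetric]
  by (rule restrict_ext) (simp add: V_smult_one)

lemma E0_minus_apply: "f \<in> carrier E0 \<Longrightarrow> v \<in> carrier rep.V \<Longrightarrow> (\<ominus>\<^bsub>E0\<^esub> f) v = \<ominus>\<^bsub>rep.V\<^esub> f v"
  by (simp add: scalar_action.linear_endos_minus[OF rep.scalar_action_V])

definition quadE :: "nat \<Rightarrow> (root \<Rightarrow> nat fpoly set) \<Rightarrow> root \<Rightarrow> nat fpoly set" where
  "quadE i = sigE i \<otimes>\<^bsub>E0\<^esub> sigE i \<oplus>\<^bsub>E0\<^esub> smul m_par \<otimes>\<^bsub>E0\<^esub> sigE i \<ominus>\<^bsub>E0\<^esub> \<one>\<^bsub>E0\<^esub>"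

lemma quadE_closed [simp]: "i \<in> nodes M \<Longrightarrow> quadE i \<in> carrier E0"
  by (simp add: quadE_def Q_generators)

lemma quadE_apply:
  assumes "i \<in> nodes M" "v \<in> carrier rep.V"
  shows "quadE i v = rep.quad i v"
proof -
  have "quadE i v = (sigE i \<otimes>\<^bsub>E0\<^esub> sigE i) v \<oplus>\<^bsub>rep.V\<^esub> (smul m_par \<otimes>\<^bsub>E0\<^esub> sigE i) v \<oplus>\<^bsub>rep.V\<^esub> (\<ominus>\<^bsub>E0\<^esub> \<one>\<^bsub>E0\<^esub>) v"
    using assms by (simp add: quadE_def a_minus_def linear_endos_add)
  then show ?thesis
    using assms by (simp add: E0_minus_apply rep.quad_def a_minus_def)
      (simp add: linear_endos_mult linear_endos_one sigE_apply smul_apply)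
qed

lemma quad_closed: "i \<in> nodes M \<Longrightarrow> v \<in> carrier rep.V \<Longrightarrow> rep.quad i v \<in> carrier rep.V"
  using linear_endos_carrierD(2)[OF quadE_closed] quadE_apply by metis

lemma sigE_quadE:
  assumes i: "i \<in> nodes M"
  shows "sigE i \<otimes>\<^bsub>E0\<^esub> quadE i = smul (inverse l_ind) \<otimes>\<^bsub>E0\<^esub> quadE i"
proof (rule linear_endos_eqI[where Z = "Z0 M" and V = rep.V])
  fix v assume v: "v \<in> carrier rep.V"
  show "(sigE i \<otimes>\<^bsub>E0\<^esub> quadE i) v = (smul (inverse l_ind) \<otimes>\<^bsub>E0\<^esub> quadE i) v"
    using i v quad_closed[OF i v]
    by (simp add: linear_endos_mult sigE_apply smul_apply quadE_apply rep.sig_quad)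
qed (use i in \<open>simp_all add: Q_generators\<close>)

lemma quadE_quadE:
  assumes "i \<in> nodes M" "j \<in> nodes M" "i \<noteq> j" "\<not> adj M i j"
  shows "quadE i \<otimes>\<^bsub>E0\<^esub> quadE j = \<zero>\<^bsub>E0\<^esub>"
proof (rule linear_endos_eqI[where Z = "Z0 M" and V = rep.V])
  fix v assume v: "v \<in> carrier rep.V"
  show "(quadE i \<otimes>\<^bsub>E0\<^esub> quadE j) v = \<zero>\<^bsub>E0\<^esub> v"
    using assms v quad_closed[OF assms(2) v] by (simp add: linear_endos_mult linear_endos_zero quadE_apply rep.quad_quad_nonadj)
qed (use assms in simp_all)

lemma quadE_sigE_quadE:
  assumes "i \<in> nodes M" "j \<in> nodes M" "adj M i j"
  shows "quadE i \<otimes>\<^bsub>E0\<^esub> (sigE j \<otimes>\<^bsub>E0\<^esub> quadE i) = smul m_par \<otimes>\<^bsub>E0\<^esub> quadE i"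
proof (rule linear_endos_eqI[where Z = "Z0 M" and V = rep.V])
  fix v assume v: "v \<in> carrier rep.V"
  show "(quadE i \<otimes>\<^bsub>E0\<^esub> (sigE j \<otimes>\<^bsub>E0\<^esub> quadE i)) v = (smul m_par \<otimes>\<^bsub>E0\<^esub> quadE i) v"
    using assms v quad_closed[OF assms(1) v]
    by (simp add: linear_endos_mult sigE_apply smul_apply quadE_apply rep.quad_sig_quad_adj)
qed (use assms in \<open>simp_all add: Q_generators\<close>)

lemma sigE_commute:
  assumes "i \<in> nodes M" "j \<in> nodes M" "i \<noteq> j" "\<not> adj M i j"
  shows "sigE i \<otimes>\<^bsub>E0\<^esub> sigE j = sigE j \<otimes>\<^bsub>E0\<^esub> sigE i"
  unfolding linear_endos_mult by (rule restrict_ext) (use assms in \<open>simp add: sigE_apply rep.sig_commute[OF assms]\<close>)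

lemma sigE_braid:
  assumes "i \<in> nodes M" "j \<in> nodes M" "adj M i j"
  shows "sigE i \<otimes>\<^bsub>E0\<^esub> (sigE j \<otimes>\<^bsub>E0\<^esub> sigE i) = sigE j \<otimes>\<^bsub>E0\<^esub> (sigE i \<otimes>\<^bsub>E0\<^esub> sigE j)"
  unfolding linear_endos_mult by (rule restrict_ext) (use assms in \<open>simp add: sigE_apply rep.sig_braid[OF assms]\<close>)

text \<open>By \<open>sigE_quadE\<close> the operator satisfies the cubic relation of
  \<open>cubic_unit\<close>, in which the inverse of \<open>l\<close> plays the part of the
  invertible eigenvalue.\<close>

lemma sigE_unit:
  assumes i: "i \<in> nodes M"
  shows "sigE i \<in> Units E0"
proof (rule E0.cubic_unit[of _ "smul m_par" "smul (inverse l_ind)"])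
  have "smul (inverse l_ind) \<otimes>\<^bsub>E0\<^esub> smul l_ind = \<one>\<^bsub>E0\<^esub>" "smul l_ind \<otimes>\<^bsub>E0\<^esub> smul (inverse l_ind) = \<one>\<^bsub>E0\<^esub>"
    using l_ind_nonzero by (simp_all add: smul_mult Q_generators smul_one)
  then show "smul (inverse l_ind) \<in> Units E0" unfolding Units_def using Q_generators by auto
  show "sigE i \<otimes>\<^bsub>E0\<^esub> smul m_par = smul m_par \<otimes>\<^bsub>E0\<^esub> sigE i"
    "sigE i \<otimes>\<^bsub>E0\<^esub> smul (inverse l_ind) = smul (inverse l_ind) \<otimes>\<^bsub>E0\<^esub> sigE i"
    using i by (simp_all only: smul_central Q_generators sigE_closed)
  show "smul m_par \<otimes>\<^bsub>E0\<^esub> smul (inverse l_ind) = smul (inverse l_ind) \<otimes>\<^bsub>E0\<^esub> smul m_par"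
    by (simp add: smul_mult Q_generators mult.commute)
qed (use i sigE_quadE[OF i] in \<open>simp_all add: quadE_def[symmetric] Q_generators\<close>)

lemma artin_hom:
  assumes "monoid B" and f: "\<And>i. i \<in> nodes M \<Longrightarrow> f i \<in> Units B"
    and commute: "\<And>i j. i \<in> nodes M \<Longrightarrow> j \<in> nodes M \<Longrightarrow> i \<noteq> j \<Longrightarrow> \<not> adj M i j \<Longrightarrow> f i \<otimes>\<^bsub>B\<^esub> f j = f j \<otimes>\<^bsub>B\<^esub> f i"
    and braid: "\<And>i j. i \<in> nodes M \<Longrightarrow> j \<in> nodes M \<Longrightarrow> adj M i j \<Longrightarrow>
      f i \<otimes>\<^bsub>B\<^esub> (f j \<otimes>\<^bsub>B\<^esub> f i) = f j \<otimes>\<^bsub>B\<^esub> (f i \<otimes>\<^bsub>B\<^esub> f j)"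
  obtains \<phi> where "\<phi> \<in> hom (artin M) (units_of B)" "\<And>i. i \<in> nodes M \<Longrightarrow> \<phi> (artin_gen M i) = f i"
proof -
  interpret monoid B by (rule assms(1))
  have fc: "\<And>g. g \<in> nodes M \<Longrightarrow> f g \<in> carrier (units_of B)" using f by (simp add: units_of_carrier)
  have "eval_word (units_of B) f p = eval_word (units_of B) f q" if "(p, q) \<in> braid_rels M" for p q
    using that Units_closed[OF f]
    by (auto simp: braid_rels_def eval_letter_def units_of_mult units_of_one intro: commute braid)
  from presented_group_hom[OF units_group fc word_rels_braid this]
  obtain \<phi> where \<phi>: "\<phi> \<in> hom (presented_group (nodes M) (braid_rels M)) (units_of B)"
    "\<And>u. u \<in> lists (nodes M \<times> UNIV) \<Longrightarrow> \<phi> (pres_class (nodes M) (braid_rels M) u) = eval_word (units_of B) f u"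
    by blast
  have "\<phi> (artin_gen M i) = f i" if "i \<in> nodes M" for i
    using \<phi>(2)[of "pos_word [i]"] that Units_closed[OF f[OF that]]
    by (simp add: artin_word_def eval_letter_def units_of_mult units_of_one)
  then show ?thesis using that \<phi>(1) by (simp add: artin_def)
qed

lemma artin_hom_eqI:
  assumes "monoid B" "\<phi> \<in> hom (artin M) (units_of B)" "\<psi> \<in> hom (artin M) (units_of B)"
    and "\<And>i. i \<in> nodes M \<Longrightarrow> \<phi> (artin_gen M i) = \<psi> (artin_gen M i)" "a \<in> carrier (artin M)"
  shows "\<phi> a = \<psi> a"
  using assms hom_presented_group_eqI[OF word_rels_braid monoid.units_group[OF assms(1)], of \<phi> M \<psi> a]
  by (simp add: artin_def artin_word_def)

end

lemma ring_hom_units: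
  assumes "monoid A" "monoid B" "x \<in> Units A"
    and closed: "\<And>x. x \<in> carrier A \<Longrightarrow> f x \<in> carrier B"
    and mult: "\<And>x y. x \<in> carrier A \<Longrightarrow> y \<in> carrier A \<Longrightarrow> f (x \<otimes>\<^bsub>A\<^esub> y) = f x \<otimes>\<^bsub>B\<^esub> f y"
    and one: "f \<one>\<^bsub>A\<^esub> = \<one>\<^bsub>B\<^esub>"
  shows "f x \<in> Units B"
proof -
  obtain y where y: "x \<in> carrier A" "y \<in> carrier A" "x \<otimes>\<^bsub>A\<^esub> y = \<one>\<^bsub>A\<^esub>" "y \<otimes>\<^bsub>A\<^esub> x = \<one>\<^bsub>A\<^esub>"
    using assms(3) by (auto simp: Units_def)
  then have "f x \<otimes>\<^bsub>B\<^esub> f y = \<one>\<^bsub>B\<^esub>" "f y \<otimes>\<^bsub>B\<^esub> f x = \<one>\<^bsub>B\<^esub>" using mult one by metis+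
  then show ?thesis using closed[OF y(1)] closed[OF y(2)] by (auto simp: Units_def)
qed

lemma hom_units_compose:
  assumes "monoid A" "monoid B" "\<phi> \<in> hom \<Gamma> (units_of A)"
    and closed: "\<And>x. x \<in> carrier A \<Longrightarrow> f x \<in> carrier B"
    and mult: "\<And>x y. x \<in> carrier A \<Longrightarrow> y \<in> carrier A \<Longrightarrow> f (x \<otimes>\<^bsub>A\<^esub> y) = f x \<otimes>\<^bsub>B\<^esub> f y"
    and one: "f \<one>\<^bsub>A\<^esub> = \<one>\<^bsub>B\<^esub>"
  shows "(\<lambda>a. f (\<phi> a)) \<in> hom \<Gamma> (units_of B)"
proof (rule homI)
  have u: "\<phi> a \<in> Units A" if "a \<in> carrier \<Gamma>" for a
    using assms(3) that by (auto simp: hom_def units_of_carrier)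
  fix a b assume a: "a \<in> carrier \<Gamma>"
  show "f (\<phi> a) \<in> carrier (units_of B)"
    using ring_hom_units[OF assms(1,2) u[OF a] closed mult one] by (simp add: units_of_carrier)
  assume b: "b \<in> carrier \<Gamma>"
  have "\<phi> (a \<otimes>\<^bsub>\<Gamma>\<^esub> b) = \<phi> a \<otimes>\<^bsub>A\<^esub> \<phi> b"
    using hom_mult[OF assms(3) a b] by (simp add: units_of_mult)
  moreover have "\<phi> a \<in> carrier A" "\<phi> b \<in> carrier A" using u[OF a] u[OF b] by (auto simp: Units_def)
  ultimately show "f (\<phi> (a \<otimes>\<^bsub>\<Gamma>\<^esub> b)) = f (\<phi> a) \<otimes>\<^bsub>units_of B\<^esub> f (\<phi> b)"
    using mult by (simp add: units_of_mult)
qed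

subsection \<open>The BMW algebra\<close>

locale bmw_alg =
  fixes M :: diagram
begin

definition bmw_gens :: "bmw_gen set" where
  "bmw_gens = G ` nodes M \<union> E ` nodes M"

lemma bmw_free_eq: "bmw_free M = free_algebra UNIV (bmw_gens)"
  by (simp add: bmw_free_def bmw_gens_def)

lemma bmw_gens_mem: "i \<in> nodes M \<Longrightarrow> G i \<in> bmw_gens" "i \<in> nodes M \<Longrightarrow> E i \<in> bmw_gens"
  by (auto simp: bmw_gens_def)

lemma bmw_free_closed:
  "p \<in> carrier (bmw_free M) \<Longrightarrow> q \<in> carrier (bmw_free M) \<Longrightarrow> p * q \<in> carrier (bmw_free M)"
  "p \<in> carrier (bmw_free M) \<Longrightarrow> q \<in> carrier (bmw_free M) \<Longrightarrow> p + q \<in> carrier (bmw_free M)"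
  "p \<in> carrier (bmw_free M) \<Longrightarrow> q \<in> carrier (bmw_free M) \<Longrightarrow> p - q \<in> carrier (bmw_free M)"
  "p \<in> carrier (bmw_free M) \<Longrightarrow> p ^ 2 \<in> carrier (bmw_free M)"
  "p \<in> carrier (bmw_free M) \<Longrightarrow> - p \<in> carrier (bmw_free M)"
  "1 \<in> carrier (bmw_free M)" "0 \<in> carrier (bmw_free M)" "const c \<in> carrier (bmw_free M)"
  "i \<in> nodes M \<Longrightarrow> gen (G i) \<in> carrier (bmw_free M)" "i \<in> nodes M \<Longrightarrow> gen (E i) \<in> carrier (bmw_free M)"
  unfolding bmw_free_eq
  by (intro free_algebra_mult free_algebra_add free_algebra_diff free_algebra_power2 free_algebra_minus free_algebra_1
      free_algebra_0 free_algebra_const free_algebra_gen coeff_ring_UNIV bmw_gens_mem UNIV_I; assumption)+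

lemma bmw_rels_subset: "bmw_rels M \<subseteq> carrier (bmw_free M)"
  unfolding bmw_rels_def by (auto intro!: bmw_free_closed)

sublocale bmw_scalar: scalar_algebra "bmw_free M" UNIV const
  unfolding bmw_free_eq by (rule scalar_algebra_free_algebra[OF coeff_ring_UNIV])

sublocale BMW: scalar_algebra_ideal "bmw_free M" UNIV const "bmw_ideal M"
proof (intro scalar_algebra_ideal.intro bmw_scalar.scalar_algebra_axioms)
  show "ideal (bmw_ideal M) (bmw_free M)"
    unfolding bmw_ideal_def by (rule bmw_scalar.genideal_ideal[OF bmw_rels_subset])
qed

lemma bmw_eq: "bmw M = quot_algebra (bmw_free M) (bmw_ideal M)"
  by (simp add: bmw_def)

sublocale B: scalar_algebra "bmw M" UNIV "\<lambda>c. bmw_ideal M +>\<^bsub>bmw_free M\<^esub> const c"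
  unfolding bmw_eq by (rule BMW.scalar_algebra_quot)

abbreviation bcl :: "bmw_gen fpoly \<Rightarrow> bmw_gen fpoly set" where
  "bcl p \<equiv> bmw_ideal M +>\<^bsub>bmw_free M\<^esub> p"

lemma bmw_free_minus:
  "p \<in> carrier (bmw_free M) \<Longrightarrow> q \<in> carrier (bmw_free M) \<Longrightarrow> p \<ominus>\<^bsub>bmw_free M\<^esub> q = p - q"
  unfolding bmw_free_eq by (simp add: a_minus_def free_algebra_simps free_algebra_uminus[OF coeff_ring_UNIV])

lemma bcl_closed: "p \<in> carrier (bmw_free M) \<Longrightarrow> bcl p \<in> carrier (bmw M)"
  unfolding bmw_eq by (rule BMW.coset_closed)

lemma bcl_mult: "p \<in> carrier (bmw_free M) \<Longrightarrow> q \<in> carrier (bmw_free M) \<Longrightarrow>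
    bcl p \<otimes>\<^bsub>bmw M\<^esub> bcl q = bcl (p * q)"
  and bcl_add: "p \<in> carrier (bmw_free M) \<Longrightarrow> q \<in> carrier (bmw_free M) \<Longrightarrow>
    bcl p \<oplus>\<^bsub>bmw M\<^esub> bcl q = bcl (p + q)"
  and bcl_one: "\<one>\<^bsub>bmw M\<^esub> = bcl 1"
  unfolding bmw_eq using BMW.coset_mult[of p q] BMW.coset_add[of p q] BMW.coset_one
  by (simp_all add: bmw_free_eq free_algebra_simps)

lemma bcl_eqI: "p \<in> carrier (bmw_free M) \<Longrightarrow> q \<in> carrier (bmw_free M) \<Longrightarrow> p - q \<in> bmw_rels M \<Longrightarrow> bcl p = bcl q"
  using BMW.coset_eq_iff[of p q] bmw_scalar.genideal_self[OF bmw_rels_subset]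
  by (auto simp: bmw_free_minus bmw_ideal_def)

lemma bcl_minus:
  assumes "p \<in> carrier (bmw_free M)" "q \<in> carrier (bmw_free M)"
  shows "bcl p \<ominus>\<^bsub>bmw M\<^esub> bcl q = bcl (p - q)"
proof -
  have "bcl (p - q) \<oplus>\<^bsub>bmw M\<^esub> bcl q = bcl p" using assms by (simp add: bcl_add bmw_free_closed)
  then show ?thesis
    using assms bcl_closed[OF assms(1)] bcl_closed[OF assms(2)] bcl_closed[OF bmw_free_closed(3)[OF assms]]
    by (metis B.add.inv_solve_right' B.minus_eq)
qed

lemma bmw_elt_eq: "bmw_elt M a = bcl (gen a)"
  by (simp add: bmw_elt_def)

lemma bmw_elt_closed: "i \<in> nodes M \<Longrightarrow> bmw_elt M (G i) \<in> carrier (bmw M)"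
  "i \<in> nodes M \<Longrightarrow> bmw_elt M (E i) \<in> carrier (bmw M)"
  by (auto simp: bmw_elt_eq intro!: bcl_closed bmw_free_closed)

lemma bcl_const_central:
  assumes "X \<in> carrier (bmw M)"
  shows "X \<otimes>\<^bsub>bmw M\<^esub> bcl (const c) = bcl (const c) \<otimes>\<^bsub>bmw M\<^esub> X"
proof -
  obtain p where "p \<in> carrier (bmw_free M)" "X = bcl p"
    using assms unfolding bmw_eq BMW.quot_carrier by blast
  then show ?thesis by (simp add: bcl_mult bmw_free_closed const_central)
qed

text \<open>Relation (D1) makes \<open>g\<^sub>i\<^sup>2 + m g\<^sub>i - 1\<close> equal to
  \<open>l\<^sup>-\<^sup>1 m e\<^sub>i\<close>, and (R1) makes it an eigenvector for left
  multiplication by \<open>g\<^sub>i\<close>. This is the cubic relation of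
  \<open>cubic_unit\<close>.\<close>

lemma bmw_G_unit:
  assumes i: "i \<in> nodes M"
  shows "bmw_elt M (G i) \<in> Units (bmw M)"
proof (rule B.cubic_unit[of _ "bcl (const m_par)" "bcl (const (inverse l_ind))"])
  let ?g = "gen (G i)" and ?e = "gen (E i)" and ?L = "const (inverse l_ind)"
  let ?F = "?g ^ 2 + const m_par * ?g - 1"
  have g: "?g \<in> carrier (bmw_free M)" "?e \<in> carrier (bmw_free M)" "?F \<in> carrier (bmw_free M)"
    "?L \<in> carrier (bmw_free M)" "const m_par \<in> carrier (bmw_free M)"
    using i by (intro bmw_free_closed; assumption)+
  have ll: "const (inverse l_ind) * const l_ind = (1 :: bmw_gen fpoly)"
    using l_ind_nonzero by (simp add: const_mult const_1)
  have "bcl (const m_par * ?e) = bcl (const l_ind * ?F)"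
    by (rule bcl_eqI) (use i in \<open>auto simp: bmw_rels_def intro!: bmw_free_closed\<close>)
  then have "bcl ?L \<otimes>\<^bsub>bmw M\<^esub> bcl (const m_par * ?e) = bcl ?L \<otimes>\<^bsub>bmw M\<^esub> bcl (const l_ind * ?F)" by simp
  then have F: "bcl ?F = bcl (?L * (const m_par * ?e))"
    using g by (simp add: bcl_mult bmw_free_closed ll flip: mult.assoc)
  have ge: "bcl (?g * ?e) = bcl (?L * ?e)"
    by (rule bcl_eqI) (use i in \<open>auto simp: bmw_rels_def intro!: bmw_free_closed\<close>)
  have comm: "?g * (?L * (const m_par * ?e)) = ?L * const m_par * (?g * ?e)"
    "?L * (?L * (const m_par * ?e)) = ?L * const m_par * (?L * ?e)"
  proof -
    have left_commute: "p * (const c * r) = const c * (p * r)" for p r :: "bmw_gen fpoly" and c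
      by (simp add: mult.assoc[symmetric] const_central[of c p])
    show "?g * (?L * (const m_par * ?e)) = ?L * const m_par * (?g * ?e)"
      by (simp only: left_commute[of ?g] mult.assoc)
    show "?L * (?L * (const m_par * ?e)) = ?L * const m_par * (?L * ?e)"
      by (simp only: left_commute[of ?L m_par] mult.assoc)
  qed
  have "bcl ?g \<otimes>\<^bsub>bmw M\<^esub> bcl ?F = bcl (?L * const m_par) \<otimes>\<^bsub>bmw M\<^esub> bcl (?g * ?e)"
    unfolding F using g by (simp add: bcl_mult bmw_free_closed comm)
  also have "\<dots> = bcl ?L \<otimes>\<^bsub>bmw M\<^esub> bcl ?F"
    unfolding F ge using g by (simp add: bcl_mult bmw_free_closed comm)
  finally have gF: "bcl ?g \<otimes>\<^bsub>bmw M\<^esub> bcl ?F = bcl ?L \<otimes>\<^bsub>bmw M\<^esub> bcl ?F" .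
  have "bcl ?F = bmw_elt M (G i) \<otimes>\<^bsub>bmw M\<^esub> bmw_elt M (G i)
      \<oplus>\<^bsub>bmw M\<^esub> bcl (const m_par) \<otimes>\<^bsub>bmw M\<^esub> bmw_elt M (G i) \<ominus>\<^bsub>bmw M\<^esub> \<one>\<^bsub>bmw M\<^esub>"
    using g by (simp add: bmw_elt_eq bcl_mult bcl_add bcl_minus bcl_one bmw_free_closed power2_eq_square)
  then show "bmw_elt M (G i) \<otimes>\<^bsub>bmw M\<^esub> (bmw_elt M (G i) \<otimes>\<^bsub>bmw M\<^esub> bmw_elt M (G i)
      \<oplus>\<^bsub>bmw M\<^esub> bcl (const m_par) \<otimes>\<^bsub>bmw M\<^esub> bmw_elt M (G i) \<ominus>\<^bsub>bmw M\<^esub> \<one>\<^bsub>bmw M\<^esub>) =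
    bcl ?L \<otimes>\<^bsub>bmw M\<^esub> (bmw_elt M (G i) \<otimes>\<^bsub>bmw M\<^esub> bmw_elt M (G i)
      \<oplus>\<^bsub>bmw M\<^esub> bcl (const m_par) \<otimes>\<^bsub>bmw M\<^esub> bmw_elt M (G i) \<ominus>\<^bsub>bmw M\<^esub> \<one>\<^bsub>bmw M\<^esub>)"
    using gF by (simp add: bmw_elt_eq)
  have "bcl ?L \<otimes>\<^bsub>bmw M\<^esub> bcl (const l_ind) = \<one>\<^bsub>bmw M\<^esub>" "bcl (const l_ind) \<otimes>\<^bsub>bmw M\<^esub> bcl ?L = \<one>\<^bsub>bmw M\<^esub>"
    using ll l_ind_nonzero by (simp_all add: bcl_mult bcl_one bmw_free_closed const_mult const_1)
  then show "bcl ?L \<in> Units (bmw M)"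
    unfolding Units_def using bcl_closed[OF bmw_free_closed(8)] by blast
  show gc: "bmw_elt M (G i) \<in> carrier (bmw M)" and mc: "bcl (const m_par) \<in> carrier (bmw M)"
    using i by (auto intro!: bmw_elt_closed bcl_closed bmw_free_closed)
  show "bmw_elt M (G i) \<otimes>\<^bsub>bmw M\<^esub> bcl (const m_par) = bcl (const m_par) \<otimes>\<^bsub>bmw M\<^esub> bmw_elt M (G i)"
    "bmw_elt M (G i) \<otimes>\<^bsub>bmw M\<^esub> bcl ?L = bcl ?L \<otimes>\<^bsub>bmw M\<^esub> bmw_elt M (G i)"
    "bcl (const m_par) \<otimes>\<^bsub>bmw M\<^esub> bcl ?L = bcl ?L \<otimes>\<^bsub>bmw M\<^esub> bcl (const m_par)"
    by (rule bcl_const_central, rule gc mc)+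
qed

lemma bmw_G_commute:
  assumes "i \<in> nodes M" "j \<in> nodes M" "\<not> adj M i j"
  shows "bmw_elt M (G i) \<otimes>\<^bsub>bmw M\<^esub> bmw_elt M (G j) = bmw_elt M (G j) \<otimes>\<^bsub>bmw M\<^esub> bmw_elt M (G i)"
proof -
  have "bcl (gen (G i) * gen (G j)) = bcl (gen (G j) * gen (G i))"
    using assms by (intro bcl_eqI bmw_free_closed) (auto simp: bmw_rels_def)
  then show ?thesis using assms by (simp add: bmw_elt_eq bcl_mult bmw_free_closed)
qed

lemma bmw_G_braid:
  assumes "i \<in> nodes M" "j \<in> nodes M" "adj M i j"
  shows "bmw_elt M (G i) \<otimes>\<^bsub>bmw M\<^esub> (bmw_elt M (G j) \<otimes>\<^bsub>bmw M\<^esub> bmw_elt M (G i)) =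
    bmw_elt M (G j) \<otimes>\<^bsub>bmw M\<^esub> (bmw_elt M (G i) \<otimes>\<^bsub>bmw M\<^esub> bmw_elt M (G j))"
proof -
  have "gen (G i) * gen (G j) * gen (G i) - gen (G j) * gen (G i) * gen (G j) \<in> bmw_rels M"
    using assms by (auto simp: bmw_rels_def)
  then have "bcl (gen (G i) * gen (G j) * gen (G i)) = bcl (gen (G j) * gen (G i) * gen (G j))"
    using assms by (intro bcl_eqI bmw_free_closed)
  then show ?thesis using assms by (simp add: bmw_elt_eq bcl_mult bmw_free_closed mult.assoc)
qed

lemma I2_gens_subset:
  "{bmw_elt M (E i) \<otimes>\<^bsub>bmw M\<^esub> bmw_elt M (E j) | i j. i \<in> nodes M \<and> j \<in> nodes M \<and> i \<noteq> j \<and> \<not> adj M i j}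
    \<subseteq> carrier (bmw M)"
  by (auto intro!: B.m_closed bmw_elt_closed)

sublocale BI: scalar_algebra_ideal "bmw M" UNIV "\<lambda>c. bmw_ideal M +>\<^bsub>bmw_free M\<^esub> const c" "I2 M"
proof (intro scalar_algebra_ideal.intro B.scalar_algebra_axioms)
  show "ideal (I2 M) (bmw M)" unfolding I2_def by (rule B.genideal_ideal[OF I2_gens_subset])
qed

text \<open>Relation (D1) forces the image of \<open>e\<^sub>i\<close> to be \<open>(l / m) q\<^sub>i\<close>.\<close>

lemma bmw_mod_I2_hom:
  fixes B :: "(ratfun, 'b) module" (structure)
  assumes "unital_algebra B"
    and g: "\<And>i. i \<in> nodes M \<Longrightarrow> g i \<in> carrier B"
    and q: "\<And>i. i \<in> nodes M \<Longrightarrow> q i = g i \<otimes> g i \<oplus> (m_par \<odot>\<^bsub>B\<^esub> g i) \<ominus> \<one>"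
    and commute: "\<And>i j. i \<in> nodes M \<Longrightarrow> j \<in> nodes M \<Longrightarrow> \<not> adj M i j \<Longrightarrow> g i \<otimes> g j = g j \<otimes> g i"
    and braid: "\<And>i j. i \<in> nodes M \<Longrightarrow> j \<in> nodes M \<Longrightarrow> adj M i j \<Longrightarrow> g i \<otimes> (g j \<otimes> g i) = g j \<otimes> (g i \<otimes> g j)"
    and gq: "\<And>i. i \<in> nodes M \<Longrightarrow> g i \<otimes> q i = inverse l_ind \<odot>\<^bsub>B\<^esub> q i"
    and qgq: "\<And>i j. i \<in> nodes M \<Longrightarrow> j \<in> nodes M \<Longrightarrow> adj M i j \<Longrightarrow> q i \<otimes> (g j \<otimes> q i) = m_par \<odot>\<^bsub>B\<^esub> q i"
    and qq: "\<And>i j. i \<in> nodes M \<Longrightarrow> j \<in> nodes M \<Longrightarrow> i \<noteq> j \<Longrightarrow> \<not> adj M i j \<Longrightarrow> q i \<otimes> q j = \<zero>"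
  obtains \<theta>\<^sub>1 \<theta> where "\<theta>\<^sub>1 \<in> alg_hom K_ring (bmw M) B" "\<And>i. i \<in> nodes M \<Longrightarrow> \<theta>\<^sub>1 (bmw_elt M (G i)) = g i"
    and "\<theta> \<in> alg_hom K_ring (bmw_mod_I2 M) B" "\<And>X. X \<in> carrier (bmw M) \<Longrightarrow> \<theta> (I2 M +>\<^bsub>bmw M\<^esub> X) = \<theta>\<^sub>1 X"
proof -
  interpret unital_algebra B by fact
  define f where "f a = (case a of G i \<Rightarrow> g i | E i \<Rightarrow> (l_ind / m_par) \<odot>\<^bsub>B\<^esub> q i)" for a
  have qc: "q i \<in> carrier B" if "i \<in> nodes M" for i using q[OF that] g[OF that] by (simp add: smult_closed)
  have f: "\<And>a. a \<in> bmw_gens \<Longrightarrow> f a \<in> carrier B"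
    by (auto simp: bmw_gens_def f_def g qc smult_closed)
  let ?F = "bmw_free M" and ?ev = "fpoly_eval f"
  have ev: "?ev \<in> alg_hom K_ring ?F B" unfolding bmw_free_eq by (rule fpoly_eval_alg_hom[OF f])
  then have evr: "?ev \<in> ring_hom ?F B" by (simp add: alg_hom_def)
  interpret ev: ring_hom_ring ?F B ?ev
    by (intro ring_hom_ringI2 evr bmw_scalar.ring_axioms ring_axioms)
  have evG: "?ev (gen (G i)) = g i" if "i \<in> nodes M" for i
    using fpoly_eval_gen[where f = f and S = bmw_gens and g = "G i", OF f] that by (simp add: f_def bmw_gens_mem)
  have evE: "?ev (gen (E i)) = (l_ind / m_par) \<odot>\<^bsub>B\<^esub> q i" if "i \<in> nodes M" for i
    using fpoly_eval_gen[where f = f and S = bmw_gens and g = "E i", OF f] that by (simp add: f_def bmw_gens_mem)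
  have ev_mult: "?ev (p * r) = ?ev p \<otimes> ?ev r" if "p \<in> carrier ?F" "r \<in> carrier ?F" for p r
    using ev.hom_mult[OF that] by (simp add: bmw_free_eq free_algebra_simps)
  have ev_add: "?ev (p + r) = ?ev p \<oplus> ?ev r" if "p \<in> carrier ?F" "r \<in> carrier ?F" for p r
    using ev.hom_add[OF that] by (simp add: bmw_free_eq free_algebra_simps)
  have ev_diff: "?ev (p - r) = ?ev p \<ominus> ?ev r" if "p \<in> carrier ?F" "r \<in> carrier ?F" for p r
    using ev.hom_add[of p "\<ominus>\<^bsub>?F\<^esub> r"] that by (simp add: bmw_free_minus[symmetric] a_minus_def)
  have ev_const: "?ev (const c) = c \<odot>\<^bsub>B\<^esub> \<one>" for c
    by (rule fpoly_eval_const[where f = f and S = bmw_gens, OF f])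
  have ev1: "?ev 1 = \<one>" using ev.hom_one by (simp add: bmw_free_eq free_algebra_simps)
  note ev_simps = ev_mult ev_add ev_diff ev_const ev1 evG evE bmw_free_closed power2_eq_square
  note sm = smult_closed smult_mult_left smult_mult_right smult_assoc[symmetric]
  have rel: "?ev x = \<zero>" if "x \<in> bmw_rels M" for x
    using that unfolding bmw_rels_def
  proof (elim UnE CollectE exE conjE)
    fix i j assume "x = gen (G i) * gen (G j) - gen (G j) * gen (G i)" "i \<in> nodes M" "j \<in> nodes M" "\<not> adj M i j"
    then show ?thesis using commute[of i j] g by (simp add: ev_simps)
  next
    fix i j assume "x = gen (G i) * gen (G j) * gen (G i) - gen (G j) * gen (G i) * gen (G j)"
      "i \<in> nodes M" "j \<in> nodes M" "adj M i j"
    then show ?thesis using braid[of i j] g by (simp add: ev_simps m_assoc)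
  next
    fix i assume x: "x = const m_par * gen (E i) - const l_ind * ((gen (G i))\<^sup>2 + const m_par * gen (G i) - 1)" "i \<in> nodes M"
    have "?ev x = m_par \<odot>\<^bsub>B\<^esub> ((l_ind / m_par) \<odot>\<^bsub>B\<^esub> q i) \<ominus> l_ind \<odot>\<^bsub>B\<^esub> q i"
      using x g by (simp add: ev_simps q smult_mult_left smult_closed)
    then show ?thesis using x qc m_par_nonzero by (simp add: sm)
  next
    fix i assume x: "x = gen (G i) * gen (E i) - const (inverse l_ind) * gen (E i)" "i \<in> nodes M"
    then show ?thesis using g qc gq[of i] by (simp add: ev_simps sm mult.commute)
  next
    fix i j assume x: "x = gen (E i) * gen (G j) * gen (E i) - const l_ind * gen (E i)"
      "i \<in> nodes M" "j \<in> nodes M" "adj M i j"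
    \<comment> \<open>Two factors from the images of \<open>E i\<close> and one \<open>m_par\<close>
      from the relation for \<open>q i\<close> must combine to \<open>l_ind\<close> times the factor
      of a single \<open>E i\<close>; this is what (R2) asks of the normalization.\<close>
    have "l_ind / m_par * (l_ind / m_par) * m_par = l_ind * (l_ind / m_par)" using m_par_nonzero by simp
    then show ?thesis using x g qc qgq[of i j] by (simp add: ev_simps sm m_assoc)
  qed
  have ker: "?ev a = \<zero>" if "a \<in> bmw_ideal M" for a
    using that unfolding bmw_ideal_def
    by (rule alg_hom_kills_ideal[OF bmw_scalar.ring_axioms ring_axioms evr bmw_rels_subset rel, rotated])
  obtain \<theta>\<^sub>1 where \<theta>\<^sub>1: "\<theta>\<^sub>1 \<in> alg_hom K_ring (quot_algebra ?F (bmw_ideal M)) B"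
    "\<And>a. a \<in> carrier ?F \<Longrightarrow> \<theta>\<^sub>1 (bcl a) = ?ev a"
    using BMW.quot_lift[OF ring_axioms ev _ ker] by (metis subset_UNIV)
  have \<theta>\<^sub>1': "\<theta>\<^sub>1 \<in> alg_hom K_ring (bmw M) B" using \<theta>\<^sub>1(1) by (simp add: bmw_eq)
  then have \<theta>\<^sub>1r: "\<theta>\<^sub>1 \<in> ring_hom (bmw M) B" by (simp add: alg_hom_def)
  have \<theta>E: "\<theta>\<^sub>1 (bmw_elt M (E i)) = (l_ind / m_par) \<odot>\<^bsub>B\<^esub> q i" if "i \<in> nodes M" for i
    using \<theta>\<^sub>1(2) that by (simp add: bmw_elt_eq bmw_free_closed evE)
  have ker2: "\<theta>\<^sub>1 a = \<zero>" if "a \<in> I2 M" for a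
  proof (rule alg_hom_kills_ideal[OF B.ring_axioms ring_axioms \<theta>\<^sub>1r I2_gens_subset])
    show "a \<in> Idl\<^bsub>bmw M\<^esub> {bmw_elt M (E i) \<otimes>\<^bsub>bmw M\<^esub> bmw_elt M (E j) | i j.
        i \<in> nodes M \<and> j \<in> nodes M \<and> i \<noteq> j \<and> \<not> adj M i j}" using that by (simp add: I2_def)
    fix x assume "x \<in> {bmw_elt M (E i) \<otimes>\<^bsub>bmw M\<^esub> bmw_elt M (E j) | i j.
        i \<in> nodes M \<and> j \<in> nodes M \<and> i \<noteq> j \<and> \<not> adj M i j}"
    then obtain i j where ij: "x = bmw_elt M (E i) \<otimes>\<^bsub>bmw M\<^esub> bmw_elt M (E j)"
      "i \<in> nodes M" "j \<in> nodes M" "i \<noteq> j" "\<not> adj M i j" by blast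
    have zero: "c \<odot>\<^bsub>B\<^esub> \<zero> = \<zero>" for c
      using smult_add_right[of \<zero> \<zero> c] smult_closed[of \<zero> c] by (metis add.r_cancel_one' l_zero zero_closed)
    have "\<theta>\<^sub>1 x = ((l_ind / m_par) \<odot>\<^bsub>B\<^esub> q i) \<otimes> ((l_ind / m_par) \<odot>\<^bsub>B\<^esub> q j)"
      using ij ring_hom_mult[OF \<theta>\<^sub>1r] by (simp add: bmw_elt_closed \<theta>E)
    then show "\<theta>\<^sub>1 x = \<zero>" using ij qc qq[of i j] by (simp add: sm zero)
  qed
  obtain \<theta> where \<theta>: "\<theta> \<in> alg_hom K_ring (quot_algebra (bmw M) (I2 M)) B"
    "\<And>a. a \<in> carrier (bmw M) \<Longrightarrow> \<theta> (I2 M +>\<^bsub>bmw M\<^esub> a) = \<theta>\<^sub>1 a"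
    using BI.quot_lift[OF ring_axioms \<theta>\<^sub>1' _ ker2] by (metis subset_UNIV)
  have "\<theta>\<^sub>1 (bmw_elt M (G i)) = g i" if "i \<in> nodes M" for i
    using \<theta>\<^sub>1(2) that by (simp add: bmw_elt_eq bmw_free_closed evG)
  then show ?thesis using that \<theta>\<^sub>1' \<theta> by (simp add: bmw_mod_I2_def)
qed

end

section \<open>Extension of scalars and factorization through the BMW algebra\<close>

context simply_laced
begin

abbreviation W0 where "W0 \<equiv> restrict_scalars (Z0 M) rep.V"

sublocale bm: bmw_alg M .

lemma abelian_group_W0: "abelian_group W0"
  by (rule abelian_groupI)
    (auto simp: restrict_scalars_simps rep.V.a_ac intro!: bexI[of _ "\<ominus>\<^bsub>rep.V\<^esub> x" for x] rep.V.l_neg)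

sublocale X: scalar_extension Q_l_m W0
  by (intro scalar_extension.intro abelian_group_W0)
    (simp_all add: restrict_scalars_simps restrict_scalars_smult rep.V_smult_closed V_smult_add)

abbreviation tm where "tm \<equiv> tensor_map Q_l_m W0"

lemma W_linear: "f \<in> carrier E0 \<Longrightarrow> X.W_linear f"
  by (simp add: X.W_linear_def restrict_scalars_simps restrict_scalars_smult linear_endos_carrierD)

lemma tm_closed: "f \<in> carrier E0 \<Longrightarrow> tm f \<in> carrier X.EK"
  by (rule X.tensor_map_closed[OF W_linear])

interpretation EK: unital_algebra X.EK
  by (rule X.unital_algebra_EK)

lemma tm_pure: "f \<in> carrier E0 \<Longrightarrow> v \<in> carrier rep.V \<Longrightarrow> tm f (X.pure v c) = X.pure (f v) c"
  by (rule X.tensor_map_pure[OF W_linear]) (simp_all add: restrict_scalars_simps)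

lemma pure_closed': "v \<in> carrier rep.V \<Longrightarrow> X.pure v c \<in> carrier X.TK"
  by (rule X.pure_closed) (simp add: restrict_scalars_simps)

lemma tm_mult:
  assumes "f \<in> carrier E0" "g \<in> carrier E0"
  shows "tm (f \<otimes>\<^bsub>E0\<^esub> g) = tm f \<otimes>\<^bsub>X.EK\<^esub> tm g"
proof (rule X.tensor_map_eqI)
  fix v c assume "v \<in> carrier W0"
  then have v: "v \<in> carrier rep.V" by (simp add: restrict_scalars_simps)
  then show "X.pure ((f \<otimes>\<^bsub>E0\<^esub> g) v) c = (tm f \<otimes>\<^bsub>X.EK\<^esub> tm g) (X.pure v c)"
    using assms by (simp add: linear_endos_mult tm_pure pure_closed' linear_endos_carrierD)
qed (use assms in \<open>auto intro!: W_linear tm_closed EK.m_closed\<close>)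

lemma tm_add:
  assumes "f \<in> carrier E0" "g \<in> carrier E0"
  shows "tm (f \<oplus>\<^bsub>E0\<^esub> g) = tm f \<oplus>\<^bsub>X.EK\<^esub> tm g"
proof (rule X.tensor_map_eqI)
  fix v c assume "v \<in> carrier W0"
  then have v: "v \<in> carrier rep.V" by (simp add: restrict_scalars_simps)
  then show "X.pure ((f \<oplus>\<^bsub>E0\<^esub> g) v) c = (tm f \<oplus>\<^bsub>X.EK\<^esub> tm g) (X.pure v c)"
    using assms X.pure_add_left[of "f v" "g v" c]
    by (simp add: linear_endos_add tm_pure pure_closed' linear_endos_carrierD restrict_scalars_simps)
qed (use assms in \<open>auto intro!: W_linear tm_closed EK.a_closed\<close>)

lemma tm_one: "tm \<one>\<^bsub>E0\<^esub> = \<one>\<^bsub>X.EK\<^esub>"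
proof (rule X.tensor_map_eqI)
  fix v c assume "v \<in> carrier W0"
  then have v: "v \<in> carrier rep.V" by (simp add: restrict_scalars_simps)
  then show "X.pure (\<one>\<^bsub>E0\<^esub> v) c = \<one>\<^bsub>X.EK\<^esub> (X.pure v c)"
    by (simp add: linear_endos_one pure_closed')
qed (auto intro!: W_linear)

text \<open>Here the endomorphism \<open>smul c\<close> becomes genuine scalar multiplication: in a
  pure tensor the scalar moves to the second factor.\<close>

lemma tm_smul:
  assumes "c \<in> Q_l_m" "f \<in> carrier E0"
  shows "tm (smul c \<otimes>\<^bsub>E0\<^esub> f) = c \<odot>\<^bsub>X.EK\<^esub> tm f"
proof (rule X.tensor_map_eqI)
  fix v d assume "v \<in> carrier W0"
  then have v: "v \<in> carrier rep.V" by (simp add: restrict_scalars_simps)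
  then show "X.pure ((smul c \<otimes>\<^bsub>E0\<^esub> f) v) d = (c \<odot>\<^bsub>X.EK\<^esub> tm f) (X.pure v d)"
    using assms X.pure_smult[of "f v" c d]
    by (simp add: linear_endos_mult linear_endos_smult tm_pure pure_closed' linear_endos_carrierD smul_apply
        restrict_scalars_simps restrict_scalars_smult X.TK_smult_pure)
qed (use assms in \<open>auto intro!: W_linear tm_closed X.EK_smult_closed\<close>)

lemma tm_hom: "ring_hom_ring E0 X.EK tm"
  by (intro ring_hom_ringI2 ring_hom_memI ring_E0 X.ring_EK tm_closed tm_mult tm_add tm_one)

interpretation tm: ring_hom_ring E0 X.EK tm
  by (rule tm_hom)

declare tm.hom_mult [simp del]

text \<open>Going through the BMW algebra and going through \<open>tm\<close> give two homomorphisms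
  from the Artin group to the same group of units; both send the generator of \<open>i\<close> to
  \<open>tm (sigE i)\<close>, hence they agree.\<close>

lemma representation_factors:
  "\<exists>\<rho> \<in> hom (artin M) (units_of E0).
      (\<forall>i\<in>nodes M. \<rho> (artin_gen M i) = sigma M C1.T_coeff i) \<and>
      (\<lambda>a. tm (\<rho> a)) \<in> hom (artin M) (units_of X.EK) \<and>
      (\<exists>\<pi> \<in> hom (artin M) (units_of (bmw M)).
        (\<forall>i\<in>nodes M. \<pi> (artin_gen M i) = bmw_elt M (G i)) \<and>
        (\<exists>\<theta> \<in> alg_hom K_ring (bmw_mod_I2 M) X.EK.
          \<forall>a\<in>carrier (artin M). \<theta> (I2 M +>\<^bsub>bmw M\<^esub> \<pi> a) = tm (\<rho> a)))"
proof -
  obtain \<rho> where \<rho>: "\<rho> \<in> hom (artin M) (units_of E0)" "\<And>i. i \<in> nodes M \<Longrightarrow> \<rho> (artin_gen M i) = sigE i"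
    using artin_hom[of E0 sigE, OF E0.monoid_axioms sigE_unit sigE_commute sigE_braid] by blast
  obtain \<pi> where \<pi>: "\<pi> \<in> hom (artin M) (units_of (bmw M))"
    "\<And>i. i \<in> nodes M \<Longrightarrow> \<pi> (artin_gen M i) = bmw_elt M (G i)"
    using artin_hom[of "bmw M" "\<lambda>i. bmw_elt M (G i)", OF bm.B.monoid_axioms bm.bmw_G_unit bm.bmw_G_commute bm.bmw_G_braid]
    by blast
  have tm\<rho>: "(\<lambda>a. tm (\<rho> a)) \<in> hom (artin M) (units_of X.EK)"
    by (rule hom_units_compose[where f = tm, OF E0.monoid_axioms EK.monoid_axioms \<rho>(1) tm_closed tm_mult tm_one])
  have q: "tm (quadE i) = tm (sigE i) \<otimes>\<^bsub>X.EK\<^esub> tm (sigE i) \<oplus>\<^bsub>X.EK\<^esub> m_par \<odot>\<^bsub>X.EK\<^esub> tm (sigE i) \<ominus>\<^bsub>X.EK\<^esub> \<one>\<^bsub>X.EK\<^esub>"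
    if i: "i \<in> nodes M" for i
    using i unfolding quadE_def a_minus_def by (simp add: tm_mult[of "sigE i" "sigE i"] tm_add tm_smul Q_generators)
  obtain \<theta>\<^sub>1 \<theta> where \<theta>\<^sub>1: "\<theta>\<^sub>1 \<in> alg_hom K_ring (bmw M) X.EK" "\<And>i. i \<in> nodes M \<Longrightarrow> \<theta>\<^sub>1 (bmw_elt M (G i)) = tm (sigE i)"
    and \<theta>: "\<theta> \<in> alg_hom K_ring (bmw_mod_I2 M) X.EK" "\<And>Y. Y \<in> carrier (bmw M) \<Longrightarrow> \<theta> (I2 M +>\<^bsub>bmw M\<^esub> Y) = \<theta>\<^sub>1 Y"
  proof (rule bm.bmw_mod_I2_hom[OF X.unital_algebra_EK, of "\<lambda>i. tm (sigE i)" "\<lambda>i. tm (quadE i)"])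
    fix i assume i: "i \<in> nodes M"
    show "tm (sigE i) \<in> carrier X.EK" using i by (simp add: tm_closed)
    show "tm (quadE i) = tm (sigE i) \<otimes>\<^bsub>X.EK\<^esub> tm (sigE i) \<oplus>\<^bsub>X.EK\<^esub> m_par \<odot>\<^bsub>X.EK\<^esub> tm (sigE i) \<ominus>\<^bsub>X.EK\<^esub> \<one>\<^bsub>X.EK\<^esub>"
      using i by (rule q)
    show "tm (sigE i) \<otimes>\<^bsub>X.EK\<^esub> tm (quadE i) = inverse l_ind \<odot>\<^bsub>X.EK\<^esub> tm (quadE i)"
      using i sigE_quadE[OF i] by (simp add: tm_mult[symmetric] tm_smul[symmetric] Q_generators)
    fix j assume j: "j \<in> nodes M"
    \<comment> \<open>The commutation relations of the BMW algebra include the trivial case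
      \<open>i = j\<close>, as no node is adjacent to itself.\<close>
    show "tm (sigE i) \<otimes>\<^bsub>X.EK\<^esub> tm (sigE j) = tm (sigE j) \<otimes>\<^bsub>X.EK\<^esub> tm (sigE i)" if "\<not> adj M i j"
      using i j sigE_commute[OF i j _ that] by (cases "i = j") (simp_all add: tm_mult[symmetric])
    show "tm (sigE i) \<otimes>\<^bsub>X.EK\<^esub> (tm (sigE j) \<otimes>\<^bsub>X.EK\<^esub> tm (sigE i)) = tm (sigE j) \<otimes>\<^bsub>X.EK\<^esub> (tm (sigE i) \<otimes>\<^bsub>X.EK\<^esub> tm (sigE j))"
      if "adj M i j" using i j sigE_braid[OF i j that] by (simp add: tm_mult[symmetric])
    show "tm (quadE i) \<otimes>\<^bsub>X.EK\<^esub> (tm (sigE j) \<otimes>\<^bsub>X.EK\<^esub> tm (quadE i)) = m_par \<odot>\<^bsub>X.EK\<^esub> tm (quadE i)"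
      if "adj M i j" using i j quadE_sigE_quadE[OF i j that] by (simp add: tm_mult[symmetric] tm_smul[symmetric] Q_generators)
    show "tm (quadE i) \<otimes>\<^bsub>X.EK\<^esub> tm (quadE j) = \<zero>\<^bsub>X.EK\<^esub>" if "i \<noteq> j" "\<not> adj M i j"
      using i j quadE_quadE[OF i j that] by (simp add: tm_mult[symmetric])
  qed blast
  have \<theta>\<^sub>1r: "\<theta>\<^sub>1 \<in> ring_hom (bmw M) X.EK" using \<theta>\<^sub>1(1) by (simp add: alg_hom_def)
  have \<theta>\<pi>: "(\<lambda>a. \<theta>\<^sub>1 (\<pi> a)) \<in> hom (artin M) (units_of X.EK)"
    by (rule hom_units_compose[OF bm.B.monoid_axioms EK.monoid_axioms \<pi>(1)])
       (use ring_hom_closed[OF \<theta>\<^sub>1r] ring_hom_mult[OF \<theta>\<^sub>1r] ring_hom_one[OF \<theta>\<^sub>1r] in auto)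
  have "\<theta> (I2 M +>\<^bsub>bmw M\<^esub> \<pi> a) = tm (\<rho> a)" if a: "a \<in> carrier (artin M)" for a
  proof -
    have "\<pi> a \<in> carrier (bmw M)" using \<pi>(1) a by (auto simp: hom_def units_of_carrier Units_def)
    then have "\<theta> (I2 M +>\<^bsub>bmw M\<^esub> \<pi> a) = \<theta>\<^sub>1 (\<pi> a)" by (rule \<theta>(2))
    also have "\<dots> = tm (\<rho> a)"
      by (rule artin_hom_eqI[OF EK.monoid_axioms \<theta>\<pi> tm\<rho> _ a]) (simp add: \<rho>(2) \<pi>(2) \<theta>\<^sub>1(2))
    finally show ?thesis .
  qed
  then show ?thesis using \<rho> \<pi> tm\<rho> \<theta>(1) by (auto simp: sigma_eq intro!: bexI[of _ \<rho>] bexI[of _ \<pi>] bexI[of _ \<theta>])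
qed

end

theorem theorem6p1:
  fixes M :: diagram
  assumes "simply_laced_finite M"
  shows "\<exists>T :: nat \<Rightarrow> root \<Rightarrow> nat fpoly set.
    (\<forall>i\<in>nodes M. \<forall>\<beta>\<in>pos_roots M. T i \<beta> \<in> carrier (Z1 M)) \<and>
    (\<forall>i\<in>nodes M. T i (simple_root i) = \<one>\<^bsub>Z1 M\<^esub>) \<and>
    (\<exists>\<rho> \<in> hom (artin M) (units_of (linear_endos (Z0 M) (V0 M))).
      (\<forall>i\<in>nodes M. \<rho> (artin_gen M i) = sigma M T i) \<and>
      (\<lambda>a. tensor_map Q_l_m (V0_scalars M) (\<rho> a))
        \<in> hom (artin M) (units_of (linear_endos K_ring (VK M))) \<and>
      (\<exists>\<pi> \<in> hom (artin M) (units_of (bmw M)).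
        (\<forall>i\<in>nodes M. \<pi> (artin_gen M i) = bmw_elt M (G i)) \<and>
        (\<exists>\<theta> \<in> alg_hom K_ring (bmw_mod_I2 M) (linear_endos K_ring (VK M)).
          \<forall>a\<in>carrier (artin M).
            \<theta> (I2 M +>\<^bsub>bmw M\<^esub> \<pi> a) = tensor_map Q_l_m (V0_scalars M) (\<rho> a))))"
proof -
  interpret simply_laced M by unfold_locales (rule assms)
  show ?thesis
    unfolding pos_roots_eq
    by (rule exI[of _ C1.T_coeff], intro conjI representation_factors)
       (simp_all add: C1.T_coeff_closed C1.T_coeff_simple Phi_pos_Phi)
qed

end
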